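(* For each prime $p$, the smallest non-abelian Beauville $p$-group (that is, the non-abelian Beauville $p$-group of least order) is, up to isomorphism: (1) for $p=2$, the group $\mathtt{SmallGroup}(2^7,36)$, of order $2^7$; (2) for $p=3$, the group $$\langle x,y,z,w,t\mid x^3,y^3,z^3,w^3,t^3,\ y^x=yz,\ z^x=zw,\ z^y=zt\rangle,$$ of order $3^5$; (3) for $p=5$, the group $\mathtt{SmallGroup}(5^3,3)$, of order $5^3$; (4) for $p\ge 7$, the group $$\langle x,y,z\mid x^p,y^p,z^p,\ [x,y]=z\rangle,$$ of order $p^3$.
   Context: Let $G$ be a finite group with identity $e$. For $x,y\in G$ put $$\Sigma(x,y):=\bigcup_{i=1}^{|G|}\bigcup_{g\in G}\{(x^i)^g,(y^i)^g,((xy)^i)^g\},$$ where $a^g$ denotes the conjugate $g^{-1}ag$. A Beauville structure for $G$ is a pair of generating sets $\{x_1,y_1\},\{x_2,y_2\}$ of $G$ (i.e. $\langle x_1,y_1\rangle=\langle x_2,y_2\rangle=G$) such that $\Sigma(x_1,y_1)\cap\Sigma(x_2,y_2)=\{e\}$. $G$ is a Beauville group if there exists a Beauville structure for $G$; a Beauville $p$-group is a Beauville group that is a $p$-group. $\mathtt{SmallGroup}(m,n)$ denotes the $n$-th group of order $m$ in the Small Groups Library of GAP and MAGMA. The group $\mathtt{SmallGroup}(5^3,3)$ is the non-abelian group $\langle x,y,z\mid x^5,y^5,z^5,[x,y]=z\rangle$ of order $5^3$ and exponent $5$. Presentation conventions: $[a,b]=aba^{-1}b^{-1}$, and relations $[a,b]=e$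 between commuting generators are omitted, i.e. any two generators whose commutator or conjugate is not specified by a listed relation are understood to commute. Thus in (2) all pairs of generators commute except $(x,y)$, $(x,z)$, $(y,z)$, and in (4) (and in the presentation of $\mathtt{SmallGroup}(5^3,3)$) $z$ is central. *)

theory Defs
  imports "HOL-Algebra.Algebra" "HOL-Computational_Algebra.Primes"
begin

section \<open>Groups given by generators and relations\<close>

text \<open>A word is a list of letters \<open>(s, b)\<close>: the letter \<open>(s, True)\<close> stands for the generator \<open>s\<close>
  and \<open>(s, False)\<close> for its inverse.\<close>

type_synonym 'g word = "('g \<times> bool) list"

definition words :: "'g set \<Rightarrow> 'g word set" where
  "words S = lists (S \<times> UNIV)"

definition gen :: "'g \<Rightarrow> 'g word" where
  "gen s = [(s, True)]"

definition winv :: "'g word \<Rightarrow> 'g word" where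
  "winv u = rev (map (\<lambda>(s, b). (s, \<not> b)) u)"

definition wpow :: "'g word \<Rightarrow> nat \<Rightarrow> 'g word" where
  "wpow u n = concat (replicate n u)"

text \<open>The two conventions in force: \<open>[u, v] = u v u\<inverse> v\<inverse>\<close> and \<open>u\<^sup>v = v\<inverse> u v\<close>.\<close>

definition wcomm :: "'g word \<Rightarrow> 'g word \<Rightarrow> 'g word" where
  "wcomm u v = u @ v @ winv u @ winv v"

definition wconj :: "'g word \<Rightarrow> 'g word \<Rightarrow> 'g word" where
  "wconj u v = winv v @ u @ v"

text \<open>A pair \<open>(u, v)\<close> in \<open>E\<close> is the defining relation \<open>u = v\<close>; \<open>word_cong S E\<close> is the least
  congruence on the words over \<open>S\<close> containing \<open>E\<close> and the free cancellations.\<close>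

inductive_set word_cong :: "'g set \<Rightarrow> ('g word \<times> 'g word) set \<Rightarrow> ('g word \<times> 'g word) set"
  for S :: "'g set" and E :: "('g word \<times> 'g word) set" where
  refl: "u \<in> words S \<Longrightarrow> (u, u) \<in> word_cong S E"
| sym: "(u, v) \<in> word_cong S E \<Longrightarrow> (v, u) \<in> word_cong S E"
| trans: "(u, v) \<in> word_cong S E \<Longrightarrow> (v, w) \<in> word_cong S E \<Longrightarrow> (u, w) \<in> word_cong S E"
| append: "(u, u') \<in> word_cong S E \<Longrightarrow> (v, v') \<in> word_cong S E \<Longrightarrow> (u @ v, u' @ v') \<in> word_cong S E"
| cancel: "s \<in> S \<Longrightarrow> ([(s, b), (s, \<not> b)], []) \<in> word_cong S E"
| relation: "(u, v) \<in> E \<Longrightarrow> u \<in> words S \<Longrightarrow> v \<in> words S \<Longrightarrow> (u, v) \<in> word_cong S E"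

definition presented_group :: "'g set \<Rightarrow> ('g word \<times> 'g word) set \<Rightarrow> 'g word set monoid" where
  "presented_group S E =
    \<lparr>carrier = words S // word_cong S E,
     monoid.mult = (\<lambda>A B. \<Union>u\<in>A. \<Union>v\<in>B. word_cong S E `` {u @ v}),
     one = word_cong S E `` {[]}\<rparr>"

lemma words_Nil [simp]: "[] \<in> words S"
  by (simp add: words_def)

lemma words_append [simp]: "u @ v \<in> words S \<longleftrightarrow> u \<in> words S \<and> v \<in> words S"
  by (auto simp: words_def)

lemma words_winv [simp]: "u \<in> words S \<Longrightarrow> winv u \<in> words S"
  by (auto simp: words_def winv_def)

lemma word_cong_words: "(u, v) \<in> word_cong S E \<Longrightarrow> u \<in> words S \<and> v \<in> words S"
  by (induction rule: word_cong.induct) (auto simp: words_def)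

lemma equiv_word_cong: "equiv (words S) (word_cong S E)"
proof (rule equivI)
  show "word_cong S E \<subseteq> words S \<times> words S"
    using word_cong_words by auto
  show "refl_on (words S) (word_cong S E)"
    by (auto simp: refl_on_def intro: word_cong.refl dest: word_cong_words)
  show "sym (word_cong S E)"
    by (rule symI) (rule word_cong.sym)
  show "trans (word_cong S E)"
    by (rule transI) (rule word_cong.trans)
qed

lemma winv_cancel: "u \<in> words S \<Longrightarrow> (winv u @ u, []) \<in> word_cong S E"
proof (induction u)
  case Nil
  show ?case by (simp add: winv_def word_cong.refl)
next
  case (Cons a u)
  obtain s b where a: "a = (s, b)" by (cases a)
  have s: "s \<in> S" and u: "u \<in> words S"
    using Cons.prems by (auto simp: a words_def)
  have "([(s, \<not> b), (s, b)], []) \<in> word_cong S E"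
    using word_cong.cancel[OF s, of "\<not> b" E] by simp
  from word_cong.append[OF word_cong.refl[OF words_winv[OF u]] this]
  have "(winv u @ [(s, \<not> b), (s, b)], winv u) \<in> word_cong S E" by simp
  from word_cong.append[OF this word_cong.refl[OF u]]
  have "(winv (a # u) @ (a # u), winv u @ u) \<in> word_cong S E"
    by (simp add: a winv_def)
  then show ?case
    using Cons.IH[OF u] by (rule word_cong.trans)
qed

lemma presented_group_mult:
  assumes "u \<in> words S" and "v \<in> words S"
  shows "word_cong S E `` {u} \<otimes>\<^bsub>presented_group S E\<^esub> word_cong S E `` {v} = word_cong S E `` {u @ v}"
proof -
  have "(\<lambda>u v. word_cong S E `` {u @ v}) respects2 word_cong S E"
    by (intro congruent2I' equiv_class_eq[OF equiv_word_cong] word_cong.append)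
  from UN_equiv_class2[OF equiv_word_cong equiv_word_cong this assms]
  show ?thesis
    by (simp add: presented_group_def)
qed

lemma group_presented_group: "group (presented_group S E)"
proof -
  let ?G = "presented_group S E" and ?c = "\<lambda>u. word_cong S E `` {u}"
  have carrI: "?c u \<in> carrier ?G" if "u \<in> words S" for u
    using that by (simp add: presented_group_def quotientI)
  have carrE: thesis if "A \<in> carrier ?G" and "\<And>u. u \<in> words S \<Longrightarrow> A = ?c u \<Longrightarrow> thesis" for A thesis
    using that by (auto simp: presented_group_def elim: quotientE)
  have one: "\<one>\<^bsub>?G\<^esub> = ?c []"
    by (simp add: presented_group_def)
  show ?thesis
  proof (rule groupI)
    fix A B assume "A \<in> carrier ?G" "B \<in> carrier ?G"
    then show "A \<otimes>\<^bsub>?G\<^esub> B \<in> carrier ?G"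
      by (elim carrE) (simp add: presented_group_mult carrI)
  next
    show "\<one>\<^bsub>?G\<^esub> \<in> carrier ?G"
      by (simp add: one carrI)
  next
    fix A B C assume "A \<in> carrier ?G" "B \<in> carrier ?G" "C \<in> carrier ?G"
    then show "A \<otimes>\<^bsub>?G\<^esub> B \<otimes>\<^bsub>?G\<^esub> C = A \<otimes>\<^bsub>?G\<^esub> (B \<otimes>\<^bsub>?G\<^esub> C)"
      by (elim carrE) (simp add: presented_group_mult)
  next
    fix A assume "A \<in> carrier ?G"
    then show "\<one>\<^bsub>?G\<^esub> \<otimes>\<^bsub>?G\<^esub> A = A"
      by (elim carrE) (simp add: one presented_group_mult)
  next
    fix A assume "A \<in> carrier ?G"
    then obtain u where u: "u \<in> words S" "A = ?c u"
      by (rule carrE)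
    have "?c (winv u) \<otimes>\<^bsub>?G\<^esub> A = ?c (winv u @ u)"
      using u by (simp add: presented_group_mult)
    also have "\<dots> = \<one>\<^bsub>?G\<^esub>"
      unfolding one by (rule equiv_class_eq[OF equiv_word_cong winv_cancel[OF u(1)]])
    finally show "\<exists>B\<in>carrier ?G. B \<otimes>\<^bsub>?G\<^esub> A = \<one>\<^bsub>?G\<^esub>"
      by (rule bexI) (rule carrI[OF words_winv[OF u(1)]])
  qed
qed

section \<open>Beauville groups\<close>

definition conj_elt :: "('a, 'm) monoid_scheme \<Rightarrow> 'a \<Rightarrow> 'a \<Rightarrow> 'a" where
  "conj_elt G a g = inv\<^bsub>G\<^esub> g \<otimes>\<^bsub>G\<^esub> a \<otimes>\<^bsub>G\<^esub> g"

definition Sigma_set :: "('a, 'm) monoid_scheme \<Rightarrow> 'a \<Rightarrow> 'a \<Rightarrow> 'a set" where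
  "Sigma_set G x y =
    (\<Union>i\<in>{1..order G}. \<Union>g\<in>carrier G.
      {conj_elt G (x [^]\<^bsub>G\<^esub> i) g,
       conj_elt G (y [^]\<^bsub>G\<^esub> i) g,
       conj_elt G ((x \<otimes>\<^bsub>G\<^esub> y) [^]\<^bsub>G\<^esub> i) g})"

definition generating_pair :: "('a, 'm) monoid_scheme \<Rightarrow> 'a \<Rightarrow> 'a \<Rightarrow> bool" where
  "generating_pair G x y \<longleftrightarrow>
    x \<in> carrier G \<and> y \<in> carrier G \<and> generate G {x, y} = carrier G"

definition beauville_structure ::
  "('a, 'm) monoid_scheme \<Rightarrow> 'a \<times> 'a \<Rightarrow> 'a \<times> 'a \<Rightarrow> bool" where
  "beauville_structure G = (\<lambda>(x1, y1) (x2, y2).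
    generating_pair G x1 y1 \<and> generating_pair G x2 y2 \<and>
    Sigma_set G x1 y1 \<inter> Sigma_set G x2 y2 = {\<one>\<^bsub>G\<^esub>})"

definition beauville_group :: "('a, 'm) monoid_scheme \<Rightarrow> bool" where
  "beauville_group G \<longleftrightarrow>
    group G \<and> finite (carrier G) \<and> (\<exists>P Q. beauville_structure G P Q)"

definition finite_p_group :: "nat \<Rightarrow> ('a, 'm) monoid_scheme \<Rightarrow> bool" where
  "finite_p_group p G \<longleftrightarrow>
    group G \<and> finite (carrier G) \<and> (\<exists>n. order G = p ^ n)"

definition nonabelian_beauville_p_group :: "nat \<Rightarrow> ('a, 'm) monoid_scheme \<Rightarrow> bool" where
  "nonabelian_beauville_p_group p G \<longleftrightarrow>
    finite_p_group p G \<and> beauville_group G \<and> \<not> comm_group G"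

text \<open>\<open>H\<close> is, up to isomorphism, the unique non-abelian Beauville \<open>p\<close>-group of least order.
  The competitors \<open>G\<close> range over the groups with elements in \<open>'a\<close>; leaving \<open>'a\<close> a free type
  variable in a theorem makes them range over all groups.\<close>

definition smallest_nonabelian_beauville ::
  "'a itself \<Rightarrow> nat \<Rightarrow> ('h, 'm) monoid_scheme \<Rightarrow> bool" where
  "smallest_nonabelian_beauville (_ :: 'a itself) p H \<longleftrightarrow>
    nonabelian_beauville_p_group p H \<and>
    (\<forall>G :: 'a monoid. nonabelian_beauville_p_group p G \<longrightarrow>
      order H \<le> order G \<and> (order G = order H \<longrightarrow> G \<cong> H))"

section \<open>The groups\<close>

datatype letter = Lx | Ly | Lz | Lw | Lt

abbreviation (input) "wx \<equiv> gen Lx"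
abbreviation (input) "wy \<equiv> gen Ly"
abbreviation (input) "wz \<equiv> gen Lz"
abbreviation (input) "ww \<equiv> gen Lw"
abbreviation (input) "wt \<equiv> gen Lt"

text \<open>\<open>SmallGroup(2^7, 36)\<close>, by a polycyclic presentation. It is the largest group of nilpotency
  class 3 generated by two elements of order dividing 4 whose commutator, together with the
  threefold commutators, has order dividing 2: the normal subgroup generated by \<open>wz, ww, wt\<close> is
  elementary abelian of order \<open>2^3\<close>, with quotient \<open>C\<^sub>4 \<times> C\<^sub>4\<close>.\<close>

definition small_group_128_36 :: "letter word set monoid" where
  "small_group_128_36 = presented_group {Lx, Ly, Lz, Lw, Lt}
    {(wpow wx 4, []), (wpow wy 4, []), (wpow wz 2, []), (wpow ww 2, []), (wpow wt 2, []),
     (wcomm wx wy, wz), (wcomm wz wx, ww), (wcomm wz wy, wt),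
     (wcomm wx ww, []), (wcomm wy ww, []), (wcomm wz ww, []),
     (wcomm wx wt, []), (wcomm wy wt, []), (wcomm wz wt, []), (wcomm ww wt, [])}"

definition beauville_3_group :: "letter word set monoid" where
  "beauville_3_group = presented_group {Lx, Ly, Lz, Lw, Lt}
    {(wpow wx 3, []), (wpow wy 3, []), (wpow wz 3, []), (wpow ww 3, []), (wpow wt 3, []),
     (wconj wy wx, wy @ wz), (wconj wz wx, wz @ ww), (wconj wz wy, wz @ wt),
     (wcomm wx ww, []), (wcomm wy ww, []), (wcomm wz ww, []),
     (wcomm wx wt, []), (wcomm wy wt, []), (wcomm wz wt, []), (wcomm ww wt, [])}"

definition heisenberg_group :: "nat \<Rightarrow> letter word set monoid" where
  "heisenberg_group p = presented_group {Lx, Ly, Lz}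
    {(wpow wx p, []), (wpow wy p, []), (wpow wz p, []),
     (wcomm wx wy, wz), (wcomm wx wz, []), (wcomm wy wz, [])}"

definition small_group_125_3 :: "letter word set monoid" where
  "small_group_125_3 = heisenberg_group 5"

end

theory Submission
  imports Defs "HOL-Combinatorics.Perm"
begin

text \<open>Let \<open>L\<^sub>0 = G\<close> and \<open>L\<^sub>k\<^sub>+\<^sub>1 = [L\<^sub>k, G] L\<^sub>k\<^sup>p\<close> be the lower exponent-\<open>p\<close> central series of a two-generated
  \<open>p\<close>-group \<open>G\<close>. If \<open>a^(p^i)\<close> is a nontrivial power of \<open>a\<close> and conjugation together with powers prime
  to \<open>p\<close> moves it through its whole coset of \<open>L\<^sub>i\<^sub>+\<^sub>1\<close>, then all elements of \<open>a L\<^sub>1\<close> have conjugate nontrivial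
  powers. The \<open>p + 1\<close> lines of the plane \<open>G / L\<^sub>1\<close> are too few for the two generating pairs of a Beauville structure
  to avoid each other: for \<open>p = 2\<close> each pair covers all three lines, and for \<open>p = 3\<close> each covers three of the
  four. Counting the layers then bounds the order from below, and in the case of equality it determines the relations
  of the generators. Conversely, representations of the presented groups by unitriangular matrices over the
  integers modulo \<open>p\<close> and their abelian quotients yield the orders and separate the conjugacy classes of the powers in an
  explicit pair of generating pairs.\<close>

text \<open>The orders are products of forced indices along \<open>G > L 1 > L 2 > 1\<close>:
  \<open>243 = 9 * 3 * 9\<close> and \<open>128 = 4 * 8 * 4\<close>. The upper bound on the order is
  assumed from the start, so each step is a finite case analysis on the orders of the
  \<open>L k\<close>. For \<open>p = 3\<close> the second pair leaves one line uncovered, so only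
  two of the three elements of the first pair are sure to be ample. For \<open>p = 2\<close> all
  three lines are at hand, but squaring is compatible neither with products modulo
  \<open>L 2\<close> nor with commutators modulo \<open>L 3\<close>: \<open>[x^2, y]\<close> carries
  the extra factor \<open>[x, [x, y]]\<close>. This makes that case the longest. For
  \<open>p >= 5\<close> there are at least six lines, enough for both pairs, and the argument
  changes: non-commutativity alone forces order \<open>p^3\<close>, and \<open>p\<close>-th powers
  lie in \<open>L 1\<close> of order \<open>p\<close>, so nontrivial ones in both pairs would
  generate the same subgroup; hence exponent \<open>p\<close>. The explicit second pairs occupy
  three fresh lines when \<open>p >= 5\<close>. They reuse all lines of the first pair when
  \<open>p = 2\<close> and two of them when \<open>p = 3\<close>; there the abelian quotient cannot
  separate the pairs and matrices are needed.\<close>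

hide_const (open) Perm.order Perm.orbit
hide_fact (open) Perm.order_def Perm.orbit_def

section \<open>Groups as a type class, with commutators, conjugates and generated subgroups\<close>

class group_mult = monoid_mult + inverse +
  assumes g_left_inverse [simp]: "inverse a * a = 1"
begin

lemma g_cancel_left [simp]: "inverse a * (a * b) = b"
  by (metis g_left_inverse mult.assoc mult_1_left)

lemma g_right_inverse [simp]: "a * inverse a = 1"
  by (metis g_cancel_left g_left_inverse mult_1_right)

lemma g_cancel_right [simp]: "a * (inverse a * b) = b"
  by (metis g_right_inverse mult.assoc mult_1_left)

lemma g_mult_left_eq [simp]: "a * b = a * c \<longleftrightarrow> b = c"
  by (metis g_cancel_left)

lemma g_mult_right_eq [simp]: "b * a = c * a \<longleftrightarrow> b = c"
  by (metis g_right_inverse mult.assoc mult_1_right)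

lemma g_inverse_unique: "a * b = 1 \<Longrightarrow> inverse a = b"
  by (metis g_cancel_left mult_1_right)

lemma g_inverse_one [simp]: "inverse 1 = 1"
  by (rule g_inverse_unique) simp

lemma g_inverse_inverse [simp]: "inverse (inverse a) = a"
  by (rule g_inverse_unique) simp

lemma g_inverse_mult: "inverse (a * b) = inverse b * inverse a"
  by (rule g_inverse_unique) (simp add: mult.assoc)

lemma g_inverse_eq_iff [simp]: "inverse a = inverse b \<longleftrightarrow> a = b"
  by (metis g_inverse_inverse)

lemma g_inverse_power: "inverse (a ^ n) = inverse a ^ n"
  by (induction n) (simp_all add: g_inverse_mult power_commutes)

definition com :: "'a \<Rightarrow> 'a \<Rightarrow> 'a" where
  "com a b = a * b * inverse a * inverse b"

text \<open>Conjugation is taken from the left so that it is a left action (\<open>cj_cj\<close>).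
  The sets \<open>Sigma_set\<close> use \<open>conj_elt\<close>, which conjugates from the right;
  passing between the two replaces \<open>g\<close> by its inverse.\<close>

definition cj :: "'a \<Rightarrow> 'a \<Rightarrow> 'a" where
  "cj g a = g * a * inverse g"

definition subgrp :: "'a set \<Rightarrow> bool" where
  "subgrp H \<longleftrightarrow> 1 \<in> H \<and> (\<forall>a\<in>H. \<forall>b\<in>H. a * b \<in> H) \<and> (\<forall>a\<in>H. inverse a \<in> H)"

definition sgen :: "'a set \<Rightarrow> 'a set" where
  "sgen S = \<Inter>{H. subgrp H \<and> S \<subseteq> H}"

end

lemmas g_simps = mult.assoc g_inverse_mult

lemma cj_simps:
  fixes a b g h :: "'a::group_mult"
  shows cj_mult: "cj g (a * b) = cj g a * cj g b"
    and cj_inverse: "cj g (inverse a) = inverse (cj g a)"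
    and cj_one: "cj g 1 = 1"
    and cj_by_one: "cj 1 a = a"
    and cj_cj: "cj g (cj h a) = cj (g * h) a"
  by (simp_all add: cj_def g_simps)

lemma cj_power: "cj g (a ^ n) = cj g (a::'a::group_mult) ^ n"
  by (induction n) (simp_all add: cj_simps)

lemma cj_eq_com: "cj g a = com g a * (a::'a::group_mult)"
  by (simp add: cj_def com_def g_simps)

lemma com_eq_one_iff: "com a b = 1 \<longleftrightarrow> a * b = b * (a::'a::group_mult)"
proof
  assume "com a b = 1"
  then have "com a b * (b * a) = b * a" by simp
  then show "a * b = b * a" by (simp add: com_def g_simps)
next
  assume "a * b = b * a"
  then show "com a b = 1" unfolding com_def by (simp add: g_simps)
qed

lemma com_inverse: "inverse (com a b) = com b (a::'a::group_mult)"
  by (simp add: com_def g_simps)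

lemma com_mult_left: "com (a * b) c = cj a (com b c) * com a (c::'a::group_mult)"
  by (simp add: com_def cj_def g_simps)

lemma com_mult_right: "com a (b * c) = com a b * cj b (com a (c::'a::group_mult))"
  by (simp add: com_def cj_def g_simps)

lemma com_one [simp]: "com 1 a = 1" "com a 1 = (1::'a::group_mult)"
  by (simp_all add: com_def)

lemma com_self [simp]: "com a a = (1::'a::group_mult)"
  by (simp add: com_def g_simps)

lemma com_power_self [simp]: "com (a ^ n) a = (1::'a::group_mult)" "com a (a ^ n) = (1::'a::group_mult)"
  by (simp_all add: com_eq_one_iff power_commutes)

lemma cj_com: "cj g (com a b) = com (cj g a) (cj g (b::'a::group_mult))"
  by (simp add: com_def cj_simps)

lemma mult_com: "a * b = com a b * b * (a::'a::group_mult)"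
  by (simp add: com_def g_simps)

subsection \<open>Subgroups\<close>

lemma subgrpI:
  assumes "1 \<in> H" "\<And>a b. a \<in> H \<Longrightarrow> b \<in> H \<Longrightarrow> a * b \<in> H" "\<And>a. a \<in> H \<Longrightarrow> inverse a \<in> H"
  shows "subgrp H"
  using assms by (simp add: subgrp_def)

lemma subgrp_one: "subgrp H \<Longrightarrow> 1 \<in> H"
  and subgrp_mult: "subgrp H \<Longrightarrow> a \<in> H \<Longrightarrow> b \<in> H \<Longrightarrow> a * b \<in> H"
  and subgrp_inverse: "subgrp H \<Longrightarrow> a \<in> H \<Longrightarrow> inverse a \<in> H"
  by (simp_all add: subgrp_def)

lemma subgrp_power: "subgrp H \<Longrightarrow> a \<in> H \<Longrightarrow> a ^ n \<in> H"
  by (induction n) (simp_all add: subgrp_one subgrp_mult)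

lemma subgrp_cj: "subgrp H \<Longrightarrow> g \<in> H \<Longrightarrow> a \<in> H \<Longrightarrow> cj g a \<in> H"
  by (simp add: cj_def subgrp_mult subgrp_inverse)

lemma subgrp_com: "subgrp H \<Longrightarrow> g \<in> H \<Longrightarrow> a \<in> H \<Longrightarrow> com g a \<in> H"
  by (simp add: com_def subgrp_mult subgrp_inverse)

lemma subgrp_inverse_iff: "subgrp H \<Longrightarrow> inverse a \<in> H \<longleftrightarrow> a \<in> H"
  by (metis subgrp_inverse g_inverse_inverse)

lemma subgrp_mult_left_iff: "subgrp H \<Longrightarrow> a \<in> H \<Longrightarrow> a * b \<in> H \<longleftrightarrow> b \<in> H"
  by (metis g_cancel_left subgrp_inverse subgrp_mult)

lemma subgrp_mult_right_iff: "subgrp H \<Longrightarrow> a \<in> H \<Longrightarrow> b * a \<in> H \<longleftrightarrow> b \<in> H"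
  by (metis subgrp_inverse_iff subgrp_mult_left_iff g_inverse_mult)

text \<open>Left multiplication by an element is injective on the finite set, hence onto it. Hitting
  the element itself yields \<open>1\<close>, and hitting \<open>1\<close> yields the
  inverse.\<close>

lemma finite_subgrpI:
  assumes "finite H" "H \<noteq> {}" "\<And>a b. a \<in> H \<Longrightarrow> b \<in> H \<Longrightarrow> a * b \<in> H"
  shows "subgrp H"
proof -
  have *: "1 \<in> H \<and> inverse a \<in> H" if a: "a \<in> H" for a
  proof -
    have "inj_on ((*) a) H" by (simp add: inj_on_def)
    moreover have "(*) a ` H \<subseteq> H" using assms(3) a by auto
    ultimately have im: "(*) a ` H = H" using assms(1) by (metis endo_inj_surj)
    then obtain e where e: "e \<in> H" "a = a * e" using a by (metis imageE)
    from e(2) have "a * 1 = a * e" by simp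
    then have "e = 1" by (simp only: g_mult_left_eq)
    then have "1 \<in> H" using e by simp
    then obtain b where "b \<in> H" "1 = a * b" using im by (metis imageE)
    then show ?thesis using \<open>1 \<in> H\<close> g_inverse_unique by metis
  qed
  show ?thesis using * assms by (auto simp: subgrp_def)
qed

lemma subgrp_gen: "subgrp (sgen S)"
  by (auto simp: sgen_def subgrp_def)

lemma gen_incl: "s \<in> S \<Longrightarrow> s \<in> sgen S"
  by (auto simp: sgen_def)

lemma gen_least: "subgrp H \<Longrightarrow> S \<subseteq> H \<Longrightarrow> sgen S \<subseteq> H"
  by (auto simp: sgen_def)

lemma gen_mono: "S \<subseteq> T \<Longrightarrow> sgen S \<subseteq> sgen T"
  by (meson gen_least gen_incl subgrp_gen subset_iff)

lemma gen_subset_gen: "S \<subseteq> sgen T \<Longrightarrow> sgen S \<subseteq> sgen T"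
  by (simp add: gen_least subgrp_gen)

lemma gen_subgrp_eq: "subgrp H \<Longrightarrow> sgen H = H"
  by (meson gen_least gen_incl subset_antisym subset_iff)

abbreviation monoid_of :: "'a::group_mult set \<Rightarrow> 'a monoid" where
  "monoid_of H \<equiv> \<lparr>carrier = H, monoid.mult = (*), one = 1\<rparr>"

lemma group_monoid_of: "subgrp H \<Longrightarrow> group (monoid_of H)"
  by (rule groupI) (auto simp: subgrp_def mult.assoc intro: g_left_inverse)

lemma inv_monoid_of: "subgrp H \<Longrightarrow> a \<in> H \<Longrightarrow> inv\<^bsub>monoid_of H\<^esub> a = inverse a"
  by (rule group.inv_equality[OF group_monoid_of]) (auto simp: subgrp_def)

lemma pow_monoid_of: "a [^]\<^bsub>monoid_of H\<^esub> (n::nat) = a ^ n"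
  by (induction n) (simp_all add: nat_pow_def power_Suc2 del: power_Suc)

lemma subgrp_card_dvd:
  assumes "subgrp H" "subgrp K" "H \<subseteq> K" "finite K"
  shows "card H dvd card K"
proof -
  have "subgroup H (monoid_of K)"
    using assms by (intro group.subgroupI[OF group_monoid_of])
      (auto simp: inv_monoid_of subset_iff subgrp_def)
  from group.lagrange_finite[OF group_monoid_of[OF assms(2)] _ this] assms
  have "card (rcosets\<^bsub>monoid_of K\<^esub> H) * card H = card K"
    by (simp add: order_def)
  then show ?thesis by (metis dvd_triv_right)
qed

text \<open>Orbits have \<open>p\<close>-power length, so those with more than one point vanish
  modulo \<open>p\<close>; the induction removes one such orbit at a time.\<close>

lemma card_fixed_points_mod:
  fixes G :: "'a::group_mult set"
  assumes G: "subgrp G" "finite G" "card G = p ^ n" and p: "Factorial_Ring.prime (p::nat)"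
    and act: "\<And>g x. g \<in> G \<Longrightarrow> x \<in> E \<Longrightarrow> act g x \<in> E" "\<And>x. x \<in> E \<Longrightarrow> act 1 x = x"
      "\<And>g h x. g \<in> G \<Longrightarrow> h \<in> G \<Longrightarrow> x \<in> E \<Longrightarrow> act (g * h) x = act g (act h x)"
    and E: "finite E"
  shows "card E mod p = card {x\<in>E. \<forall>g\<in>G. act g x = x} mod p"
  using E act
proof (induction "card E" arbitrary: E rule: less_induct)
  case less
  note act = less.prems(2-4)
  show ?case
  proof (cases "\<forall>x\<in>E. \<forall>g\<in>G. act g x = x")
    case True
    then have "{x\<in>E. \<forall>g\<in>G. act g x = x} = E" by auto
    then show ?thesis by simp
  next
    case False
    then obtain x g0 where x: "x \<in> E" and g0: "g0 \<in> G" "act g0 x \<noteq> x" by auto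
    define Ob where "Ob = (\<lambda>g. act g x) ` G"
    define St where "St = {g\<in>G. act g x = x}"
    have ObE: "Ob \<subseteq> E" using act(1) x by (auto simp: Ob_def)
    have xO: "x \<in> Ob" using act(2)[OF x] G(1) by (force simp: Ob_def subgrp_def)
    have fO: "finite Ob" using G(2) by (simp add: Ob_def)
    have inv_act: "act (inverse g) (act g y) = y" if "g \<in> G" "y \<in> E" for g y
      using act(3)[of "inverse g" g y] act(2)[of y] that G(1) by (simp add: subgrp_def)
    \<comment> \<open>The fibre over \<open>y = act h x\<close> is the left coset of the stabiliser
      by \<open>h\<close>; counting \<open>G\<close> by fibres is the orbit-stabiliser
      formula.\<close>
    have fib: "card {g\<in>G. act g x = y} = card St" if y: "y \<in> Ob" for y
    proof -
      obtain h where h: "h \<in> G" "y = act h x" using y by (auto simp: Ob_def)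
      have "bij_betw ((*) h) St {g\<in>G. act g x = y}"
      proof (rule bij_betwI[where g = "(*) (inverse h)"])
        show "(*) h \<in> St \<rightarrow> {g\<in>G. act g x = y}"
          using h G(1) act(3) x by (auto simp: St_def subgrp_def)
        show "(*) (inverse h) \<in> {g\<in>G. act g x = y} \<rightarrow> St"
          using h G(1) act(3) x inv_act by (auto simp: St_def subgrp_def)
      qed auto
      then show ?thesis by (metis bij_betw_same_card)
    qed
    have "card G = (\<Sum>y\<in>Ob. card {g\<in>G. act g x = y})"
    proof -
      have "G = (\<Union>y\<in>Ob. {g\<in>G. act g x = y})" by (auto simp: Ob_def)
      moreover have "card (\<Union>y\<in>Ob. {g\<in>G. act g x = y}) = (\<Sum>y\<in>Ob. card {g\<in>G. act g x = y})"
        by (rule card_UN_disjoint) (use fO G(2) in auto)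
      ultimately show ?thesis by metis
    qed
    then have "card G = card Ob * card St" using fib by simp
    then have "card Ob dvd p ^ n" using G(3) by (metis dvd_triv_left)
    then obtain i where i: "card Ob = p ^ i" using p divides_primepow_nat by blast
    have "card Ob \<noteq> 1"
    proof
      assume "card Ob = 1"
      then obtain z where "Ob = {z}" by (auto simp: card_1_singleton_iff)
      moreover have "act g0 x \<in> Ob" using g0 by (simp add: Ob_def)
      ultimately show False using xO g0 by auto
    qed
    then have pO: "p dvd card Ob" using i by (cases i) auto
    have inv: "act g y \<in> E - Ob" if "g \<in> G" "y \<in> E - Ob" for g y
    proof -
      have "act g y \<notin> Ob"
      proof
        assume "act g y \<in> Ob"
        then obtain h where h: "h \<in> G" "act g y = act h x" by (auto simp: Ob_def)
        then have "y = act (inverse g) (act h x)" using inv_act that by (metis DiffD1)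
        also have "\<dots> = act (inverse g * h) x" using act(3) that h x G(1) by (simp add: subgrp_def)
        finally show False using that h G(1) by (auto simp: Ob_def subgrp_def)
      qed
      then show ?thesis using act(1) that by auto
    qed
    have "card (E - Ob) < card E"
      using x xO less.prems(1) by (intro psubset_card_mono) auto
    from less.hyps[OF this] have "card (E - Ob) mod p = card {x\<in>E - Ob. \<forall>g\<in>G. act g x = x} mod p"
      using less.prems(1) inv act by auto
    moreover have "{y\<in>E - Ob. \<forall>g\<in>G. act g y = y} = {y\<in>E. \<forall>g\<in>G. act g y = y}"
    proof -
      have False if y: "y \<in> Ob" "\<forall>g\<in>G. act g y = y" for y
      proof -
        obtain h where h: "h \<in> G" "y = act h x" using y by (auto simp: Ob_def)
        have "x = act (inverse h) y" using h inv_act x by metis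
        also have "\<dots> = y" using y(2) h G(1) by (auto simp: subgrp_def)
        finally show False using y g0 by auto
      qed
      then show ?thesis by auto
    qed
    moreover have "card E = card (E - Ob) + card Ob"
      using ObE fO less.prems(1) by (metis card_Diff_subset card_mono le_add_diff_inverse2)
    ultimately show ?thesis using pO by (auto simp: mod_add_eq dvd_def)
  qed
qed

section \<open>Finite \<open>p\<close>-groups\<close>

lemma subgrp_pow_card:
  assumes "subgrp G" "finite G" "g \<in> G"
  shows "g ^ card G = (1::'a::group_mult)"
proof -
  have "g [^]\<^bsub>monoid_of G\<^esub> (order (monoid_of G)) = \<one>\<^bsub>monoid_of G\<^esub>"
    using assms by (intro group.pow_order_eq_1[OF group_monoid_of]) (auto simp: order_def)
  then show ?thesis by (simp add: pow_monoid_of order_def)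
qed

definition eqm :: "'a::group_mult set \<Rightarrow> 'a \<Rightarrow> 'a \<Rightarrow> bool" where
  "eqm K a b \<longleftrightarrow> a * inverse b \<in> K"

locale fin_p_group =
  fixes G :: "'a::group_mult set" and p :: nat
  assumes subG: "subgrp G" and finG: "finite G"
    and prp: "Factorial_Ring.prime p" and cardG: "\<exists>n. card G = p ^ n"
begin

lemmas G_closed [simp] = subgrp_one[OF subG] subgrp_mult[OF subG] subgrp_inverse[OF subG]
  subgrp_power[OF subG] subgrp_cj[OF subG] subgrp_com[OF subG]

lemma p_gt_1: "1 < p" using prp prime_gt_1_nat by blast

definition nrm :: "'a set \<Rightarrow> bool" where
  "nrm N \<longleftrightarrow> subgrp N \<and> N \<subseteq> G \<and> (\<forall>g\<in>G. \<forall>n\<in>N. cj g n \<in> N)"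

lemma nrm_subgrp: "nrm N \<Longrightarrow> subgrp N"
  and nrm_subset: "nrm N \<Longrightarrow> N \<subseteq> G"
  and nrm_in: "nrm N \<Longrightarrow> n \<in> N \<Longrightarrow> n \<in> G"
  and nrm_cj: "nrm N \<Longrightarrow> g \<in> G \<Longrightarrow> n \<in> N \<Longrightarrow> cj g n \<in> N"
  by (auto simp: nrm_def)

lemma nrm_mult: "nrm N \<Longrightarrow> a \<in> N \<Longrightarrow> b \<in> N \<Longrightarrow> a * b \<in> N"
  and nrm_inverse: "nrm N \<Longrightarrow> a \<in> N \<Longrightarrow> inverse a \<in> N"
  and nrm_one: "nrm N \<Longrightarrow> 1 \<in> N"
  and nrm_power: "nrm N \<Longrightarrow> a \<in> N \<Longrightarrow> a ^ n \<in> N"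
  by (auto simp: nrm_def subgrp_mult subgrp_inverse subgrp_one subgrp_power)

lemma nrm_cj_iff: "nrm N \<Longrightarrow> g \<in> G \<Longrightarrow> cj g n \<in> N \<longleftrightarrow> n \<in> N"
  by (metis G_closed(3) cj_by_one cj_cj g_left_inverse nrm_cj)

lemma nrm_com_left: "nrm N \<Longrightarrow> n \<in> N \<Longrightarrow> g \<in> G \<Longrightarrow> com n g \<in> N"
proof -
  assume *: "nrm N" "n \<in> N" "g \<in> G"
  have "com n g = n * cj g (inverse n)" by (simp add: com_def cj_def g_simps)
  then show ?thesis using * by (simp add: nrm_mult nrm_cj nrm_inverse)
qed

lemma nrm_com_right: "nrm N \<Longrightarrow> n \<in> N \<Longrightarrow> g \<in> G \<Longrightarrow> com g n \<in> N"
  by (metis com_inverse nrm_com_left nrm_inverse)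

lemma nrm_G: "nrm G" by (simp add: nrm_def subG)

lemma nrm_trivial: "nrm {1}"
  by (simp add: nrm_def subgrp_def cj_one)

lemma finite_nrm: "nrm N \<Longrightarrow> finite N"
  using finG finite_subset nrm_subset by blast

lemma nrm_com_swap: "nrm N \<Longrightarrow> com a b \<in> N \<longleftrightarrow> com b a \<in> N"
  by (metis com_inverse nrm_inverse)

subsection \<open>Congruence modulo a normal subgroup\<close>

lemma eqm_refl [simp]: "nrm K \<Longrightarrow> eqm K a a"
  by (simp add: eqm_def nrm_one)

lemma eqm_sym: "nrm K \<Longrightarrow> eqm K a b \<Longrightarrow> eqm K b a"
  unfolding eqm_def using nrm_inverse[of K "a * inverse b"] by (simp add: g_inverse_mult)

lemma eqm_trans [trans]: "nrm K \<Longrightarrow> eqm K a b \<Longrightarrow> eqm K b c \<Longrightarrow> eqm K a c"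
  unfolding eqm_def using nrm_mult[of K "a * inverse b" "b * inverse c"] by (simp add: mult.assoc)

lemma eqm_mult:
  assumes "nrm K" "eqm K a b" "eqm K c d" "a \<in> G"
  shows "eqm K (a * c) (b * d)"
proof -
  have "(a * c) * inverse (b * d) = cj a (c * inverse d) * (a * inverse b)"
    by (simp add: cj_def g_simps)
  then show ?thesis using assms by (simp add: eqm_def nrm_mult nrm_cj)
qed

lemma eqm_inverse:
  assumes "nrm K" "eqm K a b" "b \<in> G"
  shows "eqm K (inverse a) (inverse b)"
proof -
  have "inverse a * inverse (inverse b) = cj (inverse b) (inverse (a * inverse b))"
    by (simp add: cj_def g_simps)
  then show ?thesis unfolding eqm_def using assms by (simp add: eqm_def nrm_inverse nrm_cj)
qed

lemma eqm_power:
  assumes "nrm K" "eqm K a b" "a \<in> G"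
  shows "eqm K (a ^ n) (b ^ n)"
  by (induction n) (auto simp: assms intro!: eqm_mult)

lemma eqm_cj:
  assumes "nrm K" "eqm K a b" "g \<in> G"
  shows "eqm K (cj g a) (cj g b)"
  using assms by (simp add: eqm_def nrm_cj flip: cj_inverse cj_mult)

lemma eqm_mem_iff:
  assumes "eqm K a b" "subgrp H" "K \<subseteq> H"
  shows "a \<in> H \<longleftrightarrow> b \<in> H"
proof -
  have h: "a * inverse b \<in> H" using assms by (auto simp: eqm_def)
  have e: "a = (a * inverse b) * b" by (simp add: mult.assoc)
  show ?thesis using subgrp_mult_left_iff[OF assms(2) h, of b] e by simp
qed

lemma eqm_one_iff: "nrm K \<Longrightarrow> eqm K a 1 \<longleftrightarrow> a \<in> K"
  by (simp add: eqm_def)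

lemma eqm_mult_left: "nrm K \<Longrightarrow> k \<in> K \<Longrightarrow> eqm K (k * a) a"
  by (simp add: eqm_def mult.assoc)

lemma eqm_mult_right: "nrm K \<Longrightarrow> k \<in> K \<Longrightarrow> a \<in> G \<Longrightarrow> eqm K (a * k) a"
  using nrm_cj[of K a k] by (simp add: eqm_def cj_def)

lemma eqm_trivial: "eqm {1} a b \<longleftrightarrow> a = b"
  by (metis eqm_def g_cancel_left g_inverse_inverse g_right_inverse mult_1_right singleton_iff)

lemma eqm_com_mult: "com a b \<in> K \<Longrightarrow> eqm K (a * b) (b * a)"
  by (simp add: eqm_def com_def g_simps)

lemma eqm_cj_self: "com g a \<in> K \<Longrightarrow> eqm K (cj g a) a"
  by (simp add: eqm_def cj_def com_def g_simps)

lemma eqm_power_mult: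
  assumes K: "nrm K" and a: "a \<in> G" "b \<in> G" and c: "com b a \<in> K"
  shows "eqm K ((a * b) ^ n) (a ^ n * b ^ n)"
proof (induction n)
  case (Suc n)
  have sw: "eqm K (b * a ^ n) (a ^ n * b)" for n
  proof (induction n)
    case (Suc n)
    have "eqm K ((b * a) * a ^ n) ((a * b) * a ^ n)"
      using K a c by (intro eqm_mult eqm_com_mult) auto
    moreover have "eqm K (a * (b * a ^ n)) (a * (a ^ n * b))"
      by (rule eqm_mult[OF K eqm_refl[OF K] Suc]) (use a in auto)
    ultimately show ?case using eqm_trans[OF K] by (simp add: mult.assoc)
  qed (use K in simp)
  have "eqm K ((a * b) * (a * b) ^ n) ((a * b) * (a ^ n * b ^ n))"
    using K a Suc by (intro eqm_mult) auto
  moreover have "eqm K (a * ((b * a ^ n) * b ^ n)) (a * ((a ^ n * b) * b ^ n))"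
    by (rule eqm_mult[OF K eqm_refl[OF K] eqm_mult[OF K sw eqm_refl[OF K]]]) (use a in auto)
  ultimately show ?case using eqm_trans[OF K] by (simp add: mult.assoc)
qed (use K in simp)

text \<open>Subgroup orders are powers of \<open>p\<close>, so a proper inclusion costs at least a
  factor \<open>p\<close>. All counting of layers rests on this.\<close>

lemma proper_card:
  assumes "subgrp H" "subgrp K" "H \<subset> K" "K \<subseteq> G"
  shows "p * card H \<le> card K" and "p * card H dvd card K"
proof -
  have fK: "finite K" using assms finG finite_subset by blast
  obtain n where "card G = p ^ n" using cardG by blast
  moreover have "card K dvd card G" using assms subG finG by (intro subgrp_card_dvd)
  ultimately obtain i where i: "card K = p ^ i" using prp divides_primepow_nat by metis
  have "card H dvd card K" using assms fK by (intro subgrp_card_dvd) auto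
  then obtain j where j: "card H = p ^ j" using i prp divides_primepow_nat by metis
  have "card H < card K" using assms fK by (simp add: psubset_card_mono)
  then have "j < i" using i j p_gt_1 power_strict_increasing_iff by metis
  then show d: "p * card H dvd card K" using i j by (simp add: le_imp_power_dvd flip: power_Suc)
  then show "p * card H \<le> card K" using i p_gt_1 by (simp add: dvd_imp_le)
qed

text \<open>The index is below \<open>p^2\<close>, so nothing fits strictly between the two
  subgroups.\<close>

lemma proper_gen:
  assumes "subgrp H" "subgrp K" "H \<subseteq> K" "K \<subseteq> G" "card K < p * (p * card H)" "e \<in> K" "e \<notin> H"
  shows "K = sgen (insert e H)"
proof (rule ccontr)
  assume "K \<noteq> sgen (insert e H)"
  moreover have "sgen (insert e H) \<subseteq> K" using assms by (intro gen_least) auto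
  ultimately have 1: "sgen (insert e H) \<subset> K" by blast
  have 2: "H \<subset> sgen (insert e H)" using assms gen_incl[of _ "insert e H"] by auto
  have "p * card H \<le> card (sgen (insert e H))"
    using 1 2 assms by (intro proper_card subgrp_gen) auto
  moreover have "p * card (sgen (insert e H)) \<le> card K"
    using 1 assms by (intro proper_card subgrp_gen) auto
  ultimately have "p * (p * card H) \<le> card K" by (meson le_trans mult_le_mono2)
  then show False using assms by simp
qed

text \<open>The set is the preimage in \<open>G\<close> of the centre of the quotient by
  \<open>K\<close>.\<close>

lemma central_mod_subgrp:
  assumes K: "nrm K"
  shows "subgrp {g\<in>G. \<forall>h\<in>G. com h g \<in> K}"
proof (rule subgrpI)
  show "1 \<in> {g\<in>G. \<forall>h\<in>G. com h g \<in> K}" using K by (simp add: nrm_one)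
next
  fix a b assume "a \<in> {g\<in>G. \<forall>h\<in>G. com h g \<in> K}" "b \<in> {g\<in>G. \<forall>h\<in>G. com h g \<in> K}"
  then show "a * b \<in> {g\<in>G. \<forall>h\<in>G. com h g \<in> K}"
    using K by (auto simp: com_mult_right nrm_mult nrm_cj)
next
  fix a assume a: "a \<in> {g\<in>G. \<forall>h\<in>G. com h g \<in> K}"
  have "com h (inverse a) = cj (inverse a) (inverse (com h a))" for h
    by (simp add: com_def cj_def g_simps)
  then show "inverse a \<in> {g\<in>G. \<forall>h\<in>G. com h g \<in> K}"
    using a K by (auto simp: nrm_cj nrm_inverse)
qed

text \<open>\<open>G\<close> permutes the cosets of \<open>K\<close> in \<open>N\<close> by
  conjugation. Their number is divisible by \<open>p\<close> and \<open>K\<close> itself is fixed,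
  so another coset is fixed too; its representative is central modulo \<open>K\<close>.\<close>

lemma central_step:
  assumes K: "nrm K" and N: "nrm N" and KN: "K \<subset> N"
  shows "\<exists>g\<in>N - K. \<forall>h\<in>G. com h g \<in> K"
proof -
  define E where "E = rcosets\<^bsub>monoid_of N\<^esub> K"
  have E: "E = (\<lambda>g. (\<lambda>k. k * g) ` K) ` N"
    unfolding E_def RCOSETS_def r_coset_def by auto
  have "subgroup K (monoid_of N)"
    using K N KN by (intro group.subgroupI[OF group_monoid_of])
      (auto simp: inv_monoid_of subset_iff nrm_def subgrp_def)
  from group.lagrange_finite[OF group_monoid_of[OF nrm_subgrp[OF N]] _ this]
  have cE: "card E * card K = card N" using finite_nrm[OF N] by (simp add: E_def order_def)
  have "p * card K dvd card N"
    using K N KN by (intro proper_card nrm_subgrp nrm_subset) auto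
  then have "p * card K dvd card E * card K" using cE by simp
  moreover have "card K \<noteq> 0" using finite_nrm[OF K] nrm_one[OF K] by auto
  ultimately have pE: "p dvd card E" by simp
  have fE: "finite E" using E finite_nrm[OF N] by simp
  obtain n where n: "card G = p ^ n" using cardG by blast
  have cjK: "cj h ` K = K" if "h \<in> G" for h
  proof -
    have "k \<in> cj h ` K" if "k \<in> K" for k
      using nrm_cj[OF K, of "inverse h" k] that \<open>h \<in> G\<close>
      by (intro image_eqI[where x = "cj (inverse h) k"]) (auto simp: cj_cj cj_by_one)
    then show ?thesis using nrm_cj[OF K] that by auto
  qed
  have co: "cj h ` ((\<lambda>k. k * g) ` K) = (\<lambda>k. k * cj h g) ` K" if "h \<in> G" for h g
  proof -
    have "cj h ` ((\<lambda>k. k * g) ` K) = (\<lambda>k. k * cj h g) ` (cj h ` K)"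
      by (simp add: image_image cj_mult)
    then show ?thesis using cjK[OF that] by simp
  qed
  have "card E mod p = card {x\<in>E. \<forall>g\<in>G. cj g ` x = x} mod p"
  proof (rule card_fixed_points_mod[OF subG finG n prp, where act = "\<lambda>g. (`) (cj g)"])
    show "cj h ` x \<in> E" if "h \<in> G" "x \<in> E" for h x
      using that co N by (auto simp: E nrm_cj)
  qed (auto simp: cj_by_one image_image cj_cj fE)
  then have pF: "p dvd card {x\<in>E. \<forall>g\<in>G. cj g ` x = x}" using pE by (simp add: dvd_eq_mod_eq_0)
  have KF: "K \<in> {x\<in>E. \<forall>g\<in>G. cj g ` x = x}"
    using cjK nrm_one[OF N] by (auto simp: E image_iff intro!: bexI[of _ 1])
  have "\<not> {x\<in>E. \<forall>g\<in>G. cj g ` x = x} \<subseteq> {K}"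
  proof
    assume "{x\<in>E. \<forall>g\<in>G. cj g ` x = x} \<subseteq> {K}"
    then have "{x\<in>E. \<forall>g\<in>G. cj g ` x = x} = {K}" using KF by blast
    then show False using pF p_gt_1 by simp
  qed
  then obtain C where C: "C \<in> E" "\<forall>g\<in>G. cj g ` C = C" "C \<noteq> K" by blast
  then obtain g where g: "g \<in> N" "C = (\<lambda>k. k * g) ` K" by (auto simp: E)
  have "g \<notin> K"
  proof
    assume "g \<in> K"
    have "(\<lambda>k. k * g) ` K = K"
    proof
      show "(\<lambda>k. k * g) ` K \<subseteq> K" using \<open>g \<in> K\<close> K by (auto simp: nrm_mult)
      show "K \<subseteq> (\<lambda>k. k * g) ` K"
      proof
        fix k assume "k \<in> K"
        then show "k \<in> (\<lambda>k. k * g) ` K" using \<open>g \<in> K\<close> K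
          by (intro image_eqI[where x = "k * inverse g"]) (auto simp: mult.assoc nrm_mult nrm_inverse)
      qed
    qed
    then show False using C g by simp
  qed
  moreover have "com h g \<in> K" if "h \<in> G" for h
  proof -
    have "cj h g \<in> (\<lambda>k. k * cj h g) ` K" using nrm_one[OF K] by force
    then have "cj h g \<in> (\<lambda>k. k * g) ` K" using C g co[OF that] that by metis
    then obtain k where "k \<in> K" "cj h g = k * g" by auto
    then show ?thesis by (simp add: cj_eq_com)
  qed
  ultimately show ?thesis using g by blast
qed

subsection \<open>The lower exponent-\<open>p\<close> central series\<close>

definition D :: "'a set \<Rightarrow> 'a set" where
  "D N = sgen ((\<lambda>n. n ^ p) ` N \<union> {com n g | n g. n \<in> N \<and> g \<in> G})"

lemma D_power: "n \<in> N \<Longrightarrow> n ^ p \<in> D N"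
  and D_com: "n \<in> N \<Longrightarrow> g \<in> G \<Longrightarrow> com n g \<in> D N"
  by (auto simp: D_def intro!: gen_incl)

lemma D_subset: "nrm N \<Longrightarrow> D N \<subseteq> N"
  unfolding D_def by (rule gen_least) (auto simp: nrm_subgrp nrm_power nrm_com_left)

lemma D_least:
  "subgrp H \<Longrightarrow> (\<And>n. n \<in> N \<Longrightarrow> n ^ p \<in> H) \<Longrightarrow> (\<And>n g. n \<in> N \<Longrightarrow> g \<in> G \<Longrightarrow> com n g \<in> H) \<Longrightarrow> D N \<subseteq> H"
  unfolding D_def by (rule gen_least) auto

lemma subgrp_cj_vimage: "subgrp H \<Longrightarrow> subgrp {n. cj g n \<in> H}"
  by (rule subgrpI) (auto simp: cj_simps subgrp_one subgrp_mult subgrp_inverse)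

lemma nrm_D:
  assumes N: "nrm N"
  shows "nrm (D N)"
proof -
  have s: "subgrp (D N)" by (simp add: D_def subgrp_gen)
  have "D N \<subseteq> {n. cj g n \<in> D N}" if "g \<in> G" for g
    using that N by (intro D_least subgrp_cj_vimage s) (auto simp: cj_power cj_com nrm_cj intro!: D_power D_com)
  then show ?thesis using s D_subset[OF N] nrm_subset[OF N] by (auto simp: nrm_def)
qed

text \<open>Let \<open>K\<close> be maximal among the subgroups normal in \<open>G\<close> and
  properly contained in \<open>N\<close>. An element central modulo \<open>K\<close>, raised to a
  suitable power of \<open>p\<close>, has order \<open>p\<close> modulo \<open>K\<close>. The
  elements of \<open>N\<close> that are central of exponent \<open>p\<close> modulo \<open>K\<close>
  therefore exceed \<open>K\<close> and fill \<open>N\<close>, which puts \<open>D N\<close> inside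
  \<open>K\<close>.\<close>

lemma D_proper:
  assumes N: "nrm N" and N1: "N \<noteq> {1}"
  shows "D N \<subset> N"
proof -
  let ?S = "{K. nrm K \<and> K \<subset> N}"
  have "{1} \<in> ?S" using N N1 nrm_one[OF N] nrm_trivial by auto
  moreover have "finite ?S" using finite_nrm[OF N] by (auto intro: finite_subset[of _ "Pow N"])
  ultimately obtain K where K: "nrm K" "K \<subset> N" and max: "\<And>M. nrm M \<Longrightarrow> M \<subset> N \<Longrightarrow> K \<subseteq> M \<Longrightarrow> M = K"
    using finite_has_maximal[of ?S] by (metis (no_types, lifting) empty_iff mem_Collect_eq)
  obtain g where g: "g \<in> N" "g \<notin> K" "\<forall>h\<in>G. com h g \<in> K"
    using central_step[OF K(1) N K(2)] by blast
  obtain n where "card G = p ^ n" using cardG by blast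
  then have "g ^ (p ^ n) \<in> K"
    using subgrp_pow_card[OF subG finG, of g] g nrm_in[OF N] nrm_one[OF K(1)] by simp
  moreover have "g ^ (p ^ 0) \<notin> K" using g by simp
  \<comment> \<open>\<open>m\<close> marks the last \<open>p\<close>-power of \<open>g\<close> that
    still lies outside \<open>K\<close>.\<close>
  ultimately obtain m where m: "g ^ (p ^ m) \<notin> K" "g ^ (p ^ Suc m) \<in> K"
    using dec_induct[of 0 n "\<lambda>m. g ^ (p ^ m) \<notin> K"] by blast
  define M where "M = {n\<in>N. n ^ p \<in> K \<and> (\<forall>h\<in>G. com h n \<in> K)}"
  note Z = central_mod_subgrp[OF K(1)]
  have MN: "M \<subseteq> N" by (auto simp: M_def)
  have sM: "subgrp M"
  proof (rule finite_subgrpI)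
    show "finite M" using finite_nrm[OF N] MN finite_subset by blast
    show "M \<noteq> {}" using N K by (auto simp: M_def nrm_one intro!: exI[of _ 1])
    fix a b assume a: "a \<in> M" and b: "b \<in> M"
    have ab: "a \<in> G" "b \<in> G" using a b nrm_in[OF N] by (auto simp: M_def)
    have "eqm K ((a * b) ^ p) (a ^ p * b ^ p)"
      using K ab a by (intro eqm_power_mult) (auto simp: M_def)
    then have "(a * b) ^ p \<in> K"
      using eqm_mem_iff[OF _ nrm_subgrp[OF K(1)] subset_refl] a b K(1) by (auto simp: M_def nrm_mult)
    then show "a * b \<in> M"
      using a b ab subgrp_mult[OF Z, of a b] N by (auto simp: M_def nrm_mult)
  qed
  have "nrm M"
    unfolding nrm_def
  proof (intro conjI ballI sM)
    show "M \<subseteq> G" using MN nrm_subset[OF N] by blast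
    fix h n assume h: "h \<in> G" and n: "n \<in> M"
    have "com h' (cj h n) \<in> K" if "h' \<in> G" for h'
    proof -
      have "com h' (cj h n) = cj h (com (cj (inverse h) h') n)" by (simp add: cj_com cj_cj cj_by_one)
      then show ?thesis using n h that K(1) by (auto simp: M_def nrm_cj)
    qed
    then show "cj h n \<in> M" using n h N K(1) by (auto simp: M_def nrm_cj simp flip: cj_power)
  qed
  moreover have "K \<subseteq> M" using K by (auto simp: M_def nrm_power nrm_com_right)
  moreover have "g ^ (p ^ m) \<in> M"
  proof -
    have gG: "g \<in> G" using g nrm_in[OF N] by blast
    have "(g ^ (p ^ m)) ^ p \<in> K" using m(2) by (metis power_Suc2 power_mult)
    moreover have "g ^ (p ^ m) \<in> {g\<in>G. \<forall>h\<in>G. com h g \<in> K}" using g gG by (intro subgrp_power[OF Z]) auto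
    ultimately show ?thesis using g N by (auto simp: M_def nrm_power)
  qed
  ultimately have "M = N" using max[of M] MN m(1) by blast
  then have "D N \<subseteq> K"
    using nrm_subgrp[OF K(1)] by (intro D_least) (auto simp: M_def nrm_com_swap[OF K(1)])
  then show ?thesis using K by blast
qed

primrec L :: "nat \<Rightarrow> 'a set" where
  "L 0 = G"
| "L (Suc k) = D (L k)"

declare L.simps(2) [simp del]

lemma nrm_L [simp]: "nrm (L k)"
  by (induction k) (simp_all add: nrm_G nrm_D L.simps(2))

lemmas L_closed = nrm_one[OF nrm_L] nrm_mult[OF nrm_L] nrm_inverse[OF nrm_L] nrm_power[OF nrm_L]

lemma subgrp_L [simp]: "subgrp (L k)"
  by (simp add: nrm_subgrp)

lemma L_Suc_subset: "L (Suc k) \<subseteq> L k"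
  by (simp add: D_subset L.simps(2))

lemma L_antimono: "i \<le> j \<Longrightarrow> L j \<subseteq> L i"
  using lift_Suc_antimono_le[of L] L_Suc_subset by blast

lemma L_in_G: "a \<in> L k \<Longrightarrow> a \<in> G"
  using nrm_in nrm_L by blast

lemma L_power: "n \<in> L k \<Longrightarrow> n ^ p \<in> L (Suc k)"
  and L_com: "n \<in> L k \<Longrightarrow> g \<in> G \<Longrightarrow> com n g \<in> L (Suc k)"
  by (simp_all add: D_power D_com L.simps(2))

lemma L_com': "n \<in> L k \<Longrightarrow> g \<in> G \<Longrightarrow> com g n \<in> L (Suc k)"
  using L_com nrm_com_swap nrm_L by blast

lemma L_power_dvd: "n \<in> L k \<Longrightarrow> p dvd e \<Longrightarrow> n ^ e \<in> L (Suc k)"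
  using L_power by (metis dvdE nrm_L nrm_power power_mult)

lemma L_proper: "L k \<noteq> {1} \<Longrightarrow> L (Suc k) \<subset> L k"
  by (simp add: D_proper L.simps(2))

lemma finite_L: "finite (L k)"
  by (simp add: finite_nrm)

lemma L_card: "L k \<noteq> {1} \<Longrightarrow> p * card (L (Suc k)) \<le> card (L k)"
  by (intro proper_card L_proper nrm_subgrp nrm_subset) auto

lemma card_L_pos: "0 < card (L k)"
  using finite_L nrm_one[OF nrm_L] card_gt_0_iff by blast

lemma L_eventually_trivial: "\<exists>k. L k = {1}"
proof (rule ccontr)
  assume "\<nexists>k. L k = {1}"
  then have "card (L (Suc k)) < card (L k)" for k
    using L_proper finite_L psubset_card_mono by metis
  then have "card (L k) + k \<le> card (L 0)" for k
    by (induction k) (auto simp: Suc_le_eq le_less_trans intro: less_le_trans, (metis add_Suc_right Suc_leI add_less_mono1 le_trans less_le_trans not_less_eq_eq))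
  then show False by (metis not_add_less2 less_Suc_eq_le add.commute)
qed

lemma L_trivial_Suc: "L k = {1} \<Longrightarrow> k \<le> j \<Longrightarrow> L j = {1}"
  using L_antimono[of k j] nrm_one[OF nrm_L, of j] by auto

lemma L_cj_eqm: "n \<in> L k \<Longrightarrow> g \<in> G \<Longrightarrow> eqm (L (Suc k)) (cj g n) n"
  by (intro eqm_cj_self L_com')

lemma L_commute_eqm: "n \<in> L k \<Longrightarrow> g \<in> G \<Longrightarrow> eqm (L (Suc k)) (g * n) (n * g)"
  by (intro eqm_com_mult L_com')

lemma L_level: "a \<in> G \<Longrightarrow> a \<noteq> 1 \<Longrightarrow> \<exists>k. a \<in> L k \<and> a \<notin> L (Suc k)"
proof -
  assume a: "a \<in> G" "a \<noteq> 1"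
  obtain k where "L k = {1}" using L_eventually_trivial by blast
  then have "a \<notin> L k" using a by simp
  moreover have "a \<in> L 0" using a by simp
  ultimately show ?thesis using dec_induct[of 0 k "\<lambda>k. a \<in> L k"] by blast
qed

text \<open>By \<open>com_mult_left\<close> the condition survives products because \<open>K\<close>
  is normal. Commutator conditions thus need checking on generators only.\<close>

lemma subgrp_com_vimage:
  assumes K: "nrm K" and H: "subgrp H" "H \<subseteq> G" and E: "E \<subseteq> G"
  shows "subgrp {a\<in>H. \<forall>b\<in>E. com a b \<in> K}"
proof (rule subgrpI)
  show "1 \<in> {a\<in>H. \<forall>b\<in>E. com a b \<in> K}" using K H by (simp add: nrm_one subgrp_one)
next
  fix a b assume "a \<in> {a\<in>H. \<forall>b\<in>E. com a b \<in> K}" "b \<in> {a\<in>H. \<forall>b\<in>E. com a b \<in> K}"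
  then show "a * b \<in> {a\<in>H. \<forall>b\<in>E. com a b \<in> K}"
    using K H E by (auto simp: com_mult_left nrm_mult nrm_cj subgrp_mult)
next
  fix a assume a: "a \<in> {a\<in>H. \<forall>b\<in>E. com a b \<in> K}"
  have "com (inverse a) b = cj (inverse a) (inverse (com a b))" for b
    by (simp add: com_def cj_def g_simps)
  then show "inverse a \<in> {a\<in>H. \<forall>b\<in>E. com a b \<in> K}"
    using a K H by (auto simp: nrm_cj nrm_inverse subgrp_inverse)
qed

text \<open>Modulo \<open>L (Suc j)\<close> the commutator is central, so conjugating it by
  \<open>a\<close> changes nothing and the factors simply accumulate.\<close>

lemma com_power_eqm:
  assumes "a \<in> G" "b \<in> G" "com a b \<in> L j"
  shows "eqm (L (Suc j)) (com (a ^ n) b) (com a b ^ n)"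
proof (induction n)
  case (Suc n)
  have m: "com (a ^ n) b \<in> L j"
    by (rule eqm_mem_iff[OF Suc, THEN iffD2]) (use assms L_Suc_subset in \<open>auto intro: L_closed\<close>)
  have "eqm (L (Suc j)) (cj a (com (a ^ n) b)) (com (a ^ n) b)"
    using m assms by (intro L_cj_eqm) auto
  then have 1: "eqm (L (Suc j)) (cj a (com (a ^ n) b)) (com a b ^ n)"
    using Suc eqm_trans[OF nrm_L] by blast
  have "eqm (L (Suc j)) (cj a (com (a ^ n) b) * com a b) (com a b ^ n * com a b)"
    by (rule eqm_mult[OF nrm_L 1 eqm_refl[OF nrm_L]]) (use assms in auto)
  then show ?case by (simp add: com_mult_left power_commutes)
qed simp

text \<open>A form of the three subgroups lemma, by induction on \<open>i\<close> over the
  generators of \<open>D (L i)\<close>. The indices start at 0 here, so the usual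
  \<open>[P_i, P_j] <= P_(i+j)\<close> becomes \<open>Suc (i + j)\<close>.\<close>

lemma L_com_L:
  "a \<in> L i \<Longrightarrow> b \<in> L j \<Longrightarrow> com a b \<in> L (Suc (i + j))"
proof (induction i arbitrary: a b j)
  case 0
  then show ?case using L_com' by simp
next
  case (Suc i)
  let ?K = "L (Suc (Suc i + j))"
  let ?H = "{a \<in> L (Suc i). \<forall>b\<in>L j. com a b \<in> ?K}"
  have K: "nrm ?K" by (rule nrm_L)
  have up: "?K = L (Suc (Suc (i + j)))" by simp
  have "D (L i) \<subseteq> ?H"
  proof (rule D_least)
    show "subgrp ?H" by (rule subgrp_com_vimage) (auto intro: L_in_G nrm_subgrp)
  next
    fix n assume n: "n \<in> L i"
    have "com (n ^ p) b \<in> ?K" if b: "b \<in> L j" for b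
    proof -
      have c: "com n b \<in> L (Suc (i + j))" using Suc.IH n b by blast
      have "eqm ?K (com (n ^ p) b) (com n b ^ p)"
        unfolding up using c n b by (intro com_power_eqm L_in_G)
      moreover have "com n b ^ p \<in> ?K" unfolding up using c by (rule L_power)
      ultimately show ?thesis using eqm_mem_iff subset_refl subgrp_L by blast
    qed
    then show "n ^ p \<in> ?H" using L_power[OF n] by blast
  next
    fix n g assume n: "n \<in> L i" and g: "g \<in> G"
    have nG: "n \<in> G" using n L_in_G by blast
    have "com (com n g) b \<in> ?K" if b: "b \<in> L j" for b
    proof -
      have bG: "b \<in> G" using b L_in_G by blast
      define u where "u = com (inverse g) b"
      define z where "z = com (inverse n) (u * b)"
      have u: "u \<in> L (Suc j)" unfolding u_def using b g by (intro L_com') auto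
      have uG: "u \<in> G" using u L_in_G by blast
      have ub: "u * b \<in> L j" using u b L_Suc_subset by (blast intro: L_closed)
      have ni: "inverse n \<in> L i" using n by (rule L_closed)
      have z: "z \<in> L (Suc (i + j))" unfolding z_def using Suc.IH ni ub by blast
      have zG: "z \<in> G" using z L_in_G by blast
      have cnb: "com n b \<in> L (Suc (i + j))" using Suc.IH n b by blast
      \<comment> \<open>A Hall-Witt type identity: \<open>u * b\<close> is \<open>b\<close>
        conjugated by the inverse of \<open>g\<close>. Since \<open>u\<close> lies one layer below
        \<open>b\<close>, modulo \<open>?K\<close> the element \<open>z\<close> is
        \<open>com (inverse n) b\<close>, which cancels \<open>com n b\<close>.\<close>
      have eq: "com (com n g) b = cj n (cj g z) * com n b"
        by (simp add: u_def z_def com_def cj_def g_simps)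
      have 1: "eqm ?K (cj n (cj g z)) z"
        unfolding up cj_cj using z nG g by (intro L_cj_eqm) auto
      have "com (inverse n) u \<in> ?K" using Suc.IH[OF ni u] by simp
      moreover have "eqm ?K (cj u (com (inverse n) b)) (com (inverse n) b)"
        unfolding up using Suc.IH[OF ni b] uG by (intro L_cj_eqm)
      ultimately have "eqm ?K (com (inverse n) u * cj u (com (inverse n) b)) (1 * com (inverse n) b)"
        using nG uG K by (intro eqm_mult) (auto simp: eqm_one_iff)
      then have 2: "eqm ?K z (com (inverse n) b)" by (simp add: z_def com_mult_right)
      have "com (inverse n) b = cj (inverse n) (inverse (com n b))"
        by (simp add: com_def cj_def g_simps)
      moreover have "eqm ?K (cj (inverse n) (inverse (com n b))) (inverse (com n b))"
        unfolding up using cnb nG by (intro L_cj_eqm L_closed) auto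
      ultimately have 3: "eqm ?K (com (inverse n) b) (inverse (com n b))" by simp
      have "eqm ?K (cj n (cj g z)) (inverse (com n b))"
        using 1 2 3 eqm_trans[OF K] by blast
      then have "eqm ?K (cj n (cj g z) * com n b) (inverse (com n b) * com n b)"
        using nG g zG bG by (intro eqm_mult K) (auto)
      then show ?thesis using eq eqm_one_iff[OF K] by simp
    qed
    then show "com n g \<in> ?H" using L_com[OF n g] by blast
  qed
  then have "L (Suc i) \<subseteq> ?H" by (simp only: L.simps(2)[of i])
  then show ?case using Suc.prems by auto
qed

text \<open>Each factor of the series is central in the corresponding quotient of \<open>G\<close>,
  so every intermediate subgroup is invariant under conjugation.\<close>

lemma nrm_between:
  assumes "subgrp P" "L (Suc j) \<subseteq> P" "P \<subseteq> L j"
  shows "nrm P"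
  unfolding nrm_def
proof (intro conjI ballI)
  fix g n assume "g \<in> G" "n \<in> P"
  then have "com g n \<in> P" using L_com' assms by blast
  then show "cj g n \<in> P" using \<open>n \<in> P\<close> assms(1) by (simp add: cj_eq_com subgrp_mult)
qed (use assms L_in_G in auto)

text \<open>Commutators of \<open>L k\<close> with \<open>G\<close> are bilinear modulo
  \<open>L (Suc (Suc k))\<close> and vanish on \<open>L (Suc k)\<close> and on \<open>L 1\<close>,
  so generators suffice on both sides. The claims 1 and 2 treat the two arguments in turn.\<close>

lemma L_Suc_gen:
  assumes T: "T \<subseteq> G" "sgen (T \<union> L 1) = G" and S: "S \<subseteq> L k" "sgen (S \<union> L (Suc k)) = L k"
  shows "L (Suc k) = sgen ((\<lambda>s. s ^ p) ` S \<union> {com s t | s t. s \<in> S \<and> t \<in> T} \<union> L (Suc (Suc k)))"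
    (is "_ = ?P")
proof
  have P: "subgrp ?P" by (rule subgrp_gen)
  have PL: "?P \<subseteq> L (Suc k)"
  proof (rule gen_least)
    have "s ^ p \<in> L (Suc k)" "com s t \<in> L (Suc k)" if "s \<in> S" "t \<in> T" for s t
      using that S T by (auto intro!: L_power L_com)
    moreover have "s ^ p \<in> L (Suc k)" if "s \<in> S" for s
      using that S by (auto intro!: L_power)
    ultimately show "(\<lambda>s. s ^ p) ` S \<union> {com s t | s t. s \<in> S \<and> t \<in> T} \<union> L (Suc (Suc k)) \<subseteq> L (Suc k)"
      using L_Suc_subset[of "Suc k"] by blast
  qed simp
  have LP: "L (Suc (Suc k)) \<subseteq> ?P" using gen_incl by blast
  have N: "nrm ?P" using P LP PL by (rule nrm_between)
  have 1: "com n t \<in> ?P" if t: "t \<in> T" and n: "n \<in> L k" for n t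
  proof -
    have "subgrp {a \<in> L k. \<forall>b\<in>{t}. com a b \<in> ?P}"
      using N T t by (intro subgrp_com_vimage) (auto intro: L_in_G)
    moreover have "S \<union> L (Suc k) \<subseteq> {a \<in> L k. \<forall>b\<in>{t}. com a b \<in> ?P}"
    proof
      fix s assume "s \<in> S \<union> L (Suc k)"
      then show "s \<in> {a \<in> L k. \<forall>b\<in>{t}. com a b \<in> ?P}"
      proof
        assume "s \<in> S"
        then show ?thesis using S t by (auto intro!: gen_incl)
      next
        assume s: "s \<in> L (Suc k)"
        then have "com s t \<in> L (Suc (Suc k))" using t T by (intro L_com) auto
        then show ?thesis using s LP L_Suc_subset by auto
      qed
    qed
    ultimately have "sgen (S \<union> L (Suc k)) \<subseteq> {a \<in> L k. \<forall>b\<in>{t}. com a b \<in> ?P}" by (rule gen_least)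
    then show ?thesis using S n by auto
  qed
  have 2: "com n g \<in> ?P" if n: "n \<in> L k" and g: "g \<in> G" for n g
  proof -
    have "subgrp {a \<in> G. \<forall>b\<in>{n}. com a b \<in> ?P}"
      using N n subG by (intro subgrp_com_vimage) (auto intro: L_in_G)
    moreover have "T \<union> L 1 \<subseteq> {a \<in> G. \<forall>b\<in>{n}. com a b \<in> ?P}"
    proof
      fix t assume "t \<in> T \<union> L 1"
      then show "t \<in> {a \<in> G. \<forall>b\<in>{n}. com a b \<in> ?P}"
      proof
        assume "t \<in> T"
        then show ?thesis using 1[OF _ n, of t] T nrm_com_swap[OF N, of t n] by auto
      next
        assume t: "t \<in> L 1"
        then have "com t n \<in> L (Suc (1 + k))" using n by (rule L_com_L)
        then show ?thesis using t LP L_in_G by auto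
      qed
    qed
    ultimately have "sgen (T \<union> L 1) \<subseteq> {a \<in> G. \<forall>b\<in>{n}. com a b \<in> ?P}" by (rule gen_least)
    then show ?thesis using T g nrm_com_swap[OF N, of g n] by auto
  qed
  \<comment> \<open>Powers come last: for \<open>k = 0\<close> the \<open>p\<close>-th power map
    need not be multiplicative modulo \<open>L 2\<close>, but it is modulo \<open>?P\<close>, which
    contains all commutators by claim 2.\<close>
  have 3: "n ^ p \<in> ?P" if n: "n \<in> L k" for n
  proof -
    have "subgrp {a \<in> L k. a ^ p \<in> ?P}"
    proof (rule finite_subgrpI)
      show "finite {a \<in> L k. a ^ p \<in> ?P}" using finite_L by simp
      show "{a \<in> L k. a ^ p \<in> ?P} \<noteq> {}" using P by (auto intro!: exI[of _ 1] simp: L_closed subgrp_one)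
      fix a b assume a: "a \<in> {a \<in> L k. a ^ p \<in> ?P}" and b: "b \<in> {a \<in> L k. a ^ p \<in> ?P}"
      have "eqm ?P ((a * b) ^ p) (a ^ p * b ^ p)"
        using a b L_in_G by (intro eqm_power_mult N 2) auto
      then show "a * b \<in> {a \<in> L k. a ^ p \<in> ?P}"
        using a b eqm_mem_iff[OF _ P subset_refl] P by (auto simp: L_closed subgrp_mult)
    qed
    moreover have "S \<union> L (Suc k) \<subseteq> {a \<in> L k. a ^ p \<in> ?P}"
      using S LP L_power[of _ "Suc k"] L_Suc_subset[of k] by (auto intro!: gen_incl)
    ultimately have "sgen (S \<union> L (Suc k)) \<subseteq> {a \<in> L k. a ^ p \<in> ?P}" by (rule gen_least)
    then show ?thesis using S n by auto
  qed
  show "L (Suc k) \<subseteq> ?P" unfolding L.simps(2)[of k] using P 2 3 by (intro D_least)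
  show "?P \<subseteq> L (Suc k)" by (rule PL)
qed

end

context fin_p_group
begin

subsection \<open>Generators of the layers\<close>

text \<open>\<open>L 1\<close> is the Frattini subgroup, so this is generation modulo it. In a
  non-abelian group the images are then independent as well (\<open>noncomm_card\<close>).\<close>

definition basis :: "'a \<Rightarrow> 'a \<Rightarrow> bool" where
  "basis x y \<longleftrightarrow> x \<in> G \<and> y \<in> G \<and> sgen ({x, y} \<union> L 1) = G"

definition spans :: "'a set \<Rightarrow> nat \<Rightarrow> bool" where
  "spans S k \<longleftrightarrow> S \<subseteq> L k \<and> L k \<subseteq> sgen (S \<union> L (Suc k))"

lemma spans_eq: "spans S k \<Longrightarrow> sgen (S \<union> L (Suc k)) = L k"
  unfolding spans_def using L_Suc_subset by (intro antisym gen_least Un_least) auto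

lemma spans_in: "spans S k \<Longrightarrow> s \<in> S \<Longrightarrow> s \<in> L k"
  by (auto simp: spans_def)

lemma nrm_gen_layer: "S \<subseteq> L k \<Longrightarrow> nrm (sgen (S \<union> L (Suc k)))"
  using L_Suc_subset by (intro nrm_between[where j = k] gen_least subgrp_gen Un_least) (auto intro: gen_incl)

text \<open>The tool with which all series are computed: it is enough to locate the powers of the
  spanning elements and their commutators with \<open>x\<close> and \<open>y\<close>, each modulo
  the following term.\<close>

lemma spans_Suc:
  assumes "basis x y" "spans S k" "S' \<subseteq> L (Suc k)"
    and "\<And>s. s \<in> S \<Longrightarrow> s ^ p \<in> sgen (S' \<union> L (Suc (Suc k)))"
    and "\<And>s. s \<in> S \<Longrightarrow> com s x \<in> sgen (S' \<union> L (Suc (Suc k)))"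
    and "\<And>s. s \<in> S \<Longrightarrow> com s y \<in> sgen (S' \<union> L (Suc (Suc k)))"
  shows "spans S' (Suc k)"
  unfolding spans_def
proof
  have "L (Suc k) = sgen ((\<lambda>s. s ^ p) ` S \<union> {com s t | s t. s \<in> S \<and> t \<in> {x, y}} \<union> L (Suc (Suc k)))"
    using assms(1,2) spans_eq by (intro L_Suc_gen) (auto simp: basis_def spans_def)
  also have "\<dots> \<subseteq> sgen (S' \<union> L (Suc (Suc k)))"
    using assms(4-6) by (intro gen_subset_gen) (auto intro: gen_incl)
  finally show "L (Suc k) \<subseteq> sgen (S' \<union> L (Suc (Suc k)))" .
qed (fact assms(3))

lemma spans_one:
  assumes b: "basis x y" and S: "S \<subseteq> L 1"
    and "x ^ p \<in> sgen (S \<union> L 2)" "y ^ p \<in> sgen (S \<union> L 2)" "com x y \<in> sgen (S \<union> L 2)"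
  shows "spans S 1"
proof -
  have "spans {x, y} 0" using b by (auto simp: basis_def spans_def)
  moreover have "com y x \<in> sgen (S \<union> L 2)"
    using assms(5) subgrp_inverse[OF subgrp_gen] com_inverse by metis
  ultimately have "spans S (Suc 0)"
    using assms subgrp_one[OF subgrp_gen]
    by (intro spans_Suc[OF b]) (auto simp: numeral_2_eq_2)
  then show ?thesis by simp
qed

text \<open>Spanning by nothing means that the series stalls, and by \<open>L_proper\<close> it
  stalls only at the trivial group. Many contradictions below end here.\<close>

lemma spans_empty: "spans {} k \<Longrightarrow> L k = {1}"
proof (rule ccontr)
  assume "spans {} k" "L k \<noteq> {1}"
  then have "L k \<subseteq> L (Suc k)" by (simp add: spans_def gen_subgrp_eq)
  then show False using L_proper[OF \<open>L k \<noteq> {1}\<close>] by blast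
qed

text \<open>Burnside's basis theorem. Every layer is spanned by elements of \<open>sgen S\<close>,
  built from powers and commutators of those for the previous layer; climbing up from the trivial
  term then absorbs all of \<open>G\<close>.\<close>

lemma frattini:
  assumes S: "S \<subseteq> G" and g: "sgen (S \<union> L 1) = G"
  shows "sgen S = G"
proof -
  have *: "\<exists>T. T \<subseteq> sgen S \<and> spans T k" for k
  proof (induction k)
    case 0
    then show ?case using S g by (intro exI[of _ S]) (auto simp: spans_def gen_incl)
  next
    case (Suc k)
    then obtain T where T: "T \<subseteq> sgen S" "spans T k" by blast
    define T' where "T' = (\<lambda>s. s ^ p) ` T \<union> {com s t | s t. s \<in> T \<and> t \<in> S}"
    have "L (Suc k) = sgen (T' \<union> L (Suc (Suc k)))"
      unfolding T'_def using T(2) S g spans_eq by (intro L_Suc_gen) (auto simp: spans_def)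
    moreover have "T' \<subseteq> L (Suc k)" using T(2) S by (auto simp: T'_def spans_def intro!: L_power L_com)
    moreover have "T' \<subseteq> sgen S"
    proof -
      have "s ^ p \<in> sgen S" "t \<in> S \<Longrightarrow> com s t \<in> sgen S" if "s \<in> T" for s t
        using that T(1) by (auto intro: subgrp_power subgrp_com subgrp_gen gen_incl)
      then show ?thesis by (auto simp: T'_def)
    qed
    ultimately show ?case by (intro exI[of _ T']) (auto simp: spans_def)
  qed
  obtain c where c: "L c = {1}" using L_eventually_trivial by blast
  have "L 0 \<subseteq> sgen S"
  proof (rule inc_induct[of 0 c])
    show "L c \<subseteq> sgen S" using c subgrp_one[OF subgrp_gen] by simp
    fix k assume "L (Suc k) \<subseteq> sgen S"
    then show "L k \<subseteq> sgen S" using *[of k] gen_subset_gen[of _ S] unfolding spans_def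
      by (metis Un_least order_trans)
  qed simp
  then show ?thesis using gen_least[OF subG S] by simp
qed

lemma basis_gen: "basis x y \<Longrightarrow> sgen {x, y} = G"
  by (rule frattini) (auto simp: basis_def)

lemma basis_swap: "basis x y \<Longrightarrow> basis y x"
  by (simp add: basis_def insert_commute)

lemma basisI: "x \<in> G \<Longrightarrow> y \<in> G \<Longrightarrow> G \<subseteq> sgen ({x, y} \<union> L 1) \<Longrightarrow> basis x y"
  unfolding basis_def using L_in_G subG by (intro conjI antisym gen_least Un_least) auto

lemma basis_transfer:
  assumes "basis x y" "x' \<in> G" "y' \<in> G" "x \<in> sgen ({x', y'} \<union> L 1)" "y \<in> sgen ({x', y'} \<union> L 1)"
  shows "basis x' y'"
proof (rule basisI[OF assms(2,3)])
  have "sgen ({x, y} \<union> L 1) \<subseteq> sgen ({x', y'} \<union> L 1)"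
    using assms by (intro gen_subset_gen) (auto intro: gen_incl)
  then show "G \<subseteq> sgen ({x', y'} \<union> L 1)" using assms(1) by (simp add: basis_def)
qed

lemma basis_mult: "basis x y \<Longrightarrow> basis x (x * y)"
proof (rule basis_transfer)
  have *: "x \<in> sgen ({x, x * y} \<union> L 1)" "x * y \<in> sgen ({x, x * y} \<union> L 1)" by (auto intro: gen_incl)
  then show "x \<in> sgen ({x, x * y} \<union> L 1)" "y \<in> sgen ({x, x * y} \<union> L 1)"
    using subgrp_mult_left_iff[OF subgrp_gen] by blast+
qed (auto simp: basis_def)

lemma basis_in: "basis x y \<Longrightarrow> x \<in> G" "basis x y \<Longrightarrow> y \<in> G"
  by (simp_all add: basis_def)

subsection \<open>Powers and conjugation\<close>

lemma L_power_eqm: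
  assumes "eqm (L k) a b" "a \<in> G" "b \<in> G"
  shows "eqm (L (Suc k)) (a ^ p) (b ^ p)"
proof -
  define l where "l = a * inverse b"
  have l: "l \<in> L k" "a = l * b" using assms by (simp_all add: l_def eqm_def mult.assoc)
  have "eqm (L (Suc k)) ((l * b) ^ p) (l ^ p * b ^ p)"
    using l assms L_in_G by (intro eqm_power_mult L_com') auto
  moreover have "eqm (L (Suc k)) (l ^ p * b ^ p) (b ^ p)"
    using l by (intro eqm_mult_left L_power) auto
  ultimately show ?thesis using l eqm_trans[OF nrm_L] by blast
qed

lemma L_power_power_eqm:
  assumes "eqm (L k) a b" "a \<in> G" "b \<in> G"
  shows "eqm (L (k + i)) (a ^ (p ^ i)) (b ^ (p ^ i))"
proof (induction i)
  case (Suc i)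
  have "eqm (L (Suc (k + i))) ((a ^ p ^ i) ^ p) ((b ^ p ^ i) ^ p)"
    using Suc assms by (intro L_power_eqm) auto
  then show ?case by (simp add: power_mult[symmetric] mult.commute)
qed (use assms in simp)

lemma L_power_in: "a \<in> G \<Longrightarrow> a ^ (p ^ i) \<in> L i"
proof (induction i)
  case (Suc i)
  have "a ^ p ^ Suc i = (a ^ p ^ i) ^ p" by (simp only: power_Suc2 power_mult)
  then show ?case using L_power Suc by simp
qed simp

text \<open>A nontrivial element shared by the cyclic group of \<open>b\<close> and a conjugate of
  that of \<open>a\<close>: exactly what a Beauville structure forbids between its two
  triples.\<close>

definition meets :: "'a \<Rightarrow> 'a \<Rightarrow> bool" where
  "meets a b \<longleftrightarrow> (\<exists>i j. \<exists>g\<in>G. cj g (a ^ i) = b ^ j \<and> b ^ j \<noteq> 1)"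

text \<open>The coset of \<open>a\<close> modulo \<open>L 1\<close> has room for one element from
  each triple. Beauville structures supply ample elements; \<open>not_ample\<close> and
  \<open>not_ample_power\<close> refute ampleness.\<close>

definition ample :: "'a \<Rightarrow> bool" where
  "ample a \<longleftrightarrow> (\<exists>u\<in>G. \<exists>v\<in>G. eqm (L 1) u a \<and> eqm (L 1) v a \<and> \<not> meets u v)"

text \<open>Up to conjugation and powers prime to \<open>p\<close>, \<open>c\<close> reaches every element of the layer
  \<open>c L\<^sub>j / L\<^sub>j\<^sub>+\<^sub>1\<close>.\<close>

definition reach :: "'a \<Rightarrow> nat \<Rightarrow> 'a set" where
  "reach c j = {n\<in>L j. \<exists>e. \<exists>g\<in>G. eqm (L (Suc j)) (cj g (c ^ (1 + p * e))) (c * n)}"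

lemma reachI:
  "n \<in> L j \<Longrightarrow> g \<in> G \<Longrightarrow> eqm (L (Suc j)) (cj g (c ^ (1 + p * e))) (c * n) \<Longrightarrow> n \<in> reach c j"
  unfolding reach_def by blast

text \<open>The equation realising the shift \<open>m\<close> is raised to the exponent
  \<open>1 + p * e\<close> and conjugated by \<open>g\<close>. Exponents of this shape are closed
  under products, and \<open>m\<close> is central of order dividing \<open>p\<close> modulo the next
  term, so it passes through unchanged.\<close>

lemma reach_combine:
  assumes c: "c \<in> G" and g: "g \<in> G" and m: "m \<in> reach c j"
  shows "\<exists>e'. \<exists>g'\<in>G. eqm (L (Suc j)) (cj g' (c ^ (1 + p * e'))) (cj g (c ^ (1 + p * e)) * m)"
proof -
  let ?K = "L (Suc j)" and ?o = "1 + p * e"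
  obtain d h where h: "h \<in> G" "eqm ?K (cj h (c ^ (1 + p * d))) (c * m)" and mj: "m \<in> L j"
    using m by (auto simp: reach_def)
  have mG: "m \<in> G" using mj L_in_G by blast
  have K: "nrm ?K" by simp
  have "eqm ?K ((cj h (c ^ (1 + p * d))) ^ ?o) ((c * m) ^ ?o)"
    using h c mG by (intro eqm_power) auto
  moreover have "eqm ?K ((c * m) ^ ?o) (c ^ ?o * m ^ ?o)"
    using c mj L_in_G by (intro eqm_power_mult) (auto intro: L_com)
  moreover have "eqm ?K (c ^ ?o * m ^ ?o) (c ^ ?o * m)"
  proof -
    have "m ^ (p * e) \<in> ?K" using mj by (intro L_power_dvd) auto
    then have "eqm ?K (m * m ^ (p * e)) m" using mG by (intro eqm_mult_right) auto
    then have "eqm ?K (c ^ ?o * (m * m ^ (p * e))) (c ^ ?o * m)"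
      by (rule eqm_mult[OF K eqm_refl[OF K]]) (use c in simp)
    then show ?thesis by simp
  qed
  ultimately have "eqm ?K ((cj h (c ^ (1 + p * d))) ^ ?o) (c ^ ?o * m)"
    using eqm_trans[OF K] by blast
  then have "eqm ?K (cj g ((cj h (c ^ (1 + p * d))) ^ ?o)) (cj g (c ^ ?o * m))"
    using g by (intro eqm_cj K)
  moreover have "cj g ((cj h (c ^ (1 + p * d))) ^ ?o) = cj (g * h) (c ^ ((1 + p * d) * ?o))"
    by (simp only: cj_power[symmetric] power_mult[symmetric] cj_cj)
  moreover have "(1 + p * d) * ?o = 1 + p * (d + e + p * d * e)"
    by (simp add: algebra_simps)
  moreover have "eqm ?K (cj g (c ^ ?o * m)) (cj g (c ^ ?o) * m)"
    unfolding cj_mult by (rule eqm_mult[OF K eqm_refl[OF K] L_cj_eqm[OF mj g]]) (use c g in simp)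
  ultimately have "eqm ?K (cj (g * h) (c ^ (1 + p * (d + e + p * d * e)))) (cj g (c ^ ?o) * m)"
    using eqm_trans[OF K] by metis
  then show ?thesis using g h by (metis G_closed(2))
qed

text \<open>By \<open>reach_combine\<close> shifts can be composed, so a whole layer is reached once
  its spanning elements are.\<close>

lemma subgrp_reach:
  assumes c: "c \<in> G"
  shows "subgrp (reach c j)"
proof (rule finite_subgrpI)
  show "finite (reach c j)" using finite_L by (simp add: reach_def)
  have "eqm (L (Suc j)) (cj 1 (c ^ (1 + p * 0))) (c * 1)" by (simp add: cj_by_one)
  then show "reach c j \<noteq> {}" unfolding reach_def using nrm_one[OF nrm_L] G_closed(1) by blast
  fix a b assume a: "a \<in> reach c j" and b: "b \<in> reach c j"
  have K: "nrm (L (Suc j))" by simp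
  have ab: "a \<in> L j" "b \<in> L j" using a b by (auto simp: reach_def)
  obtain e g where g: "g \<in> G" "eqm (L (Suc j)) (cj g (c ^ (1 + p * e))) (c * a)"
    using a by (auto simp: reach_def)
  obtain e' g' where g': "g' \<in> G"
    "eqm (L (Suc j)) (cj g' (c ^ (1 + p * e'))) (cj g (c ^ (1 + p * e)) * b)"
    using reach_combine[OF c g(1) b] by blast
  have "eqm (L (Suc j)) (cj g (c ^ (1 + p * e)) * b) (c * a * b)"
    by (rule eqm_mult[OF K g(2) eqm_refl[OF K]]) (use g c in simp)
  from eqm_trans[OF K g'(2) this]
  have "eqm (L (Suc j)) (cj g' (c ^ (1 + p * e'))) (c * (a * b))"
    by (simp only: mult.assoc)
  then show "a * b \<in> reach c j" by (rule reachI[OF L_closed(2)[OF ab] g'(1)])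
qed

lemma reach_L_Suc: "c \<in> G \<Longrightarrow> L (Suc j) \<subseteq> reach c j"
proof
  fix n assume c: "c \<in> G" and n: "n \<in> L (Suc j)"
  have "eqm (L (Suc j)) (cj 1 (c ^ (1 + p * 0))) (c * n)"
    using eqm_sym[OF nrm_L eqm_mult_right[OF nrm_L n c]] by (simp add: cj_by_one)
  then show "n \<in> reach c j" using n L_Suc_subset G_closed(1) by (blast intro: reachI)
qed

text \<open>Conjugation by \<open>g\<close> is one source of shifts; the exponent
  \<open>1 + p\<close> is the other, in \<open>reach_power\<close>.\<close>

lemma reach_com: "c \<in> G \<Longrightarrow> g \<in> G \<Longrightarrow> com g c \<in> L j \<Longrightarrow> com g c \<in> reach c j"
proof -
  assume *: "c \<in> G" "g \<in> G" "com g c \<in> L j"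
  have "cj g (c ^ (1 + p * 0)) = com g c * c" by (simp add: cj_eq_com)
  moreover have "eqm (L (Suc j)) (com g c * c) (c * com g c)"
    using * L_commute_eqm eqm_sym[OF nrm_L] by blast
  ultimately have "eqm (L (Suc j)) (cj g (c ^ (1 + p * 0))) (c * com g c)" by simp
  then show ?thesis using * by (blast intro: reachI)
qed

lemma reach_com': "c \<in> G \<Longrightarrow> g \<in> G \<Longrightarrow> com c g \<in> L j \<Longrightarrow> com c g \<in> reach c j"
  using reach_com subgrp_inverse[OF subgrp_reach] com_inverse nrm_inverse[OF nrm_L] by metis

lemma reach_power: "c \<in> G \<Longrightarrow> c ^ p \<in> L j \<Longrightarrow> c ^ p \<in> reach c j"
proof -
  assume *: "c \<in> G" "c ^ p \<in> L j"
  have "eqm (L (Suc j)) (cj 1 (c ^ (1 + p * 1))) (c * c ^ p)" by (simp add: cj_by_one)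
  then show ?thesis using * G_closed(1) by (blast intro: reachI)
qed

definition full :: "'a \<Rightarrow> nat \<Rightarrow> bool" where
  "full c j \<longleftrightarrow> L j \<subseteq> reach c j"

lemma full_spans: "c \<in> G \<Longrightarrow> spans S j \<Longrightarrow> S \<subseteq> reach c j \<Longrightarrow> full c j"
  unfolding full_def spans_def using gen_least[OF subgrp_reach[of c j], of "S \<union> L (Suc j)"] reach_L_Suc[of c j] by blast

lemma full_trivial: "c \<in> G \<Longrightarrow> L j = {1} \<Longrightarrow> full c j"
  unfolding full_def using subgrp_one[OF subgrp_reach] by simp

text \<open>Successive approximation: the error left at depth \<open>i + m\<close> is corrected by
  \<open>reach_combine\<close>, and the series ends.\<close>

lemma full_conj:
  assumes c: "c \<in> G" and full: "\<And>j. i \<le> j \<Longrightarrow> full c j" and n: "n \<in> L i"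
  shows "\<exists>e. \<exists>g\<in>G. cj g (c ^ (1 + p * e)) = c * n"
proof -
  have nG: "n \<in> G" using n L_in_G by blast
  have *: "\<exists>e. \<exists>g\<in>G. eqm (L (i + m)) (cj g (c ^ (1 + p * e))) (c * n)" for m
  proof (induction m)
    case 0
    have "eqm (L i) (cj 1 (c ^ (1 + p * 0))) (c * n)"
      using eqm_sym[OF nrm_L eqm_mult_right[OF nrm_L n c]] by (simp add: cj_by_one)
    then show ?case unfolding add_0_right using G_closed(1) by blast
  next
    case (Suc m)
    then obtain e g where g: "g \<in> G" "eqm (L (i + m)) (cj g (c ^ (1 + p * e))) (c * n)" by blast
    define d where "d = cj g (c ^ (1 + p * e))"
    have dG: "d \<in> G" using c g by (simp add: d_def)
    define r where "r = inverse d * (c * n)"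
    have "eqm (L (i + m)) (inverse d * (c * n)) (inverse d * d)"
      by (rule eqm_mult[OF nrm_L eqm_refl[OF nrm_L] eqm_sym[OF nrm_L g(2)[folded d_def]]])
        (use dG in simp)
    then have r: "r \<in> L (i + m)" by (simp add: r_def eqm_one_iff)
    then have "r \<in> reach c (i + m)" using full[of "i + m"] by (auto simp: full_def)
    from reach_combine[OF c g(1) this, of e] have
      "\<exists>e. \<exists>g\<in>G. eqm (L (Suc (i + m))) (cj g (c ^ (1 + p * e))) (d * r)" by (simp only: d_def)
    then show ?case by (simp only: r_def g_cancel_right add_Suc_right)
  qed
  obtain k where "L k = {1}" using L_eventually_trivial by blast
  then have "L (i + k) = {1}" using L_trivial_Suc by simp
  then show ?thesis using *[of k] by (simp only: eqm_trivial)
qed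

text \<open>\<open>c ^ (p * e)\<close> lies strictly deeper in the series than \<open>c\<close>, so
  it cannot cancel it.\<close>

lemma power_prime_to_neq_one:
  assumes "c \<in> G" "c \<noteq> 1"
  shows "c ^ (1 + p * e) \<noteq> 1"
proof
  assume a: "c ^ (1 + p * e) = 1"
  obtain k where k: "c \<in> L k" "c \<notin> L (Suc k)" using L_level assms by blast
  have "c ^ (p * e) \<in> L (Suc k)" using k by (intro L_power_dvd) auto
  moreover have "c * c ^ (p * e) = 1" using a by simp
  ultimately have "c \<in> L (Suc k)" using nrm_inverse[OF nrm_L] by (metis g_inverse_inverse g_inverse_unique)
  then show False using k by blast
qed

text \<open>If \<open>a^(p^i)\<close> reaches all of the lower layers, then any two elements of \<open>a L\<^sub>1\<close> have
  conjugate powers.\<close>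

lemma not_ample:
  assumes a: "a \<in> G" and c: "a ^ (p ^ i) \<noteq> 1" and full: "\<And>j. Suc i \<le> j \<Longrightarrow> full (a ^ (p ^ i)) j"
  shows "\<not> ample a"
proof
  assume "ample a"
  then obtain u v where uv: "u \<in> G" "v \<in> G" "eqm (L 1) u a" "eqm (L 1) v a" "\<not> meets u v"
    by (auto simp: ample_def)
  let ?c = "a ^ (p ^ i)"
  have cG: "?c \<in> G" using a by simp
  have ex: "\<exists>e. \<exists>g\<in>G. cj g (?c ^ (1 + p * e)) = w ^ (p ^ i)" if w: "w \<in> G" "eqm (L 1) w a" for w
  proof -
    \<comment> \<open>Each \<open>p\<close>-th power gains one layer: congruence modulo
      \<open>L 1\<close> becomes congruence modulo \<open>L (Suc i)\<close>, where fullness of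
      \<open>?c\<close> begins.\<close>
    have "eqm (L (1 + i)) (w ^ (p ^ i)) ?c" using w a by (intro L_power_power_eqm)
    then have "eqm (L (1 + i)) (inverse ?c * w ^ (p ^ i)) (inverse ?c * ?c)"
      by (rule eqm_mult[OF nrm_L eqm_refl[OF nrm_L]]) (use a in simp)
    then have "inverse ?c * w ^ (p ^ i) \<in> L (Suc i)" by (simp add: eqm_one_iff)
    from full_conj[OF cG full this] show ?thesis by (simp only: g_cancel_right)
  qed
  obtain e g where g: "g \<in> G" "cj g (?c ^ (1 + p * e)) = u ^ (p ^ i)" using ex uv by blast
  obtain f h where h: "h \<in> G" "cj h (?c ^ (1 + p * f)) = v ^ (p ^ i)" using ex uv by blast
  \<comment> \<open>Crossing the two exponents produces one power of \<open>?c\<close> conjugate to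
    a power of \<open>u\<close> and to a power of \<open>v\<close>.\<close>
  let ?d = "?c ^ ((1 + p * e) * (1 + p * f))"
  have u: "u ^ (p ^ i * (1 + p * f)) = cj g ?d"
    unfolding power_mult g(2)[symmetric] by (simp only: cj_power power_mult)
  have v: "v ^ (p ^ i * (1 + p * e)) = cj h ?d"
    unfolding power_mult h(2)[symmetric] by (simp only: cj_power[symmetric] power_mult[symmetric] mult.commute mult.left_commute)
  have "cj (h * inverse g) (u ^ (p ^ i * (1 + p * f))) = v ^ (p ^ i * (1 + p * e))"
    unfolding u v by (simp only: cj_cj mult.assoc g_left_inverse mult_1_right)
  moreover have "v ^ (p ^ i * (1 + p * e)) \<noteq> 1"
  proof
    assume "v ^ (p ^ i * (1 + p * e)) = 1"
    then have "cj h ?d = 1" using v by simp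
    then have "?d = 1" by (metis cj_by_one cj_cj cj_one g_left_inverse)
    moreover have "(1 + p * e) * (1 + p * f) = 1 + p * (e + f + p * e * f)" by (simp add: algebra_simps)
    ultimately show False using power_prime_to_neq_one[OF cG c, of "e + f + p * e * f"] by simp
  qed
  ultimately show False using uv(5) G_closed(2)[OF h(1) G_closed(3)[OF g(1)]] unfolding meets_def by blast
qed

end

section \<open>Tools for counting layers and for refuting ampleness\<close>

context fin_p_group
begin

text \<open>The index is passed as an equation so that the rules match numerals such as
  \<open>L 3\<close>.\<close>

lemma L_comI: "n \<in> L j \<Longrightarrow> g \<in> G \<Longrightarrow> k = Suc j \<Longrightarrow> com n g \<in> L k"
  and L_comI': "n \<in> L j \<Longrightarrow> g \<in> G \<Longrightarrow> k = Suc j \<Longrightarrow> com g n \<in> L k"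
  and L_powerI: "n \<in> L j \<Longrightarrow> e = p \<Longrightarrow> k = Suc j \<Longrightarrow> n ^ e \<in> L k"
  and L_com_LI: "a \<in> L i \<Longrightarrow> b \<in> L j \<Longrightarrow> k = Suc (i + j) \<Longrightarrow> com a b \<in> L k"
  and L_cjI: "n \<in> L j \<Longrightarrow> g \<in> G \<Longrightarrow> k = Suc j \<Longrightarrow> eqm (L k) (cj g n) n"
  and L_commI: "n \<in> L j \<Longrightarrow> g \<in> G \<Longrightarrow> k = Suc j \<Longrightarrow> eqm (L k) (g * n) (n * g)"
  using L_com L_com' L_power L_com_L L_cj_eqm L_commute_eqm by simp_all

lemma spans_least:
  assumes "spans S k" "subgrp H" "S \<subseteq> H" "L (Suc k) \<subseteq> H"
  shows "L k \<subseteq> H"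
  using assms gen_least[of H "S \<union> L (Suc k)"] by (auto simp: spans_def)

lemma spans_single:
  assumes "card (L k) < p * (p * card (L (Suc k)))" "e \<in> L k" "e \<notin> L (Suc k)"
  shows "spans {e} k"
proof -
  have "L k = sgen (insert e (L (Suc k)))"
    using assms L_Suc_subset L_in_G by (intro proper_gen) auto
  then show ?thesis using assms by (simp add: spans_def)
qed

lemma L_cardI: "L j \<noteq> {1} \<Longrightarrow> k = Suc j \<Longrightarrow> p * card (L k) \<le> card (L j)"
  using L_card by simp

lemma card_power:
  assumes "subgrp K" "K \<subseteq> G"
  shows "\<exists>i. card K = p ^ i"
proof -
  obtain n where "card G = p ^ n" using cardG by blast
  moreover have "card K dvd card G" using assms subG finG by (intro subgrp_card_dvd)
  ultimately show ?thesis using prp divides_primepow_nat by metis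
qed

lemma com_inverse_left_mem:
  assumes "nrm N" "a \<in> G"
  shows "com (inverse a) b \<in> N \<longleftrightarrow> com a b \<in> N"
proof -
  have "com (inverse a) b = cj (inverse a) (inverse (com a b))"
    by (simp add: com_def cj_def g_simps)
  then show ?thesis using assms by (simp add: nrm_cj_iff subgrp_inverse_iff nrm_subgrp)
qed

lemma spans_trivial: "spans S k \<Longrightarrow> S \<subseteq> {1} \<Longrightarrow> L k = {1}"
  using spans_least[of S k "L (Suc k)"] L_proper[of k] L_closed(1)[of "Suc k"] by auto

lemma spans_inverse:
  assumes "spans {s} k"
  shows "spans {inverse s} k"
proof -
  have i: "inverse s \<in> L k" using assms L_closed(3) by (auto simp: spans_def)
  have "L k \<subseteq> sgen ({inverse s} \<union> L (Suc k))"
  proof (rule spans_least[OF assms subgrp_gen])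
    have "inverse s \<in> sgen ({inverse s} \<union> L (Suc k))" by (rule gen_incl) simp
    then show "{s} \<subseteq> sgen ({inverse s} \<union> L (Suc k))" by (simp only: subgrp_inverse_iff[OF subgrp_gen] empty_subsetI insert_subset simp_thms)
  qed (auto intro: gen_incl)
  then show ?thesis using i by (simp add: spans_def)
qed

lemma subgrp_power_vimage:
  assumes N: "nrm N" and H: "subgrp H" "H \<subseteq> G" and c: "\<And>a b. a \<in> H \<Longrightarrow> b \<in> H \<Longrightarrow> com a b \<in> N"
  shows "subgrp {f\<in>H. f ^ p \<in> N}"
proof (rule finite_subgrpI)
  show "finite {f\<in>H. f ^ p \<in> N}" using H finG finite_subset by fastforce
  show "{f\<in>H. f ^ p \<in> N} \<noteq> {}" using N H by (auto intro!: exI[of _ 1] simp: nrm_one subgrp_one)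
  fix a b assume a: "a \<in> {f\<in>H. f ^ p \<in> N}" and b: "b \<in> {f\<in>H. f ^ p \<in> N}"
  have "eqm N ((a * b) ^ p) (a ^ p * b ^ p)"
    using a b H c by (intro eqm_power_mult N) auto
  then have "(a * b) ^ p \<in> N"
    using eqm_mem_iff[OF _ nrm_subgrp[OF N] subset_refl] a b N by (auto simp: nrm_mult)
  then show "a * b \<in> {f\<in>H. f ^ p \<in> N}" using a b H by (auto simp: subgrp_mult)
qed

lemma subgrp_com_one_vimage:
  assumes N: "nrm N" and H: "subgrp H" "H \<subseteq> G" and g: "g \<in> G"
  shows "subgrp {f\<in>H. com f g \<in> N}"
  using subgrp_com_vimage[OF N H, of "{g}"] g by simp

lemma eqm_cancel_right: "eqm K (a * c) (b * c) \<longleftrightarrow> eqm K a b"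
  by (simp add: eqm_def g_simps)

text \<open>The Jacobi identity in the graded Lie ring of the series: the two sides differ by the
  bracket of \<open>s\<close> with \<open>[y, x]\<close>, which is the inverse of \<open>s\<close>
  and hence commutes with it.\<close>

lemma com_com_swap:
  assumes x: "x \<in> G" and y: "y \<in> G" and s: "s = com x y"
  shows "eqm (L 4) (com (com s y) x) (com (com s x) y)"
proof -
  let ?K = "L 4"
  have K: "nrm ?K" by simp
  define w where "w = com s y"
  define e where "e = com s x"
  have s1: "s \<in> L 1" using x y by (auto simp: s intro: L_comI[of x 0 y])
  have sG: "s \<in> G" using s1 L_in_G by blast
  have w2: "w \<in> L 2" and e2: "e \<in> L 2"
    unfolding w_def e_def by (rule L_comI[OF s1 y] L_comI[OF s1 x]; simp)+
  have wG: "w \<in> G" and eG: "e \<in> G" using w2 e2 L_in_G by blast+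
  have X3: "com x w \<in> L 3" and Y3: "com y e \<in> L 3"
    using L_comI'[OF w2 x] L_comI'[OF e2 y] by auto
  have XG: "com x w \<in> G" and YG: "com y e \<in> G" using x y wG eG by auto
  \<comment> \<open>Both sides expand \<open>com s (x * y)\<close>, the right one after rewriting
    \<open>x * y\<close> as \<open>s * (y * x)\<close>.\<close>
  have eq: "e * cj x w = cj s w * cj s (cj y e)"
    unfolding s w_def e_def by (simp add: com_def cj_def g_simps)
  have l3: "eqm ?K (a * n) (n * a)" if "n \<in> L 3" "a \<in> G" for a n
    by (rule L_commI[OF that]) simp
  have sw: "eqm ?K (cj s m) m" if "m \<in> L 2" for m
    by (rule eqm_cj_self, rule L_com_LI[OF s1 that]) simp
  have "com w e \<in> L 5" by (rule L_com_LI[OF w2 e2]) simp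
  then have "com w e \<in> ?K" using L_antimono[of 4 5] by auto
  then have we: "eqm ?K (w * e) (e * w)" by (rule eqm_com_mult)
  have ye2: "cj y e \<in> L 2" using e2 y by (auto intro: nrm_cj)
  have "eqm ?K (cj s w * cj s (cj y e)) (w * cj y e)"
    using sw[OF w2] sw[OF ye2] sG wG by (intro eqm_mult K) auto
  then have 1: "eqm ?K (e * (com x w * w)) (w * (com y e * e))"
    by (simp add: eq flip: cj_eq_com)
  have "eqm ?K ((e * com x w) * w) ((com x w * e) * w)"
    by (rule eqm_mult[OF K l3[OF X3 eG] eqm_refl[OF K]]) (use eG XG in auto)
  then have 2: "eqm ?K (com x w * (e * w)) (e * (com x w * w))"
    using eqm_sym[OF K] by (simp add: mult.assoc)
  have "eqm ?K ((w * com y e) * e) ((com y e * w) * e)"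
    by (rule eqm_mult[OF K l3[OF Y3 wG] eqm_refl[OF K]]) (use wG YG in auto)
  then have 3: "eqm ?K (w * (com y e * e)) (com y e * (w * e))" by (simp add: mult.assoc)
  have 4: "eqm ?K (com y e * (w * e)) (com y e * (e * w))"
    by (rule eqm_mult[OF K eqm_refl[OF K] we YG])
  have "eqm ?K (com x w * (e * w)) (com y e * (e * w))"
    by (rule eqm_trans[OF K eqm_trans[OF K eqm_trans[OF K 2 1] 3] 4])
  then have "eqm ?K (com x w) (com y e)" by (simp only: eqm_cancel_right)
  from eqm_inverse[OF K this YG] show ?thesis by (simp only: com_inverse w_def e_def)
qed

text \<open>If one element generated \<open>G\<close> modulo \<open>L 1\<close>, it would generate
  \<open>G\<close> by \<open>frattini\<close> and \<open>G\<close> would be commutative. So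
  \<open>x\<close> and \<open>y\<close> are independent modulo \<open>L 1\<close>.\<close>

lemma noncomm_card:
  assumes b: "basis x y" and nc: "\<exists>a\<in>G. \<exists>b\<in>G. a * b \<noteq> b * a"
  shows "x \<notin> L 1" "y \<notin> L 1" "y \<notin> sgen ({x} \<union> L 1)" "p * (p * card (L 1)) \<le> card G"
proof -
  have cyc: "sgen ({a} \<union> L 1) \<noteq> G" if a: "a \<in> G" for a
  proof
    assume "sgen ({a} \<union> L 1) = G"
    then have g: "sgen {a} = G" by (rule frattini[rotated]) (use a in simp)
    have sc: "subgrp {h. h * k = k * h}" for k :: 'a
    proof (rule subgrpI)
      fix h h' assume h: "h \<in> {h. h * k = k * h}" "h' \<in> {h. h * k = k * h}"
      have "h * h' * k = h * (h' * k)" by (simp only: mult.assoc)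
      also have "\<dots> = (h * k) * h'" using h(2) by (simp add: mult.assoc)
      also have "\<dots> = k * (h * h')" using h(1) by (simp flip: mult.assoc)
      finally show "h * h' \<in> {h. h * k = k * h}" by simp
    next
      fix h assume h: "h \<in> {h. h * k = k * h}"
      have "inverse h * k = inverse h * (k * h) * inverse h" by (simp add: mult.assoc)
      also have "\<dots> = inverse h * (h * k) * inverse h" using h by simp
      finally show "inverse h \<in> {h. h * k = k * h}" by (simp add: mult.assoc)
    qed simp
    have 1: "h * a = a * h" if "h \<in> G" for h
      using gen_least[OF sc[of a], of "{a}"] that g by auto
    have "h * k = k * h" if "h \<in> G" "k \<in> G" for h k
      using gen_least[OF sc[of k], of "{a}"] that g 1 by auto
    then show False using nc by blast
  qed
  have xy: "x \<in> G" "y \<in> G" "sgen ({x, y} \<union> L 1) = G" using b by (auto simp: basis_def)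
  show y: "y \<notin> sgen ({x} \<union> L 1)"
  proof
    assume "y \<in> sgen ({x} \<union> L 1)"
    then have "sgen ({x, y} \<union> L 1) \<subseteq> sgen ({x} \<union> L 1)"
      by (intro gen_subset_gen) (auto intro: gen_incl)
    moreover have "sgen ({x} \<union> L 1) \<subseteq> G" using xy subG L_in_G by (intro gen_least) auto
    ultimately show False using cyc xy by auto
  qed
  show x: "x \<notin> L 1"
  proof
    assume "x \<in> L 1"
    then have "{x, y} \<union> L 1 = {y} \<union> L 1" by auto
    then show False using cyc xy by metis
  qed
  show "y \<notin> L 1" using y by (auto intro: gen_incl)
  have "p * card (L 1) \<le> card (sgen ({x} \<union> L 1))"
    using x xy L_in_G subG gen_incl[of _ "{x} \<union> L 1"]
    by (intro proper_card subgrp_gen gen_least) (auto simp: psubset_eq)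
  moreover have "p * card (sgen ({x} \<union> L 1)) \<le> card G"
  proof (rule proper_card(1)[OF subgrp_gen subG])
    have "sgen ({x} \<union> L 1) \<subseteq> G" using xy subG L_in_G by (intro gen_least) auto
    then show "sgen ({x} \<union> L 1) \<subset> G" using y xy by auto
  qed simp
  ultimately show "p * (p * card (L 1)) \<le> card G" by (meson le_trans mult_le_mono2)
qed

lemma meets_eq_power:
  assumes "u \<in> G" "u ^ i = v ^ i" "v ^ i \<noteq> 1"
  shows "meets u v"
  unfolding meets_def using assms by (intro exI[of _ i] bexI[of _ 1]) (auto simp: cj_by_one)

text \<open>The second obstruction, for cosets on which conjugation achieves too little: there a
  whole coset has one common nontrivial power.\<close>

lemma not_ample_power:
  assumes a: "a \<in> G" and c: "c \<noteq> 1" and eq: "\<And>l. l \<in> L 1 \<Longrightarrow> (l * a) ^ n = c"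
  shows "\<not> ample a"
proof
  assume "ample a"
  then obtain u v where uv: "u \<in> G" "v \<in> G" "eqm (L 1) u a" "eqm (L 1) v a" "\<not> meets u v"
    by (auto simp: ample_def)
  have "w ^ n = c" if "eqm (L 1) w a" for w
    using eq[of "w * inverse a"] that by (simp add: eqm_def mult.assoc)
  then show False using uv meets_eq_power[of u n v] c by auto
qed

subsection \<open>The prime 3\<close>

text \<open>Expanding \<open>[x^3, y]\<close> yields three factors \<open>e = [x, s]\<close>, that
  is binomial(3, 2), and \<open>e^3\<close> lies in \<open>L 3\<close>. The analogue for squares
  fails because binomial(2, 2) is odd.\<close>

lemma com_cube_eqm:
  assumes p3: "p = 3" and x: "x \<in> G" and y: "y \<in> G"
  shows "eqm (L 3) (com (x ^ 3) y) (com x y ^ 3)"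
proof -
  let ?K = "L 3"
  have K: "nrm ?K" by simp
  define s where "s = com x y"
  define e where "e = com x s"
  have s1: "s \<in> L 1" using x y by (auto simp: s_def intro: L_comI[of x 0 y])
  have sG: "s \<in> G" using s1 L_in_G by blast
  have e2: "e \<in> L 2" unfolding e_def by (rule L_comI'[OF s1 x]) simp
  have eG: "e \<in> G" using e2 L_in_G by blast
  have com: "eqm ?K (a * e) (e * a)" if "a \<in> G" for a
    by (rule L_commI[OF e2 that]) simp
  have eq: "com (x ^ 3) y = cj x e * (e * (s * (e * (s * s))))"
    unfolding e_def s_def by (simp add: numeral_3_eq_3 com_def cj_def g_simps)
  have c: "eqm ?K (cj x e) e" using L_cjI[OF e2 x] by simp
  have "eqm ?K (s * (e * (s * s))) ((e * s) * (s * s))"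
    using eqm_mult[OF K com[OF sG] eqm_refl[OF K, of "s * s"]] sG eG by (simp add: mult.assoc)
  then have "eqm ?K (e * (s * (e * (s * s)))) (e * ((e * s) * (s * s)))"
    using eqm_mult[OF K eqm_refl[OF K, of e]] eG by blast
  then have "eqm ?K (cj x e * (e * (s * (e * (s * s))))) (e * (e * ((e * s) * (s * s))))"
    using eqm_mult[OF K c] eG x by simp
  then have 1: "eqm ?K (com (x ^ 3) y) (e ^ 3 * s ^ 3)"
    unfolding eq by (simp add: numeral_3_eq_3 mult.assoc)
  have "e ^ 3 \<in> ?K" using L_powerI[OF e2] by (simp add: p3)
  then have "eqm ?K (e ^ 3 * s ^ 3) (s ^ 3)" by (rule eqm_mult_left[OF K])
  then show ?thesis using eqm_trans[OF K 1] by (simp add: s_def)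
qed

text \<open>Each of the layers 1, 2, 3 is spanned by one commutator with \<open>y\<close>, namely of
  \<open>x\<close>, of \<open>s\<close> and of \<open>com s y\<close>. Conjugation by these moves
  \<open>y\<close> through its whole coset of \<open>L 1\<close>.\<close>

lemma maximal_class_not_ample:
  assumes p3: "p = 3" and b: "basis x y" and s: "s = com x y" and w: "com s y \<notin> L 3"
    and c2: "card (L 2) = 9" and c3: "card (L 3) = 3" and L4: "L 4 = {1}"
    and x3: "x ^ 3 \<in> L 2" and y3: "y ^ 3 \<in> L 2" and y1: "y \<noteq> 1"
  shows "\<not> ample y"
proof -
  have x: "x \<in> G" and y: "y \<in> G" using b basis_in by auto
  have nums: "Suc 1 = 2" "Suc 2 = 3" "Suc 3 = 4" by simp_all
  have s1: "s \<in> L 1" using x y by (auto simp: s intro: L_comI[of x 0 y])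
  have sG: "s \<in> G" using s1 L_in_G by blast
  have sp1: "spans {s} 1"
    using b s1 x3 y3 by (intro spans_one) (auto simp: p3 s intro: gen_incl)
  define w where "w = com s y"
  have w2: "w \<in> L 2" "w \<notin> L 3" unfolding w_def by (rule L_comI[OF s1 y], simp) (rule w)
  have wG: "w \<in> G" using w2 L_in_G by blast
  have sp2: "spans {w} 2" using w2 c2 c3 by (intro spans_single) (auto simp: p3 nums)
  have "com (x ^ 3) y \<in> L 3" by (rule L_comI[OF x3 y]) simp
  then have s3: "s ^ 3 \<in> L 3"
    using eqm_mem_iff[OF com_cube_eqm[OF p3 x y] subgrp_L subset_refl] by (simp add: s)
  have "com (s ^ 3) y = 1" using L_comI[OF s3 y, of 4] L4 by simp
  moreover have "s * w = w * s"
    using L_com_LI[OF s1 w2(1), of 4] L4 by (simp add: com_eq_one_iff)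
  then have "cj s w = w" by (simp add: cj_def mult.assoc)
  then have "com (s ^ 3) y = w ^ 3"
    by (simp add: numeral_3_eq_3 com_mult_left cj_mult w_def[symmetric] mult.assoc)
  ultimately have w3: "w ^ 3 = 1" by simp
  \<comment> \<open>Otherwise \<open>y\<close> centralises \<open>L 2\<close>, then
    \<open>com_com_swap\<close> makes \<open>w\<close> commute with \<open>x\<close> too, and with
    \<open>w^3 = 1\<close> nothing is left to span \<open>L 3\<close>.\<close>
  have z: "com w y \<noteq> 1"
  proof
    assume z: "com w y = 1"
    have "subgrp {f\<in>L 2. com f y \<in> L 4}" using y by (intro subgrp_com_one_vimage) (auto intro: L_in_G)
    moreover have "L 3 \<subseteq> {f\<in>L 2. com f y \<in> L 4}"
      using L_comI[of _ 3 y 4] y L_antimono[of 2 3] by auto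
    ultimately have "L 2 \<subseteq> {f\<in>L 2. com f y \<in> L 4}"
      using w2 z L_closed(1) by (intro spans_least[OF sp2]) (auto simp: nums)
    moreover have "com s x \<in> L 2" by (rule L_comI[OF s1 x]) simp
    ultimately have "com (com s x) y = 1" using L4 by auto
    then have "com w x = 1" using com_com_swap[OF x y s] by (simp add: L4 eqm_trivial w_def)
    then have "spans {} (Suc 2)"
      using z w3 by (intro spans_Suc[OF b sp2]) (auto simp: p3 subgrp_one[OF subgrp_gen])
    then have "L 3 = {1}" using spans_empty by (simp add: nums)
    then show False using c3 by simp
  qed
  have z3: "com w y \<in> L 3" by (rule L_comI[OF w2(1) y]) simp
  have sp3: "spans {com w y} 3" using z z3 c3 L4 by (intro spans_single) (auto simp: p3 nums)
  have full: "full y j" if j: "Suc 0 \<le> j" for j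
  proof -
    consider "j = 1" | "j = 2" | "j = 3" | "4 \<le> j" using j by linarith
    then show ?thesis
    proof cases
      case 1
      then show ?thesis using full_spans[OF y sp1] reach_com[OF y x] s1 by (simp add: s)
    next
      case 2
      then show ?thesis using full_spans[OF y sp2] reach_com[OF y sG] w2 by (simp add: w_def)
    next
      case 3
      then show ?thesis using full_spans[OF y sp3] reach_com[OF y wG] z3 by simp
    next
      case 4
      then show ?thesis using full_trivial[OF y] L_trivial_Suc[OF L4] by simp
    qed
  qed
  show ?thesis using not_ample[of y 0] y y1 full by simp
qed

lemma com_inverse_left_one: "com (inverse a) b = 1 \<longleftrightarrow> com a b = 1"
proof -
  have "com (inverse a) b = cj (inverse a) (inverse (com a b))"
    by (simp add: com_def cj_def g_simps)
  moreover have "cj g c = 1 \<longleftrightarrow> c = 1" for g c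
    by (metis cj_by_one cj_cj cj_one g_left_inverse)
  ultimately show ?thesis by (metis g_inverse_inverse g_inverse_one)
qed

text \<open>Conjugating \<open>x\<close> by \<open>y\<close> reaches the first layer, conjugating by
  the commutator reaches the second.\<close>

lemma class_three_not_ample:
  assumes b: "basis x y" and x1: "x \<noteq> 1" and sp: "spans {com x y} 1" and c: "com (com x y) x \<noteq> 1"
    and c2: "card (L 2) < p * p" and L3: "L 3 = {1}"
  shows "\<not> ample x"
proof -
  have x: "x \<in> G" and y: "y \<in> G" using b basis_in by auto
  have s1: "com x y \<in> L 1" by (rule L_comI[of x 0 y]) (use x y in auto)
  have sG: "com x y \<in> G" using x y by simp
  have m: "com (com x y) x \<in> L 2" by (rule L_comI[OF s1 x]) simp
  have sp2: "spans {com (com x y) x} 2"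
    using m c c2 L3 by (intro spans_single) (auto simp: eval_nat_numeral)
  have "full x j" if j: "Suc 0 \<le> j" for j
  proof -
    consider "j = 1" | "j = 2" | "3 \<le> j" using j by linarith
    then show ?thesis
    proof cases
      case 1
      then show ?thesis using full_spans[OF x sp] reach_com'[OF x y s1] by simp
    next
      case 2
      then show ?thesis using full_spans[OF x sp2] reach_com[OF x sG m] by simp
    next
      case 3
      then show ?thesis using full_trivial[OF x] L_trivial_Suc[OF L3] by simp
    qed
  qed
  then show ?thesis using not_ample[of x 0] x x1 by simp
qed

text \<open>Counting shows that \<open>x^3\<close> and \<open>s = [x, y]\<close> span
  \<open>L 1\<close> modulo \<open>L 2\<close>. If \<open>[s, x]\<close> is nontrivial,
  \<open>x\<close> reaches both layers; if it is trivial, the cube is constant on the coset of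
  \<open>x\<close>.\<close>

lemma cube_not_in_second_layer:
  assumes p3: "p = 3" and b: "basis x y" and c1: "card (L 1) \<le> 27" and c2: "card (L 2) = 3" and L3: "L 3 = {1}"
    and X1: "(x ^ 3) ^ 3 = 1" "com (x ^ 3) y = 1" and Y1: "(y ^ 3) ^ 3 = 1" "com (y ^ 3) x = 1"
    and X2: "x ^ 3 \<notin> L 2"
  shows "\<not> ample x"
proof -
  have nums: "Suc 1 = 2" "Suc 2 = 3" by simp_all
  define s where "s = com x y"
  have x: "x \<in> G" and y: "y \<in> G" using b basis_in by auto
  have s1: "s \<in> L 1" unfolding s_def by (rule L_comI[of x 0 y]) (use x y in auto)
  have sG: "s \<in> G" using s1 L_in_G by blast
  have pw: "a ^ p = a ^ 3" for a :: 'a by (simp add: p3)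
  have cube1: "a ^ 3 \<in> L 1" if "a \<in> G" for a
    using L_power[of a 0] that by (simp add: pw)
  have one: "1 \<in> sgen S" for S using subgrp_one[OF subgrp_gen] .
  have s3: "s ^ 3 = 1"
    using com_cube_eqm[OF p3 x y] X1 by (simp add: L3 eqm_trivial s_def)
  have sp: "spans {x ^ 3, y ^ 3, s} 1"
    using cube1[OF x] cube1[OF y] s1 by (intro spans_one[OF b]) (auto simp: pw s_def intro: gen_incl)
  define V where "V = sgen ({x ^ 3} \<union> L 2)"
  define U where "U = sgen ({x ^ 3, y ^ 3} \<union> L 2)"
  have UG: "U \<subseteq> L 1" unfolding U_def
    using cube1[OF x] cube1[OF y] L_antimono[of 1 2] by (intro gen_least) auto
  have VU: "V \<subseteq> U" unfolding U_def V_def by (rule gen_mono) auto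
  have LV: "L 2 \<subset> V" using X2 gen_incl[of _ "{x ^ 3} \<union> L 2"] by (auto simp: V_def)
  \<comment> \<open>If the cubes alone spanned the first layer, their trivial cubes and commutators
    would make \<open>L 2\<close> trivial.\<close>
  have sU: "s \<notin> U"
  proof
    assume "s \<in> U"
    then have "L 1 \<subseteq> U"
      by (intro spans_least[OF sp]) (auto simp: U_def subgrp_gen numeral_2_eq_2 intro: gen_incl)
    then have "spans {x ^ 3, y ^ 3} 1"
      using cube1[OF x] cube1[OF y] by (simp add: spans_def U_def numeral_2_eq_2)
    then have "spans {} (Suc 1)"
      using X1 Y1 by (intro spans_Suc[OF b]) (auto simp: pw one)
    from spans_empty[OF this] have "L 2 = {1}" by (simp only: nums)
    then show False using c2 by simp
  qed
  \<comment> \<open>A strict chain \<open>L 2 < V < U < L 1\<close> would need index 27 over a group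
    of order 3, but \<open>L 1\<close> has at most 27 elements. So \<open>y^3\<close> adds nothing
    to \<open>x^3\<close>.\<close>
  have "V = U"
  proof (rule ccontr)
    assume "V \<noteq> U"
    then have "p * card V \<le> card U"
      using VU UG L_in_G by (intro proper_card) (auto simp: U_def V_def subgrp_gen)
    moreover have "p * card U \<le> card (L 1)"
      using UG sU s1 L_in_G by (intro proper_card) (auto simp: U_def subgrp_gen)
    moreover have "p * card (L 2) \<le> card V"
      using LV VU UG L_in_G by (intro proper_card) (auto simp: V_def subgrp_gen)
    ultimately show False using c1 c2 p3 by simp
  qed
  then have "y ^ 3 \<in> V" using gen_incl[of "y ^ 3" "{x ^ 3, y ^ 3} \<union> L 2"] by (simp add: U_def)
  then have "y ^ 3 \<in> sgen ({x ^ 3, s} \<union> L 2)" unfolding V_def using gen_mono[of "{x ^ 3} \<union> L 2" "{x ^ 3, s} \<union> L 2"] by auto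
  then have sp1: "spans {x ^ 3, s} 1"
    using cube1[OF x] s1 by (intro spans_one[OF b]) (auto simp: pw s_def intro: gen_incl)
  have m: "com s x \<in> L 2" by (rule L_comI[OF s1 x]) simp
  show ?thesis
  proof (cases "com s x = 1")
    case False
    have sp2: "spans {com s x} 2"
      using m False c2 L3 by (intro spans_single) (auto simp: eval_nat_numeral p3)
    have full: "full x j" if j: "Suc 0 \<le> j" for j
    proof -
      consider "j = 1" | "j = 2" | "3 \<le> j" using j by linarith
      then show ?thesis
      proof cases
        case 1
        have "x ^ 3 \<in> reach x 1" using reach_power[of x 1] x cube1[OF x] by (simp add: pw)
        then show ?thesis using 1 full_spans[OF x sp1] reach_com'[OF x y] s1 by (simp add: s_def)
      next
        case 2
        then show ?thesis using full_spans[OF x sp2] reach_com[OF x sG m] by simp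
      next
        case 3
        then show ?thesis using full_trivial[OF x] L_trivial_Suc[OF L3] by simp
      qed
    qed
    have "x \<noteq> 1" using X2 L_closed(1) by auto
    then show ?thesis using not_ample[of x 0] x full by simp
  next
    \<comment> \<open>Now \<open>x\<close> centralises \<open>L 1\<close>, and \<open>L 1\<close>
      has exponent 3, so all elements of the coset have the cube \<open>x^3\<close>.\<close>
    case True
    have L2: "L (Suc 1) = L 2" by (simp add: numeral_2_eq_2)
    have "L 1 \<subseteq> {f\<in>L 1. com f x \<in> L 3}"
    proof (rule spans_least[OF sp1])
      show "subgrp {f\<in>L 1. com f x \<in> L 3}" using x by (intro subgrp_com_one_vimage) (auto intro: L_in_G)
      show "{x ^ 3, s} \<subseteq> {f\<in>L 1. com f x \<in> L 3}" using True cube1[OF x] s1 by (auto simp: L_closed)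
      show "L (Suc 1) \<subseteq> {f\<in>L 1. com f x \<in> L 3}"
        unfolding L2 using L_antimono[of 1 2] L_comI[OF _ x, of _ 2 3] by auto
    qed
    then have comm: "com f x = 1" if "f \<in> L 1" for f using that L3 by auto
    have "L 1 \<subseteq> {f\<in>L 1. f ^ p \<in> L 3}"
    proof (rule spans_least[OF sp1])
      show "subgrp {f\<in>L 1. f ^ p \<in> L 3}"
        by (rule subgrp_power_vimage) (auto intro: L_in_G L_com_LI)
      show "{x ^ 3, s} \<subseteq> {f\<in>L 1. f ^ p \<in> L 3}" using X1 s3 cube1[OF x] s1 by (auto simp: L_closed pw)
      show "L (Suc 1) \<subseteq> {f\<in>L 1. f ^ p \<in> L 3}"
        unfolding L2 using L_antimono[of 1 2] L_powerI[of _ 2 p 3] by auto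
    qed
    then have cub: "f ^ 3 = 1" if "f \<in> L 1" for f using that L3 by (auto simp: pw)
    have "(l * x) ^ 3 = x ^ 3" if l: "l \<in> L 1" for l
    proof -
      have "com x l = 1" using comm[OF l] com_inverse[of l x] by simp
      then have "eqm {1} ((l * x) ^ 3) (l ^ 3 * x ^ 3)"
        using l L_in_G x by (intro eqm_power_mult nrm_trivial) auto
      then show ?thesis using cub[OF l] by (simp add: eqm_trivial)
    qed
    moreover have "x ^ 3 \<noteq> 1" using X2 L_closed(1) by auto
    ultimately show ?thesis using x by (intro not_ample_power)
  qed
qed

text \<open>A second layer of order 3 is spanned by any of its nontrivial elements, so it is easily
  reached. Once the cubes are pushed into \<open>L 2\<close>, it must contain a nontrivial
  \<open>[s, x]\<close> or \<open>[s, y]\<close>, and \<open>class_three_not_ample\<close> applies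
  to \<open>x\<close> or to \<open>y\<close>.\<close>

lemma second_layer_card_three:
  assumes p3: "p = 3" and b: "basis x y" and ne: "x \<noteq> 1" "y \<noteq> 1"
    and c1: "card (L 1) \<le> 27" and c2: "card (L 2) = 3" and L3: "L 3 = {1}"
    and ax: "ample x" and ay: "ample y"
  shows False
proof -
  have nums: "Suc 1 = 2" "Suc 2 = 3" "Suc 3 = 4" by simp_all
  define s where "s = com x y"
  have x: "x \<in> G" and y: "y \<in> G" using b basis_in by auto
  have s1: "s \<in> L 1" unfolding s_def by (rule L_comI[of x 0 y]) (use x y in auto)
  have pw: "a ^ p = a ^ 3" for a :: 'a by (simp add: p3)
  have cube1: "a ^ 3 \<in> L 1" if "a \<in> G" for a
    using L_power[of a 0] that by (simp add: pw)
  have single: "spans {e} 2" if "e \<in> L 2" "e \<noteq> 1" for e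
    using that c2 L3 by (intro spans_single) (auto simp: p3 eval_nat_numeral)
  \<comment> \<open>Either element, if nontrivial, spans \<open>L 2\<close> and is a shift of
    \<open>a^3\<close>; then \<open>a^3\<close> is full from depth 2 and \<open>not_ample\<close>
    applies with \<open>i = 1\<close>.\<close>
  have A: "(a ^ 3) ^ 3 = 1 \<and> com (a ^ 3) d = 1" if a: "basis a d" "ample a" for a d
  proof (rule ccontr)
    assume *: "\<not> ?thesis"
    have aG: "a \<in> G" "d \<in> G" using a basis_in by auto
    have m: "(a ^ 3) ^ 3 \<in> L 2" "com (a ^ 3) d \<in> L 2"
      by (rule L_powerI[OF cube1[OF aG(1)] p3[symmetric]]; simp) (rule L_comI[OF cube1[OF aG(1)] aG(2)]; simp)
    have "full (a ^ 3) 2"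
    proof (cases "(a ^ 3) ^ 3 = 1")
      case True
      then have "com (a ^ 3) d \<noteq> 1" using * by simp
      then show ?thesis using full_spans[OF _ single[OF m(2)]] reach_com'[OF _ aG(2) m(2)] aG by simp
    next
      case False
      then show ?thesis using full_spans[OF _ single[OF m(1)]] reach_power[of "a ^ 3" 2] m(1) aG by (simp add: pw)
    qed
    then have "full (a ^ (p ^ 1)) j" if "Suc 1 \<le> j" for j
      using that full_trivial[of "a ^ 3" j] L_trivial_Suc[OF L3, of j] aG by (cases "j = 2") (auto simp: pw)
    moreover have "a ^ (p ^ 1) \<noteq> 1"
      using * com_one(1)[of d] power_one[of 3, where 'a='a] unfolding power_one_right pw by metis
    ultimately show False using not_ample[of a 1] aG a by blast
  qed
  have X1: "(x ^ 3) ^ 3 = 1" "com (x ^ 3) y = 1" and Y1: "(y ^ 3) ^ 3 = 1" "com (y ^ 3) x = 1"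
    using A[OF b ax] A[OF basis_swap[OF b] ay] by auto
  have x2: "x ^ 3 \<in> L 2" using cube_not_in_second_layer[OF p3 b c1 c2 L3 X1 Y1] ax by blast
  have y2: "y ^ 3 \<in> L 2" using cube_not_in_second_layer[OF p3 basis_swap[OF b] c1 c2 L3 Y1 X1] ay by blast
  have s3: "s ^ 3 = 1"
    using com_cube_eqm[OF p3 x y] X1 by (simp add: L3 eqm_trivial s_def)
  have sp1: "spans {s} 1"
    using s1 x2 y2 by (intro spans_one[OF b]) (auto simp: pw s_def intro: gen_incl)
  have "spans {com s x, com s y} (Suc 1)"
    using s3 L_com[OF s1 x] L_com[OF s1 y]
    by (intro spans_Suc[OF b sp1]) (auto simp: pw subgrp_one[OF subgrp_gen] intro: gen_incl)
  then have "spans {com s x, com s y} 2" by (simp only: nums)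
  from spans_trivial[OF this] have "com s x \<noteq> 1 \<or> com s y \<noteq> 1" using c2 by auto
  then show False
  proof
    assume "com s x \<noteq> 1"
    then show False
      using class_three_not_ample[OF b ne(1)] sp1 c2 L3 ax p3 by (simp add: s_def)
  next
    assume c: "com s y \<noteq> 1"
    have "spans {com y x} 1" using spans_inverse[OF sp1] by (simp only: s_def com_inverse)
    moreover have "com (com y x) y \<noteq> 1"
      using c com_inverse_left_one[of s y] by (simp add: s_def com_inverse)
    ultimately show False
      using class_three_not_ample[OF basis_swap[OF b] ne(2)] c2 L3 ay p3 by simp
  qed
qed

text \<open>If \<open>L 2\<close> were trivial, ample elements would have trivial cube, so the
  commutator would span \<open>L 1\<close>, and conjugation by \<open>y\<close> moves
  \<open>x\<close> through its coset.\<close>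

lemma three_group_second_layer:
  assumes p3: "p = 3" and b: "basis x y" and ne: "x \<noteq> 1" "y \<noteq> 1" and ax: "ample x" and ay: "ample y"
  shows "L 2 \<noteq> {1}"
proof
  assume L2: "L 2 = {1}"
  have pw: "a ^ p = a ^ 3" for a :: 'a by (simp add: p3)
  have x: "x \<in> G" and y: "y \<in> G" using b basis_in by auto
  have s1: "com x y \<in> L 1" by (rule L_comI[of x 0 y]) (use x y in auto)
  have triv: "full c j" if "c \<in> G" "2 \<le> j" for c j
    using full_trivial[OF that(1)] L_trivial_Suc[OF L2 that(2)] .
  have A: "a ^ 3 = 1" if "a \<in> G" "ample a" for a
    using not_ample[of a 1] that triv[of "a ^ (p ^ 1)"] pw[of a] by auto
  have sp: "spans {com x y} 1"
    using A[OF x ax] A[OF y ay] s1 subgrp_one[OF subgrp_gen]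
    by (intro spans_one[OF b]) (auto simp: pw intro: gen_incl)
  have "full x j" if "Suc 0 \<le> j" for j
  proof (cases "j = 1")
    case True
    then show ?thesis using full_spans[OF x sp] reach_com'[OF x y s1] by simp
  next
    case False
    then show ?thesis using triv[OF x] that by simp
  qed
  then show False using not_ample[of x 0] x ne ax by simp
qed

text \<open>A nontrivial \<open>L 3\<close> forces the orders 27, 9, 3, 1 of \<open>L 1\<close> to
  \<open>L 4\<close>. Then the cubes lie in \<open>L 2\<close>, and the group is of the shape
  treated by \<open>maximal_class_not_ample\<close>.\<close>

lemma three_group_third_layer:
  assumes p3: "p = 3" and b: "basis x y" and ne: "x \<noteq> 1" "y \<noteq> 1"
    and c1: "card (L 1) \<le> 27" and ax: "ample x" and ay: "ample y"
  shows "L 3 = {1}"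
proof (rule ccontr)
  assume L3: "L 3 \<noteq> {1}"
  have nums: "Suc 1 = 2" "Suc 2 = 3" "Suc 3 = 4" by simp_all
  have pw: "a ^ p = a ^ 3" for a :: 'a by (simp add: p3)
  have pc: "p * n = 3 * n" for n by (simp add: p3)
  have down: "L j \<noteq> {1}" if "L k \<noteq> {1}" "j \<le> k" for j k using L_trivial_Suc that by blast
  have L2: "L 2 \<noteq> {1}" and L1: "L 1 \<noteq> {1}" using down[OF L3] by auto
  have c12: "3 * card (L 2) \<le> card (L 1)" and c23: "3 * card (L 3) \<le> card (L 2)"
    and c34: "3 * card (L 4) \<le> card (L 3)"
    using L_cardI[OF L1, of 2] L_cardI[OF L2, of 3] L_cardI[OF L3, of 4] by (simp_all add: pc)
  have L4: "L 4 = {1}"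
  proof (rule ccontr)
    assume L4: "L 4 \<noteq> {1}"
    then have "3 * card (L 5) \<le> card (L 4)" using L_cardI[of 4 5] by (simp add: pc)
    moreover have "0 < card (L 5)" by (rule card_L_pos)
    ultimately show False using c12 c23 c34 c1 by linarith
  qed
  then have "card (L 4) = 1" by simp
  then have card1: "card (L 1) = 27" and card2: "card (L 2) = 9" and card3: "card (L 3) = 3"
    using c12 c23 c34 c1 by linarith+
  have single1: "spans {e} 1" if "e \<in> L 1" "e \<notin> L 2" for e
    using that card1 card2 by (intro spans_single) (auto simp: pc numeral_2_eq_2)
  have single2: "spans {e} 2" if "e \<in> L 2" "e \<notin> L 3" for e
    using that card2 card3 by (intro spans_single) (auto simp: pc)
  have x: "x \<in> G" and y: "y \<in> G" using b basis_in by auto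
  have cube1: "a ^ 3 \<in> L 1" if "a \<in> G" for a
    using L_power[of a 0] that by (simp add: pw)
  have B1: "a ^ 3 \<in> L 2" if ab: "basis a d" and am: "ample a" for a d
  proof (rule ccontr)
    assume A: "a ^ 3 \<notin> L 2"
    have a: "a \<in> G" and d: "d \<in> G" using ab basis_in by auto
    have sp1: "spans {a ^ 3} 1" using single1 cube1[OF a] A by blast
    have a9: "(a ^ 3) ^ 3 \<in> L 2" by (rule L_powerI[OF cube1[OF a] p3[symmetric]]) simp
    have cd: "com (a ^ 3) d \<in> L 2" by (rule L_comI[OF cube1[OF a] d]) simp
    have s1: "com a d \<in> L 1" by (rule L_comI[of a 0 d]) (use a d in auto)
    \<comment> \<open>Otherwise cubes of \<open>L 1\<close> lie in \<open>L 3\<close>; by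
      \<open>com_cube_eqm\<close> so does \<open>[a^3, d]\<close>, and nothing would span
      \<open>L 2\<close> modulo \<open>L 3\<close>. Hence \<open>a^9\<close> spans that layer, and
      the powers of \<open>a\<close> reach everything below it.\<close>
    have a9n: "(a ^ 3) ^ 3 \<notin> L 3"
    proof
      assume a9: "(a ^ 3) ^ 3 \<in> L 3"
      have "L 1 \<subseteq> {f\<in>L 1. f ^ p \<in> L 3}"
      proof (rule spans_least[OF sp1])
        show "subgrp {f\<in>L 1. f ^ p \<in> L 3}"
          by (rule subgrp_power_vimage) (auto intro: L_in_G L_com_LI)
        show "{a ^ 3} \<subseteq> {f\<in>L 1. f ^ p \<in> L 3}" using a9 cube1[OF a] by (simp add: pw)
        show "L (Suc 1) \<subseteq> {f\<in>L 1. f ^ p \<in> L 3}"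
          unfolding nums using L_antimono[of 1 2] L_powerI[of _ 2 p 3] by auto
      qed
      then have "com a d ^ 3 \<in> L 3" using s1 pw by auto
      then have "com (a ^ 3) d \<in> L 3"
        using eqm_mem_iff[OF com_cube_eqm[OF p3 a d] subgrp_L subset_refl] by simp
      then have "spans {} (Suc 1)"
        using a9 by (intro spans_Suc[OF ab sp1]) (auto simp: pw nums gen_subgrp_eq L_closed numeral_3_eq_3[symmetric])
      from spans_empty[OF this] show False using L2 by (simp only: nums)
    qed
    have sp2: "spans {(a ^ 3) ^ 3} 2" using single2 a9 a9n by blast
    have c: "(a ^ 3) ^ 3 \<in> G" using a by simp
    have "((a ^ 3) ^ 3) ^ 3 \<in> L 3" by (rule L_powerI[OF a9 p3[symmetric]]) simp
    moreover have "com ((a ^ 3) ^ 3) d \<in> L 3" by (rule L_comI[OF a9 d]) simp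
    moreover have "com ((a ^ 3) ^ 3) a = 1" unfolding power_mult[symmetric] by simp
    ultimately have "spans {((a ^ 3) ^ 3) ^ 3, com ((a ^ 3) ^ 3) d} (Suc 2)"
      unfolding pw[symmetric] using subgrp_one[OF subgrp_gen]
      by (intro spans_Suc[OF ab sp2[unfolded pw[symmetric]]]) (auto simp: nums intro: gen_incl)
    then have sp3: "spans {((a ^ 3) ^ 3) ^ 3, com ((a ^ 3) ^ 3) d} 3" by (simp only: nums)
    have "full ((a ^ 3) ^ 3) j" if "Suc 2 \<le> j" for j
    proof (cases "j = 3")
      case True
      have "((a ^ 3) ^ 3) ^ 3 \<in> reach ((a ^ 3) ^ 3) 3"
        using reach_power[OF c, of 3] spans_in[OF sp3] unfolding pw by blast
      moreover have "com ((a ^ 3) ^ 3) d \<in> reach ((a ^ 3) ^ 3) 3"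
        using reach_com'[OF c d, of 3] spans_in[OF sp3] by blast
      ultimately show ?thesis using full_spans[OF c sp3] True by simp
    next
      case False
      then show ?thesis using full_trivial[OF c] L_trivial_Suc[OF L4, of j] that by simp
    qed
    moreover have "a ^ (p ^ 2) = (a ^ 3) ^ 3" by (simp add: p3 flip: power_mult)
    moreover have "(a ^ 3) ^ 3 \<noteq> 1" using a9n L_closed(1) by auto
    ultimately show False using not_ample[OF a, of 2] am by metis
  qed
  have x2: "x ^ 3 \<in> L 2" and y2: "y ^ 3 \<in> L 2" using B1[OF b ax] B1[OF basis_swap[OF b] ay] by auto
  define s where "s = com x y"
  have s1: "s \<in> L 1" unfolding s_def by (rule L_comI[of x 0 y]) (use x y in auto)
  have sG: "s \<in> G" using s1 L_in_G by blast
  have sp1: "spans {s} 1"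
    using s1 x2 y2 by (intro spans_one[OF b]) (auto simp: pw s_def intro: gen_incl)
  have "com (x ^ 3) y \<in> L 3" by (rule L_comI[OF x2 y]) simp
  then have s3: "s ^ 3 \<in> L 3"
    using eqm_mem_iff[OF com_cube_eqm[OF p3 x y] subgrp_L subset_refl] by (simp add: s_def)
  have m: "com s x \<in> L 2" "com s y \<in> L 2" by (rule L_comI[OF s1 x], simp, rule L_comI[OF s1 y], simp)
  have "spans {com s x, com s y} (Suc 1)"
    using s3 m by (intro spans_Suc[OF b sp1]) (auto simp: pw numeral_2_eq_2 numeral_3_eq_3 intro: gen_incl)
  then have sp2: "spans {com s x, com s y} 2" by (simp only: nums)
  have "\<not> L 2 \<subseteq> L 3" using card2 card3 card_mono[OF finite_L, of "L 2" 3] by auto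
  then have "com s x \<notin> L 3 \<or> com s y \<notin> L 3"
    using spans_least[OF sp2 subgrp_L[of 3]] by (auto simp: nums)
  then show False
  proof
    assume "com s y \<notin> L 3"
    then show False
      using maximal_class_not_ample[OF p3 b s_def _ card2 card3 L4 x2 y2 ne(2)] ay by blast
  next
    assume "com s x \<notin> L 3"
    then have "com (com y x) x \<notin> L 3"
      using com_inverse_left_mem[OF nrm_L sG, of x 3] by (simp add: s_def com_inverse)
    then show False
      using maximal_class_not_ample[OF p3 basis_swap[OF b] HOL.refl _ card2 card3 L4 y2 x2 ne(1)] ax by blast
  qed
qed

text \<open>\<open>L 2\<close> is nontrivial and its order is not 3, so it is at least 9; with the
  indices 9 and 3 above it this exhausts the bound 243.\<close>

theorem three_group_relations:
  assumes p3: "p = 3" and b: "basis x y" and nc: "\<exists>a\<in>G. \<exists>b\<in>G. a * b \<noteq> b * a"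
    and card: "card G \<le> 243" and ax: "ample x" and ay: "ample y"
  shows "card G = 243" "x ^ 3 = 1" "y ^ 3 = 1" "L 3 = {1}" "\<And>f. f \<in> L 1 \<Longrightarrow> f ^ 3 = 1"
proof -
  have nums: "Suc 1 = 2" "Suc 2 = 3" "Suc 3 = 4" by simp_all
  have pw: "a ^ p = a ^ 3" for a :: 'a by (simp add: p3)
  have pc: "p * n = 3 * n" for n by (simp add: p3)
  define s where "s = com x y"
  have x: "x \<in> G" and y: "y \<in> G" using b basis_in by auto
  note nonc = noncomm_card[OF b nc]
  have c9: "9 * card (L 1) \<le> card G" using nonc(4) by (simp add: pc)
  then have c1: "card (L 1) \<le> 27" using card by linarith
  have ne: "x \<noteq> 1" "y \<noteq> 1" using nonc L_closed(1) by auto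
  have s1: "s \<in> L 1" unfolding s_def by (rule L_comI[of x 0 y]) (use x y in auto)
  have cube1: "a ^ 3 \<in> L 1" if "a \<in> G" for a
    using L_power[of a 0] that by (simp add: pw)
  have L2: "L 2 \<noteq> {1}" using three_group_second_layer[OF p3 b ne ax ay] .
  show L3: "L 3 = {1}" using three_group_third_layer[OF p3 b ne c1 ax ay] .
  have L1: "L 1 \<noteq> {1}" using L2 L_trivial_Suc[of 1 2] by auto
  have c12: "3 * card (L 2) \<le> card (L 1)" using L_cardI[OF L1, of 2] by (simp add: pc)
  have "p \<le> card (L 2)" using L_cardI[OF L2, of 3] L3 by simp
  then have c23: "3 \<le> card (L 2)" using p3 by linarith
  obtain i where "card (L 2) = p ^ i" using card_power[OF subgrp_L nrm_subset[OF nrm_L]] by blast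
  then have i: "card (L 2) = 3 ^ i" by (simp only: p3)
  have n3: "card (L 2) \<noteq> 3" using second_layer_card_three[OF p3 b ne c1 _ L3 ax ay] by blast
  have "i \<noteq> 0" using i c23 by (intro notI) simp
  moreover have "i \<noteq> 1" using i n3 by (intro notI) simp
  ultimately have "2 \<le> i" by linarith
  then have "(3::nat) ^ 2 \<le> 3 ^ i" by (intro power_increasing) auto
  then have card2: "card (L 2) = 9" and card1: "card (L 1) = 27" using i c12 c1 by simp_all
  show "card G = 243" using c9 card1 card by simp
  have single1: "spans {e} 1" if "e \<in> L 1" "e \<notin> L 2" for e
    using that card1 card2 by (intro spans_single) (auto simp: pc numeral_2_eq_2)
  \<comment> \<open>With \<open>L 3\<close> trivial, ampleness gives \<open>a^9 = 1\<close>. If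
    \<open>a^3\<close> spanned the first layer, its cube and its commutators would then all be
    trivial, and so would \<open>L 2\<close>.\<close>
  have C1: "a ^ 3 \<in> L 2" if ab: "basis a d" and am: "ample a" for a d
  proof (rule ccontr)
    assume A: "a ^ 3 \<notin> L 2"
    have a: "a \<in> G" and d: "d \<in> G" using ab basis_in by auto
    have sp1: "spans {a ^ 3} 1" using single1 cube1[OF a] A by blast
    have sd: "com a d \<in> L 1" by (rule L_comI[of a 0 d]) (use a d in auto)
    have c: "(a ^ 3) ^ 3 \<in> G" using a by simp
    have e2: "a ^ (p ^ 2) = (a ^ 3) ^ 3" by (simp add: p3 flip: power_mult)
    have "full ((a ^ 3) ^ 3) j" if "Suc 2 \<le> j" for j
      using full_trivial[OF c] L_trivial_Suc[OF L3, of j] that by simp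
    then have a9: "(a ^ 3) ^ 3 = 1" using not_ample[OF a, of 2] am e2 by metis
    have "L 1 \<subseteq> {f\<in>L 1. f ^ p \<in> L 3}"
    proof (rule spans_least[OF sp1])
      show "subgrp {f\<in>L 1. f ^ p \<in> L 3}"
        by (rule subgrp_power_vimage) (auto intro: L_in_G L_com_LI)
      show "{a ^ 3} \<subseteq> {f\<in>L 1. f ^ p \<in> L 3}" using a9 cube1[OF a] L_closed(1) by (simp add: pw)
      show "L (Suc 1) \<subseteq> {f\<in>L 1. f ^ p \<in> L 3}"
        unfolding nums using L_antimono[of 1 2] L_powerI[of _ 2 p 3] by auto
    qed
    then have "com a d ^ 3 = 1" using sd pw L3 by auto
    then have "com (a ^ 3) d = 1" using com_cube_eqm[OF p3 a d] by (simp add: L3 eqm_trivial)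
    then have "spans {} (Suc 1)"
      using a9 by (intro spans_Suc[OF ab sp1]) (auto simp: pw subgrp_one[OF subgrp_gen])
    from spans_empty[OF this] show False using L2 by (simp only: nums)
  qed
  have x2: "x ^ 3 \<in> L 2" and y2: "y ^ 3 \<in> L 2" using C1[OF b ax] C1[OF basis_swap[OF b] ay] by auto
  have sp1: "spans {s} 1"
    using s1 x2 y2 by (intro spans_one[OF b]) (auto simp: pw s_def intro: gen_incl)
  have "com (x ^ 3) y = 1" using L_comI[OF x2 y, of 3] L3 by simp
  then have s3: "s ^ 3 = 1" using com_cube_eqm[OF p3 x y] by (simp add: L3 eqm_trivial s_def)
  have "L 1 \<subseteq> {f\<in>L 1. f ^ p \<in> L 3}"
  proof (rule spans_least[OF sp1])
    show "subgrp {f\<in>L 1. f ^ p \<in> L 3}"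
      by (rule subgrp_power_vimage) (auto intro: L_in_G L_com_LI)
    show "{s} \<subseteq> {f\<in>L 1. f ^ p \<in> L 3}" using s3 s1 L_closed(1) by (simp add: pw)
    show "L (Suc 1) \<subseteq> {f\<in>L 1. f ^ p \<in> L 3}"
      unfolding nums using L_antimono[of 1 2] L_powerI[of _ 2 p 3] by auto
  qed
  then show cub: "f ^ 3 = 1" if "f \<in> L 1" for f using that pw L3 by auto
  \<comment> \<open>For \<open>l\<close> in \<open>L 1\<close>, collecting \<open>(l * a)^3\<close>
    yields \<open>k^3\<close> with \<open>k = [a, l]\<close> central of exponent 3, so the cube is
    constant on the coset of \<open>a\<close>.\<close>
  have C2: "a ^ 3 = 1" if a: "a \<in> G" and am: "ample a" for a
  proof (rule ccontr)
    assume A: "a ^ 3 \<noteq> 1"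
    have "(l * a) ^ 3 = a ^ 3" if l: "l \<in> L 1" for l
    proof -
      define k where "k = com a l"
      have k2: "k \<in> L 2" unfolding k_def by (rule L_comI'[OF l a]) simp
      have cent: "g * k = k * g" if "g \<in> G" for g
        using L_comI'[OF k2 that, of 3] L3 by (simp add: com_eq_one_iff)
      have "k ^ p \<in> L 3" using k2 by (rule L_powerI) simp_all
      then have k3: "k ^ 3 = 1" using L3 pw by auto
      have lG: "l \<in> G" using l L_in_G by blast
      have al: "a * l = k * (l * a)" by (simp add: k_def com_def g_simps)
      have al': "a * (l * z) = k * (l * (a * z))" for z using al by (metis mult.assoc)
      have lk: "l * (k * z) = k * (l * z)" "a * (k * z) = k * (a * z)" for z
        using cent[OF lG] cent[OF a] by (metis mult.assoc)+
      have "(l * a) ^ 3 = k ^ 3 * (l ^ 3 * a ^ 3)"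
        by (simp add: numeral_3_eq_3 mult.assoc al al' lk)
      then show ?thesis using k3 cub[OF l] by simp
    qed
    then show False using not_ample_power[OF a A] am by blast
  qed
  show "x ^ 3 = 1" "y ^ 3 = 1" using C2 x y ax ay by auto
qed

end

section \<open>Auxiliary facts on shifts, commutators and cosets\<close>

context fin_p_group
begin

lemma reach_power_mult: "c \<in> G \<Longrightarrow> c ^ (p * e) \<in> L j \<Longrightarrow> c ^ (p * e) \<in> reach c j"
proof -
  assume *: "c \<in> G" "c ^ (p * e) \<in> L j"
  have "eqm (L (Suc j)) (cj 1 (c ^ (1 + p * e))) (c * c ^ (p * e))" by (simp add: cj_by_one)
  then show ?thesis using * G_closed(1) by (blast intro: reachI)
qed

lemma spans_of_trivial: "L k = {1} \<Longrightarrow> S \<subseteq> L k \<Longrightarrow> spans S k"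
  by (simp add: spans_def subgrp_one[OF subgrp_gen])

lemma com_eqm_Suc:
  assumes "eqm (L j) a b" "a \<in> G" "b \<in> G" "g \<in> G"
  shows "eqm (L (Suc j)) (com a g) (com b g)"
proof -
  define l where "l = a * inverse b"
  have l: "l \<in> L j" "a = l * b" using assms by (simp_all add: l_def eqm_def mult.assoc)
  have lG: "l \<in> G" using l L_in_G by blast
  have "eqm (L (Suc j)) (cj l (com b g)) (com b g)"
    using l assms by (intro eqm_cj_self L_com) auto
  moreover have "eqm (L (Suc j)) (com l g) 1" using l assms by (simp add: eqm_one_iff L_com)
  ultimately have "eqm (L (Suc j)) (cj l (com b g) * com l g) (com b g * 1)"
    using lG assms by (intro eqm_mult) auto
  then show ?thesis using l by (simp add: com_mult_left)
qed

lemma coset_two: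
  assumes N: "nrm N" and t: "t \<in> G" "t * t \<in> N" and f: "f \<in> sgen ({t} \<union> N)"
  shows "f \<in> N \<or> eqm N f t"
proof -
  let ?H = "N \<union> (\<lambda>n. n * t) ` N"
  have "subgrp ?H"
  proof (rule finite_subgrpI)
    show "finite ?H" using finite_nrm[OF N] by simp
    show "?H \<noteq> {}" using nrm_one[OF N] by auto
    fix a b assume a: "a \<in> ?H" and b: "b \<in> ?H"
    from a consider "a \<in> N" | n where "n \<in> N" "a = n * t" by auto
    then show "a * b \<in> ?H"
    proof cases
      case 1
      from b consider "b \<in> N" | m where "m \<in> N" "b = m * t" by auto
      then show ?thesis
      proof cases
        case 2
        then have "a * b = (a * m) * t" by (simp add: mult.assoc)
        then show ?thesis using 1 2 N by (simp add: nrm_mult)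
      qed (use 1 N in \<open>simp add: nrm_mult\<close>)
    next
      case a2: 2
      from b consider "b \<in> N" | m where "m \<in> N" "b = m * t" by auto
      then show ?thesis
      proof cases
        case 1
        have "a * b = (n * cj t b) * t" by (simp add: a2 cj_def g_simps)
        then show ?thesis using 1 a2 N t by (simp add: nrm_mult nrm_cj)
      next
        case 2
        have "a * b = (n * cj t m) * (t * t)" by (simp add: a2 2 cj_def g_simps)
        moreover have "(n * cj t m) * (t * t) \<in> N" by (intro nrm_mult N a2(1) nrm_cj t 2(1))
        ultimately show ?thesis by simp
      qed
    qed
  qed
  moreover have "{t} \<union> N \<subseteq> ?H" using nrm_one[OF N] by (force intro: image_eqI[of _ _ 1])
  ultimately have "f \<in> ?H" using gen_least f by blast
  then show ?thesis by (auto simp: eqm_def mult.assoc)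
qed

lemma basis_product_notin:
  assumes "basis x y" "y \<notin> sgen ({x} \<union> L 1)"
  shows "x * y \<notin> L 1"
proof
  assume "x * y \<in> L 1"
  then have "x * y \<in> sgen ({x} \<union> L 1)" by (auto intro: gen_incl)
  moreover have "x \<in> sgen ({x} \<union> L 1)" by (auto intro: gen_incl)
  ultimately show False using subgrp_mult_left_iff[OF subgrp_gen] assms(2) by blast
qed

end

subsection \<open>The prime 2\<close>

locale fin_2_group = fin_p_group G 2 for G :: "'a::group_mult set"
begin

lemma nums: "Suc 1 = 2" "Suc 2 = 3" "Suc 3 = 4" "Suc 4 = 5" by simp_all

lemma com_in_first: "x \<in> G \<Longrightarrow> y \<in> G \<Longrightarrow> com x y \<in> L 1"
  by (rule L_comI[of x 0 y]) auto

lemma square_in: "a \<in> L k \<Longrightarrow> j = Suc k \<Longrightarrow> a ^ 2 \<in> L j"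
  by (rule L_powerI) auto

lemma square_in_first: "a \<in> G \<Longrightarrow> a ^ 2 \<in> L 1"
  by (rule square_in[of _ 0]) auto

lemma power4_in: "a \<in> G \<Longrightarrow> a ^ 4 \<in> L 2"
  using L_power_in[of a 2] by simp

text \<open>Both \<open>[x, s]\<close> and \<open>s^2\<close>, for \<open>s = [x, y]\<close>, lie
  only in \<open>L 2\<close>, so neither may be dropped. The two variants after it serve when the
  square stands on the right, or when conjugation of \<open>s\<close> by \<open>x\<close> is
  known.\<close>

lemma com_square: "com (x ^ 2) y = com x (com x y) * (com x y) ^ 2"
  by (simp add: com_def power2_eq_square g_simps)

lemma com_square': "com (x ^ 2) y = cj x (com x y) * com x y"
  by (simp add: com_def cj_def power2_eq_square g_simps)

lemma com_square_right: "com x (y ^ 2) = cj (com x y) (com y (com x y)) * (com x y) ^ 2"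
  by (simp add: com_def cj_def power2_eq_square g_simps)

lemma square_mult: "(x * y) ^ 2 = inverse (cj x (com x y)) * x ^ 2 * y ^ 2"
  by (simp add: com_def cj_def power2_eq_square g_simps)

lemma square_mult_eqm:
  assumes x: "x \<in> G" and y: "y \<in> G"
  shows "eqm (L 2) ((x * y) ^ 2) (inverse (com x y) * x ^ 2 * y ^ 2)"
proof -
  have "eqm (L 2) (inverse (cj x (com x y))) (inverse (com x y))"
    using L_cjI[OF com_in_first[OF x y] x, of 2] x y by (intro eqm_inverse) auto
  then show ?thesis unfolding square_mult using x y by (intro eqm_mult) auto
qed

lemma square_mult_eqm_first:
  assumes "f \<in> L 1" "g \<in> L 1"
  shows "eqm (L 3) ((f * g) ^ 2) (f ^ 2 * g ^ 2)"
  using assms L_in_G by (intro eqm_power_mult L_com_LI) auto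

text \<open>Squaring is multiplicative on \<open>L 1\<close> modulo \<open>L 3\<close>, because
  commutators of elements of \<open>L 1\<close> lie in \<open>L 3\<close>. This ties
  \<open>[x, y]^2\<close> to the fourth powers on the three lines.\<close>

lemma power4_mult_eqm:
  assumes x: "x \<in> G" and y: "y \<in> G"
  shows "eqm (L 3) ((x * y) ^ 4) (inverse (com x y) ^ 2 * (x ^ 4 * y ^ 4))"
proof -
  have K: "nrm (L 3)" by simp
  let ?s = "inverse (com x y)"
  have s1: "?s \<in> L 1" using com_in_first[OF x y] by (rule L_closed)
  have sG: "?s \<in> G" using x y by simp
  note x2 = square_in_first[OF x] and y2 = square_in_first[OF y]
  have "eqm (L (Suc 2)) (((x * y) ^ 2) ^ 2) ((?s * x ^ 2 * y ^ 2) ^ 2)"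
    using square_mult_eqm[OF x y] x y by (intro L_power_eqm) auto
  then have 1: "eqm (L 3) ((x * y) ^ 4) ((?s * (x ^ 2 * y ^ 2)) ^ 2)"
    by (simp add: nums mult.assoc)
  have 2: "eqm (L 3) ((?s * (x ^ 2 * y ^ 2)) ^ 2) (?s ^ 2 * (x ^ 2 * y ^ 2) ^ 2)"
    by (rule square_mult_eqm_first[OF s1 L_closed(2)[OF x2 y2]])
  have "eqm (L 3) ((x ^ 2 * y ^ 2) ^ 2) (x ^ 4 * y ^ 4)"
    using square_mult_eqm_first[OF x2 y2] by simp
  then have 3: "eqm (L 3) (?s ^ 2 * (x ^ 2 * y ^ 2) ^ 2) (?s ^ 2 * (x ^ 4 * y ^ 4))"
    by (rule eqm_mult[OF K eqm_refl[OF K]]) (use sG in simp)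
  show ?thesis by (rule eqm_trans[OF K eqm_trans[OF K 1 2] 3])
qed

lemma single:
  assumes "card (L k) < 4 * card (L (Suc k))" "e \<in> L k" "e \<notin> L (Suc k)"
  shows "spans {e} k"
  using assms by (intro spans_single) auto

end

text \<open>With \<open>p = 2\<close>, each generating pair together with its product represents all
  three lines, so every element outside \<open>L 1\<close> is ample;
  \<open>beauville_two_group\<close> provides this.\<close>

locale ample_2_group = fin_2_group G for G :: "'a::group_mult set" +
  assumes amp: "\<And>a. a \<in> G \<Longrightarrow> a \<notin> L 1 \<Longrightarrow> ample a"
    and nonabelian: "\<exists>a\<in>G. \<exists>b\<in>G. a * b \<noteq> b * a"
    and card_le: "card G \<le> 128"
begin

lemma basis_notin:
  assumes "basis x y"
  shows "x \<notin> L 1" "y \<notin> L 1" "x * y \<notin> L 1"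
  using noncomm_card[OF assms nonabelian] basis_product_notin[OF assms] by auto

lemma basis_ample:
  assumes "basis x y"
  shows "ample x" "ample y" "ample (x * y)"
  using basis_notin[OF assms] basis_in[OF assms] amp by auto

lemma card_first: "basis x y \<Longrightarrow> card (L 1) \<le> 32" "basis x y \<Longrightarrow> 4 * card (L 1) \<le> card G"
  using noncomm_card(4)[OF _ nonabelian, of x y] card_le by auto

lemma first_nontrivial: "L 1 \<noteq> {1}"
proof
  assume "L 1 = {1}"
  then have "com a b = 1" if "a \<in> G" "b \<in> G" for a b
    using L_comI[of a 0 b 1] that by auto
  then show False using nonabelian by (auto simp: com_eq_one_iff)
qed

text \<open>\<open>not_ample\<close> with \<open>i = 2\<close>: below \<open>L 2\<close> there is
  nothing left to reach.\<close>

lemma power4_trivial: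
  assumes "L 3 = {1}" "a \<in> G" "a \<notin> L 1"
  shows "a ^ 4 = 1"
  using not_ample[of a 2] assms amp full_trivial[of "a ^ 4"] L_trivial_Suc[OF assms(1)] by force

text \<open>Any nontrivial element spans \<open>L 3\<close>. If it were \<open>a^8\<close> or a
  commutator with \<open>a^4\<close>, then \<open>a^4\<close> would be full from depth 3.\<close>

lemma power4_central:
  assumes c3: "card (L 3) \<le> 2" and a: "a \<in> G" "a \<notin> L 1"
  shows "a ^ 8 = 1" "g \<in> G \<Longrightarrow> com (a ^ 4) g = 1"
proof -
  have L4: "L 4 = {1}"
  proof (rule ccontr)
    assume L4: "L 4 \<noteq> {1}"
    then have "L 3 \<noteq> {1}" using L_trivial_Suc[of 3 4] by auto
    then have "2 * card (L 4) \<le> card (L 3)" using L_cardI[of 3 4] by simp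
    moreover have "2 * card (L 5) \<le> card (L 4)" using L_cardI[OF L4, of 5] by simp
    ultimately show False using c3 card_L_pos[of 5] by linarith
  qed
  have single: "spans {e} 3" if "e \<in> L 3" "e \<noteq> 1" for e
    using that c3 L4 by (intro single) (auto simp: nums)
  have 1: False if "e \<in> L 3" "e \<noteq> 1" "e \<in> reach (a ^ 4) 3" "a ^ 4 \<noteq> 1" for e
  proof -
    have "full (a ^ 4) j" if "3 \<le> j" for j
    proof (cases "j = 3")
      case True
      then show ?thesis using full_spans[of "a ^ 4"] single[of e] \<open>e \<in> L 3\<close> \<open>e \<noteq> 1\<close> \<open>e \<in> reach (a ^ 4) 3\<close> a by auto
    next
      case False
      then show ?thesis using full_trivial[of "a ^ 4"] L_trivial_Suc[OF L4, of j] that a by simp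
    qed
    then show False using not_ample[of a 2] a amp that(4) by simp
  qed
  have a8: "(a ^ 4) ^ 2 \<in> L 3" using power4_in[OF a(1)] by (rule square_in) simp
  show "a ^ 8 = 1"
  proof (rule ccontr)
    assume *: "a ^ 8 \<noteq> 1"
    have "(a ^ 4) ^ 2 \<in> reach (a ^ 4) 3" using a a8 by (intro reach_power) auto
    moreover have n: "(a ^ 4) ^ 2 \<noteq> 1" using * by simp
    moreover have "a ^ 4 \<noteq> 1" using n power_one[of 2] by metis
    ultimately show False using 1[OF a8] by blast
  qed
  assume g: "g \<in> G"
  have m: "com (a ^ 4) g \<in> L 3" by (rule L_comI[OF power4_in[OF a(1)] g]) simp
  show "com (a ^ 4) g = 1"
  proof (rule ccontr)
    assume *: "com (a ^ 4) g \<noteq> 1"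
    then have "a ^ 4 \<noteq> 1" by auto
    then show False using 1[OF m * reach_com'[OF _ g m]] a by simp
  qed
qed

text \<open>The first layer has order 2 and is spanned by \<open>a^2\<close>; inductively each layer
  is spanned by the next iterated square of \<open>a\<close>. The point is that
  \<open>[q^2, d]\<close> contributes nothing new beyond \<open>q^4\<close>.\<close>

lemma square_spans:
  assumes b: "basis a d" and a2: "a ^ 2 \<notin> L 2" and c: "card (L 1) < 4 * card (L 2)"
  shows "spans {a ^ (2 ^ Suc k)} (Suc k)"
proof (induction k)
  case 0
  have "a ^ 2 \<in> L 1" using square_in_first basis_in[OF b] by blast
  then show ?case using a2 c single[of 1 "a ^ 2"] by (simp add: nums numeral_2_eq_2)
next
  case (Suc k)
  have a: "a \<in> G" and d: "d \<in> G" using basis_in[OF b] by auto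
  define q where "q = a ^ (2 ^ k)"
  define t where "t = a ^ (2 ^ Suc k)"
  have t: "t = q * q" by (simp only: t_def q_def power_Suc mult_2 power_add)
  have qG: "q \<in> G" using a by (simp add: q_def)
  have qk: "q \<in> L k" unfolding q_def using L_power_in[OF a] by simp
  have tk: "t \<in> L (Suc k)" unfolding t_def using L_power_in[OF a] by blast
  have t2: "t ^ 2 \<in> L (Suc (Suc k))" using tk by (rule square_in) simp
  let ?P = "sgen ({t ^ 2} \<union> L (Suc (Suc (Suc k))))"
  have P: "nrm ?P" by (rule nrm_gen_layer) (use t2 in simp)
  have LP: "L (Suc (Suc (Suc k))) \<subseteq> ?P" by (auto intro: gen_incl)
  have tP: "t ^ 2 \<in> ?P" by (auto intro: gen_incl)
  \<comment> \<open>\<open>[q^2, d]\<close> equals \<open>cj q r * r\<close> for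
    \<open>r = [q, d]\<close>. Modulo the next term \<open>r\<close> is a power of
    \<open>t = q^2\<close>, which commutes with \<open>q\<close>, and for \<open>r = t\<close> the
    product is \<open>t^2\<close>.\<close>
  let ?H = "{r\<in>L (Suc k). cj q r * r \<in> ?P}"
  have "L (Suc k) \<subseteq> ?H"
  proof (rule spans_least[OF Suc[folded t_def]])
    show "subgrp ?H"
    proof (rule finite_subgrpI)
      show "finite ?H" using finite_L by simp
      show "?H \<noteq> {}" using L_closed(1) P by (auto intro!: exI[of _ 1] simp: cj_one nrm_one)
      fix r r' assume r: "r \<in> ?H" and r': "r' \<in> ?H"
      have rG: "r \<in> G" "r' \<in> G" using r r' L_in_G by auto
      have "com (cj q r') r \<in> L (Suc (Suc k + Suc k))"
        using r r' qG by (intro L_com_L) (auto simp: nrm_cj)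
      then have "com (cj q r') r \<in> ?P" using L_antimono[of "Suc (Suc (Suc k))" "Suc (Suc k + Suc k)"] LP by auto
      then have "eqm ?P (cj q r' * r) (r * cj q r')" by (rule eqm_com_mult)
      then have "eqm ?P (cj q r * ((cj q r' * r) * r')) (cj q r * ((r * cj q r') * r'))"
        by (intro eqm_mult[OF P eqm_refl[OF P]] eqm_mult[OF P _ eqm_refl[OF P]]) (use rG qG in auto)
      moreover have "(cj q r * r) * (cj q r' * r') \<in> ?P" using r r' P by (simp add: nrm_mult)
      ultimately have "cj q (r * r') * (r * r') \<in> ?P"
        using eqm_mem_iff[OF _ nrm_subgrp[OF P] subset_refl] by (simp add: cj_mult mult.assoc)
      then show "r * r' \<in> ?H" using r r' by (simp add: L_closed)
    qed
    have "cj q t = t" unfolding t by (simp add: cj_def g_simps)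
    then show "{t} \<subseteq> ?H" using tk tP by (simp add: power2_eq_square)
    show "L (Suc (Suc k)) \<subseteq> ?H"
    proof
      fix l assume l: "l \<in> L (Suc (Suc k))"
      have "com q l \<in> ?P" using L_com'[OF l qG] LP by auto
      moreover have "l ^ 2 \<in> ?P" using square_in[OF l HOL.refl] LP by auto
      ultimately have "com q l * l ^ 2 \<in> ?P" using P by (simp add: nrm_mult)
      then show "l \<in> ?H" using l L_Suc_subset[of "Suc k"] by (auto simp: cj_eq_com power2_eq_square mult.assoc)
    qed
  qed
  moreover have "com q d \<in> L (Suc k)" using qk d by (rule L_com)
  ultimately have "cj q (com q d) * com q d \<in> ?P" by blast
  then have "com t d \<in> ?P" by (simp add: t com_mult_left)
  moreover have "com t a = 1" by (simp add: t_def del: power_Suc)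
  ultimately have "spans {t ^ 2} (Suc (Suc k))"
    using t2 tP P by (intro spans_Suc[OF b Suc[folded t_def]]) (auto simp: nrm_one)
  moreover have "t ^ 2 = a ^ (2 ^ Suc (Suc k))" by (simp add: t_def flip: power_mult)
  ultimately show ?case by simp
qed

end

section \<open>Fourth powers and the index of \<open>L 2\<close> in \<open>L 1\<close> for
  two-groups\<close>

context ample_2_group
begin

lemma card_half: "L j \<noteq> {1} \<Longrightarrow> k = Suc j \<Longrightarrow> 2 * card (L k) \<le> card (L j)"
  by (rule L_cardI)

lemma nontrivial_le: "L k \<noteq> {1} \<Longrightarrow> j \<le> k \<Longrightarrow> L j \<noteq> {1}"
  using L_trivial_Suc by blast

lemma card_L_two:
  assumes "card (L k) \<le> 2" "k < j"
  shows "L j = {1}"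
proof (rule ccontr)
  assume "L j \<noteq> {1}"
  then have n: "L k \<noteq> {1}" "L (Suc k) \<noteq> {1}" using nontrivial_le assms(2) by (blast intro: less_imp_le, metis Suc_leI nontrivial_le assms(2))
  have "2 * card (L (Suc k)) \<le> card (L k)" "2 * card (L (Suc (Suc k))) \<le> card (L (Suc k))"
    using n card_half by blast+
  then show False using assms(1) card_L_pos[of "Suc (Suc k)"] by linarith
qed

text \<open>With index 2, an iterated square of one generator would span the last nontrivial layer,
  and \<open>not_ample\<close> applies to it because all deeper layers are trivial.\<close>

lemma first_layer_card:
  assumes b: "basis x y"
  shows "4 * card (L 2) \<le> card (L 1)"
proof (rule ccontr)
  assume "\<not> ?thesis"
  then have c: "card (L 1) < 4 * card (L 2)" by simp
  have x: "x \<in> G" and y: "y \<in> G" using b basis_in by auto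
  \<comment> \<open>If \<open>x^2\<close>, \<open>y^2\<close> and \<open>(x * y)^2\<close> were all
    in \<open>L 2\<close>, the square formula would put the commutator there too, and
    \<open>L 1\<close> would be trivial.\<close>
  have ex: "\<exists>a d. basis a d \<and> a ^ 2 \<notin> L 2"
  proof (rule ccontr)
    assume "\<not> ?thesis"
    then have sq: "a ^ 2 \<in> L 2" if "basis a d" for a d using that by blast
    have x2: "x ^ 2 \<in> L 2" and y2: "y ^ 2 \<in> L 2" and xy2: "(x * y) ^ 2 \<in> L 2"
      using sq[OF b] sq[OF basis_swap[OF b]] sq[OF basis_swap[OF basis_mult[OF b]]] by auto
    have "inverse (com x y) * x ^ 2 * y ^ 2 \<in> L 2"
      using xy2 eqm_mem_iff[OF square_mult_eqm[OF x y] subgrp_L subset_refl] by blast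
    then have "com x y \<in> L 2"
      using x2 y2 by (simp add: subgrp_mult_right_iff[OF subgrp_L] subgrp_inverse_iff[OF subgrp_L])
    then have "spans {} 1"
      using x2 y2 by (intro spans_one[OF b]) (auto simp: gen_subgrp_eq)
    then show False using spans_empty first_nontrivial by blast
  qed
  then obtain a d where ad: "basis a d" "a ^ 2 \<notin> L 2" by blast
  have a: "a \<in> G" using ad basis_in by blast
  obtain m where m: "L m = {1}" using L_eventually_trivial by blast
  have "L (Suc 0) \<noteq> {1}" using first_nontrivial by simp
  then have "\<exists>k. L (Suc k) \<noteq> {1} \<and> L (Suc (Suc k)) = {1}"
  proof -
    assume 1: "L (Suc 0) \<noteq> {1}"
    have "L (Suc m) = {1}" using m L_trivial_Suc[of m "Suc m"] by simp
    with 1 show ?thesis using dec_induct[of 0 m "\<lambda>k. L (Suc k) \<noteq> {1}"] by blast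
  qed
  then obtain k where k: "L (Suc k) \<noteq> {1}" "L (Suc (Suc k)) = {1}" by blast
  let ?c = "a ^ (2 ^ Suc k)"
  have "spans {?c} (Suc k)" by (rule square_spans[OF ad c])
  then have "?c \<noteq> 1" using spans_trivial[of "{?c}" "Suc k"] k(1) by auto
  moreover have "full ?c j" if "Suc (Suc k) \<le> j" for j
    using full_trivial[of ?c j] a L_trivial_Suc[OF k(2) that] by (simp del: power_Suc)
  ultimately show False using not_ample[OF a, of "Suc k"] basis_ample[OF ad(1)] by blast
qed

text \<open>If \<open>L 2\<close> is trivial, ampleness gives
  \<open>x^2 = y^2 = (x * y)^2 = 1\<close>, so \<open>x\<close> and \<open>y\<close>
  commute.\<close>

lemma second_nontrivial:
  assumes b: "basis x y"
  shows "L 2 \<noteq> {1}"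
proof
  assume L2: "L 2 = {1}"
  have x: "x \<in> G" and y: "y \<in> G" using b basis_in by auto
  have "a ^ 2 = 1" if "a \<in> G" "ample a" for a
    using not_ample[of a 1] that full_trivial[of "a ^ 2"] L_trivial_Suc[OF L2] by force
  then have sq: "x ^ 2 = 1" "y ^ 2 = 1" "(x * y) ^ 2 = 1" using basis_ample[OF b] x y by auto
  then have "com x y = 1"
    using square_mult_eqm[OF x y] by (simp add: L2 eqm_trivial g_inverse_eq_iff[of "com x y" 1, simplified])
  then have "spans {} 1"
    using sq by (intro spans_one[OF b]) (auto simp: subgrp_one[OF subgrp_gen])
  then show False using spans_empty first_nontrivial by blast
qed

lemma second_layer_card: "basis x y \<Longrightarrow> card (L 2) \<le> 8"
  using first_layer_card card_first by fastforce

lemma third_layer_cases: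
  assumes b: "basis x y"
  shows "card (L 3) \<le> 2 \<or> card (L 3) = 4 \<and> card (L 2) = 8"
proof -
  have 1: "2 * card (L 3) \<le> card (L 2)" using card_half[OF second_nontrivial[OF b], of 3] by simp
  obtain i where i: "card (L 3) = 2 ^ i" using card_power[OF subgrp_L nrm_subset[OF nrm_L]] by blast
  have le4: "card (L 3) \<le> 4" using 1 second_layer_card[OF b] by linarith
  show ?thesis
  proof (cases "i \<le> 1")
    case True
    then have "card (L 3) \<le> 2 ^ 1" unfolding i by (intro power_increasing) auto
    then show ?thesis by simp
  next
    case False
    then have "(2::nat) ^ 2 \<le> card (L 3)" unfolding i by (intro power_increasing) auto
    then show ?thesis using le4 1 second_layer_card[OF b] by auto
  qed
qed

text \<open>If \<open>c = a^4\<close> escaped \<open>L 3\<close>, it would span the second layer and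
  reach the third through \<open>c^2\<close> and \<open>[c, d]\<close>. Only \<open>L 4\<close>, of
  order at most 2, remains to be reached, by \<open>c\<close> or by
  \<open>c^2 = a^8\<close>.\<close>

lemma power4_third:
  assumes c2: "card (L 2) = 8" and c3: "card (L 3) = 4" and b: "basis a d"
  shows "a ^ 4 \<in> L 3"
proof (rule ccontr)
  assume A: "a ^ 4 \<notin> L 3"
  have a: "a \<in> G" and d: "d \<in> G" using b basis_in by auto
  have am: "ample a" using basis_ample[OF b] by blast
  define c where "c = a ^ 4"
  have c2': "c \<in> L 2" "c \<notin> L 3" using A power4_in[OF a] by (auto simp: c_def)
  have cG: "c \<in> G" using a by (simp add: c_def)
  have ca: "com c a = 1" by (simp add: c_def)
  have cn1: "c \<noteq> 1" using c2'(2) L_closed(1) by auto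
  have sp2: "spans {c} 2" using c2' c2 c3 by (intro single) (auto simp: nums)
  define e where "e = com c d"
  have e3: "e \<in> L 3" unfolding e_def by (rule L_comI[OF c2'(1) d]) simp
  have eG: "e \<in> G" using e3 L_in_G by blast
  have q3: "c ^ 2 \<in> L 3" using c2'(1) by (rule square_in) simp
  have "spans {c ^ 2, e} (Suc 2)"
    using q3 e3 ca subgrp_one[OF subgrp_gen]
    by (intro spans_Suc[OF b sp2]) (auto simp: nums e_def intro: gen_incl)
  then have sp3: "spans {c ^ 2, e} 3" by (simp only: nums)
  have full3: "full c 3"
    using full_spans[OF cG sp3] reach_power[OF cG, of 3] q3 reach_com'[OF cG d] e3 by (simp add: e_def)
  have c34: "2 * card (L 4) \<le> card (L 3)" using card_half[of 3 4] c3 by (cases "L 3 = {1}") auto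
  have L5: "L 5 = {1}" using card_L_two[of 4 5] c34 c3 by simp
  have final: False if "full c 4"
  proof -
    have "full c j" if j: "Suc 2 \<le> j" for j
    proof -
      consider "j = 3" | "j = 4" | "5 \<le> j" using j by linarith
      then show ?thesis
        using full3 \<open>full c 4\<close> full_trivial[OF cG] L_trivial_Suc[OF L5] by cases auto
    qed
    moreover have "a ^ (2 ^ 2) = c" by (simp add: c_def)
    ultimately show False using not_ample[OF a, of 2] am cn1 by metis
  qed
  have L4: "L 4 \<noteq> {1}" using final full_trivial[OF cG] by blast
  then have c4: "card (L 4) = 2"
    using c34 c3 card_half[OF L4, of 5] L5 by simp
  have single4: "spans {r} 4" if "r \<in> L 4" "r \<noteq> 1" for r
    using that c4 L5 by (intro single) (auto simp: nums)
  show False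
  \<comment> \<open>If \<open>c^2\<close> is outside \<open>L 4\<close>, it spans the third layer
    and reaches \<open>L 4\<close> itself, so \<open>not_ample\<close> applies with
    \<open>i = 3\<close>. Otherwise \<open>e = [c, d]\<close> spans the third layer and
    \<open>c\<close> is still the element to use.\<close>
  proof (cases "c ^ 2 \<in> L 4")
    case False
    let ?f = "c ^ 2"
    have fG: "?f \<in> G" using cG by simp
    have sp3: "spans {?f} 3" using q3 False c3 c4 by (intro single) (auto simp: nums)
    have m: "?f ^ 2 \<in> L 4" "com ?f d \<in> L 4"
      by (rule square_in[OF q3], simp, rule L_comI[OF q3 d], simp)
    have "com ?f a = 1" unfolding c_def power_mult[symmetric] by simp
    then have "spans {?f ^ 2, com ?f d} (Suc 3)"
      using m subgrp_one[OF subgrp_gen]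
      by (intro spans_Suc[OF b sp3]) (auto simp: nums intro: gen_incl)
    then have sp4: "spans {?f ^ 2, com ?f d} 4" by (simp only: nums)
    have "full ?f 4"
      using full_spans[OF fG sp4] reach_power[OF fG, of 4] m reach_com'[OF fG d] by simp
    then have "full ?f j" if "Suc 3 \<le> j" for j
      using that full_trivial[OF fG] L_trivial_Suc[OF L5, of j] by (cases "j = 4") auto
    moreover have "a ^ (2 ^ 3) = ?f" by (simp add: c_def)
    moreover have "?f \<noteq> 1" using False L_closed(1) by auto
    ultimately show False using not_ample[OF a, of 3] am by metis
  next
    case True
    have eL4: "e \<notin> L 4"
    proof
      assume "e \<in> L 4"
      then have "L 3 \<subseteq> L 4" using True by (intro spans_least[OF sp3]) (auto simp: nums)
      then show False using card_mono[OF finite_L, of "L 3" 4] c3 c4 by simp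
    qed
    have sp3e: "spans {e} 3" using e3 eL4 c3 c4 by (intro single) (auto simp: nums)
    have one: "com g h = 1" if "com g h \<in> L k" "5 \<le> k" for g h k
      using that L_trivial_Suc[OF L5, of k] by auto
    have ce: "com c e = 1" using L_com_L[OF c2'(1) e3] one[of c e 6] by simp
    have cc: "cj c e = e" using ce by (simp add: cj_eq_com)
    have "com (c ^ 2) d = 1" using L_comI[OF True d, of 5] one by simp
    then have e2: "e ^ 2 = 1" using cc com_square'[of c d] by (simp add: e_def power2_eq_square)
    have m: "com e a \<in> L 4" "com e d \<in> L 4"
      by (rule L_comI[OF e3 a], simp, rule L_comI[OF e3 d], simp)
    have "spans {com e a, com e d} (Suc 3)"
      using m e2 subgrp_one[OF subgrp_gen]
      by (intro spans_Suc[OF b sp3e]) (auto simp: nums intro: gen_incl)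
    then have "spans {com e a, com e d} 4" by (simp only: nums)
    from spans_trivial[OF this] L4 have "com e a \<noteq> 1 \<or> com e d \<noteq> 1" by auto
    \<comment> \<open>A nontrivial commutator of \<open>e\<close> must be rewritten as a commutator
      with \<open>c\<close>: conjugating by \<open>d^2\<close> serves for \<open>[e, d]\<close>,
      conjugating by \<open>[a, d]\<close> for \<open>[e, a]\<close>.\<close>
    then obtain r where r: "r \<in> L 4" "r \<noteq> 1" "r \<in> reach c 4"
    proof
      assume n: "com e d \<noteq> 1"
      have "com c (d ^ 2) = cj (com c d) (com d (com c d)) * com c d ^ 2" by (rule com_square_right)
      also have "\<dots> = cj e (com d e)" using e2 by (simp add: e_def)
      finally have eq: "com c (d ^ 2) = cj e (com d e)" .
      have "com d e \<in> L 4" by (rule L_comI'[OF e3 d]) simp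
      then have "com c (d ^ 2) \<in> L 4" unfolding eq using eG by (simp add: nrm_cj)
      moreover have "com c (d ^ 2) \<noteq> 1"
        unfolding eq using n com_inverse[of e d] by (metis cj_by_one cj_cj cj_one g_inverse_one g_left_inverse g_inverse_inverse)
      ultimately show ?thesis using that reach_com'[OF cG, of "d ^ 2" 4] d by simp
    next
      assume n: "com e a \<noteq> 1"
      define s where "s = com a d"
      have s1: "s \<in> L 1" unfolding s_def by (rule com_in_first[OF a d])
      have sG: "s \<in> G" using s1 L_in_G by blast
      have "com s e = 1" using L_com_L[OF s1 e3] one[of s e 5] by simp
      then have se: "cj s e = e" by (simp add: cj_eq_com)
      have "a * c = c * a" using ca by (simp add: com_eq_one_iff)
      then have cac: "cj a c = c" by (simp add: cj_def mult.assoc)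
      \<comment> \<open>Conjugation by \<open>a\<close> fixes \<open>c\<close>, a power of
        \<open>a\<close>, and sends \<open>d\<close> to \<open>s * d\<close>; expanding gives
        \<open>[a, e] = [c, s]\<close>.\<close>
      have "cj a e = com c (s * d)"
        unfolding e_def cj_com cac by (simp add: s_def cj_eq_com)
      also have "\<dots> = com c s * e" by (simp add: com_mult_right se flip: e_def)
      finally have "com a e = com c s" by (simp add: cj_eq_com)
      moreover have "com a e \<in> L 4" by (rule L_comI'[OF e3 a]) simp
      moreover have "com a e \<noteq> 1" using n com_inverse[of a e] by auto
      ultimately show ?thesis using that reach_com'[OF cG sG, of 4] by simp
    qed
    then show False using final full_spans[OF cG single4] by simp
  qed
qed

text \<open>In all cases that remain, the fourth powers lie too deep to generate \<open>L\<^sub>2\<close>.\<close>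

lemma power4_not_spanning:
  assumes b: "basis x y" and sp: "spans {x ^ 4, y ^ 4, (x * y) ^ 4} 2"
  shows False
proof -
  have x: "x \<in> G" and y: "y \<in> G" using b basis_in by auto
  have xy: "x * y \<in> G" using x y by simp
  note n = basis_notin[OF b]
  have one: "1 \<in> sgen S" for S using subgrp_one[OF subgrp_gen] .
  show False
    using third_layer_cases[OF b]
  proof
    assume c3: "card (L 3) \<le> 2"
    note c = power4_central[OF c3 x n(1)] power4_central[OF c3 y n(2)] power4_central[OF c3 xy n(3)]
    have "spans {} (Suc 2)" using c x y one by (intro spans_Suc[OF b sp]) auto
    from spans_empty[OF this] have L3: "L 3 = {1}" by (simp only: nums)
    then have "x ^ 4 = 1" "y ^ 4 = 1" "(x * y) ^ 4 = 1"
      using power4_trivial x y xy n by blast+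
    then show False using spans_trivial[OF sp] second_nontrivial[OF b] by auto
  next
    assume c: "card (L 3) = 4 \<and> card (L 2) = 8"
    then have "x ^ 4 \<in> L 3" "y ^ 4 \<in> L 3" "(x * y) ^ 4 \<in> L 3"
      using power4_third b basis_swap[OF b] basis_swap[OF basis_mult[OF b]] by blast+
    then have "L 2 \<subseteq> L 3" by (intro spans_least[OF sp]) (auto simp: nums)
    then show False using card_mono[OF finite_L, of "L 2" 3] c by simp
  qed
qed

section \<open>Two-groups: the squares and the commutator are independent modulo
  \<open>L 2\<close>\<close>

lemma com_square_mem:
  assumes U: "nrm U" "L 3 \<subseteq> U" and x: "x \<in> G" and y: "y \<in> G"
    and c: "com (x ^ 2) y \<in> L 3" and s: "com x y ^ 2 \<in> U"
  shows "com (com x y) x \<in> U"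
proof -
  have "com x (com x y) * com x y ^ 2 \<in> U" using c U by (auto simp: com_square)
  then have "com x (com x y) \<in> U" using s U by (simp add: subgrp_mult_right_iff nrm_subgrp)
  then show ?thesis using nrm_com_swap[OF U(1)] by blast
qed

lemma com_swap_square: "com x y ^ 2 \<in> U \<Longrightarrow> nrm U \<Longrightarrow> com y x ^ 2 \<in> U"
  unfolding com_inverse[of x y, symmetric] g_inverse_power[symmetric] by (rule nrm_inverse)

text \<open>\<open>power4_mult_eqm\<close> solved for the square of the commutator.\<close>

lemma com_square_of_power4:
  assumes U: "nrm U" "L 3 \<subseteq> U" and x: "x \<in> G" and y: "y \<in> G"
    and m: "x ^ 4 * y ^ 4 \<in> U" "(x * y) ^ 4 \<in> U"
  shows "com x y ^ 2 \<in> U"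
proof -
  have "inverse (com x y) ^ 2 * (x ^ 4 * y ^ 4) \<in> U"
    using m(2) eqm_mem_iff[OF power4_mult_eqm[OF x y] nrm_subgrp[OF U(1)] U(2)] by blast
  then have "inverse (com x y) ^ 2 \<in> U" using m(1) subgrp_mult_right_iff[OF nrm_subgrp[OF U(1)]] by blast
  then show ?thesis by (simp add: g_inverse_power[symmetric] subgrp_inverse_iff nrm_subgrp[OF U(1)])
qed

text \<open>If the commutator lay in \<open>L 2\<close>, the squares would span the first layer and
  their mixed commutators would fall into \<open>L 3\<close>; the second layer would be spanned by
  fourth powers.\<close>

lemma commutator_not_second:
  assumes b: "basis x y"
  shows "com x y \<notin> L 2"
proof
  assume s: "com x y \<in> L 2"
  have x: "x \<in> G" and y: "y \<in> G" using b basis_in by auto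
  have sq1: "x ^ 2 \<in> L 1" "y ^ 2 \<in> L 1" using square_in_first x y by auto
  have "com x y \<in> sgen ({x ^ 2, y ^ 2} \<union> L 2)" using s by (auto intro: gen_incl)
  then have sp1: "spans {x ^ 2, y ^ 2} 1"
    using sq1 by (intro spans_one[OF b]) (auto intro: gen_incl)
  have c: "com (a ^ 2) d \<in> L 3" if "com a d \<in> L 2" "a \<in> G" for a d
  proof -
    have "com a (com a d) \<in> L 3" by (rule L_comI'[OF that]) simp
    moreover have "com a d ^ 2 \<in> L 3" using that(1) by (rule square_in) simp
    ultimately show ?thesis unfolding com_square by (rule L_closed)
  qed
  have "com y x \<in> L 2" using s nrm_com_swap[OF nrm_L] by blast
  with s c x y have "com (x ^ 2) y \<in> L 3" "com (y ^ 2) x \<in> L 3" by auto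
  then have "spans {x ^ 4, y ^ 4, (x * y) ^ 4} (Suc 1)"
    using power4_in x y subgrp_one[OF subgrp_gen]
    by (intro spans_Suc[OF b sp1]) (auto simp: nums numeral_2_eq_2[symmetric] intro: gen_incl)
  from power4_not_spanning[OF b this[unfolded nums]] show False .
qed

text \<open>If \<open>x^2\<close> and \<open>y^2\<close> agree modulo \<open>L 2\<close>, then
  \<open>[x^2, y]\<close> is trivial modulo \<open>L 3\<close>, since \<open>[y^2, y] = 1\<close>.
  By \<open>com_square\<close> the commutators of \<open>s\<close> then fall into the span of the
  fourth powers.\<close>

lemma squares_differ:
  assumes b: "basis x y"
  shows "\<not> eqm (L 2) (x ^ 2) (y ^ 2)"
proof
  assume e: "eqm (L 2) (x ^ 2) (y ^ 2)"
  have x: "x \<in> G" and y: "y \<in> G" using b basis_in by auto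
  define s where "s = com x y"
  have s1: "s \<in> L 1" unfolding s_def by (rule com_in_first[OF x y])
  have sG: "s \<in> G" using s1 L_in_G by blast
  have "y ^ 2 \<in> sgen ({y ^ 2, s} \<union> L 2)" by (auto intro: gen_incl)
  then have "x ^ 2 \<in> sgen ({y ^ 2, s} \<union> L 2)"
    using eqm_mem_iff[OF e subgrp_gen, of "{y ^ 2, s} \<union> L 2"] by (auto intro: gen_incl)
  then have sp1: "spans {y ^ 2, s} 1"
    using s1 square_in_first[OF y] by (intro spans_one[OF b]) (auto simp: s_def intro: gen_incl)
  let ?S = "{x ^ 4, y ^ 4, (x * y) ^ 4}"
  let ?U = "sgen (?S \<union> L (Suc 2))"
  have S2: "?S \<subseteq> L 2" using power4_in x y by simp
  have U: "nrm ?U" using S2 by (rule nrm_gen_layer)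
  have LU: "L 3 \<subseteq> ?U" by (auto simp: nums intro: gen_incl)
  have mem: "x ^ 4 \<in> ?U" "y ^ 4 \<in> ?U" "(x * y) ^ 4 \<in> ?U" by (auto intro: gen_incl)
  have s2: "s ^ 2 \<in> ?U"
    unfolding s_def by (rule com_square_of_power4[OF U LU x y nrm_mult[OF U mem(1,2)] mem(3)])
  have "eqm (L (Suc 2)) (com (x ^ 2) y) (com (y ^ 2) y)" using e x y by (intro com_eqm_Suc) auto
  then have cx: "com (x ^ 2) y \<in> L 3" by (simp add: eqm_one_iff nums)
  have "eqm (L (Suc 2)) (com (x ^ 2) x) (com (y ^ 2) x)" using e x y by (intro com_eqm_Suc) auto
  from eqm_sym[OF nrm_L this] have cy: "com (y ^ 2) x \<in> L 3" by (simp add: eqm_one_iff nums)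
  have "com s x \<in> ?U"
    using com_square_mem[OF U LU x y cx] s2 by (simp only: s_def)
  moreover have "com (com y x) y \<in> ?U"
    using com_square_mem[OF U LU y x cy] com_swap_square[OF _ U] s2 by (simp only: s_def)
  then have "com s y \<in> ?U"
    using com_inverse_left_mem[OF U sG, of y] by (simp only: s_def com_inverse)
  moreover have "com (y ^ 2) x \<in> ?U" using cy LU by blast
  ultimately have "spans ?S (Suc 1)"
    using s2 mem subgrp_one[OF nrm_subgrp[OF U]] S2
    by (intro spans_Suc[OF b sp1]) (auto simp only: nums insert_iff empty_iff power_mult[symmetric] com_power_self mult_2[symmetric] numeral_times_numeral semiring_norm)
  from power4_not_spanning[OF b this[unfolded nums]] show False .
qed

text \<open>Here \<open>y\<close> itself is full from depth 1: its even powers and its commutators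
  with \<open>x\<close>, \<open>s\<close>, \<open>w\<close>, \<open>z\<close> span all
  layers.\<close>

lemma full_line:
  assumes b: "basis x y" and x2: "x ^ 2 \<in> L 2" and s: "s = com x y" and w: "w = com s y" and z: "z = com w y"
    and sp2: "spans {y ^ 4, w} 2" and sp3: "spans {z} 3" and sp4: "spans {com z y} 4" and L5: "L 5 = {1}"
  shows False
proof -
  have x: "x \<in> G" and y: "y \<in> G" using b basis_in by auto
  have s1: "s \<in> L 1" unfolding s by (rule com_in_first[OF x y])
  have G: "s \<in> G" "w \<in> G" "z \<in> G" using x y by (auto simp: s w z)
  have sp1: "spans {y ^ 2, s} 1"
    using s1 square_in_first[OF y] x2 by (intro spans_one[OF b]) (auto simp: s intro: gen_incl)
  have "full y j" if j: "Suc 0 \<le> j" for j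
  proof -
    consider "j = 1" | "j = 2" | "j = 3" | "j = 4" | "5 \<le> j" using j by linarith
    then show ?thesis
    proof cases
      case 1
      have "y ^ 2 \<in> reach y 1" by (rule reach_power[OF y square_in_first[OF y]])
      moreover have "s \<in> reach y 1" using reach_com[OF y x] s1 by (simp add: s)
      ultimately show ?thesis using 1 full_spans[OF y sp1] by simp
    next
      case 2
      \<comment> \<open>The exponent \<open>5 = 1 + 2 * 2\<close> gives the shift by
        \<open>y^4\<close>.\<close>
      have "y ^ 4 \<in> reach y 2" using reach_power_mult[OF y, of 2 2] power4_in[OF y] by simp
      moreover have "w \<in> reach y 2" using reach_com[OF y G(1)] spans_in[OF sp2] by (simp add: w)
      ultimately show ?thesis using 2 full_spans[OF y sp2] by simp
    next
      case 3
      then show ?thesis using full_spans[OF y sp3] reach_com[OF y G(2)] spans_in[OF sp3] by (simp add: z)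
    next
      case 4
      then show ?thesis using full_spans[OF y sp4] reach_com[OF y G(3)] spans_in[OF sp4] by simp
    next
      case 5
      then show ?thesis using full_trivial[OF y] L_trivial_Suc[OF L5] by simp
    qed
  qed
  moreover have "y \<noteq> 1" using basis_notin[OF b] L_closed(1) by auto
  ultimately show False using not_ample[OF y, of 0] basis_ample[OF b] by simp
qed

text \<open>As \<open>x^2\<close> is in \<open>L 2\<close>, its commutator with \<open>y\<close> is
  in \<open>L 3\<close>; \<open>com_square\<close> then ties \<open>[s, x]\<close> to
  \<open>s^2\<close>, and \<open>com_square_right\<close> expresses \<open>[x, y^2]\<close> by
  \<open>[y, s]\<close> and \<open>s^2\<close>.\<close>

lemma second_layer_spans:
  assumes b: "basis x y" and x2: "x ^ 2 \<in> L 2" and s: "s = com x y"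
    and s2: "s ^ 2 \<in> sgen ({y ^ 4} \<union> L 3)"
  shows "spans {y ^ 4, com s y} 2" "com (x ^ 2) y \<in> L 3" "com s x \<in> sgen ({y ^ 4} \<union> L 3)"
proof -
  have x: "x \<in> G" and y: "y \<in> G" using b basis_in by auto
  have s1: "s \<in> L 1" unfolding s by (rule com_in_first[OF x y])
  have sG: "s \<in> G" using s1 L_in_G by blast
  have sp1: "spans {y ^ 2, s} 1"
    using s1 square_in_first[OF y] x2 by (intro spans_one[OF b]) (auto simp: s intro: gen_incl)
  show c: "com (x ^ 2) y \<in> L 3" by (rule L_comI[OF x2 y]) simp
  have w2: "com s y \<in> L 2" by (rule L_comI[OF s1 y]) simp
  let ?V = "sgen ({y ^ 4} \<union> L (Suc 2))"
  let ?U = "sgen ({y ^ 4, com s y} \<union> L (Suc 2))"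
  have V: "nrm ?V" by (rule nrm_gen_layer) (use power4_in[OF y] in simp)
  have U: "nrm ?U" by (rule nrm_gen_layer) (use power4_in[OF y] w2 in simp)
  have LV: "L 3 \<subseteq> ?V" by (auto simp: nums intro: gen_incl)
  have VU: "?V \<subseteq> ?U" by (rule gen_mono) auto
  have s2V: "s ^ 2 \<in> ?V" using s2 by (simp only: nums)
  have sxV: "com s x \<in> ?V" using com_square_mem[OF V LV x y c] s2V by (simp only: s)
  then show "com s x \<in> sgen ({y ^ 4} \<union> L 3)" by (simp only: nums)
  have wU: "com s y \<in> ?U" by (auto intro: gen_incl)
  have "com x (y ^ 2) = cj s (com y s) * s ^ 2" unfolding s by (rule com_square_right)
  moreover have "com y s \<in> ?U" using wU nrm_com_swap[OF U] by blast
  ultimately have "com x (y ^ 2) \<in> ?U" using s2V VU sG U by (auto simp: nrm_mult nrm_cj)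
  then have cy: "com (y ^ 2) x \<in> ?U" using nrm_com_swap[OF U] by blast
  have "(y ^ 2) ^ 2 \<in> ?U" by (auto intro: gen_incl)
  then have "spans {y ^ 4, com s y} (Suc 1)"
    using cy wU sxV s2V VU U power4_in[OF y] w2
    by (intro spans_Suc[OF b sp1]) (auto simp: nrm_one nums numeral_2_eq_2[symmetric] numeral_3_eq_3[symmetric])
  then show "spans {y ^ 4, com s y} 2" by (simp only: nums)
qed

text \<open>Everything generated by \<open>y^4\<close> and \<open>L 3\<close> is central, including
  \<open>s^2\<close> and \<open>[s, x]\<close>. Hence \<open>w^2 = 1\<close> and, by
  \<open>com_com_swap\<close>, \<open>[w, x] = 1\<close>; so \<open>[w, y]\<close> spans
  \<open>L 3\<close> and \<open>full_line\<close> applies with a trivial last layer.\<close>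

lemma square_case_small_aux:
  assumes b: "basis x y" and x2: "x ^ 2 \<in> L 2" and c3: "card (L 3) \<le> 2"
    and s2: "com x y ^ 2 \<in> sgen ({y ^ 4} \<union> L 3)"
  shows False
proof -
  have x: "x \<in> G" and y: "y \<in> G" using b basis_in by auto
  define s where "s = com x y"
  define w where "w = com s y"
  have s1: "s \<in> L 1" unfolding s_def by (rule com_in_first[OF x y])
  have sG: "s \<in> G" using s1 L_in_G by blast
  have w2: "w \<in> L 2" unfolding w_def by (rule L_comI[OF s1 y]) simp
  note sls = second_layer_spans[OF b x2 s_def s2[folded s_def]]
  have L4: "L 4 = {1}" by (rule card_L_two[OF c3]) simp
  then have L5: "L 5 = {1}" using L_trivial_Suc[of 4 5] by simp
  note pc = power4_central[OF c3 y basis_notin(2)[OF b]]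
  have cent: "com f g = 1" if f: "f \<in> sgen ({y ^ 4} \<union> L 3)" and g: "g \<in> G" for f g
  proof -
    have "subgrp {f\<in>G. com f g \<in> {1}}"
      by (rule subgrp_com_one_vimage[OF nrm_trivial subG]) (use g in auto)
    moreover have "com l g = 1" if "l \<in> L 3" for l
      using L_comI[OF that g, of 4] L4 by simp
    then have "{y ^ 4} \<union> L 3 \<subseteq> {f\<in>G. com f g \<in> {1}}" using pc g y L_in_G by auto
    ultimately show ?thesis using gen_least f by blast
  qed
  have "com s w = 1" using L_com_LI[OF s1 w2, of 4] L4 by simp
  then have "cj s w = w" by (simp add: cj_eq_com)
  moreover have "com (s ^ 2) y = 1" using cent s2 y by (simp add: s_def)
  ultimately have w2': "w ^ 2 = 1" using com_square'[of s y] by (simp add: w_def power2_eq_square)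
  have "com (com s x) y = 1" using cent sls(3) y by blast
  then have wx: "com w x = 1" using com_com_swap[OF x y s_def] by (simp add: L4 eqm_trivial w_def)
  have z3: "com w y \<in> L 3" by (rule L_comI[OF w2 y]) simp
  have one: "1 \<in> sgen S" for S using subgrp_one[OF subgrp_gen] .
  have "spans {com w y} (Suc 2)"
    using pc w2' wx x y z3 one
    by (intro spans_Suc[OF b sls(1)]) (auto simp: nums w_def[symmetric] intro: gen_incl)
  then have sp3: "spans {com w y} 3" by (simp only: nums)
  have "com (com w y) y \<in> L 4" by (rule L_comI[OF z3 y]) simp
  then have sp4: "spans {com (com w y) y} 4" using L4 by (intro spans_of_trivial) auto
  show False by (rule full_line[OF b x2 s_def w_def HOL.refl sls(1)[folded w_def] sp3 sp4 L5])
qed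

lemma square_case_small:
  assumes b: "basis x y" and x2: "x ^ 2 \<in> L 2" and c3: "card (L 3) \<le> 2"
  shows False
proof -
  have x: "x \<in> G" and y: "y \<in> G" using b basis_in by auto
  have xyG: "x * y \<in> G" using x y by simp
  define s where "s = com x y"
  have s1: "s \<in> L 1" unfolding s_def by (rule com_in_first[OF x y])
  have s22: "s ^ 2 \<in> L 2" using s1 by (rule square_in) simp
  have "(x ^ 2) ^ 2 \<in> L 3" using x2 by (rule square_in) simp
  then have x4: "x ^ 4 \<in> L 3" by simp
  have nV: "nrm (sgen ({f} \<union> L 3))" if "f \<in> L 2" for f
    using nrm_gen_layer[of "{f}" 2] that by (simp only: nums) simp
  show False
  proof (cases "s ^ 2 \<in> sgen ({y ^ 4} \<union> L 3)")
    case True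
    from square_case_small_aux[OF b x2 c3 this[unfolded s_def]] show False .
  next
    case sn: False
    show False
    proof (cases "y ^ 4 \<in> L 3")
      case True
      \<comment> \<open>With \<open>x^4\<close> and \<open>y^4\<close> both in \<open>L 3\<close>,
        the square of the commutator agrees with \<open>(x * y)^4\<close> up to sign and
        \<open>L 3\<close>. Replacing \<open>y\<close> by \<open>x * y\<close> restores the
        hypothesis of the auxiliary lemma.\<close>
      let ?V = "sgen ({(x * y) ^ 4} \<union> L 3)"
      have V: "nrm ?V" using nV power4_in[OF xyG] by blast
      have LV: "L 3 \<subseteq> ?V" by (auto intro: gen_incl)
      have "x ^ 4 * y ^ 4 \<in> ?V" using LV x4 True L_closed(2) by blast
      moreover have "(x * y) ^ 4 \<in> ?V" by (auto intro: gen_incl)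
      ultimately have "s ^ 2 \<in> ?V" unfolding s_def by (rule com_square_of_power4[OF V LV x y])
      moreover have "com x (x * y) = cj x s" by (simp add: com_mult_right s_def)
      ultimately have "com x (x * y) ^ 2 \<in> ?V" using V x by (simp add: nrm_cj flip: cj_power)
      then show False using square_case_small_aux[OF basis_mult[OF b] x2 c3] by blast
    next
      case yn: False
      \<comment> \<open>\<open>L 3\<close> is nontrivial since \<open>y^4\<close> is, so
        \<open>?V\<close> has at least 4 elements and index at most 2 in \<open>L 2\<close>. Hence
        \<open>s^2\<close> and \<open>?V\<close> generate \<open>L 2\<close>, and fourth powers span
        it.\<close>
      let ?V = "sgen ({y ^ 4} \<union> L 3)"
      have V2: "?V \<subseteq> L 2" using power4_in[OF y] L_antimono[of 2 3] by (intro gen_least) auto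
      have L3V: "L 3 \<subset> ?V" using yn gen_incl[of _ "{y ^ 4} \<union> L 3"] by auto
      have c3V: "2 * card (L 3) \<le> card ?V"
        using L3V V2 L_in_G by (intro proper_card subgrp_gen) auto
      have L3: "L 3 \<noteq> {1}"
        using yn power4_trivial[OF _ y basis_notin(2)[OF b]] by auto
      then have "2 * card (L 4) \<le> card (L 3)" by (intro card_half) auto
      then have "2 \<le> card (L 3)" using card_L_pos[of 4] by linarith
      then have "card (L 2) < 2 * (2 * card ?V)" using c3V second_layer_card[OF b] by linarith
      then have "L 2 = sgen (insert (s ^ 2) ?V)"
        using V2 sn s22 L_in_G by (intro proper_gen subgrp_gen) auto
      also have "\<dots> \<subseteq> sgen ({x ^ 4, y ^ 4, (x * y) ^ 4} \<union> L (Suc 2))" (is "_ \<subseteq> ?U")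
      proof (rule gen_subset_gen)
        have U: "nrm ?U" by (rule nrm_gen_layer) (use power4_in x y in simp)
        have LU: "L 3 \<subseteq> ?U" by (auto simp: nums intro: gen_incl)
        have mem: "x ^ 4 \<in> ?U" "y ^ 4 \<in> ?U" "(x * y) ^ 4 \<in> ?U" by (auto intro: gen_incl)
        have "s ^ 2 \<in> ?U"
          unfolding s_def by (rule com_square_of_power4[OF U LU x y nrm_mult[OF U mem(1,2)] mem(3)])
        moreover have "?V \<subseteq> ?U" using mem LU by (intro gen_subset_gen) auto
        ultimately show "insert (s ^ 2) ?V \<subseteq> ?U" by simp
      qed
      finally show False using power4_not_spanning[OF b] power4_in x y by (simp add: spans_def)
    qed
  qed
qed

text \<open>Fourth powers, hence \<open>s^2\<close>, lie in \<open>L 3\<close>, so \<open>w\<close>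
  and \<open>z\<close> span the second and third layers. By \<open>full_line\<close>,
  \<open>[z, y]\<close> cannot span \<open>L 4\<close> and is therefore trivial; as
  \<open>L 4\<close> is not trivial, \<open>[z, x]\<close> has to survive.\<close>

lemma square_case_large_aux:
  assumes b: "basis x y" and x2: "x ^ 2 \<in> L 2" and c3: "card (L 3) = 4" and c2: "card (L 2) = 8"
    and s: "s = com x y" and w: "w = com s y" and z: "z = com w y"
  shows "com s x \<in> L 3" "com w x \<in> L 4" "L 5 = {1}" "com z y = 1" "com z x \<noteq> 1"
proof -
  have x: "x \<in> G" and y: "y \<in> G" using b basis_in by auto
  have s1: "s \<in> L 1" unfolding s by (rule com_in_first[OF x y])
  have sG: "s \<in> G" using s1 L_in_G by blast
  have w2: "w \<in> L 2" unfolding w by (rule L_comI[OF s1 y]) simp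
  have wG: "w \<in> G" using w2 L_in_G by blast
  have z3: "z \<in> L 3" unfolding z by (rule L_comI[OF w2 y]) simp
  have p4: "x ^ 4 \<in> L 3" "y ^ 4 \<in> L 3" "(x * y) ^ 4 \<in> L 3"
    using power4_third[OF c2 c3] b basis_swap[OF b] basis_swap[OF basis_mult[OF b]] by blast+
  have s2: "s ^ 2 \<in> L 3"
    unfolding s by (rule com_square_of_power4[OF nrm_L subset_refl x y L_closed(2)[OF p4(1,2)] p4(3)])
  have V: "sgen ({y ^ 4} \<union> L 3) = L 3" using p4(2) by (simp add: insert_absorb gen_subgrp_eq)
  note sls = second_layer_spans[OF b x2 s, unfolded V, OF s2]
  show e3: "com s x \<in> L 3" by (rule sls(3))
  have "L 2 \<subseteq> sgen ({w} \<union> L (Suc 2))"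
    using p4(2) by (intro spans_least[OF sls(1)[folded w]] subgrp_gen) (auto simp: nums intro: gen_incl)
  then have sp2: "spans {w} 2" using w2 by (simp add: spans_def)
  have four: "card (L 4) \<le> 2" using card_half[of 3 4] c3 by (cases "L 3 = {1}") auto
  show L5: "L 5 = {1}" by (rule card_L_two[OF four]) simp
  have one: "com g h = 1" if "com g h \<in> L k" "5 \<le> k" for g h k
    using that L_trivial_Suc[OF L5, of k] by auto
  have "com (s ^ 2) y \<in> L 4" by (rule L_comI[OF s2 y]) simp
  then have "cj s w * w \<in> L 4" using com_square'[of s y] by (simp add: w)
  moreover have sw: "com s w \<in> L 4" by (rule L_com_LI[OF s1 w2]) simp
  ultimately have w22: "w ^ 2 \<in> L 4"
    by (simp add: cj_eq_com power2_eq_square mult.assoc subgrp_mult_left_iff)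
  have "com (com s x) y \<in> L 4" by (rule L_comI[OF e3 y]) simp
  then show wx: "com w x \<in> L 4"
    using eqm_mem_iff[OF com_com_swap[OF x y s] subgrp_L subset_refl] by (simp add: w)
  have "spans {z} (Suc 2)"
    using w22 wx z3 by (intro spans_Suc[OF b sp2]) (auto simp: nums z intro: gen_incl)
  then have sp3: "spans {z} 3" by (simp only: nums)
  have zy4: "com z y \<in> L 4" "com z x \<in> L 4"
    by (rule L_comI[OF z3 y], simp, rule L_comI[OF z3 x], simp)
  have contra: False if "spans {com z y} 4"
    by (rule full_line[OF b x2 s w z sls(1)[folded w] sp3 that L5])
  have L4: "L 4 \<noteq> {1}" using contra spans_of_trivial[of 4 "{com z y}"] zy4 by auto
  show zy: "com z y = 1"
  proof (rule ccontr)
    assume n: "com z y \<noteq> 1"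
    have "spans {com z y} 4"
      using n zy4 four L5 by (intro single) (auto simp: nums)
    then show False by (rule contra)
  qed
  have "com w z \<in> L 6" by (rule L_com_LI[OF w2 z3]) simp
  then have "cj w z = z" using one[of w z 6] by (simp add: cj_eq_com)
  moreover have "com (w ^ 2) y = 1" using L_comI[OF w22 y, of 5] one by simp
  ultimately have z2: "z ^ 2 = 1" using com_square'[of w y] by (simp add: z power2_eq_square)
  show "com z x \<noteq> 1"
  proof
    assume "com z x = 1"
    then have "spans {} (Suc 3)"
      using z2 zy subgrp_one[OF subgrp_gen] by (intro spans_Suc[OF b sp3]) auto
    from spans_empty[OF this] L4 show False by (simp only: nums)
  qed
qed

text \<open>The auxiliary lemma holds for \<open>(x, y)\<close> and for \<open>(x, x * y)\<close>.
  The second instance kills the commutator of \<open>z'\<close> with \<open>x * y\<close>, but this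
  equals \<open>[z, x]\<close>, nontrivial by the first instance.\<close>

lemma square_not_second:
  assumes b: "basis x y"
  shows "x ^ 2 \<notin> L 2"
proof
  assume x2: "x ^ 2 \<in> L 2"
  have x: "x \<in> G" and y: "y \<in> G" using b basis_in by auto
  have xy: "x * y \<in> G" using x y by simp
  obtain c3: "card (L 3) = 4" and c2: "card (L 2) = 8"
    using third_layer_cases[OF b] square_case_small[OF b x2] by blast
  define s where "s = com x y"
  define w where "w = com s y"
  define z where "z = com w y"
  note A = square_case_large_aux[OF b x2 c3 c2 s_def w_def z_def]
  define s' where "s' = com x (x * y)"
  define w' where "w' = com s' (x * y)"
  define z' where "z' = com w' (x * y)"
  note B = square_case_large_aux[OF basis_mult[OF b] x2 c3 c2 s'_def w'_def z'_def]
  have G: "s \<in> G" "w \<in> G" "z \<in> G" "s' \<in> G" "w' \<in> G" "z' \<in> G"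
    using x y by (auto simp: s_def w_def z_def s'_def w'_def z'_def)
  have s1: "s \<in> L 1" unfolding s_def by (rule com_in_first[OF x y])
  have w2: "w \<in> L 2" unfolding w_def by (rule L_comI[OF s1 y]) simp
  have z3: "z \<in> L 3" unfolding z_def by (rule L_comI[OF w2 y]) simp
  have K: "nrm (L k)" for k by simp
  \<comment> \<open>Replacing \<open>y\<close> by \<open>x * y\<close> alters \<open>s\<close>,
    \<open>w\<close>, \<open>z\<close> only by elements of the next term, because the commutators
    with \<open>x\<close> lie deeper.\<close>
  have step: "eqm (L k) (com f (x * y)) g"
    if f: "f \<in> L j" "com f x \<in> L k" "g = com f y" "g \<in> L i" "k = Suc i" for f g i j k
  proof -
    have fG: "f \<in> G" "g \<in> G" using f L_in_G by auto
    have "eqm (L k) (cj x g) g" by (rule L_cjI[OF f(4) x f(5)])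
    moreover have "eqm (L k) (com f x) 1" using f by (simp add: eqm_one_iff)
    ultimately have "eqm (L k) (com f x * cj x g) (1 * g)" using fG x by (intro eqm_mult) auto
    then show ?thesis using f by (simp add: com_mult_right)
  qed
  have "s' = cj x s" by (simp add: s'_def s_def com_mult_right)
  then have 1: "eqm (L 2) s' s" using L_cjI[OF s1 x, of 2] by simp
  have "eqm (L 3) w' (com s (x * y))"
    unfolding w'_def using com_eqm_Suc[OF 1] G xy by (simp only: nums)
  moreover have "eqm (L 3) (com s (x * y)) w"
    by (rule step[OF s1 A(1) w_def w2]) simp
  ultimately have 2: "eqm (L 3) w' w" by (rule eqm_trans[OF K])
  have "eqm (L 4) z' (com w (x * y))"
    unfolding z'_def using com_eqm_Suc[OF 2] G xy by (simp only: nums)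
  moreover have "eqm (L 4) (com w (x * y)) z"
    by (rule step[OF w2 A(2) z_def z3]) simp
  ultimately have 3: "eqm (L 4) z' z" by (rule eqm_trans[OF K])
  have "eqm (L 5) (com z' (x * y)) (com z (x * y))"
    using com_eqm_Suc[OF 3] G xy by (simp only: nums)
  moreover have "com z (x * y) = com z x" using A(4) by (simp add: com_mult_right cj_one)
  ultimately have "com z' (x * y) = com z x" by (simp add: A(3) eqm_trivial)
  then show False using A(5) B(4) by simp
qed

text \<open>\<open>x^2\<close>, \<open>y^2\<close> and \<open>s\<close> are independent modulo
  \<open>L 2\<close>: a relation among them would contradict the lemmas above for a suitable basis
  chosen from \<open>x\<close>, \<open>y\<close>, \<open>x * y\<close>.\<close>

lemma second_layer_card_le:
  assumes b: "basis x y"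
  shows "8 * card (L 2) \<le> card (L 1)"
proof -
  have x: "x \<in> G" and y: "y \<in> G" using b basis_in by auto
  have xy: "x * y \<in> G" using x y by simp
  define s where "s = com x y"
  have s1: "s \<in> L 1" unfolding s_def by (rule com_in_first[OF x y])
  note x1 = square_in_first[OF x] and y1 = square_in_first[OF y]
  have sq: "f * f \<in> L 2" if "f \<in> L 1" for f
    using square_in[OF that, of 2] by (simp add: power2_eq_square)
  have K: "nrm (L 2)" by simp
  define V where "V = sgen ({x ^ 2} \<union> L 2)"
  define U where "U = sgen ({y ^ 2} \<union> V)"
  have V: "nrm V" using nrm_gen_layer[of "{x ^ 2}" 1, unfolded nums] x1 by (simp add: V_def)
  have LV: "L 2 \<subseteq> V" by (auto simp: V_def intro: gen_incl)
  have V1: "V \<subseteq> L 1" unfolding V_def using x1 L_antimono[of 1 2] by (intro gen_least) auto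
  have U1: "U \<subseteq> L 1" unfolding U_def using y1 V1 by (intro gen_least) auto
  have inV: "f \<in> L 2 \<or> eqm (L 2) f (x ^ 2)" if "f \<in> V" for f
    using coset_two[OF K _ sq[OF x1]] that x by (simp add: V_def)
  have yV: "y ^ 2 \<notin> V"
    using inV[of "y ^ 2"] square_not_second[OF basis_swap[OF b]] squares_differ[OF basis_swap[OF b]] by blast
  have sU: "s \<notin> U"
  proof
    assume "s \<in> U"
    moreover have "y ^ 2 * y ^ 2 \<in> V" using sq[OF y1] LV by blast
    ultimately have "s \<in> V \<or> eqm V s (y ^ 2)"
      using coset_two[OF V, of "y ^ 2" s] y by (simp add: U_def)
    moreover have "eqm V s (y ^ 2) \<Longrightarrow> s * inverse (y ^ 2) \<in> L 2 \<or> eqm (L 2) (s * inverse (y ^ 2)) (x ^ 2)"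
      using inV by (simp add: eqm_def)
    moreover have "s * inverse (y ^ 2) \<in> L 2 \<longleftrightarrow> eqm (L 2) s (y ^ 2)" by (simp add: eqm_def)
    moreover have "eqm (L 2) (s * inverse (y ^ 2)) (x ^ 2) \<Longrightarrow> eqm (L 2) s (x ^ 2 * y ^ 2)"
      by (simp add: eqm_def g_simps)
    \<comment> \<open>In the last three cases \<open>(x * y)^2\<close>, which is
      \<open>s^-1 x^2 y^2\<close> modulo \<open>L 2\<close>, becomes \<open>y^2\<close>,
      \<open>x^2\<close> or trivial.\<close>
    ultimately consider "s \<in> L 2" | "eqm (L 2) s (x ^ 2)" | "eqm (L 2) s (y ^ 2)" | "eqm (L 2) s (x ^ 2 * y ^ 2)"
      using inV by blast
    then show False
    proof cases
      case 1
      then show False using commutator_not_second[OF b] by (simp add: s_def)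
    next
      case 2
      have "eqm (L 2) ((x * y) ^ 2) (inverse s * x ^ 2 * y ^ 2)"
        using square_mult_eqm[OF x y] by (simp add: s_def)
      moreover have "eqm (L 2) (inverse s * x ^ 2) (inverse s * s)"
        by (rule eqm_mult[OF K eqm_refl[OF K] eqm_sym[OF K 2]]) (use x y in \<open>simp add: s_def\<close>)
      then have "eqm (L 2) (inverse s * x ^ 2 * y ^ 2) (1 * y ^ 2)"
        using x y by (intro eqm_mult[OF K]) (auto simp: s_def)
      ultimately have "eqm (L 2) ((x * y) ^ 2) (y ^ 2)" using eqm_trans[OF K] by simp
      moreover have "basis (x * y) y"
        using basis_transfer[OF b xy y] subgrp_mult_right_iff[OF subgrp_gen, of y "{x * y, y} \<union> L 1" x]
        by (simp add: gen_incl)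
      ultimately show False using squares_differ by blast
    next
      case 3
      have c1: "com y x \<in> L 1" by (rule com_in_first[OF y x])
      have "eqm (L 2) (inverse s * (x ^ 2 * y ^ 2)) (inverse s * (y ^ 2 * x ^ 2))"
      proof (rule eqm_mult[OF K eqm_refl[OF K]])
        have "com (x ^ 2) (y ^ 2) \<in> L 3" by (rule L_com_LI[OF x1 y1]) simp
        then show "eqm (L 2) (x ^ 2 * y ^ 2) (y ^ 2 * x ^ 2)"
          using L_antimono[of 2 3] by (intro eqm_com_mult) auto
      qed (use x y in \<open>simp add: s_def\<close>)
      moreover have "eqm (L 2) (inverse s * y ^ 2) (inverse s * s)"
        by (rule eqm_mult[OF K eqm_refl[OF K] eqm_sym[OF K 3]]) (use x y in \<open>simp add: s_def\<close>)
      then have "eqm (L 2) (inverse s * y ^ 2 * x ^ 2) (1 * x ^ 2)"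
        using x y by (intro eqm_mult[OF K]) (auto simp: s_def)
      ultimately have "eqm (L 2) (inverse s * x ^ 2 * y ^ 2) (x ^ 2)"
        using eqm_trans[OF K] by (simp add: mult.assoc)
      then have "eqm (L 2) ((x * y) ^ 2) (x ^ 2)"
        using eqm_trans[OF K square_mult_eqm[OF x y]] by (simp add: s_def)
      then show False using squares_differ[OF basis_swap[OF basis_mult[OF b]]] by blast
    next
      case 4
      have "eqm (L 2) (inverse s * (x ^ 2 * y ^ 2)) (inverse s * s)"
        by (rule eqm_mult[OF K eqm_refl[OF K] eqm_sym[OF K 4]]) (use x y in \<open>simp add: s_def\<close>)
      then have "eqm (L 2) ((x * y) ^ 2) 1"
        using eqm_trans[OF K square_mult_eqm[OF x y]] by (simp add: s_def mult.assoc)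
      then show False using square_not_second[OF basis_swap[OF basis_mult[OF b]]] by (simp add: eqm_one_iff)
    qed
  qed
  have "L 2 \<subset> V" using LV gen_incl[of "x ^ 2" "{x ^ 2} \<union> L 2"] square_not_second[OF b] by (auto simp: V_def)
  then have "2 * card (L 2) \<le> card V"
    using V1 L_in_G by (intro proper_card) (auto simp: V_def subgrp_gen)
  moreover have "V \<subset> U" using yV gen_incl[of _ "{y ^ 2} \<union> V"] by (auto simp: U_def)
  then have "2 * card V \<le> card U"
    using U1 L_in_G by (intro proper_card) (auto simp: V_def U_def subgrp_gen)
  moreover have "U \<subset> L 1" using U1 sU s1 by blast
  then have "2 * card U \<le> card (L 1)"
    using L_in_G by (intro proper_card) (auto simp: U_def subgrp_gen)
  ultimately show ?thesis by linarith
qed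

text \<open>Here \<open>y^2\<close> is full from depth 2, so \<open>not_ample\<close> applies with
  \<open>i = 1\<close>. The commutator \<open>[x, y^2]\<close> spans the second layer, and if
  \<open>L 3\<close> is nontrivial, \<open>[s, y^2]\<close> spans it, reducing to
  \<open>[y, w]\<close> because \<open>w^2 = 1\<close>.\<close>

lemma square_line:
  assumes b: "basis x y" and s: "s = com x y" and s2: "s ^ 2 \<in> L 3" and w: "com s y \<notin> L 3"
    and c2: "card (L 2) < 4 * card (L 3)" and L4: "L 4 = {1}"
    and z: "L 3 = {1} \<or> card (L 3) = 2 \<and> com (com s y) y \<noteq> 1 \<and> com s y ^ 2 = 1"
  shows False
proof -
  have x: "x \<in> G" and y: "y \<in> G" using b basis_in by auto
  have s1: "s \<in> L 1" unfolding s by (rule com_in_first[OF x y])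
  have sG: "s \<in> G" using s1 L_in_G by blast
  let ?w = "com s y" and ?c = "y ^ 2"
  have cG: "?c \<in> G" using y by simp
  have w2: "?w \<in> L 2" by (rule L_comI[OF s1 y]) simp
  have c: "com x ?c = cj s (com y s) * s ^ 2" unfolding s by (rule com_square_right)
  have ys: "com y s \<in> L 2" "com y s \<notin> L 3" using w2 w nrm_com_swap[OF nrm_L] by blast+
  have "s ^ 2 \<in> L 2" using s2 L_antimono[of 2 3] by auto
  then have m2: "com x ?c \<in> L 2" unfolding c using ys sG by (intro L_closed(2)) (simp_all add: nrm_cj)
  have m3: "com x ?c \<notin> L 3" unfolding c using ys s2 sG by (simp add: subgrp_mult_right_iff nrm_cj_iff)
  have sp2: "spans {com x ?c} 2" using m2 m3 c2 by (intro single) (auto simp: nums)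
  have full3: "full ?c 3"
  proof (cases "L 3 = {1}")
    case True
    then show ?thesis by (rule full_trivial[OF cG])
  next
    case False
    with z have z': "card (L 3) = 2" "com ?w y \<noteq> 1" "?w ^ 2 = 1" by auto
    have z3: "com ?w y \<in> L 3" by (rule L_comI[OF w2 y]) simp
    have "com s ?c = ?w * cj y ?w" by (simp add: power2_eq_square com_mult_right)
    also have "\<dots> = ?w * (com y ?w * ?w)" by (simp add: cj_eq_com)
    also have "com y ?w * ?w = ?w * com y ?w"
    proof -
      have "com y ?w \<in> L 3" using z3 nrm_com_swap[OF nrm_L] by blast
      then have "com (com y ?w) ?w = 1" using L_comI[of "com y ?w" 3 ?w 4] L4 w2 L_in_G by auto
      then show ?thesis by (simp add: com_eq_one_iff)
    qed
    also have "?w * (?w * com y ?w) = ?w ^ 2 * com y ?w" by (simp add: power2_eq_square mult.assoc)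
    finally have e: "com s ?c = com y ?w" using z' by simp
    have n: "com s ?c \<in> L 3" "com s ?c \<noteq> 1"
      using z3 z' com_inverse[of y ?w] nrm_com_swap[OF nrm_L] unfolding e by auto
    have "spans {com s ?c} 3" using n z' L4 by (intro single) (auto simp: nums)
    then show ?thesis using full_spans[OF cG] reach_com[OF cG sG n(1)] by simp
  qed
  have "full ?c j" if j: "Suc 1 \<le> j" for j
  proof -
    consider "j = 2" | "j = 3" | "4 \<le> j" using j by linarith
    then show ?thesis
    proof cases
      case 1
      then show ?thesis using full_spans[OF cG sp2] reach_com[OF cG x m2] by simp
    next
      case 3
      then show ?thesis using full_trivial[OF cG] L_trivial_Suc[OF L4] by simp
    qed (use full3 in simp)
  qed
  moreover have "?c \<noteq> 1" using m3 L_closed(1) by auto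
  ultimately show False using not_ample[OF y, of 1] basis_ample[OF b] by simp
qed

text \<open>Otherwise \<open>com_square\<close> places all squares and commutators of
  \<open>x^2\<close>, \<open>y^2\<close>, \<open>s\<close> in \<open>L 3\<close>, so the second
  layer would be spanned by nothing.\<close>

lemma commutators_third:
  assumes b: "basis x y" and s: "s = com x y" and p4: "x ^ 4 \<in> L 3" "y ^ 4 \<in> L 3" and s2: "s ^ 2 \<in> L 3"
  shows "com s x \<notin> L 3 \<or> com s y \<notin> L 3"
proof (rule ccontr)
  assume "\<not> ?thesis"
  then have m: "com s x \<in> L 3" "com s y \<in> L 3" by auto
  have x: "x \<in> G" and y: "y \<in> G" using b basis_in by auto
  have s1: "s \<in> L 1" unfolding s by (rule com_in_first[OF x y])
  have sG: "s \<in> G" using s1 L_in_G by blast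
  have sp1: "spans {x ^ 2, y ^ 2, s} 1"
    using s1 square_in_first x y by (intro spans_one[OF b]) (auto simp: s intro: gen_incl)
  have "com x s \<in> L 3" using m nrm_com_swap[OF nrm_L] by blast
  then have "com x s * s ^ 2 \<in> L 3" using s2 by (rule L_closed)
  then have cx: "com (x ^ 2) y \<in> L 3" by (simp only: com_square s)
  have "com (inverse s) y \<in> L 3" using m com_inverse_left_mem[OF nrm_L sG] by blast
  then have "com y (com y x) \<in> L 3" using nrm_com_swap[OF nrm_L] by (simp add: s com_inverse)
  moreover have "com y x ^ 2 \<in> L 3" using com_swap_square[OF s2[unfolded s] nrm_L] .
  ultimately have "com y (com y x) * com y x ^ 2 \<in> L 3" by (rule L_closed)
  then have cy: "com (y ^ 2) x \<in> L 3" by (simp only: com_square)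
  have "spans {} (Suc 1)"
    using cx cy m s2 p4 by (intro spans_Suc[OF b sp1])
      (auto simp: gen_subgrp_eq L_closed numeral_3_eq_3[symmetric])
  from spans_empty[OF this] show False using second_nontrivial[OF b] by (simp only: nums)
qed

text \<open>\<open>w = [s, y]\<close> spans the second layer. As for the prime 3,
  \<open>com_com_swap\<close> shows that \<open>[w, y]\<close> cannot vanish, and then
  \<open>square_line\<close> applies.\<close>

lemma third_layer_trivial_aux:
  assumes b: "basis x y" and c2: "card (L 2) = 4" and c3: "card (L 3) = 2" and L4: "L 4 = {1}"
    and s: "s = com x y" and s2: "s ^ 2 \<in> L 3" and w: "com s y \<notin> L 3"
  shows False
proof -
  have x: "x \<in> G" and y: "y \<in> G" using b basis_in by auto
  have s1: "s \<in> L 1" unfolding s by (rule com_in_first[OF x y])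
  let ?w = "com s y"
  have w2: "?w \<in> L 2" by (rule L_comI[OF s1 y]) simp
  have sp2: "spans {?w} 2" using w2 w c2 c3 by (intro single) (auto simp: nums)
  have "com s ?w = 1" using L_com_LI[OF s1 w2, of 4] L4 by simp
  then have "cj s ?w = ?w" by (simp add: cj_eq_com)
  moreover have "com (s ^ 2) y = 1" using L_comI[OF s2 y, of 4] L4 by simp
  ultimately have w22: "?w ^ 2 = 1" using com_square'[of s y] by (simp add: power2_eq_square)
  have z: "com ?w y \<noteq> 1"
  proof
    assume z: "com ?w y = 1"
    have "subgrp {f\<in>L 2. com f y \<in> L 4}" using y by (intro subgrp_com_one_vimage) (auto intro: L_in_G)
    moreover have "L 3 \<subseteq> {f\<in>L 2. com f y \<in> L 4}"
      using L_comI[of _ 3 y 4] y L_antimono[of 2 3] by auto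
    ultimately have "L 2 \<subseteq> {f\<in>L 2. com f y \<in> L 4}"
      using w2 z L_closed(1) by (intro spans_least[OF sp2]) (auto simp: nums)
    moreover have "com s x \<in> L 2" by (rule L_comI[OF s1 x]) simp
    ultimately have "com (com s x) y = 1" using L4 by auto
    then have "com ?w x = 1" using com_com_swap[OF x y s] by (simp add: L4 eqm_trivial)
    then have "spans {} (Suc 2)"
      using z w22 by (intro spans_Suc[OF b sp2]) (auto simp: subgrp_one[OF subgrp_gen])
    from spans_empty[OF this] c3 show False by (simp add: nums)
  qed
  show False by (rule square_line[OF b s s2 w _ L4]) (use c2 c3 z w22 in auto)
qed

text \<open>The indices 4 and 8 leave at most 4 elements for \<open>L 2\<close>; a smaller
  \<open>L 2\<close> or a nontrivial \<open>L 3\<close> is excluded by \<open>square_line\<close>.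
  Fourth powers are then trivial on all three lines, and \<open>power4_mult_eqm\<close> yields the
  square of the commutator.\<close>

theorem two_group_relations:
  assumes b: "basis x y"
  shows "card G = 128" "x ^ 4 = 1" "y ^ 4 = 1" "com x y ^ 2 = 1" "L 3 = {1}"
proof -
  have x: "x \<in> G" and y: "y \<in> G" using b basis_in by auto
  have xy: "x * y \<in> G" using x y by simp
  note n = basis_notin[OF b]
  define s where "s = com x y"
  have sG: "s \<in> G" using x y by (simp add: s_def)
  have s': "com y x = inverse s" by (simp add: s_def com_inverse)
  have L2: "L 2 \<noteq> {1}" by (rule second_nontrivial[OF b])
  have c2: "card (L 2) \<le> 4" using second_layer_card_le[OF b] card_first(1)[OF b] by linarith
  have c23: "2 * card (L 3) \<le> card (L 2)" by (rule card_half[OF L2]) simp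
  have c3: "card (L 3) \<le> 2" using c2 c23 by linarith
  have L4: "L 4 = {1}" by (rule card_L_two[OF c3]) simp
  show L3: "L 3 = {1}"
  proof (rule ccontr)
    assume L3: "L 3 \<noteq> {1}"
    have "2 * card (L 4) \<le> card (L 3)" by (rule card_half[OF L3]) simp
    then have c3': "card (L 3) = 2" and c2': "card (L 2) = 4" using c2 c3 c23 L4 by simp_all
    \<comment> \<open>A fourth power outside \<open>L 3\<close> would span the second layer, yet it
      is central of order two, so \<open>L 3\<close> would be trivial.\<close>
    have p4: "a ^ 4 \<in> L 3" if ad: "basis a d" for a d
    proof (rule ccontr)
      assume A: "a ^ 4 \<notin> L 3"
      have a: "a \<in> G" and d: "d \<in> G" using ad basis_in by auto
      have sp: "spans {a ^ 4} 2" using A power4_in[OF a] c2' c3' by (intro single) (auto simp: nums)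
      have "spans {} (Suc 2)"
        using power4_central[OF c3 a basis_notin(1)[OF ad]] a d
        by (intro spans_Suc[OF ad sp]) (auto simp: subgrp_one[OF subgrp_gen])
      from spans_empty[OF this] L3 show False by (simp only: nums)
    qed
    have p4': "x ^ 4 \<in> L 3" "y ^ 4 \<in> L 3" "(x * y) ^ 4 \<in> L 3"
      using p4 b basis_swap[OF b] basis_swap[OF basis_mult[OF b]] by blast+
    have s2: "s ^ 2 \<in> L 3"
      unfolding s_def by (rule com_square_of_power4[OF nrm_L subset_refl x y L_closed(2)[OF p4'(1,2)] p4'(3)])
    have s2': "inverse s ^ 2 \<in> L 3" using s2 by (simp add: g_inverse_power[symmetric] subgrp_inverse_iff)
    from commutators_third[OF b s_def p4'(1,2) s2] show False
    proof
      assume "com s x \<notin> L 3"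
      then have "com (inverse s) x \<notin> L 3" using com_inverse_left_mem[OF nrm_L sG] by blast
      then show False
        by (rule third_layer_trivial_aux[OF basis_swap[OF b] c2' c3' L4 s'[symmetric] s2'])
    qed (rule third_layer_trivial_aux[OF b c2' c3' L4 s_def s2])
  qed
  show x4: "x ^ 4 = 1" and y4: "y ^ 4 = 1" using power4_trivial[OF L3] x y n by auto
  have xy4: "(x * y) ^ 4 = 1" using power4_trivial[OF L3] xy n by auto
  have "s ^ 2 \<in> L 3"
    unfolding s_def by (rule com_square_of_power4[OF nrm_L subset_refl x y]) (simp_all add: x4 y4 xy4 L_closed)
  then have s2: "s ^ 2 = 1" using L3 by simp
  then show "com x y ^ 2 = 1" by (simp add: s_def)
  have s2': "inverse s ^ 2 = 1" using s2 by (simp add: g_inverse_power[symmetric])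
  have "4 \<le> card (L 2)"
  proof (rule ccontr)
    assume "\<not> 4 \<le> card (L 2)"
    then have c: "card (L 2) < 4 * card (L 3)" using L3 by simp
    have "com s x \<notin> L 3 \<or> com s y \<notin> L 3"
      using commutators_third[OF b s_def] x4 y4 s2 L_closed(1) by simp
    then show False
    proof
      assume "com s x \<notin> L 3"
      then have "com (inverse s) x \<notin> L 3" using com_inverse_left_mem[OF nrm_L sG] by blast
      then show False
        using square_line[OF basis_swap[OF b] s'[symmetric] _ _ c L4] L3 s2' by simp
    next
      assume "com s y \<notin> L 3"
      then show False using square_line[OF b s_def _ _ c L4] L3 s2 by simp
    qed
  qed
  then show "card G = 128"
    using second_layer_card_le[OF b] card_first(2)[OF b] card_le by linarith
qed

end

section \<open>Orders of non-abelian Beauville \<open>p\<close>-groups\<close>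

context fin_p_group
begin

lemma coset_power:
  assumes N: "nrm N" and t: "t \<in> G" "t ^ p \<in> N" and f: "f \<in> sgen ({t} \<union> N)"
  shows "\<exists>i<p. eqm N f (t ^ i)"
proof -
  let ?H = "{f\<in>G. \<exists>i. eqm N f (t ^ i)}"
  have "subgrp ?H"
  proof (rule finite_subgrpI)
    show "finite ?H" using finG by simp
    have "eqm N 1 (t ^ 0)" using N by simp
    then show "?H \<noteq> {}" using G_closed(1) by blast
    fix a b assume a: "a \<in> ?H" and b: "b \<in> ?H"
    then obtain i j where "eqm N a (t ^ i)" "eqm N b (t ^ j)" by auto
    then have "eqm N (a * b) (t ^ (i + j))" unfolding power_add using N a by (intro eqm_mult) auto
    then show "a * b \<in> ?H" using a b by auto
  qed
  moreover have "{t} \<union> N \<subseteq> ?H"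
  proof
    fix n assume "n \<in> {t} \<union> N"
    then have "eqm N n (t ^ 1) \<or> eqm N n (t ^ 0)" using N by (auto simp: eqm_one_iff)
    then show "n \<in> ?H" using \<open>n \<in> {t} \<union> N\<close> t nrm_in[OF N] by blast
  qed
  ultimately have "f \<in> ?H" using gen_least f by blast
  then obtain i where i: "eqm N f (t ^ i)" by blast
  have "t ^ i = (t ^ p) ^ (i div p) * t ^ (i mod p)" by (simp flip: power_mult power_add)
  moreover have "eqm N ((t ^ p) ^ (i div p) * t ^ (i mod p)) (t ^ (i mod p))"
    by (rule eqm_mult_left[OF N nrm_power[OF N t(2)]])
  ultimately have "eqm N f (t ^ (i mod p))" using eqm_trans[OF N i] by simp
  then show ?thesis using p_gt_1 by (intro exI[of _ "i mod p"]) simp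
qed

lemma basis_coset:
  assumes b: "basis x y" and g: "g \<in> G"
  shows "\<exists>i<p. \<exists>j<p. eqm (L 1) g (x ^ i * y ^ j)"
proof -
  note xy = basis_in[OF b]
  have pw: "a ^ p \<in> L 1" if "a \<in> G" for a using L_power[of a 0] that by simp
  let ?N = "sgen ({x} \<union> L 1)"
  have N: "nrm ?N" using nrm_gen_layer[of "{x}" 0] xy by simp
  have LN: "L 1 \<subseteq> ?N" and xN: "x \<in> ?N" by (auto intro: gen_incl)
  have "sgen ({x, y} \<union> L 1) \<subseteq> sgen ({y} \<union> ?N)" by (rule gen_mono) (use LN xN in auto)
  then have "g \<in> sgen ({y} \<union> ?N)" using b g by (auto simp: basis_def)
  moreover have "y ^ p \<in> ?N" using pw xy LN by blast
  ultimately obtain j where j: "j < p" "eqm ?N g (y ^ j)" using coset_power[OF N xy(2)] by blast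
  then have "g * inverse (y ^ j) \<in> ?N" by (simp add: eqm_def)
  then obtain i where i: "i < p" "eqm (L 1) (g * inverse (y ^ j)) (x ^ i)"
    using coset_power[OF nrm_L xy(1) pw[OF xy(1)]] by blast
  have "eqm (L 1) (g * inverse (y ^ j) * y ^ j) (x ^ i * y ^ j)"
    using i g xy by (intro eqm_mult) auto
  then show ?thesis using i j by (auto simp: mult.assoc)
qed

definition beauville_pairs :: "'a \<Rightarrow> 'a \<Rightarrow> 'a \<Rightarrow> 'a \<Rightarrow> bool" where
  "beauville_pairs x1 y1 x2 y2 \<longleftrightarrow> x1 \<in> G \<and> y1 \<in> G \<and> x2 \<in> G \<and> y2 \<in> G \<and>
    sgen {x1, y1} = G \<and> sgen {x2, y2} = G \<and>
    (\<forall>a\<in>{x1, y1, x1 * y1}. \<forall>b\<in>{x2, y2, x2 * y2}. \<not> meets a b)"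

lemma sgen_basis: "x \<in> G \<Longrightarrow> y \<in> G \<Longrightarrow> sgen {x, y} = G \<Longrightarrow> basis x y"
  using gen_mono[of "{x, y}" "{x, y} \<union> L 1"] by (intro basisI) auto

lemma beauville_pairs_basis:
  assumes "beauville_pairs x1 y1 x2 y2"
  shows "basis x1 y1" "basis x2 y2"
  using assms sgen_basis unfolding beauville_pairs_def by blast+

lemma basis_mult_left: "basis x y \<Longrightarrow> basis (x * y) y"
proof (rule basis_transfer)
  have *: "x * y \<in> sgen ({x * y, y} \<union> L 1)" "y \<in> sgen ({x * y, y} \<union> L 1)" by (auto intro: gen_incl)
  then show "x \<in> sgen ({x * y, y} \<union> L 1)" "y \<in> sgen ({x * y, y} \<union> L 1)"
    using subgrp_mult_right_iff[OF subgrp_gen] by blast+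
qed (auto simp: basis_def)

lemma meets_inverse:
  assumes u: "u \<in> G" and v: "v \<in> G" and m: "meets u (inverse v)"
  shows "meets u v"
proof -
  obtain i j g where h: "g \<in> G" "cj g (u ^ i) = inverse v ^ j" "inverse v ^ j \<noteq> 1"
    using m by (auto simp: meets_def)
  have "v ^ card G = 1" by (rule subgrp_pow_card[OF subG finG v])
  moreover have "0 < card G" using finG G_closed(1) card_gt_0_iff by blast
  then have "Suc (card G - 1) = card G" by simp
  ultimately have "v * v ^ (card G - 1) = 1" by (metis power_Suc)
  then have "inverse v = v ^ (card G - 1)" by (rule g_inverse_unique)
  then have "inverse v ^ j = v ^ ((card G - 1) * j)" by (simp add: power_mult)
  then show ?thesis using h unfolding meets_def by metis
qed

text \<open>For \<open>p = 3\<close> a line consists of \<open>L 1\<close> and two mutually inverse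
  cosets, so agreement up to inversion is enough; \<open>meets_inverse\<close> absorbs the
  inversion.\<close>

lemma ample_of_pairs:
  assumes "a \<in> G" "b \<in> G" "\<not> meets a b" "eqm (L 1) a b \<or> eqm (L 1) (inverse a) b"
  shows "ample a"
proof -
  have "eqm (L 1) b a \<or> eqm (L 1) (inverse b) a"
  proof -
    have "eqm (L 1) (inverse b) a" if "eqm (L 1) (inverse a) b"
      using eqm_sym[OF nrm_L eqm_inverse[OF nrm_L that assms(2)]] by simp
    then show ?thesis using assms(4) eqm_sym[OF nrm_L] by blast
  qed
  moreover have "\<not> meets a (inverse b)" using meets_inverse assms(1-3) by blast
  moreover have "eqm (L 1) a a" by simp
  ultimately show ?thesis using assms(1-3) G_closed(3) unfolding ample_def by blast
qed

subsection \<open>Groups of order \<open>p\<^sup>3\<close>\<close>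

text \<open>The collection formula in class two: binomial(n, 2) counts the swaps of a
  \<open>b\<close> past an \<open>a\<close>.\<close>

lemma mult_power_central:
  assumes c: "c = com b a" and ca: "c * a = a * c" and cb: "c * b = b * c"
  shows "(a * b) ^ n = a ^ n * b ^ n * c ^ (n choose 2)"
proof -
  have pa: "c ^ k * a = a * c ^ k" and pb: "c ^ k * b = b * c ^ k" for k
    using ca cb by (simp_all add: power_commuting_commutes)
  have pb': "c ^ k * b ^ m = b ^ m * c ^ k" for k m
    using pb[of k] by (metis power_commuting_commutes)
  have ba: "b * a = a * b * c"
  proof -
    have "b * a = c * (a * b)" by (simp add: c com_def g_simps)
    also have "\<dots> = a * b * c" using ca cb by (metis mult.assoc)
    finally show ?thesis .
  qed
  have bna: "b ^ n * a = a * b ^ n * c ^ n" for n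
  proof (induction n)
    case (Suc n)
    have "b ^ Suc n * a = b * (a * b ^ n * c ^ n)" using Suc by (simp add: mult.assoc)
    also have "\<dots> = (b * a) * b ^ n * c ^ n" by (simp add: mult.assoc)
    also have "\<dots> = a * b * (c * b ^ n) * c ^ n" by (simp add: ba mult.assoc)
    also have "c * b ^ n = b ^ n * c" using pb'[of 1 n] by simp
    finally show ?case by (simp add: mult.assoc)
  qed simp
  show ?thesis
  proof (induction n)
    case (Suc n)
    have "(a * b) ^ Suc n = (a ^ n * b ^ n * c ^ (n choose 2)) * (a * b)"
      unfolding power_Suc2 Suc ..
    also have "\<dots> = a ^ n * (b ^ n * a) * b * c ^ (n choose 2)"
      using pa pb by (simp add: mult.assoc) (metis mult.assoc)
    also have "\<dots> = a ^ n * (a * b ^ n * c ^ n) * b * c ^ (n choose 2)" by (simp only: bna)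
    also have "\<dots> = (a ^ n * a) * (b ^ n * b) * (c ^ n * c ^ (n choose 2))"
      using pb[of n] by (simp add: mult.assoc)
    also have "\<dots> = a ^ Suc n * b ^ Suc n * c ^ (Suc n choose 2)"
      by (simp only: power_Suc2 flip: power_add) (simp add: numeral_2_eq_2)
    finally show ?case .
  qed (simp add: numeral_2_eq_2)
qed

text \<open>An odd prime divides binomial(p, 2), and commutators have order dividing
  \<open>p\<close> because \<open>L 2\<close> is trivial.\<close>

lemma power_hom_odd:
  assumes L2: "L 2 = {1}" and p: "2 < p" and a: "a \<in> G" and b: "b \<in> G"
  shows "(a * b) ^ p = a ^ p * b ^ p"
proof -
  define c where "c = com b a"
  have c1: "c \<in> L 1" unfolding c_def by (rule L_comI[of b 0 a]) (use a b in auto)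
  have cent: "c * g = g * c" if "g \<in> G" for g
    using L_comI[OF c1 that, of 2] L2 by (simp add: com_eq_one_iff)
  have "c ^ p = 1" using L_powerI[OF c1, of p 2] L2 by simp
  moreover have "p dvd (p choose 2)" using p prp by (intro dvd_choose_prime) auto
  ultimately have "c ^ (p choose 2) = 1" by (auto simp: dvd_def power_mult)
  then show ?thesis using mult_power_central[OF c_def cent[OF a] cent[OF b]] by simp
qed

lemma power_trivial_odd:
  assumes L2: "L 2 = {1}" and p: "2 < p" and xy: "x \<in> G" "y \<in> G" "sgen {x, y} = G"
    and t: "x ^ p = 1" "y ^ p = 1" and g: "g \<in> G"
  shows "g ^ p = 1"
proof -
  have "subgrp {g\<in>G. g ^ p = 1}"
    by (rule finite_subgrpI) (auto simp: finG power_hom_odd[OF L2 p] intro: exI[of _ 1])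
  then have "sgen {x, y} \<subseteq> {g\<in>G. g ^ p = 1}" using xy t by (intro gen_least) auto
  then show ?thesis using xy g by auto
qed

theorem beauville_odd_cube:
  assumes bp: "beauville_pairs x1 y1 x2 y2" and nc: "\<exists>a\<in>G. \<exists>b\<in>G. a * b \<noteq> b * a"
    and p: "2 < p" and card: "card G \<le> p ^ 3"
  shows "card G = p ^ 3" "L 2 = {1}" "\<And>g. g \<in> G \<Longrightarrow> g ^ p = 1"
proof -
  note b = beauville_pairs_basis[OF bp]
  have p0: "0 < p" using p by simp
  have c1: "p * (p * card (L 1)) \<le> card G" by (rule noncomm_card(4)[OF b(1) nc])
  have "p * (p * card (L 1)) \<le> p * (p * p)"
    by (rule order_trans[OF c1]) (use card in \<open>simp add: power3_eq_cube mult.assoc\<close>)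
  then have le: "card (L 1) \<le> p" by (simp only: nat_mult_le_cancel1[OF p0])
  have L1: "L 1 \<noteq> {1}"
  proof
    assume "L 1 = {1}"
    then have "com a b = 1" if "a \<in> G" "b \<in> G" for a b
      using L_comI[of a 0 b 1] that by auto
    then show False using nc by (auto simp: com_eq_one_iff)
  qed
  have c2: "p * card (L 2) \<le> card (L 1)" using L_cardI[OF L1, of 2] by simp
  have "p * 1 \<le> p * card (L 2)" using card_L_pos[of 2] by (intro mult_le_mono2) simp
  then have cL1: "card (L 1) = p" using le c2 by linarith
  show L2: "L 2 = {1}"
  proof (rule ccontr)
    assume "L 2 \<noteq> {1}"
    then have "p * card (L 3) \<le> card (L 2)" by (intro L_cardI) auto
    moreover have "0 < card (L 3)" by (rule card_L_pos)
    moreover have "p \<le> p * card (L 3)" using calculation(2) by simp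
    ultimately have "p \<le> card (L 2)" by linarith
    then have "p * p \<le> p" using c2 cL1 by (metis le_trans mult_le_mono2)
    then show False using p by simp
  qed
  show "card G = p ^ 3" using c1 cL1 card by (simp add: power3_eq_cube mult.assoc)
  have in1: "a ^ p \<in> L 1" if "a \<in> G" for a using L_power[of a 0] that by simp
  have G: "x1 \<in> G" "y1 \<in> G" "x2 \<in> G" "y2 \<in> G" "sgen {x1, y1} = G" "sgen {x2, y2} = G"
    using bp unfolding beauville_pairs_def by blast+
  have nm: "\<not> meets a d" if "a \<in> {x1, y1, x1 * y1}" "d \<in> {x2, y2, x2 * y2}" for a d
    using bp that unfolding beauville_pairs_def by blast
  \<comment> \<open>\<open>L 1\<close> has order \<open>p\<close>, so any two nontrivial
    \<open>p\<close>-th powers are powers of each other. Hence one of the two pairs has only trivial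
    \<open>p\<close>-th powers, and \<open>power_trivial_odd\<close> extends this to
    \<open>G\<close>.\<close>
  have no: "\<not> (a ^ p \<noteq> 1 \<and> b ^ p \<noteq> 1)" if a: "a \<in> {x1, y1, x1 * y1}" and d: "b \<in> {x2, y2, x2 * y2}" for a b
  proof
    assume n: "a ^ p \<noteq> 1 \<and> b ^ p \<noteq> 1"
    have ab: "a \<in> G" "b \<in> G" using a d G(1-4) by auto
    have "L 1 = sgen (insert (b ^ p) {1})"
      using n in1[OF ab(2)] L_closed(1) L_in_G cL1 p by (intro proper_gen) (auto simp: nrm_subgrp nrm_trivial)
    then have "a ^ p \<in> sgen ({b ^ p} \<union> {1})" using in1[OF ab(1)] by (simp add: insert_commute)
    moreover have "(b ^ p) ^ p \<in> {1}" using L_powerI[OF in1[OF ab(2)], of p 2] L2 by simp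
    ultimately obtain i where "a ^ p = (b ^ p) ^ i"
      using coset_power[OF nrm_trivial, of "b ^ p"] ab by (auto simp: eqm_trivial)
    then have "cj 1 (a ^ p) = b ^ (p * i)" by (simp add: cj_by_one power_mult)
    then have "meets a b" unfolding meets_def using n by (metis G_closed(1) cj_by_one)
    then show False using nm[OF a d] by blast
  qed
  have "(x1 ^ p = 1 \<and> y1 ^ p = 1) \<or> (x2 ^ p = 1 \<and> y2 ^ p = 1)"
    using no by blast
  then show "g ^ p = 1" if "g \<in> G" for g
    using power_trivial_odd[OF L2 p G(1,2,5) _ _ that] power_trivial_odd[OF L2 p G(3,4,6) _ _ that] by blast
qed

lemma heisenberg_layers:
  assumes b: "basis x y" and s: "s = com x y" "s ^ p = 1" "com s x = 1" "com s y = 1"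
    and pw: "x ^ p = 1" "y ^ p = 1"
  shows "L 2 = {1}"
proof -
  have s1: "s \<in> L 1" unfolding s by (rule L_comI[of x 0 y]) (use basis_in[OF b] in auto)
  have one: "1 \<in> sgen S" for S using subgrp_one[OF subgrp_gen] .
  have "spans {s} 1"
    using pw s1 one by (intro spans_one[OF b]) (auto simp: s(1) intro: gen_incl)
  then have "spans {} (Suc 1)" using s one by (intro spans_Suc[OF b]) auto
  from spans_empty[OF this] show ?thesis by (simp add: numeral_2_eq_2)
qed

subsection \<open>The prime 3\<close>

text \<open>The four lines over the field with three elements; the nine cosets
  \<open>x^i y^j\<close> are matched with their representatives up to inversion.\<close>

lemma three_line_cases:
  assumes p3: "p = 3" and b: "basis x y" and a: "a \<in> G" "a \<notin> L 1"
  shows "\<exists>d\<in>{x, y, x * y, x * y ^ 2}. eqm (L 1) a d \<or> eqm (L 1) (inverse a) d"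
proof -
  have xy: "x \<in> G" "y \<in> G" using basis_in[OF b] by auto
  have K: "nrm (L 1)" by simp
  have cube: "c ^ 3 \<in> L 1" if "c \<in> G" for c
  proof -
    have "c ^ p \<in> L 1" using L_power[of c 0] that by simp
    then show ?thesis by (simp only: p3)
  qed
  obtain i j where "i < p" "j < p" and e: "eqm (L 1) a (x ^ i * y ^ j)" using basis_coset[OF b a(1)] by blast
  then have ij: "i < 3" "j < 3" by (simp_all only: p3)
  have inv: "eqm (L 1) (inverse c) (c ^ 2)" if "c \<in> G" for c
  proof -
    have "eqm (L 1) (c ^ 2) (inverse c)"
      using cube[OF that] by (simp add: eqm_def power2_eq_square power3_eq_cube mult.assoc)
    then show ?thesis by (rule eqm_sym[OF K])
  qed
  have inv2: "eqm (L 1) (inverse (c ^ 2)) c" if "c \<in> G" for c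
    using eqm_inverse[OF K eqm_sym[OF K inv[OF that]]] that by simp
  have ie: "eqm (L 1) (inverse a) (inverse (y ^ j) * inverse (x ^ i))"
    using eqm_inverse[OF K e] xy by (simp add: g_inverse_mult)
  have com: "eqm (L 1) (c * d) (d * c)" if "c \<in> G" "d \<in> G" for c d
    by (rule eqm_com_mult, rule L_comI[of c 0]) (use that in auto)
  have ie': "eqm (L 1) (inverse a) (x' * y')"
    if "eqm (L 1) (inverse (y ^ j)) y'" "eqm (L 1) (inverse (x ^ i)) x'" "x' \<in> G" "y' \<in> G" for x' y'
    using eqm_trans[OF K ie eqm_trans[OF K eqm_mult[OF K that(1,2)] com[OF that(4,3)]]] xy by simp
  have r: "eqm (L 1) c c" for c by simp
  have "i = 0 \<or> i = 1 \<or> i = 2" "j = 0 \<or> j = 1 \<or> j = 2" using ij by auto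
  then consider "i = 0" "j = 0" | "i = 1" "j = 0" | "i = 2" "j = 0" | "i = 0" "j = 1" | "i = 0" "j = 2"
    | "i = 1" "j = 1" | "i = 2" "j = 2" | "i = 1" "j = 2" | "i = 2" "j = 1"
    by blast
  then show ?thesis
  proof cases
    case 1
    then show ?thesis using e a by (simp add: eqm_one_iff)
  next
    case 3
    then show ?thesis using ie'[OF _ inv2[OF xy(1), folded 3], of 1] xy 3 by simp
  next
    case 5
    then show ?thesis using ie'[OF inv2[OF xy(2), folded 5], of 1] xy 5 by simp
  next
    case 7
    then have "eqm (L 1) (inverse a) (x * y)" using ie' inv2 xy by metis
    then show ?thesis by simp
  next
    case 9
    then have "eqm (L 1) (inverse a) (x * y ^ 2)"
      using ie'[of "y ^ 2" x] inv[OF xy(2)] inv2[OF xy(1)] xy by simp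
    then show ?thesis by simp
  qed (use e in auto)
qed

theorem beauville_three_group:
  assumes p3: "p = 3" and bp: "beauville_pairs x1 y1 x2 y2" and nc: "\<exists>a\<in>G. \<exists>b\<in>G. a * b \<noteq> b * a"
    and card: "card G \<le> 243"
  shows "\<exists>x\<in>G. \<exists>y\<in>G. card G = 243 \<and> sgen {x, y} = G \<and> x ^ 3 = 1 \<and> y ^ 3 = 1 \<and> L 3 = {1} \<and> (\<forall>f\<in>L 1. f ^ 3 = 1)"
proof -
  note b = beauville_pairs_basis[OF bp]
  have G: "x1 \<in> G" "y1 \<in> G" "x2 \<in> G" "y2 \<in> G" using bp unfolding beauville_pairs_def by blast+
  have nm: "\<not> meets a d" if "a \<in> {x1, y1, x1 * y1}" "d \<in> {x2, y2, x2 * y2}" for a d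
    using bp that unfolding beauville_pairs_def by blast
  have K: "nrm (L 1)" by simp
  let ?e = "x2 * y2 ^ 2"
  have eG: "?e \<in> G" using G by simp
  have am: "ample a \<or> eqm (L 1) a ?e \<or> eqm (L 1) (inverse a) ?e"
    if a: "a \<in> {x1, y1, x1 * y1}" "a \<notin> L 1" for a
  proof -
    have aG: "a \<in> G" using a G by auto
    obtain d where d: "d \<in> {x2, y2, x2 * y2, ?e}" "eqm (L 1) a d \<or> eqm (L 1) (inverse a) d"
      using three_line_cases[OF p3 b(2) aG a(2)] by blast
    show ?thesis
    proof (cases "d = ?e")
      case True
      then show ?thesis using d by blast
    next
      case False
      then have d': "d \<in> {x2, y2, x2 * y2}" using d by blast
      then have "d \<in> G" using G by auto
      then show ?thesis using ample_of_pairs[OF aG _ nm[OF a(1) d'] d(2)] by blast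
    qed
  qed
  \<comment> \<open>The only line missed by the second triple is that of \<open>?e\<close>, and two
    elements of a basis cannot both lie on it. So two of the three elements of the first triple are
    ample, and any two of them form a basis.\<close>
  have pair: "ample a \<or> ample d" if ad: "basis a d" "a \<in> {x1, y1, x1 * y1}" "d \<in> {x1, y1, x1 * y1}" for a d
  proof (rule ccontr)
    assume n: "\<not> ?thesis"
    have adG: "a \<in> G" "d \<in> G" using basis_in[OF ad(1)] by auto
    note nn = noncomm_card[OF ad(1) nc]
    have e: "eqm (L 1) a ?e \<or> eqm (L 1) (inverse a) ?e" "eqm (L 1) d ?e \<or> eqm (L 1) (inverse d) ?e"
      using am[OF ad(2) nn(1)] am[OF ad(3) nn(2)] n by auto
    let ?A = "sgen ({a} \<union> L 1)"
    have sub: "subgrp ?A" "L 1 \<subseteq> ?A" "a \<in> ?A" by (auto simp: subgrp_gen intro: gen_incl)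
    have "?e \<in> ?A" using e(1) eqm_mem_iff[OF _ sub(1,2)] subgrp_inverse_iff[OF sub(1)] sub(3) by blast
    then have "d \<in> ?A" using e(2) eqm_mem_iff[OF _ sub(1,2)] subgrp_inverse_iff[OF sub(1)] by blast
    then show False using nn(3) by blast
  qed
  have "\<exists>x y. basis x y \<and> ample x \<and> ample y"
    using pair[OF b(1)] pair[OF basis_mult[OF b(1)]] pair[OF basis_mult_left[OF b(1)]]
      b(1) basis_mult[OF b(1)] basis_mult_left[OF b(1)] by blast
  then obtain x y where xy: "basis x y" "ample x" "ample y" by blast
  then show ?thesis
    using three_group_relations[OF p3 xy(1) nc card xy(2,3)] basis_in[OF xy(1)] basis_gen[OF xy(1)] by blast
qed

text \<open>The converse direction: from relations to the series. On the presented group it bounds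
  the orders of elements.\<close>

lemma three_group_layers:
  assumes p3: "p = 3" and b: "basis x y" and s: "s = com x y" "s ^ 3 = 1"
    and pw: "x ^ 3 = 1" "y ^ 3 = 1" "com s x ^ 3 = 1" "com s y ^ 3 = 1"
    and cent: "\<And>g. g \<in> G \<Longrightarrow> com (com s x) g = 1" "\<And>g. g \<in> G \<Longrightarrow> com (com s y) g = 1"
  shows "L 3 = {1}" "f \<in> L 1 \<Longrightarrow> f ^ 3 = 1"
proof -
  have nums: "Suc 1 = 2" "Suc 2 = 3" by simp_all
  have xy: "x \<in> G" "y \<in> G" using basis_in[OF b] by auto
  have pc: "a ^ p = a ^ 3" for a :: 'a by (simp add: p3)
  have s1: "s \<in> L 1" unfolding s by (rule L_comI[of x 0 y]) (use xy in auto)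
  have one: "1 \<in> sgen S" for S using subgrp_one[OF subgrp_gen] .
  have sp1: "spans {s} 1"
    using pw s1 one by (intro spans_one[OF b]) (auto simp: pc s(1) intro: gen_incl)
  have "com s x \<in> L 2" "com s y \<in> L 2" by (rule L_comI[OF s1 xy(1)], simp, rule L_comI[OF s1 xy(2)], simp)
  then have sp2: "spans {com s x, com s y} (Suc 1)"
    using s one by (intro spans_Suc[OF b sp1]) (auto simp: pc numeral_2_eq_2 intro: gen_incl)
  have "spans {} (Suc (Suc 1))"
    using pw cent xy one by (intro spans_Suc[OF b sp2]) (auto simp: pc)
  from spans_empty[OF this] show L3: "L 3 = {1}" by (simp only: nums)
  have "L 1 \<subseteq> {f\<in>L 1. f ^ p \<in> L 3}"
  proof (rule spans_least[OF sp1])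
    show "subgrp {f\<in>L 1. f ^ p \<in> L 3}"
      by (rule subgrp_power_vimage) (auto intro: L_in_G L_com_LI)
    show "{s} \<subseteq> {f\<in>L 1. f ^ p \<in> L 3}" using s s1 L_closed(1) by (simp add: pc)
    show "L (Suc 1) \<subseteq> {f\<in>L 1. f ^ p \<in> L 3}"
      unfolding nums using L_antimono[of 1 2] L_powerI[of _ 2 p 3] by auto
  qed
  then show "f \<in> L 1 \<Longrightarrow> f ^ 3 = 1" using pc L3 by auto
qed

end

subsection \<open>The prime 2\<close>

context fin_2_group
begin

theorem beauville_two_group:
  assumes bp: "beauville_pairs x1 y1 x2 y2" and nc: "\<exists>a\<in>G. \<exists>b\<in>G. a * b \<noteq> b * a"
    and card: "card G \<le> 128"
  shows "card G = 128" "x1 ^ 4 = 1" "y1 ^ 4 = 1" "com x1 y1 ^ 2 = 1" "L 3 = {1}"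
proof -
  note b = beauville_pairs_basis[OF bp]
  have G: "x1 \<in> G" "y1 \<in> G" "x2 \<in> G" "y2 \<in> G" using bp unfolding beauville_pairs_def by blast+
  have ex: "\<exists>d\<in>{x, y, x * y}. eqm (L 1) d a" if xa: "basis x y" "a \<in> G" "a \<notin> L 1" for x y a
  proof -
    obtain i j where ij: "i < 2" "j < 2" "eqm (L 1) a (x ^ i * y ^ j)" using basis_coset[OF xa(1,2)] by blast
    then consider "i = 0" "j = 0" | "i = 1" "j = 0" | "i = 0" "j = 1" | "i = 1" "j = 1" by linarith
    then show ?thesis
    proof cases
      case 1
      then show ?thesis using ij xa by (simp add: eqm_one_iff)
    qed (use eqm_sym[OF nrm_L ij(3)] in auto)
  qed
  interpret ample_2_group G
  proof unfold_locales
    fix a assume a: "a \<in> G" "a \<notin> L 1"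
    obtain u where u: "u \<in> {x1, y1, x1 * y1}" "eqm (L 1) u a" using ex[OF b(1) a] by blast
    obtain v where v: "v \<in> {x2, y2, x2 * y2}" "eqm (L 1) v a" using ex[OF b(2) a] by blast
    have "u \<in> G" "v \<in> G" using u v G by auto
    moreover have "\<not> meets u v" using bp u(1) v(1) unfolding beauville_pairs_def by blast
    ultimately show "ample a" using u v unfolding ample_def by blast
  qed (use nc card in auto)
  show "card G = 128" "x1 ^ 4 = 1" "y1 ^ 4 = 1" "com x1 y1 ^ 2 = 1" "L 3 = {1}"
    using two_group_relations[OF b(1)] by auto
qed

lemma two_group_layers:
  assumes b: "basis x y" and s: "s = com x y" "s ^ 2 = 1"
    and pw: "x ^ 4 = 1" "y ^ 4 = 1" "com s x ^ 2 = 1" "com s y ^ 2 = 1"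
    and cent: "\<And>g. g \<in> G \<Longrightarrow> com (com s x) g = 1" "\<And>g. g \<in> G \<Longrightarrow> com (com s y) g = 1"
  shows "L 3 = {1}" "a \<in> G \<Longrightarrow> a ^ 4 = 1"
proof -
  have xy: "x \<in> G" "y \<in> G" using basis_in[OF b] by auto
  have s1: "s \<in> L 1" unfolding s by (rule L_comI[of x 0 y]) (use xy in auto)
  have sG: "s \<in> G" using s1 L_in_G by blast
  have one: "1 \<in> sgen S" for S using subgrp_one[OF subgrp_gen] .
  have sp1: "spans {x ^ 2, y ^ 2, s} 1"
    using s1 square_in_first xy by (intro spans_one[OF b]) (auto simp: s intro: gen_incl)
  have m: "com s x \<in> L 2" "com s y \<in> L 2" by (rule L_comI[OF s1 xy(1)], simp, rule L_comI[OF s1 xy(2)], simp)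
  let ?U = "sgen ({com s x, com s y} \<union> L (Suc 2))"
  have U: "nrm ?U" by (rule nrm_gen_layer) (use m in auto)
  have in_U: "com s x \<in> ?U" "com s y \<in> ?U" by (auto intro: gen_incl)
  have "com (x ^ 2) y = com x s" using s by (simp add: com_square)
  then have cx: "com (x ^ 2) y \<in> ?U" using in_U nrm_com_swap[OF U] by metis
  have yx: "com y x = inverse s" by (simp add: s com_inverse)
  have "inverse s ^ 2 = 1" using s by (simp flip: g_inverse_power)
  then have "com (y ^ 2) x = com y (inverse s)" by (simp add: com_square yx)
  then have cy: "com (y ^ 2) x \<in> ?U"
    using in_U com_inverse_left_mem[OF U sG] nrm_com_swap[OF U] by metis
  have sp2: "spans {com s x, com s y} (Suc 1)"
    using m s pw cx cy in_U nrm_one[OF U] by (intro spans_Suc[OF b sp1]) (auto simp: nums numeral_2_eq_2[symmetric] numeral_3_eq_3[symmetric])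
  have "spans {} (Suc (Suc 1))"
    using pw cent xy one by (intro spans_Suc[OF b sp2]) auto
  from spans_empty[OF this] show L3: "L 3 = {1}" by (simp only: nums)
  \<comment> \<open>\<open>Q\<close> collects the elements of \<open>L 1\<close> with trivial
    square. It is normal and contains the commutator of the generators, so all commutators lie in
    it; then fourth powers are multiplicative by \<open>power4_mult_eqm\<close>.\<close>
  define Q where "Q = {f\<in>L 1. f ^ 2 \<in> L 3}"
  have L2Q: "L 2 \<subseteq> Q" unfolding Q_def using L_antimono[of 1 2] square_in[of _ 2 3] by auto
  have Q: "nrm Q"
  proof (rule nrm_between[where j = 1])
    show "subgrp Q" unfolding Q_def by (rule subgrp_power_vimage) (auto intro: L_in_G L_com_LI)
    show "L (Suc 1) \<subseteq> Q" using L2Q by (simp only: nums)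
  qed (auto simp: Q_def)
  have sQ: "com x y \<in> Q" using s s1 L_closed(1) by (auto simp: Q_def)
  have LQ: "com l g \<in> Q" if "l \<in> L 1" "g \<in> G" for l g
    using L_comI[OF that, of 2] L2Q by auto
  have gens: "G \<subseteq> H" if "subgrp H" "x \<in> H" "y \<in> H" "L 1 \<subseteq> H" for H
    using gen_least[of H "{x, y} \<union> L 1"] that b by (auto simp: basis_def)
  have cQ: "com g h \<in> Q" if g: "g \<in> G" and h: "h \<in> G" for g h
  proof -
    have 1: "com k c \<in> Q" if c: "c \<in> {x, y}" and k: "k \<in> G" for c k
    proof -
      have "G \<subseteq> {f\<in>G. com f c \<in> Q}"
      proof (rule gens)
        show "subgrp {f\<in>G. com f c \<in> Q}" using Q subG c xy by (intro subgrp_com_one_vimage) auto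
      qed (use c xy sQ LQ L_in_G nrm_one[OF Q] nrm_com_swap[OF Q] in auto)
      then show ?thesis using k by auto
    qed
    have "G \<subseteq> {f\<in>G. com f g \<in> Q}"
    proof (rule gens)
      show "subgrp {f\<in>G. com f g \<in> Q}" using Q subG g by (intro subgrp_com_one_vimage) auto
      show "x \<in> {f\<in>G. com f g \<in> Q}" "y \<in> {f\<in>G. com f g \<in> Q}"
        using 1[OF _ g] xy nrm_com_swap[OF Q] by auto
    qed (use g LQ L_in_G in auto)
    then show ?thesis using h nrm_com_swap[OF Q] by auto
  qed
  have "subgrp {a\<in>G. a ^ 4 = 1}"
  proof (rule finite_subgrpI)
    fix g h assume g: "g \<in> {a\<in>G. a ^ 4 = 1}" and h: "h \<in> {a\<in>G. a ^ 4 = 1}"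
    have "com g h ^ 2 = 1" using cQ[of g h] g h L3 by (auto simp: Q_def)
    then have "inverse (com g h) ^ 2 = 1" by (simp flip: g_inverse_power)
    then have "(g * h) ^ 4 = 1"
      using power4_mult_eqm[of g h] g h by (simp add: L3 eqm_trivial)
    then show "g * h \<in> {a\<in>G. a ^ 4 = 1}" using g h by simp
  qed (use finG in \<open>auto intro: exI[of _ 1]\<close>)
  moreover have "l ^ 4 = 1" if "l \<in> L 1" for l
  proof -
    have "l ^ 2 \<in> L 2" using that by (rule square_in) simp
    then have "(l ^ 2) ^ 2 \<in> L 3" by (rule square_in) simp
    then show ?thesis using L3 by simp
  qed
  ultimately have "G \<subseteq> {a\<in>G. a ^ 4 = 1}" using pw xy L_in_G by (intro gens) auto
  then show "a \<in> G \<Longrightarrow> a ^ 4 = 1" by auto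
qed

end

section \<open>Presented groups\<close>

definition weval :: "('a, 'm) monoid_scheme \<Rightarrow> ('g \<Rightarrow> 'a) \<Rightarrow> 'g word \<Rightarrow> 'a" where
  "weval K f u = foldr (\<lambda>(s, b) r. (if b then f s else inv\<^bsub>K\<^esub> f s) \<otimes>\<^bsub>K\<^esub> r) u \<one>\<^bsub>K\<^esub>"

lemma words_Cons [simp]: "a # u \<in> words S \<longleftrightarrow> fst a \<in> S \<and> u \<in> words S"
  by (cases a) (auto simp: words_def)

lemma words_gen [simp]: "gen s \<in> words S \<longleftrightarrow> s \<in> S"
  by (simp add: gen_def)

lemma words_wpow [simp]: "u \<in> words S \<Longrightarrow> wpow u n \<in> words S"
  by (induction n) (simp_all add: wpow_def)

lemma words_wcomm [simp]: "u \<in> words S \<Longrightarrow> v \<in> words S \<Longrightarrow> wcomm u v \<in> words S"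
  by (simp add: wcomm_def)

lemma words_wconj [simp]: "u \<in> words S \<Longrightarrow> v \<in> words S \<Longrightarrow> wconj u v \<in> words S"
  by (simp add: wconj_def)

context group
begin

lemma weval_simps [simp]:
  "weval G f [] = \<one>"
  "weval G f ((s, b) # u) = (if b then f s else inv f s) \<otimes> weval G f u"
  by (simp_all add: weval_def)

lemma weval_closed: "f \<in> S \<rightarrow> carrier G \<Longrightarrow> u \<in> words S \<Longrightarrow> weval G f u \<in> carrier G"
  by (induction u) (auto simp: Pi_iff split: prod.splits)

lemma weval_append:
  "f \<in> S \<rightarrow> carrier G \<Longrightarrow> u \<in> words S \<Longrightarrow> v \<in> words S \<Longrightarrow> weval G f (u @ v) = weval G f u \<otimes> weval G f v"
proof (induction u)
  case Nil
  then show ?case using weval_closed[OF Nil(1,3)] by simp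
next
  case (Cons a u)
  obtain s b where a: "a = (s, b)" by (cases a)
  have "f s \<in> carrier G" using Cons a by auto
  moreover have "weval G f u \<in> carrier G" "weval G f v \<in> carrier G"
    using Cons weval_closed[OF Cons.prems(1)] by auto
  ultimately show ?case using Cons a by (simp add: m_assoc)
qed

lemma weval_gen: "f s \<in> carrier G \<Longrightarrow> weval G f (gen s) = f s"
  by (simp add: gen_def)

lemma weval_winv:
  assumes f: "f \<in> S \<rightarrow> carrier G" and u: "u \<in> words S"
  shows "weval G f (winv u) = inv (weval G f u)"
  using u
proof (induction u)
  case (Cons a u)
  obtain s b where a: "a = (s, b)" by (cases a)
  have fs: "f s \<in> carrier G" "weval G f u \<in> carrier G" using Cons a f weval_closed[OF f] by auto
  have "winv (a # u) = winv u @ [(s, \<not> b)]" by (simp add: a winv_def)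
  then have "weval G f (winv (a # u)) = inv (weval G f u) \<otimes> weval G f [(s, \<not> b)]"
    using weval_append[OF f, of "winv u" "[(s, \<not> b)]"] Cons a by simp
  then show ?case using fs a by (auto simp: inv_mult_group)
qed (simp add: winv_def)

lemma weval_wpow:
  assumes f: "f \<in> S \<rightarrow> carrier G" and u: "u \<in> words S"
  shows "weval G f (wpow u n) = weval G f u [^] n"
proof (induction n)
  case (Suc n)
  have "wpow u (Suc n) = u @ wpow u n" by (simp add: wpow_def)
  then have "weval G f (wpow u (Suc n)) = weval G f u \<otimes> weval G f u [^] n"
    using Suc weval_append[OF f u words_wpow[OF u]] by simp
  also have "\<dots> = weval G f u [^] Suc n" by (rule nat_pow_Suc2[OF weval_closed[OF f u], symmetric])
  finally show ?case .
qed (simp add: wpow_def)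

lemma mult_inv_eq_iff:
  assumes "a \<in> carrier G" "b \<in> carrier G" "c \<in> carrier G"
  shows "a \<otimes> inv b = c \<longleftrightarrow> a = c \<otimes> b"
  using assms by (auto simp: m_assoc)

lemma inv_mult_eq_iff:
  assumes "a \<in> carrier G" "b \<in> carrier G" "c \<in> carrier G"
  shows "inv b \<otimes> a = c \<longleftrightarrow> a = b \<otimes> c"
  using assms by (auto simp: m_assoc[symmetric])

lemma weval_wcomm:
  assumes f: "f \<in> S \<rightarrow> carrier G" and u: "u \<in> words S" "v \<in> words S" and c: "c \<in> carrier G"
  shows "weval G f (wcomm u v) = c \<longleftrightarrow> weval G f u \<otimes> weval G f v = c \<otimes> weval G f v \<otimes> weval G f u"
proof -
  note cl = weval_closed[OF f u(1)] weval_closed[OF f u(2)]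
  have "weval G f (wcomm u v) = weval G f u \<otimes> weval G f v \<otimes> inv (weval G f v \<otimes> weval G f u)"
    using cl by (simp add: wcomm_def weval_append[OF f] u weval_winv[OF f] m_assoc inv_mult_group)
  then show ?thesis
    using cl c mult_inv_eq_iff[of "weval G f u \<otimes> weval G f v" "weval G f v \<otimes> weval G f u" c] by (simp add: m_assoc)
qed

lemma weval_wconj:
  assumes f: "f \<in> S \<rightarrow> carrier G" and u: "u \<in> words S" "v \<in> words S" and c: "c \<in> carrier G"
  shows "weval G f (wconj u v) = c \<longleftrightarrow> weval G f u \<otimes> weval G f v = weval G f v \<otimes> c"
proof -
  note cl = weval_closed[OF f u(1)] weval_closed[OF f u(2)]
  have "weval G f (wconj u v) = inv (weval G f v) \<otimes> (weval G f u \<otimes> weval G f v)"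
    using cl by (simp add: wconj_def weval_append[OF f] u weval_winv[OF f])
  then show ?thesis
    using cl c inv_mult_eq_iff[of "weval G f u \<otimes> weval G f v" "weval G f v" c] by simp
qed

lemma weval_cong:
  assumes f: "f \<in> S \<rightarrow> carrier G"
    and E: "\<And>u v. (u, v) \<in> E \<Longrightarrow> u \<in> words S \<Longrightarrow> v \<in> words S \<Longrightarrow> weval G f u = weval G f v"
    and uv: "(u, v) \<in> word_cong S E"
  shows "weval G f u = weval G f v"
  using uv
proof (induction rule: word_cong.induct)
  case (append u u' v v')
  then show ?case using word_cong_words[of _ _ S E] by (metis weval_append[OF f])
next
  case (cancel s b)
  then have "f s \<in> carrier G" using f by auto
  then show ?case by (cases b) simp_all
qed (use E in auto)

end

definition pcls :: "'g set \<Rightarrow> ('g word \<times> 'g word) set \<Rightarrow> 'g \<Rightarrow> 'g word set" where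
  "pcls S E s = word_cong S E `` {gen s}"

lemma presented_group_carrierI: "u \<in> words S \<Longrightarrow> word_cong S E `` {u} \<in> carrier (presented_group S E)"
  by (simp add: presented_group_def quotientI)

lemma pcls_closed [simp]: "s \<in> S \<Longrightarrow> pcls S E s \<in> carrier (presented_group S E)"
  by (simp add: pcls_def presented_group_carrierI)

lemma presented_group_carrierE:
  assumes "A \<in> carrier (presented_group S E)"
  obtains u where "u \<in> words S" "A = word_cong S E `` {u}"
  using assms by (auto simp: presented_group_def elim: quotientE)

lemma presented_group_inv_letter:
  assumes "s \<in> S"
  shows "inv\<^bsub>presented_group S E\<^esub> (pcls S E s) = word_cong S E `` {[(s, False)]}"
proof (rule group.inv_equality[OF group_presented_group])
  have "word_cong S E `` {[(s, False)]} \<otimes>\<^bsub>presented_group S E\<^esub> pcls S E s = word_cong S E `` {[(s, False), (s, True)]}"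
    using assms by (simp add: pcls_def presented_group_mult gen_def)
  also have "\<dots> = word_cong S E `` {[]}"
    using word_cong.cancel[OF assms, of False E] by (intro equiv_class_eq[OF equiv_word_cong]) simp
  finally show "word_cong S E `` {[(s, False)]} \<otimes>\<^bsub>presented_group S E\<^esub> pcls S E s = \<one>\<^bsub>presented_group S E\<^esub>"
    by (simp add: presented_group_def)
qed (use assms in \<open>auto intro: presented_group_carrierI\<close>)

lemma weval_presented:
  assumes "u \<in> words S"
  shows "weval (presented_group S E) (pcls S E) u = word_cong S E `` {u}"
  using assms
proof (induction u)
  case Nil
  then show ?case by (simp add: group.weval_simps[OF group_presented_group]) (simp add: presented_group_def)
next
  case (Cons a u)
  obtain s b where a: "a = (s, b)" by (cases a)
  have s: "s \<in> S" and u: "u \<in> words S" using Cons a by auto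
  have 1: "(if b then pcls S E s else inv\<^bsub>presented_group S E\<^esub> pcls S E s) = word_cong S E `` {[(s, b)]}"
    using presented_group_inv_letter[OF s] by (simp add: pcls_def gen_def)
  show ?case
    using Cons a s u presented_group_mult[of "[(s, b)]" S u E]
    by (simp add: group.weval_simps[OF group_presented_group] 1 del: if_split)
qed

lemma weval_presented_relation:
  assumes "(u, v) \<in> E" "u \<in> words S" "v \<in> words S"
  shows "weval (presented_group S E) (pcls S E) u = weval (presented_group S E) (pcls S E) v"
  using assms by (simp add: weval_presented equiv_class_eq[OF equiv_word_cong word_cong.relation])

lemma presented_group_generate:
  "generate (presented_group S E) (pcls S E ` S) = carrier (presented_group S E)"
proof
  interpret group "presented_group S E" by (rule group_presented_group)
  show "generate (presented_group S E) (pcls S E ` S) \<subseteq> carrier (presented_group S E)"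
    by (rule generate_incl) auto
  have "weval (presented_group S E) (pcls S E) u \<in> generate (presented_group S E) (pcls S E ` S)"
    if "u \<in> words S" for u
    using that
  proof (induction u)
    case Nil
    then show ?case by (simp add: generate.one)
  next
    case (Cons a u)
    obtain s b where a: "a = (s, b)" by (cases a)
    then have "s \<in> S" using Cons by simp
    then have "(if b then pcls S E s else inv\<^bsub>presented_group S E\<^esub> pcls S E s) \<in> generate (presented_group S E) (pcls S E ` S)"
      by (auto intro: generate.incl generate.inv)
    then show ?case using Cons a by (auto intro: generate.eng)
  qed
  then show "carrier (presented_group S E) \<subseteq> generate (presented_group S E) (pcls S E ` S)"
    using weval_presented by (metis presented_group_carrierE subsetI)
qed

text \<open>Von Dyck's theorem.\<close>

lemma presented_group_hom:
  assumes K: "group K" and f: "f \<in> S \<rightarrow> carrier K"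
    and E: "\<And>u v. (u, v) \<in> E \<Longrightarrow> u \<in> words S \<Longrightarrow> v \<in> words S \<Longrightarrow> weval K f u = weval K f v"
  shows "\<exists>h\<in>hom (presented_group S E) K. \<forall>s\<in>S. h (pcls S E s) = f s"
proof -
  interpret group K by (rule K)
  define h where "h A = weval K f (SOME u. u \<in> A)" for A
  have h: "h (word_cong S E `` {u}) = weval K f u" if u: "u \<in> words S" for u
  proof -
    have "u \<in> word_cong S E `` {u}" using word_cong.refl[OF u] by simp
    then have "(SOME v. v \<in> word_cong S E `` {u}) \<in> word_cong S E `` {u}" by (rule someI)
    then have "(u, SOME v. v \<in> word_cong S E `` {u}) \<in> word_cong S E" by simp
    from weval_cong[OF f E this] show ?thesis by (simp add: h_def)
  qed
  have "h \<in> hom (presented_group S E) K"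
  proof (rule homI)
    fix A assume "A \<in> carrier (presented_group S E)"
    then show "h A \<in> carrier K" using h weval_closed[OF f] by (metis presented_group_carrierE)
  next
    fix A B assume "A \<in> carrier (presented_group S E)" "B \<in> carrier (presented_group S E)"
    then obtain u v where "u \<in> words S" "A = word_cong S E `` {u}" "v \<in> words S" "B = word_cong S E `` {v}"
      by (metis presented_group_carrierE)
    then show "h (A \<otimes>\<^bsub>presented_group S E\<^esub> B) = h A \<otimes>\<^bsub>K\<^esub> h B"
      by (simp add: presented_group_mult h weval_append[OF f])
  qed
  moreover have "h (pcls S E s) = f s" if "s \<in> S" for s
    using h[of "gen s"] that f weval_gen[of f s] by (auto simp: pcls_def)
  ultimately show ?thesis by blast
qed

subsection \<open>Orders of groups built up by adjoining one generator at a time\<close>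

text \<open>Since \<open>x\<close> normalises the old subgroup and has order \<open>k\<close> modulo
  it, every element is uniquely \<open>x^i * n\<close> with \<open>i < k\<close>.\<close>

lemma (in group) card_generate_insert:
  assumes S: "S \<subseteq> carrier G" and x: "x \<in> carrier G" and fin: "finite (generate G S)"
    and k: "0 < k" "x [^] (k::nat) = \<one>"
    and norm: "\<And>s. s \<in> S \<Longrightarrow> s \<otimes> x \<in> (\<otimes>) x ` generate G S"
    and ne: "\<And>i. 0 < i \<Longrightarrow> i < k \<Longrightarrow> x [^] (i::nat) \<notin> generate G S"
  shows "finite (generate G (insert x S))" "card (generate G (insert x S)) = k * card (generate G S)"
proof -
  define N where "N = generate G S"
  have sN: "subgroup N G" unfolding N_def using S by (rule generate_is_subgroup)
  have NG: "N \<subseteq> carrier G" using sN by (rule subgroup.subset)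
  have Nc: "n \<in> carrier G" if "n \<in> N" for n using that NG by blast
  have Nm: "a \<otimes> b \<in> N" if "a \<in> N" "b \<in> N" for a b using that sN by (simp add: subgroup.m_closed)
  have Ni: "inv a \<in> N" if "a \<in> N" for a using that sN by (simp add: subgroup.m_inv_closed)
  have N1: "\<one> \<in> N" using sN by (simp add: subgroup.one_closed)
  \<comment> \<open>This set is a subgroup, so moving elements past \<open>x\<close> has to be
    checked on \<open>S\<close> only.\<close>
  have sub: "subgroup {n\<in>N. n \<otimes> x \<in> (\<otimes>) x ` N} G"
  proof (rule subgroupI)
    show "{n\<in>N. n \<otimes> x \<in> (\<otimes>) x ` N} \<noteq> {}" using N1 x by (auto intro!: exI[of _ \<one>] image_eqI[of _ _ \<one>])
    fix a assume a: "a \<in> {n\<in>N. n \<otimes> x \<in> (\<otimes>) x ` N}"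
    then obtain n where n: "n \<in> N" "a \<otimes> x = x \<otimes> n" by auto
    have c: "a \<in> carrier G" "n \<in> carrier G" using a n Nc by auto
    have "inv a \<otimes> x = inv a \<otimes> (x \<otimes> n) \<otimes> inv n" using c x by (simp add: m_assoc)
    also have "\<dots> = x \<otimes> inv n" using c x by (simp flip: n(2) add: m_assoc[symmetric])
    finally show "inv a \<in> {n\<in>N. n \<otimes> x \<in> (\<otimes>) x ` N}" using a n Ni by auto
    fix b assume b: "b \<in> {n\<in>N. n \<otimes> x \<in> (\<otimes>) x ` N}"
    then obtain m where m: "m \<in> N" "b \<otimes> x = x \<otimes> m" by auto
    have d: "b \<in> carrier G" "m \<in> carrier G" using b m Nc by auto
    have "a \<otimes> b \<otimes> x = a \<otimes> x \<otimes> m" using c d x m by (simp add: m_assoc)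
    also have "\<dots> = x \<otimes> (n \<otimes> m)" using c d x n by (simp add: m_assoc)
    finally show "a \<otimes> b \<in> {n\<in>N. n \<otimes> x \<in> (\<otimes>) x ` N}" using a b n m Nm by auto
  qed (use NG in auto)
  have "S \<subseteq> {n\<in>N. n \<otimes> x \<in> (\<otimes>) x ` N}" using norm by (auto simp: N_def generate.incl)
  from generate_subgroup_incl[OF this sub] have nx: "\<exists>m\<in>N. n \<otimes> x = x \<otimes> m" if "n \<in> N" for n
    using that by (auto simp: N_def[symmetric])
  have nxp: "\<exists>m\<in>N. n \<otimes> x [^] (j::nat) = x [^] j \<otimes> m" if "n \<in> N" for n j
  proof (induction j)
    case 0
    then show ?case using that Nc by auto
  next
    case (Suc j)
    then obtain m where m: "m \<in> N" "n \<otimes> x [^] j = x [^] j \<otimes> m" by auto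
    obtain m' where m': "m' \<in> N" "m \<otimes> x = x \<otimes> m'" using nx m by blast
    have "n \<otimes> x [^] Suc j = (n \<otimes> x [^] j) \<otimes> x" using that x Nc by (simp add: m_assoc)
    also have "\<dots> = x [^] j \<otimes> (m \<otimes> x)" using m x Nc by (simp add: m_assoc)
    also have "\<dots> = x [^] Suc j \<otimes> m'" using m' x Nc by (simp add: m_assoc)
    finally show ?case using m' by blast
  qed
  have pm: "x [^] (i mod k) = x [^] i" for i :: nat
  proof -
    have "x [^] i = x [^] (k * (i div k) + i mod k)" by simp
    also have "\<dots> = x [^] (k * (i div k)) \<otimes> x [^] (i mod k)" by (rule nat_pow_mult[OF x, symmetric])
    also have "x [^] (k * (i div k)) = (x [^] k) [^] (i div k)" by (rule nat_pow_pow[OF x, symmetric])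
    finally show ?thesis using x k by simp
  qed
  define A where "A = (\<lambda>(i, n). x [^] (i::nat) \<otimes> n) ` ({..<k} \<times> N)"
  have AI: "x [^] i \<otimes> n \<in> A" if "n \<in> N" for i :: nat and n
    unfolding A_def using that k pm[of i] by (intro image_eqI[of _ _ "(i mod k, n)"]) auto
  have sA: "subgroup A G"
  proof (rule subgroupI)
    show "A \<subseteq> carrier G" using x Nc by (auto simp: A_def)
    show "A \<noteq> {}" using AI N1 by blast
    fix a assume "a \<in> A"
    then obtain i n where a: "i < k" "n \<in> N" "a = x [^] i \<otimes> n" by (auto simp: A_def)
    obtain m where m: "m \<in> N" "inv n \<otimes> x [^] (k - i) = x [^] (k - i) \<otimes> m" using nxp Ni a by blast
    have "inv (x [^] i) = x [^] (k - i)"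
      using a x k by (intro inv_equality) (simp_all add: nat_pow_mult)
    then have "inv a = x [^] (k - i) \<otimes> m" using a x m Nc by (simp add: inv_mult_group)
    then show "inv a \<in> A" using AI m by simp
    fix b assume "b \<in> A"
    then obtain d where "d \<in> {..<k} \<times> N" "b = (\<lambda>(i, n). x [^] (i::nat) \<otimes> n) d" unfolding A_def by blast
    then have "snd d \<in> N" "b = x [^] fst d \<otimes> snd d" by auto
    then obtain j r where b: "r \<in> N" "b = x [^] (j::nat) \<otimes> r" by blast
    obtain q where q: "q \<in> N" "n \<otimes> x [^] j = x [^] j \<otimes> q" using nxp a by blast
    have "a \<otimes> b = x [^] i \<otimes> (n \<otimes> x [^] j) \<otimes> r" using a b x Nc by (simp add: m_assoc)
    also have "\<dots> = x [^] (i + j) \<otimes> (q \<otimes> r)" using q b x Nc by (simp add: m_assoc flip: nat_pow_mult)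
    finally show "a \<otimes> b \<in> A" using AI Nm q b by simp
  qed
  have gA: "generate G (insert x S) = A"
  proof
    have "x \<in> A" using AI[OF N1, of 1] x by simp
    moreover have "s \<in> A" if "s \<in> S" for s
      using AI[of s 0] that S by (auto simp: N_def generate.incl)
    ultimately show "generate G (insert x S) \<subseteq> A" by (intro generate_subgroup_incl sA) auto
    have g: "subgroup (generate G (insert x S)) G" using S x by (intro generate_is_subgroup) auto
    have "x [^] i \<in> generate G (insert x S)" for i :: nat
      by (induction i) (auto intro: subgroup.m_closed[OF g] subgroup.one_closed[OF g] generate.incl)
    moreover have "N \<subseteq> generate G (insert x S)" unfolding N_def by (rule mono_generate) auto
    ultimately show "A \<subseteq> generate G (insert x S)" by (auto simp: A_def intro!: subgroup.m_closed[OF g])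
  qed
  show "finite (generate G (insert x S))" using fin by (simp add: gA A_def N_def)
  have key: False if "i < j" "j < k" "n \<in> N" "m \<in> N" "x [^] i \<otimes> n = x [^] j \<otimes> m" for i j :: nat and n m
  proof -
    have "x [^] j = x [^] i \<otimes> x [^] (j - i)" using that x by (simp add: nat_pow_mult)
    then have "x [^] i \<otimes> n = x [^] i \<otimes> (x [^] (j - i) \<otimes> m)" using that x Nc by (simp add: m_assoc)
    then have e: "n = x [^] (j - i) \<otimes> m" using that x Nc by simp
    have "x [^] (j - i) = n \<otimes> inv m" using that x Nc by (simp add: e m_assoc)
    then have "x [^] (j - i) \<in> N" using that Nm Ni by simp
    then show False using ne[of "j - i"] that by (simp add: N_def)
  qed
  have "inj_on (\<lambda>(i, n). x [^] (i::nat) \<otimes> n) ({..<k} \<times> N)"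
  proof (rule inj_onI)
    fix a b assume ab: "a \<in> {..<k} \<times> N" "b \<in> {..<k} \<times> N"
      and "(\<lambda>(i, n). x [^] (i::nat) \<otimes> n) a = (\<lambda>(i, n). x [^] (i::nat) \<otimes> n) b"
    then have e: "x [^] fst a \<otimes> snd a = x [^] fst b \<otimes> snd b" by (simp add: case_prod_beta)
    have "fst a = fst b"
      using key[of "fst a" "fst b" "snd a" "snd b"] key[of "fst b" "fst a" "snd b" "snd a"] e ab
      by (metis mem_Times_iff lessThan_iff linorder_neqE_nat)
    moreover have "snd a = snd b" using e ab x Nc calculation by (auto simp: mem_Times_iff)
    ultimately show "a = b" by (simp add: prod_eq_iff)
  qed
  then have "card A = card ({..<k} \<times> N)" unfolding A_def by (rule card_image)
  then show "card (generate G (insert x S)) = k * card (generate G S)" by (simp add: gA N_def card_cartesian_product)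
qed

text \<open>A homomorphism that kills \<open>S\<close> but none of the powers of \<open>x\<close> shows that \<open>x\<close> has order \<open>k\<close>
  modulo the subgroup generated by \<open>S\<close>.\<close>

lemma (in group) power_notin_generate:
  assumes h: "h \<in> hom G K" and K: "group K" and S: "S \<subseteq> carrier G" and x: "x \<in> carrier G"
    and kill: "\<And>s. s \<in> S \<Longrightarrow> h s = \<one>\<^bsub>K\<^esub>" and hx: "h x [^]\<^bsub>K\<^esub> (i::nat) \<noteq> \<one>\<^bsub>K\<^esub>"
  shows "x [^] i \<notin> generate G S"
proof
  interpret gh: group_hom G K h using h K by (simp add: group_hom_def group_hom_axioms_def is_group)
  assume "x [^] i \<in> generate G S"
  moreover have "S \<subseteq> kernel G K h" using S kill by (auto simp: kernel_def)
  then have "generate G S \<subseteq> kernel G K h" by (intro generate_subgroup_incl gh.subgroup_kernel)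
  ultimately have "h (x [^] i) = \<one>\<^bsub>K\<^esub>" by (auto simp: kernel_def)
  then show False using hx x gh.hom_nat_pow by simp
qed

subsection \<open>Unitriangular matrices\<close>

text \<open>The 4 by 4 upper unitriangular matrices over the integers modulo \<open>m\<close>; the entries are listed in
  the order (1,2), (2,3), (3,4), (1,3), (2,4), (1,4).\<close>

type_synonym ut = "int \<times> int \<times> int \<times> int \<times> int \<times> int"

definition UT :: "nat \<Rightarrow> ut monoid" where
  "UT m = \<lparr>carrier = {0..<int m} \<times> {0..<int m} \<times> {0..<int m} \<times> {0..<int m} \<times> {0..<int m} \<times> {0..<int m},
    monoid.mult = (\<lambda>(a, b, c, d, e, f) (a', b', c', d', e', f').
      ((a + a') mod int m, (b + b') mod int m, (c + c') mod int m, (d + d' + a * b') mod int m,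
       (e + e' + b * c') mod int m, (f + f' + a * e' + d * c') mod int m)),
    one = (0, 0, 0, 0, 0, 0)\<rparr>"

text \<open>The (1,4) entry of the associative law. Inner reductions are stripped first, so that a
  polynomial identity over the integers remains.\<close>

lemma ut_assoc4: "((f + f' + a * e' + d * c') mod m + f'' + ((a + a') mod m) * e'' + ((d + d' + a * b') mod m) * c'') mod m
  = (f + ((f' + f'' + a' * e'' + d' * c'') mod m) + a * ((e' + e'' + b' * c'') mod m) + d * ((c' + c'') mod m)) mod (m::int)"
proof -
  have "((f + f' + a * e' + d * c') mod m + f'' + ((a + a') mod m) * e'' + ((d + d' + a * b') mod m) * c'') mod m
    = ((f + f' + a * e' + d * c') + f'' + (a + a') * e'' + (d + d' + a * b') * c'') mod m"
    by (intro mod_add_cong mod_mult_cong) simp_all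
  also have "\<dots> = (f + (f' + f'' + a' * e'' + d' * c'') + a * (e' + e'' + b' * c'') + d * (c' + c'')) mod m"
    by (rule arg_cong[of _ _ "\<lambda>x. x mod m"]) (simp only: algebra_simps)
  also have "\<dots> = (f + ((f' + f'' + a' * e'' + d' * c'') mod m) + a * ((e' + e'' + b' * c'') mod m) + d * ((c' + c'') mod m)) mod m"
    by (intro mod_add_cong mod_mult_cong) simp_all
  finally show ?thesis .
qed
lemma ut_assoc3: "((d + d' + a * b') mod m + d'' + ((a + a') mod m) * b'') mod m
   = (d + ((d' + d'' + a' * b'') mod m) + a * ((b' + b'') mod m)) mod (m::int)"
proof -
  have "((d + d' + a * b') mod m + d'' + ((a + a') mod m) * b'') mod m = ((d + d' + a * b') + d'' + (a + a') * b'') mod m"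
    by (intro mod_add_cong mod_mult_cong) simp_all
  also have "\<dots> = (d + (d' + d'' + a' * b'') + a * (b' + b'')) mod m"
    by (rule arg_cong[of _ _ "\<lambda>x. x mod m"]) (simp only: algebra_simps)
  also have "\<dots> = (d + ((d' + d'' + a' * b'') mod m) + a * ((b' + b'') mod m)) mod m" by (intro mod_add_cong mod_mult_cong) simp_all
  finally show ?thesis .
qed
lemma ut_assoc2: "((a + a') mod m + a'') mod m = (a + ((a' + a'') mod m)) mod (m::int)"
  by (simp add: mod_simps add.assoc)
lemma ut_inv3: "((a * b - d) mod m + d + ((- a) mod m) * b) mod m = (0::int)"
proof -
  have "((a * b - d) mod m + d + ((- a) mod m) * b) mod m = ((a * b - d) + d + (- a) * b) mod m"
    by (intro mod_add_cong mod_mult_cong) simp_all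
  then show ?thesis by simp
qed

lemma ut_inv4: "((a * e + d * c - a * b * c - f) mod m + f + ((- a) mod m) * e + ((a * b - d) mod m) * c) mod m = (0::int)"
proof -
  have "((a * e + d * c - a * b * c - f) mod m + f + ((- a) mod m) * e + ((a * b - d) mod m) * c) mod m
    = ((a * e + d * c - a * b * c - f) + f + (- a) * e + (a * b - d) * c) mod m"
    by (intro mod_add_cong mod_mult_cong) simp_all
  also have "(a * e + d * c - a * b * c - f) + f + (- a) * e + (a * b - d) * c = 0" by (simp add: algebra_simps)
  finally show ?thesis by simp
qed

lemma group_UT: "0 < m \<Longrightarrow> group (UT m)"
proof (rule groupI)
  assume m: "0 < m"
  fix u v w assume "u \<in> carrier (UT m)" "v \<in> carrier (UT m)" "w \<in> carrier (UT m)"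
  obtain a b c d e f where u: "u = (a, b, c, d, e, f)" by (cases u)
  obtain a' b' c' d' e' f' where v: "v = (a', b', c', d', e', f')" by (cases v)
  obtain a'' b'' c'' d'' e'' f'' where w: "w = (a'', b'', c'', d'', e'', f'')" by (cases w)
  show "u \<otimes>\<^bsub>UT m\<^esub> v \<otimes>\<^bsub>UT m\<^esub> w = u \<otimes>\<^bsub>UT m\<^esub> (v \<otimes>\<^bsub>UT m\<^esub> w)"
    unfolding u v w UT_def by (simp only: monoid.simps partial_object.simps prod.case prod.inject ut_assoc2 ut_assoc3 ut_assoc4 simp_thms)
next
  assume m: "0 < m"
  fix u assume u: "u \<in> carrier (UT m)"
  obtain a b c d e f where e: "u = (a, b, c, d, e, f)" by (cases u)
  \<comment> \<open>The entries of \<open>I - N + N^2 - N^3\<close>, the inverse of the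
    unitriangular matrix \<open>I + N\<close>.\<close>
  let ?v = "((- a) mod int m, (- b) mod int m, (- c) mod int m, (a * b - d) mod int m, (b * c - e) mod int m,
    (a * e + d * c - a * b * c - f) mod int m)"
  have "((- x) mod int m + x) mod int m = 0" for x by (simp add: mod_simps)
  then have "?v \<otimes>\<^bsub>UT m\<^esub> u = \<one>\<^bsub>UT m\<^esub>"
    unfolding e UT_def by (simp only: monoid.simps partial_object.simps prod.case prod.inject ut_inv3 ut_inv4 simp_thms)
  moreover have "?v \<in> carrier (UT m)" using m by (simp add: UT_def)
  ultimately show "\<exists>v\<in>carrier (UT m). v \<otimes>\<^bsub>UT m\<^esub> u = \<one>\<^bsub>UT m\<^esub>" by blast
qed (auto simp: UT_def)

text \<open>The square of the cyclic group of order \<open>m\<close>. As the abelian quotient it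
  records the exponents of \<open>x\<close> and \<open>y\<close>.\<close>

definition CC :: "nat \<Rightarrow> (int \<times> int) monoid" where
  "CC m = \<lparr>carrier = {0..<int m} \<times> {0..<int m},
    monoid.mult = (\<lambda>(a, b) (a', b'). ((a + a') mod int m, (b + b') mod int m)), one = (0, 0)\<rparr>"

lemma comm_group_CC: "0 < m \<Longrightarrow> comm_group (CC m)"
proof (rule comm_groupI)
  assume m: "0 < m"
  fix u assume u: "u \<in> carrier (CC m)"
  obtain a b where e: "u = (a, b)" by (cases u)
  have "((- a) mod int m, (- b) mod int m) \<otimes>\<^bsub>CC m\<^esub> u = \<one>\<^bsub>CC m\<^esub>" by (simp add: CC_def e mod_simps)
  moreover have "((- a) mod int m, (- b) mod int m) \<in> carrier (CC m)" using m by (simp add: CC_def)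
  ultimately show "\<exists>v\<in>carrier (CC m). v \<otimes>\<^bsub>CC m\<^esub> u = \<one>\<^bsub>CC m\<^esub>" by blast
qed (auto simp: CC_def mod_simps algebra_simps)

lemma CC_pow: "(a, b) [^]\<^bsub>CC m\<^esub> (n::nat) = (if n = 0 then (0, 0) else ((int n * a) mod int m, (int n * b) mod int m))"
proof (induction n)
  case 0
  then show ?case by (simp add: nat_pow_def CC_def)
next
  case (Suc n)
  have "(a, b) [^]\<^bsub>CC m\<^esub> Suc n = (a, b) [^]\<^bsub>CC m\<^esub> n \<otimes>\<^bsub>CC m\<^esub> (a, b)" by (simp add: nat_pow_def)
  then show ?case using Suc by (auto simp: CC_def mod_simps algebra_simps)
qed

section \<open>Cayley embeddings\<close>

instance perm :: (type) group_mult
  by standard simp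

lemma (in group) mem_Sigma_set:
  assumes finite_carrier: "finite (carrier G)" and xy: "x \<in> carrier G" "y \<in> carrier G" and a: "a \<in> {x, y, x \<otimes> y}" and g: "g \<in> carrier G"
  shows "conj_elt G (a [^] (i::nat)) g \<in> Sigma_set G x y"
proof -
  have aG: "a \<in> carrier G" using a xy by auto
  have o: "0 < order G" using finite_carrier one_closed unfolding order_def card_gt_0_iff by blast
  \<comment> \<open>\<open>Sigma_set\<close> lets exponents run from 1 to the order, so remainder 0
    is represented by the order itself.\<close>
  define k where "k = (if i mod order G = 0 then order G else i mod order G)"
  have k: "k \<in> {1..order G}" using o mod_less_divisor[OF o, of i] unfolding k_def by auto
  have "a [^] i = a [^] (order G * (i div order G) + i mod order G)" by simp
  also have "\<dots> = a [^] (order G * (i div order G)) \<otimes> a [^] (i mod order G)"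
    by (rule nat_pow_mult[OF aG, symmetric])
  also have "a [^] (order G * (i div order G)) = (a [^] order G) [^] (i div order G)"
    by (rule nat_pow_pow[OF aG, symmetric])
  also have "\<dots> = \<one>" by (simp add: pow_order_eq_1[OF aG])
  finally have "a [^] i = a [^] (i mod order G)" using aG by simp
  then have "a [^] i = a [^] k" using pow_order_eq_1[OF aG] by (auto simp: k_def)
  then show ?thesis unfolding Sigma_set_def using k g a by (intro UN_I[of k] UN_I[of g]) auto
qed

locale group_embedding = group G for G :: "('a, 'm) monoid_scheme" (structure) +
  fixes \<phi> :: "'a \<Rightarrow> 'b::group_mult"
  assumes finite_carrier: "finite (carrier G)" and inj: "inj_on \<phi> (carrier G)"
    and mult: "a \<in> carrier G \<Longrightarrow> b \<in> carrier G \<Longrightarrow> \<phi> (a \<otimes> b) = \<phi> a * \<phi> b"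
begin

abbreviation "H \<equiv> \<phi> ` carrier G"

lemma eq_iff: "a \<in> carrier G \<Longrightarrow> b \<in> carrier G \<Longrightarrow> \<phi> a = \<phi> b \<longleftrightarrow> a = b"
  using inj by (simp add: inj_on_eq_iff)

lemma map_one: "\<phi> \<one> = 1"
  using mult[of \<one> \<one>] g_mult_left_eq[of "\<phi> \<one>" "\<phi> \<one>" 1] by simp

lemma inverse: "a \<in> carrier G \<Longrightarrow> \<phi> (inv a) = inverse (\<phi> a)"
  using mult[of a "inv a"] by (simp add: map_one g_inverse_unique)

lemma pow: "a \<in> carrier G \<Longrightarrow> \<phi> (a [^] n) = \<phi> a ^ (n::nat)"
  by (induction n) (simp_all add: map_one mult power_commutes)

lemma eq_one_iff: "a \<in> carrier G \<Longrightarrow> \<phi> a = 1 \<longleftrightarrow> a = \<one>"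
  using eq_iff[of a \<one>] by (simp add: map_one)

lemma subgrp_image: "subgroup K G \<Longrightarrow> subgrp (\<phi> ` K)"
proof (rule subgrpI)
  assume K: "subgroup K G"
  show "1 \<in> \<phi> ` K" using subgroup.one_closed[OF K] by (metis map_one imageI)
  fix a assume "a \<in> \<phi> ` K"
  then obtain u where u: "u \<in> K" "a = \<phi> u" by blast
  then show "inverse a \<in> \<phi> ` K"
    using subgroup.m_inv_closed[OF K u(1)] subgroup.mem_carrier[OF K u(1)] by (metis inverse imageI)
  fix b assume "b \<in> \<phi> ` K"
  then obtain v where v: "v \<in> K" "b = \<phi> v" by blast
  then show "a * b \<in> \<phi> ` K"
    using subgroup.m_closed[OF K u(1) v(1)] u subgroup.mem_carrier[OF K] by (metis mult imageI)
qed

lemma subgrp_H: "subgrp H"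
  by (rule subgrp_image[OF subgroup_self])

lemma card_H: "card H = order G"
  by (simp add: card_image[OF inj] order_def)

lemma iso_H: "G \<cong> monoid_of H"
proof (rule is_isoI[OF isoI])
  show "\<phi> \<in> hom G (monoid_of H)" by (rule homI) (auto simp: mult)
  show "bij_betw \<phi> (carrier G) (carrier (monoid_of H))" using inj by (simp add: bij_betw_def)
qed

lemma sgen_image:
  assumes S: "S \<subseteq> carrier G"
  shows "sgen (\<phi> ` S) = \<phi> ` generate G S"
proof
  show "sgen (\<phi> ` S) \<subseteq> \<phi> ` generate G S"
    by (intro gen_least subgrp_image generate_is_subgroup image_mono S) (auto intro: generate.incl)
  have "\<phi> a \<in> sgen (\<phi> ` S)" if "a \<in> generate G S" for a
    using that
  proof induction
    case one
    then show ?case using subgrp_one[OF subgrp_gen] by (simp only: map_one)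
  next
    case (incl h)
    then show ?case by (auto intro: gen_incl)
  next
    case (inv h)
    then have "h \<in> carrier G" "\<phi> h \<in> sgen (\<phi> ` S)" using S by (auto intro: gen_incl)
    then show ?case by (simp add: inverse subgrp_inverse[OF subgrp_gen])
  next
    case (eng h1 h2)
    moreover have "h1 \<in> carrier G" "h2 \<in> carrier G" using eng generate_incl[OF S] by auto
    ultimately show ?case by (simp add: mult subgrp_mult[OF subgrp_gen])
  qed
  then show "\<phi> ` generate G S \<subseteq> sgen (\<phi> ` S)" by blast
qed

lemma sgen_pair_iff:
  assumes "x \<in> carrier G" "y \<in> carrier G"
  shows "sgen {\<phi> x, \<phi> y} = H \<longleftrightarrow> generating_pair G x y"
  using sgen_image[of "{x, y}"] assms generate_incl[of "{x, y}"] inj_on_image_eq_iff[OF inj, of "generate G {x, y}" "carrier G"]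
  by (simp add: generating_pair_def)

lemma noncomm: "\<not> comm_group G \<Longrightarrow> \<exists>a\<in>H. \<exists>b\<in>H. a * b \<noteq> b * a"
proof (rule ccontr)
  assume n: "\<not> comm_group G" and "\<not> (\<exists>a\<in>H. \<exists>b\<in>H. a * b \<noteq> b * a)"
  then have "a \<otimes> b = b \<otimes> a" if "a \<in> carrier G" "b \<in> carrier G" for a b
    using that eq_iff[of "a \<otimes> b" "b \<otimes> a"] by (simp add: mult)
  then have "comm_group G" by (intro group_comm_groupI) auto
  then show False using n by simp
qed

lemma fin_p_group_H: "Factorial_Ring.prime p \<Longrightarrow> order G = p ^ n \<Longrightarrow> fin_p_group H p"
  unfolding fin_p_group_def using subgrp_H finite_carrier card_H by auto

lemma beauville_pairs_H:
  assumes p: "Factorial_Ring.prime p" "order G = p ^ n" and bs: "beauville_structure G (x1, y1) (x2, y2)"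
  shows "fin_p_group.beauville_pairs H (\<phi> x1) (\<phi> y1) (\<phi> x2) (\<phi> y2)"
proof -
  interpret H: fin_p_group H p by (rule fin_p_group_H[OF p])
  have gp: "generating_pair G x1 y1" "generating_pair G x2 y2"
    and inter: "Sigma_set G x1 y1 \<inter> Sigma_set G x2 y2 = {\<one>}"
    using bs by (auto simp: beauville_structure_def)
  have c: "x1 \<in> carrier G" "y1 \<in> carrier G" "x2 \<in> carrier G" "y2 \<in> carrier G"
    using gp by (auto simp: generating_pair_def)
  have "\<not> H.meets (\<phi> a) (\<phi> b)" if a: "a \<in> {x1, y1, x1 \<otimes> y1}" and b: "b \<in> {x2, y2, x2 \<otimes> y2}" for a b
  proof
    assume "H.meets (\<phi> a) (\<phi> b)"
    then obtain i j g where g: "g \<in> carrier G" "cj (\<phi> g) (\<phi> a ^ i) = \<phi> b ^ j" "\<phi> b ^ j \<noteq> 1"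
      unfolding H.meets_def by blast
    have ab: "a \<in> carrier G" "b \<in> carrier G" using a b c by auto
    \<comment> \<open>The inverse of \<open>g\<close> appears because \<open>conj_elt\<close>
      conjugates from the other side than \<open>cj\<close>.\<close>
    have "\<phi> (conj_elt G (a [^] i) (inv g)) = cj (\<phi> g) (\<phi> a ^ i)"
      using g ab by (simp add: conj_elt_def cj_def mult inverse pow)
    also have "\<dots> = \<phi> (b [^] j)" using g ab by (simp add: pow)
    finally have "conj_elt G (a [^] i) (inv g) = b [^] j"
      using ab g by (simp add: eq_iff conj_elt_def)
    moreover have "b [^] j = conj_elt G (b [^] j) \<one>" using ab by (simp add: conj_elt_def)
    moreover have "b [^] j \<noteq> \<one>" using g ab eq_one_iff[of "b [^] j"] by (simp add: pow)
    ultimately show False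
      using inter mem_Sigma_set[OF finite_carrier c(1,2) a inv_closed[OF g(1)], of i] mem_Sigma_set[OF finite_carrier c(3,4) b one_closed, of j]
      by auto
  qed
  moreover have "\<phi> (x1 \<otimes> y1) = \<phi> x1 * \<phi> y1" "\<phi> (x2 \<otimes> y2) = \<phi> x2 * \<phi> y2" using c by (simp_all add: mult)
  ultimately have "\<forall>a\<in>{\<phi> x1, \<phi> y1, \<phi> x1 * \<phi> y1}. \<forall>b\<in>{\<phi> x2, \<phi> y2, \<phi> x2 * \<phi> y2}. \<not> H.meets a b"
    by (metis insert_iff empty_iff)
  then show ?thesis unfolding H.beauville_pairs_def using c sgen_pair_iff gp by auto
qed

end

text \<open>Left translations, extended by the identity outside the carrier; the carrier is finite,
  so they have finite support, as the type \<open>perm\<close> demands.\<close>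

lemma (in group) cayley_embedding:
  assumes "finite (carrier G)"
  shows "\<exists>\<phi> :: 'a \<Rightarrow> 'a perm. group_embedding G \<phi>"
proof -
  define f where "f g h = (if h \<in> carrier G then g \<otimes> h else h)" for g h
  have b: "bij (f g)" if g: "g \<in> carrier G" for g
  proof (rule o_bij)
    show "f (inv g) \<circ> f g = id" "f g \<circ> f (inv g) = id" using g by (auto simp: f_def fun_eq_iff m_assoc[symmetric])
  qed
  have "{h. f g h \<noteq> h} \<subseteq> carrier G" for g by (auto simp: f_def)
  then have ap: "apply (Perm.Perm (f g)) = f g" if "g \<in> carrier G" for g
    using b[OF that] assms finite_subset by (intro Perm.Perm_inverse) blast
  have "group_embedding G (\<lambda>g. Perm.Perm (f g))"
  proof (unfold_locales)
    show "inj_on (\<lambda>g. Perm.Perm (f g)) (carrier G)"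
    proof (rule inj_onI)
      fix a b assume "a \<in> carrier G" "b \<in> carrier G" "Perm.Perm (f a) = Perm.Perm (f b)"
      then have "f a \<one> = f b \<one>" using ap by metis
      then show "a = b" using \<open>a \<in> carrier G\<close> \<open>b \<in> carrier G\<close> by (simp add: f_def)
    qed
    fix a b assume "a \<in> carrier G" "b \<in> carrier G"
    then show "Perm.Perm (f (a \<otimes> b)) = Perm.Perm (f a) * Perm.Perm (f b)"
      by (intro perm_eqI) (simp add: apply_times ap f_def m_assoc)
  qed (rule assms)
  then show ?thesis by blast
qed

text \<open>Conjugacy is phrased as \<open>a^i * g = g * b^j\<close>, without inverses, so that it
  can be evaluated directly under homomorphisms.\<close>

lemma (in group) beauville_structureI:
  assumes fin: "finite (carrier G)" and gp: "generating_pair G x1 y1" "generating_pair G x2 y2"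
    and sep: "\<And>a b i j g. a \<in> {x1, y1, x1 \<otimes> y1} \<Longrightarrow> b \<in> {x2, y2, x2 \<otimes> y2} \<Longrightarrow> g \<in> carrier G \<Longrightarrow>
      a [^] (i::nat) \<otimes> g = g \<otimes> b [^] (j::nat) \<Longrightarrow> b [^] j = \<one>"
  shows "beauville_structure G (x1, y1) (x2, y2)"
proof -
  have c: "x1 \<in> carrier G" "y1 \<in> carrier G" "x2 \<in> carrier G" "y2 \<in> carrier G"
    using gp by (auto simp: generating_pair_def)
  have one: "\<one> \<in> Sigma_set G x y" if "x \<in> carrier G" "y \<in> carrier G" for x y
    using mem_Sigma_set[OF fin that, of x \<one> 0] by (simp add: conj_elt_def)
  have el: "\<exists>a\<in>{x, y, x \<otimes> y}. \<exists>i::nat. \<exists>g\<in>carrier G. u = conj_elt G (a [^] i) g" if u: "u \<in> Sigma_set G x y" for u x y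
  proof -
    obtain i g where g: "g \<in> carrier G"
      "u \<in> {conj_elt G (x [^] (i::nat)) g, conj_elt G (y [^] i) g, conj_elt G ((x \<otimes> y) [^] i) g}"
      using u unfolding Sigma_set_def by (elim UN_E)
    then have "\<exists>a\<in>{x, y, x \<otimes> y}. u = conj_elt G (a [^] i) g" by (elim insertE emptyE) simp_all
    then show ?thesis using g(1) by blast
  qed
  have "u = \<one>" if us: "u \<in> Sigma_set G x1 y1" "u \<in> Sigma_set G x2 y2" for u
  proof -
    obtain a and i :: nat and g where a: "a \<in> {x1, y1, x1 \<otimes> y1}" "g \<in> carrier G" "u = conj_elt G (a [^] i) g"
      using el[OF us(1)] by blast
    obtain b and j :: nat and h where b: "b \<in> {x2, y2, x2 \<otimes> y2}" "h \<in> carrier G" "u = conj_elt G (b [^] j) h"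
      using el[OF us(2)] by blast
    have ab: "a \<in> carrier G" "b \<in> carrier G" using a b c by auto
    have e: "inv g \<otimes> a [^] i \<otimes> g = inv h \<otimes> b [^] j \<otimes> h" using a b by (simp add: conj_elt_def)
    have "a [^] i \<otimes> (g \<otimes> inv h) = g \<otimes> (inv g \<otimes> a [^] i \<otimes> g) \<otimes> inv h"
      using a b ab by (simp add: m_assoc[symmetric])
    also have "\<dots> = g \<otimes> inv h \<otimes> b [^] j"
      using a b ab by (simp add: e m_assoc)
    finally have "b [^] j = \<one>" using sep[OF a(1) b(1), of "g \<otimes> inv h" i j] a b by simp
    then show "u = \<one>" using b by (simp add: conj_elt_def)
  qed
  then have "Sigma_set G x1 y1 \<inter> Sigma_set G x2 y2 = {\<one>}" using one c by blast
  then show ?thesis using gp by (simp add: beauville_structure_def)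
qed

text \<open>Von Dyck's theorem gives a surjection onto \<open>K\<close>, and equal finite orders
  make it injective.\<close>

lemma iso_presented_group:
  assumes K: "group K" and f: "f \<in> S \<rightarrow> carrier K"
    and E: "\<And>u v. (u, v) \<in> E \<Longrightarrow> u \<in> words S \<Longrightarrow> v \<in> words S \<Longrightarrow> weval K f u = weval K f v"
    and g: "generate K (f ` S) = carrier K" and fin: "finite (carrier K)"
    and finP: "finite (carrier (presented_group S E))" and o: "order K = order (presented_group S E)"
  shows "K \<cong> presented_group S E"
proof -
  obtain h where h: "h \<in> hom (presented_group S E) K" "\<And>s. s \<in> S \<Longrightarrow> h (pcls S E s) = f s"
    using presented_group_hom[OF K f E] by blast
  interpret h: group_hom "presented_group S E" K h
    using h K group_presented_group by (simp add: group_hom_def group_hom_axioms_def)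
  have "h ` carrier (presented_group S E) = h ` generate (presented_group S E) (pcls S E ` S)"
    by (simp only: presented_group_generate)
  also have "\<dots> = generate K (h ` pcls S E ` S)" by (rule h.generate_img[symmetric]) auto
  also have "h ` pcls S E ` S = f ` S" using h(2) by (auto simp: image_image)
  finally have sur: "h ` carrier (presented_group S E) = carrier K" using g by simp
  then have "inj_on h (carrier (presented_group S E))"
    using o finP by (intro eq_card_imp_inj_on) (simp_all add: order_def)
  then have "presented_group S E \<cong> K"
    using sur h(1) by (intro is_isoI isoI) (auto simp: bij_betw_def)
  then show ?thesis by (rule group.iso_sym[OF group_presented_group])
qed

section \<open>The presentations\<close>

lemma power_UT: "(0, 0, 0, 0, 0, c) [^]\<^bsub>UT m\<^esub> (n::nat) = (0, 0, 0, 0, 0, if n = 0 then 0 else int n * c mod int m)"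
  "(0, 0, 0, d, 0, 0) [^]\<^bsub>UT m\<^esub> (n::nat) = (0, 0, 0, if n = 0 then 0 else int n * d mod int m, 0, 0)"
  by (induction n) (auto simp: UT_def nat_pow_def mod_simps algebra_simps)

definition letters :: "letter set" where
  "letters = {Lx, Ly, Lz, Lw, Lt}"

lemma letters_UNIV: "letters = UNIV"
  using letter.exhaust by (auto simp: letters_def)

definition relators2 :: "(letter word \<times> letter word) set" where
  "relators2 = {(wpow wx 4, []), (wpow wy 4, []), (wpow wz 2, []), (wpow ww 2, []), (wpow wt 2, []),
     (wcomm wx wy, wz), (wcomm wz wx, ww), (wcomm wz wy, wt),
     (wcomm wx ww, []), (wcomm wy ww, []), (wcomm wz ww, []),
     (wcomm wx wt, []), (wcomm wy wt, []), (wcomm wz wt, []), (wcomm ww wt, [])}"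

definition relators3 :: "(letter word \<times> letter word) set" where
  "relators3 = {(wpow wx 3, []), (wpow wy 3, []), (wpow wz 3, []), (wpow ww 3, []), (wpow wt 3, []),
     (wconj wy wx, wy @ wz), (wconj wz wx, wz @ ww), (wconj wz wy, wz @ wt),
     (wcomm wx ww, []), (wcomm wy ww, []), (wcomm wz ww, []),
     (wcomm wx wt, []), (wcomm wy wt, []), (wcomm wz wt, []), (wcomm ww wt, [])}"

definition relatorsH :: "nat \<Rightarrow> (letter word \<times> letter word) set" where
  "relatorsH p = {(wpow wx p, []), (wpow wy p, []), (wpow wz p, []),
     (wcomm wx wy, wz), (wcomm wx wz, []), (wcomm wy wz, [])}"

lemma presented_eqs:
  "small_group_128_36 = presented_group letters relators2"
  "beauville_3_group = presented_group letters relators3"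
  "heisenberg_group p = presented_group {Lx, Ly, Lz} (relatorsH p)"
  by (simp_all add: letters_def small_group_128_36_def beauville_3_group_def heisenberg_group_def
      relators2_def relators3_def relatorsH_def)

abbreviation "letter2 \<equiv> pcls letters relators2"
abbreviation "letter3 \<equiv> pcls letters relators3"
abbreviation "letterH p \<equiv> pcls {Lx, Ly, Lz} (relatorsH p)"

text \<open>The relators with all inverses cleared, so that checking them in \<open>UT\<close> and
  \<open>CC\<close> is plain evaluation.\<close>

definition rels2 :: "('a, 'm) monoid_scheme \<Rightarrow> 'a \<Rightarrow> 'a \<Rightarrow> 'a \<Rightarrow> 'a \<Rightarrow> 'a \<Rightarrow> bool" where
  "rels2 K x y z w t \<longleftrightarrow> x \<in> carrier K \<and> y \<in> carrier K \<and> z \<in> carrier K \<and> w \<in> carrier K \<and> t \<in> carrier K \<and>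
    x [^]\<^bsub>K\<^esub> (4::nat) = \<one>\<^bsub>K\<^esub> \<and> y [^]\<^bsub>K\<^esub> (4::nat) = \<one>\<^bsub>K\<^esub> \<and>
    z [^]\<^bsub>K\<^esub> (2::nat) = \<one>\<^bsub>K\<^esub> \<and> w [^]\<^bsub>K\<^esub> (2::nat) = \<one>\<^bsub>K\<^esub> \<and> t [^]\<^bsub>K\<^esub> (2::nat) = \<one>\<^bsub>K\<^esub> \<and>
    x \<otimes>\<^bsub>K\<^esub> y = z \<otimes>\<^bsub>K\<^esub> y \<otimes>\<^bsub>K\<^esub> x \<and> z \<otimes>\<^bsub>K\<^esub> x = w \<otimes>\<^bsub>K\<^esub> x \<otimes>\<^bsub>K\<^esub> z \<and> z \<otimes>\<^bsub>K\<^esub> y = t \<otimes>\<^bsub>K\<^esub> y \<otimes>\<^bsub>K\<^esub> z \<and>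
    x \<otimes>\<^bsub>K\<^esub> w = w \<otimes>\<^bsub>K\<^esub> x \<and> y \<otimes>\<^bsub>K\<^esub> w = w \<otimes>\<^bsub>K\<^esub> y \<and> z \<otimes>\<^bsub>K\<^esub> w = w \<otimes>\<^bsub>K\<^esub> z \<and>
    x \<otimes>\<^bsub>K\<^esub> t = t \<otimes>\<^bsub>K\<^esub> x \<and> y \<otimes>\<^bsub>K\<^esub> t = t \<otimes>\<^bsub>K\<^esub> y \<and> z \<otimes>\<^bsub>K\<^esub> t = t \<otimes>\<^bsub>K\<^esub> z \<and> w \<otimes>\<^bsub>K\<^esub> t = t \<otimes>\<^bsub>K\<^esub> w"

definition rels3 :: "('a, 'm) monoid_scheme \<Rightarrow> 'a \<Rightarrow> 'a \<Rightarrow> 'a \<Rightarrow> 'a \<Rightarrow> 'a \<Rightarrow> bool" where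
  "rels3 K x y z w t \<longleftrightarrow> x \<in> carrier K \<and> y \<in> carrier K \<and> z \<in> carrier K \<and> w \<in> carrier K \<and> t \<in> carrier K \<and>
    x [^]\<^bsub>K\<^esub> (3::nat) = \<one>\<^bsub>K\<^esub> \<and> y [^]\<^bsub>K\<^esub> (3::nat) = \<one>\<^bsub>K\<^esub> \<and>
    z [^]\<^bsub>K\<^esub> (3::nat) = \<one>\<^bsub>K\<^esub> \<and> w [^]\<^bsub>K\<^esub> (3::nat) = \<one>\<^bsub>K\<^esub> \<and> t [^]\<^bsub>K\<^esub> (3::nat) = \<one>\<^bsub>K\<^esub> \<and>
    y \<otimes>\<^bsub>K\<^esub> x = x \<otimes>\<^bsub>K\<^esub> (y \<otimes>\<^bsub>K\<^esub> z) \<and> z \<otimes>\<^bsub>K\<^esub> x = x \<otimes>\<^bsub>K\<^esub> (z \<otimes>\<^bsub>K\<^esub> w) \<and> z \<otimes>\<^bsub>K\<^esub> y = y \<otimes>\<^bsub>K\<^esub> (z \<otimes>\<^bsub>K\<^esub> t) \<and>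
    x \<otimes>\<^bsub>K\<^esub> w = w \<otimes>\<^bsub>K\<^esub> x \<and> y \<otimes>\<^bsub>K\<^esub> w = w \<otimes>\<^bsub>K\<^esub> y \<and> z \<otimes>\<^bsub>K\<^esub> w = w \<otimes>\<^bsub>K\<^esub> z \<and>
    x \<otimes>\<^bsub>K\<^esub> t = t \<otimes>\<^bsub>K\<^esub> x \<and> y \<otimes>\<^bsub>K\<^esub> t = t \<otimes>\<^bsub>K\<^esub> y \<and> z \<otimes>\<^bsub>K\<^esub> t = t \<otimes>\<^bsub>K\<^esub> z \<and> w \<otimes>\<^bsub>K\<^esub> t = t \<otimes>\<^bsub>K\<^esub> w"

definition relsH :: "nat \<Rightarrow> ('a, 'm) monoid_scheme \<Rightarrow> 'a \<Rightarrow> 'a \<Rightarrow> 'a \<Rightarrow> bool" where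
  "relsH p K x y z \<longleftrightarrow> x \<in> carrier K \<and> y \<in> carrier K \<and> z \<in> carrier K \<and>
    x [^]\<^bsub>K\<^esub> p = \<one>\<^bsub>K\<^esub> \<and> y [^]\<^bsub>K\<^esub> p = \<one>\<^bsub>K\<^esub> \<and> z [^]\<^bsub>K\<^esub> p = \<one>\<^bsub>K\<^esub> \<and>
    x \<otimes>\<^bsub>K\<^esub> y = z \<otimes>\<^bsub>K\<^esub> y \<otimes>\<^bsub>K\<^esub> x \<and> x \<otimes>\<^bsub>K\<^esub> z = z \<otimes>\<^bsub>K\<^esub> x \<and> y \<otimes>\<^bsub>K\<^esub> z = z \<otimes>\<^bsub>K\<^esub> y"

context group
begin

lemma weval_relators2:
  assumes f: "f \<in> letters \<rightarrow> carrier G"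
  shows "(\<forall>(u, v)\<in>relators2. weval G f u = weval G f v) \<longleftrightarrow> rels2 G (f Lx) (f Ly) (f Lz) (f Lw) (f Lt)"
proof -
  have c: "f s \<in> carrier G" for s using f by (auto simp: letters_UNIV)
  have f': "f \<in> UNIV \<rightarrow> carrier G" using c by auto
  show ?thesis
    by (simp add: relators2_def rels2_def c weval_wpow[OF f'] weval_wcomm[OF f'] weval_gen)
qed

lemma weval_relators3:
  assumes f: "f \<in> letters \<rightarrow> carrier G"
  shows "(\<forall>(u, v)\<in>relators3. weval G f u = weval G f v) \<longleftrightarrow> rels3 G (f Lx) (f Ly) (f Lz) (f Lw) (f Lt)"
proof -
  have c: "f s \<in> carrier G" for s using f by (auto simp: letters_UNIV)
  have f': "f \<in> UNIV \<rightarrow> carrier G" using c by auto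
  show ?thesis
    by (simp add: relators3_def rels3_def c weval_wpow[OF f'] weval_wcomm[OF f'] weval_wconj[OF f'] weval_append[OF f'] weval_gen)
qed

lemma weval_relatorsH:
  assumes f: "f \<in> {Lx, Ly, Lz} \<rightarrow> carrier G"
  shows "(\<forall>(u, v)\<in>relatorsH p. weval G f u = weval G f v) \<longleftrightarrow> relsH p G (f Lx) (f Ly) (f Lz)"
proof -
  have c: "f Lx \<in> carrier G" "f Ly \<in> carrier G" "f Lz \<in> carrier G" using f by auto
  show ?thesis
    by (simp add: relatorsH_def relsH_def c weval_wpow[OF f] weval_wcomm[OF f] weval_gen)
qed

lemma rels2_cases:
  assumes "rels2 G x y z w t"
  shows "\<exists>f\<in>letters \<rightarrow> carrier G. (\<forall>(u, v)\<in>relators2. weval G f u = weval G f v) \<and>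
    f Lx = x \<and> f Ly = y \<and> f Lz = z \<and> f Lw = w \<and> f Lt = t"
  using assms weval_relators2[of "case_letter x y z w t"]
  by (intro bexI[of _ "case_letter x y z w t"]) (auto simp: rels2_def split: letter.split)

lemma rels3_cases:
  assumes "rels3 G x y z w t"
  shows "\<exists>f\<in>letters \<rightarrow> carrier G. (\<forall>(u, v)\<in>relators3. weval G f u = weval G f v) \<and>
    f Lx = x \<and> f Ly = y \<and> f Lz = z \<and> f Lw = w \<and> f Lt = t"
  using assms weval_relators3[of "case_letter x y z w t"]
  by (intro bexI[of _ "case_letter x y z w t"]) (auto simp: rels3_def split: letter.split)

lemma relsH_cases:
  assumes "relsH p G x y z"
  shows "\<exists>f\<in>{Lx, Ly, Lz} \<rightarrow> carrier G. (\<forall>(u, v)\<in>relatorsH p. weval G f u = weval G f v) \<and>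
    f Lx = x \<and> f Ly = y \<and> f Lz = z"
  \<comment> \<open>The last two values only fill the places of \<open>Lw\<close> and
    \<open>Lt\<close>, which do not occur among the three generators.\<close>
  using assms weval_relatorsH[of "case_letter x y z x x"]
  by (intro bexI[of _ "case_letter x y z x x"]) (auto simp: relsH_def)

end

lemma small_group_128_36_rels: "rels2 small_group_128_36 (letter2 Lx) (letter2 Ly) (letter2 Lz) (letter2 Lw) (letter2 Lt)"
proof -
  have "weval (presented_group letters relators2) letter2 u = weval (presented_group letters relators2) letter2 v"
    if "(u, v) \<in> relators2" for u v
    using that by (rule weval_presented_relation) (use that in \<open>auto simp: letters_UNIV relators2_def\<close>)
  then show ?thesis
    using group.weval_relators2[OF group_presented_group, of letter2 letters relators2] unfolding presented_eqs by auto
qed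

lemma beauville_3_group_rels: "rels3 beauville_3_group (letter3 Lx) (letter3 Ly) (letter3 Lz) (letter3 Lw) (letter3 Lt)"
proof -
  have "weval (presented_group letters relators3) letter3 u = weval (presented_group letters relators3) letter3 v"
    if "(u, v) \<in> relators3" for u v
    using that by (rule weval_presented_relation) (use that in \<open>auto simp: letters_UNIV relators3_def\<close>)
  then show ?thesis
    using group.weval_relators3[OF group_presented_group, of letter3 letters relators3] unfolding presented_eqs by auto
qed

lemma heisenberg_group_rels: "relsH p (heisenberg_group p) (letterH p Lx) (letterH p Ly) (letterH p Lz)"
proof -
  have "weval (heisenberg_group p) (letterH p) u = weval (heisenberg_group p) (letterH p) v"
    if "(u, v) \<in> relatorsH p" for u v
    unfolding presented_eqs
    using that by (rule weval_presented_relation) (use that in \<open>auto simp: relatorsH_def\<close>)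
  then show ?thesis
    using group.weval_relatorsH[OF group_presented_group[of "{Lx, Ly, Lz}" "relatorsH p"], where p = p and f = "letterH p"] unfolding presented_eqs by auto
qed

lemma small_group_128_36_hom:
  assumes K: "group K" and r: "rels2 K x y z w t"
  shows "\<exists>h\<in>hom small_group_128_36 K. h (letter2 Lx) = x \<and> h (letter2 Ly) = y \<and> h (letter2 Lz) = z \<and> h (letter2 Lw) = w \<and> h (letter2 Lt) = t"
proof -
  obtain f where f: "f \<in> letters \<rightarrow> carrier K" "\<forall>(u, v)\<in>relators2. weval K f u = weval K f v"
    "f Lx = x \<and> f Ly = y \<and> f Lz = z \<and> f Lw = w \<and> f Lt = t"
    using group.rels2_cases[OF K r] by blast
  obtain h where "h \<in> hom small_group_128_36 K" "\<forall>s\<in>letters. h (letter2 s) = f s"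
    unfolding presented_eqs using presented_group_hom[OF K f(1), of relators2] f(2) by blast
  then show ?thesis using f(3) by (auto simp: letters_UNIV)
qed

lemma beauville_3_group_hom:
  assumes K: "group K" and r: "rels3 K x y z w t"
  shows "\<exists>h\<in>hom beauville_3_group K. h (letter3 Lx) = x \<and> h (letter3 Ly) = y \<and> h (letter3 Lz) = z \<and> h (letter3 Lw) = w \<and> h (letter3 Lt) = t"
proof -
  obtain f where f: "f \<in> letters \<rightarrow> carrier K" "\<forall>(u, v)\<in>relators3. weval K f u = weval K f v"
    "f Lx = x \<and> f Ly = y \<and> f Lz = z \<and> f Lw = w \<and> f Lt = t"
    using group.rels3_cases[OF K r] by blast
  obtain h where "h \<in> hom beauville_3_group K" "\<forall>s\<in>letters. h (letter3 s) = f s"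
    unfolding presented_eqs using presented_group_hom[OF K f(1), of relators3] f(2) by blast
  then show ?thesis using f(3) by (auto simp: letters_UNIV)
qed

lemma heisenberg_group_hom:
  assumes K: "group K" and r: "relsH p K x y z"
  shows "\<exists>h\<in>hom (heisenberg_group p) K. h (letterH p Lx) = x \<and> h (letterH p Ly) = y \<and> h (letterH p Lz) = z"
proof -
  obtain f where f: "f \<in> {Lx, Ly, Lz} \<rightarrow> carrier K" "\<forall>(u, v)\<in>relatorsH p. weval K f u = weval K f v"
    "f Lx = x \<and> f Ly = y \<and> f Lz = z"
    using group.relsH_cases[OF K r] by blast
  obtain h where "h \<in> hom (heisenberg_group p) K" "\<forall>s\<in>{Lx, Ly, Lz}. h (letterH p s) = f s"
    unfolding presented_eqs using presented_group_hom[OF K f(1), of "relatorsH p"] f(2) by blast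
  then show ?thesis using f(3) by auto
qed

lemma small_group_128_36_generate: "generate small_group_128_36 {letter2 Lx, letter2 Ly, letter2 Lz, letter2 Lw, letter2 Lt} = carrier small_group_128_36"
  using presented_group_generate[of letters relators2] unfolding presented_eqs by (simp add: letters_def)

lemma beauville_3_group_generate: "generate beauville_3_group {letter3 Lx, letter3 Ly, letter3 Lz, letter3 Lw, letter3 Lt} = carrier beauville_3_group"
  using presented_group_generate[of letters relators3] unfolding presented_eqs by (simp add: letters_def)

lemma heisenberg_group_generate: "generate (heisenberg_group p) {letterH p Lx, letterH p Ly, letterH p Lz} = carrier (heisenberg_group p)"
  using presented_group_generate[of "{Lx, Ly, Lz}" "relatorsH p"] unfolding presented_eqs by simp

lemma small_group_128_36_iso:
  assumes K: "group K" and r: "rels2 K x y z w t" and g: "generate K {x, y, z, w, t} = carrier K"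
    and fin: "finite (carrier K)" "finite (carrier small_group_128_36)" and o: "order K = order small_group_128_36"
  shows "K \<cong> small_group_128_36"
proof -
  obtain f where f: "f \<in> letters \<rightarrow> carrier K" "\<forall>(u, v)\<in>relators2. weval K f u = weval K f v"
    "f Lx = x \<and> f Ly = y \<and> f Lz = z \<and> f Lw = w \<and> f Lt = t"
    using group.rels2_cases[OF K r] by blast
  then have "generate K (f ` letters) = carrier K" using g by (simp add: letters_def)
  then show ?thesis
    using iso_presented_group[OF K f(1), of relators2] f(2) fin o unfolding presented_eqs by blast
qed

lemma beauville_3_group_iso:
  assumes K: "group K" and r: "rels3 K x y z w t" and g: "generate K {x, y, z, w, t} = carrier K"
    and fin: "finite (carrier K)" "finite (carrier beauville_3_group)" and o: "order K = order beauville_3_group"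
  shows "K \<cong> beauville_3_group"
proof -
  obtain f where f: "f \<in> letters \<rightarrow> carrier K" "\<forall>(u, v)\<in>relators3. weval K f u = weval K f v"
    "f Lx = x \<and> f Ly = y \<and> f Lz = z \<and> f Lw = w \<and> f Lt = t"
    using group.rels3_cases[OF K r] by blast
  then have "generate K (f ` letters) = carrier K" using g by (simp add: letters_def)
  then show ?thesis
    using iso_presented_group[OF K f(1), of relators3] f(2) fin o unfolding presented_eqs by blast
qed

lemma heisenberg_group_iso:
  assumes K: "group K" and r: "relsH p K x y z" and g: "generate K {x, y, z} = carrier K"
    and fin: "finite (carrier K)" "finite (carrier (heisenberg_group p))" and o: "order K = order (heisenberg_group p)"
  shows "K \<cong> heisenberg_group p"
proof -
  obtain f where f: "f \<in> {Lx, Ly, Lz} \<rightarrow> carrier K" "\<forall>(u, v)\<in>relatorsH p. weval K f u = weval K f v"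
    "f Lx = x \<and> f Ly = y \<and> f Lz = z"
    using group.relsH_cases[OF K r] by blast
  then have "generate K (f ` {Lx, Ly, Lz}) = carrier K" using g by simp
  then show ?thesis
    using iso_presented_group[OF K f(1), of "relatorsH p"] f(2) fin o unfolding presented_eqs by blast
qed

subsection \<open>Representations\<close>

lemma small_powers:
  "x [^]\<^bsub>K\<^esub> (2::nat) = \<one>\<^bsub>K\<^esub> \<otimes>\<^bsub>K\<^esub> x \<otimes>\<^bsub>K\<^esub> x"
  "x [^]\<^bsub>K\<^esub> (3::nat) = \<one>\<^bsub>K\<^esub> \<otimes>\<^bsub>K\<^esub> x \<otimes>\<^bsub>K\<^esub> x \<otimes>\<^bsub>K\<^esub> x"
  "x [^]\<^bsub>K\<^esub> (4::nat) = \<one>\<^bsub>K\<^esub> \<otimes>\<^bsub>K\<^esub> x \<otimes>\<^bsub>K\<^esub> x \<otimes>\<^bsub>K\<^esub> x \<otimes>\<^bsub>K\<^esub> x"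
  by (simp_all add: nat_pow_def numeral_eq_Suc)

text \<open>The first representation keeps \<open>z\<close> and kills \<open>w\<close>,
  \<open>t\<close>. The next two send one generator to a Jordan block of size 3 and the other to the
  elementary matrix at (3,4), so that exactly one of \<open>w\<close>, \<open>t\<close> survives, in
  the corner. In the last, \<open>y\<close> is the inverse of \<open>x\<close> times that elementary
  matrix, so that \<open>x * y\<close> is elementary. The last three separate squares in the
  Beauville structure.\<close>

lemma unitriangular_rels2:
  "rels2 (UT 2) (1,0,0,0,0,0) (0,1,0,0,0,0) (0,0,0,1,0,0) (0,0,0,0,0,0) (0,0,0,0,0,0)"
  "rels2 (UT 2) (1,1,0,0,0,0) (0,0,1,0,0,0) (0,0,0,0,1,0) (0,0,0,0,0,1) (0,0,0,0,0,0)"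
  "rels2 (UT 2) (0,0,1,0,0,0) (1,1,0,0,0,0) (0,0,0,0,1,0) (0,0,0,0,0,0) (0,0,0,0,0,1)"
  "rels2 (UT 2) (1,1,0,0,0,0) (1,1,1,1,1,1) (0,0,0,0,1,1) (0,0,0,0,0,1) (0,0,0,0,0,1)"
  by (simp_all add: rels2_def UT_def small_powers)

text \<open>The first three patterns again; the entries 2 are -1, coming from the convention that
  \<open>z\<close> is the commutator of the inverses of \<open>y\<close> and
  \<open>x\<close>.\<close>

lemma unitriangular_rels3:
  "rels3 (UT 3) (1,0,0,0,0,0) (0,1,0,0,0,0) (0,0,0,2,0,0) (0,0,0,0,0,0) (0,0,0,0,0,0)"
  "rels3 (UT 3) (1,1,0,0,0,0) (0,0,1,0,0,0) (0,0,0,0,2,1) (0,0,0,0,0,1) (0,0,0,0,0,0)"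
  "rels3 (UT 3) (0,0,1,0,0,0) (1,1,0,0,0,0) (0,0,0,0,1,2) (0,0,0,0,0,0) (0,0,0,0,0,2)"
  by (simp_all add: rels3_def UT_def small_powers)

lemma elementary_power_UT:
  "(1, 0, 0, 0, 0, 0) [^]\<^bsub>UT m\<^esub> (n::nat) = (if n = 0 then 0 else int n mod int m, 0, 0, 0, 0, 0)"
  "(0, 1, 0, 0, 0, 0) [^]\<^bsub>UT m\<^esub> (n::nat) = (0, if n = 0 then 0 else int n mod int m, 0, 0, 0, 0)"
  by (induction n) (auto simp: UT_def nat_pow_def mod_simps algebra_simps)

lemma unitriangular_relsH:
  assumes "1 < p"
  shows "relsH p (UT p) (1,0,0,0,0,0) (0,1,0,0,0,0) (0,0,0,1,0,0)"
  using assms unfolding relsH_def elementary_power_UT power_UT by (auto simp: UT_def)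

lemma CC_power: "(a, b) [^]\<^bsub>CC m\<^esub> (n::nat) = (int n * a mod int m, int n * b mod int m)"
  by (simp add: CC_pow)

lemma abelian_rels2:
  "rels2 (CC 4) (1, 0) (0, 1) (0, 0) (0, 0) (0, 0)" "rels2 (CC 4) (1, 0) (0, 0) (0, 0) (0, 0) (0, 0)"
  unfolding rels2_def CC_power by (auto simp: CC_def)

lemma abelian_rels3:
  "rels3 (CC 3) (1, 0) (0, 1) (0, 0) (0, 0) (0, 0)" "rels3 (CC 3) (1, 0) (0, 0) (0, 0) (0, 0) (0, 0)"
  unfolding rels3_def CC_power by (auto simp: CC_def)

lemma abelian_relsH:
  assumes "1 < p"
  shows "relsH p (CC p) (1, 0) (0, 1) (0, 0)" "relsH p (CC p) (1, 0) (0, 0) (0, 0)"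
  using assms unfolding relsH_def CC_power by (auto simp: CC_def)

subsection \<open>Orders\<close>

lemma (in group) card_generate_three:
  assumes c: "x \<in> carrier G" "y \<in> carrier G" "z \<in> carrier G" and N: "N \<subseteq> carrier G" "finite (generate G N)"
    and k: "0 < a" "0 < q" and pw: "x [^] (a::nat) = \<one>" "y [^] a = \<one>" "z [^] (q::nat) = \<one>"
    and cN: "\<And>n. n \<in> N \<Longrightarrow> n \<otimes> x = x \<otimes> n" "\<And>n. n \<in> N \<Longrightarrow> n \<otimes> y = y \<otimes> n" "\<And>n. n \<in> N \<Longrightarrow> n \<otimes> z = z \<otimes> n"
    and zy: "z \<otimes> y \<in> (\<otimes>) y ` generate G (insert z N)"
    and zx: "z \<otimes> x \<in> (\<otimes>) x ` generate G (insert y (insert z N))"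
    and yx: "y \<otimes> x \<in> (\<otimes>) x ` generate G (insert y (insert z N))"
    and nz: "\<And>i. 0 < i \<Longrightarrow> i < q \<Longrightarrow> z [^] i \<notin> generate G N"
    and ny: "\<And>i. 0 < i \<Longrightarrow> i < a \<Longrightarrow> y [^] i \<notin> generate G (insert z N)"
    and nx: "\<And>i. 0 < i \<Longrightarrow> i < a \<Longrightarrow> x [^] i \<notin> generate G (insert y (insert z N))"
  shows "finite (generate G (insert x (insert y (insert z N))))"
    "card (generate G (insert x (insert y (insert z N)))) = a * (a * (q * card (generate G N)))"
proof -
  have im: "n \<otimes> g \<in> (\<otimes>) g ` generate G S" if "n \<in> S" "n \<otimes> g = g \<otimes> n" for n g S
    unfolding that(2) using that(1) by (intro imageI generate.incl)
  have z1: "n \<otimes> z \<in> (\<otimes>) z ` generate G N" if "n \<in> N" for n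
    using that cN by (intro im)
  have y1: "n \<otimes> y \<in> (\<otimes>) y ` generate G (insert z N)" if "n \<in> insert z N" for n
    using that im[OF that] cN zy by auto
  have x1: "n \<otimes> x \<in> (\<otimes>) x ` generate G (insert y (insert z N))" if "n \<in> insert y (insert z N)" for n
    using that im[OF that] cN zx yx by auto
  have cl: "insert z N \<subseteq> carrier G" "insert y (insert z N) \<subseteq> carrier G" using c N by auto
  note z = card_generate_insert[OF N(1) c(3) N(2) k(2) pw(3) z1 nz]
  note y = card_generate_insert[OF cl(1) c(2) z(1) k(1) pw(2) y1 ny]
  note x = card_generate_insert[OF cl(2) c(1) y(1) k(1) pw(1) x1 nx]
  show "finite (generate G (insert x (insert y (insert z N))))" by (rule x)
  show "card (generate G (insert x (insert y (insert z N)))) = a * (a * (q * card (generate G N)))"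
    by (simp only: x y z)
qed

lemma (in group) card_generate_two:
  assumes c: "w \<in> carrier G" "t \<in> carrier G" and q: "0 < q" "w [^] (q::nat) = \<one>" "t [^] q = \<one>" and wt: "w \<otimes> t = t \<otimes> w"
    and nt: "\<And>i. 0 < i \<Longrightarrow> i < q \<Longrightarrow> t [^] i \<noteq> \<one>"
    and nw: "\<And>i. 0 < i \<Longrightarrow> i < q \<Longrightarrow> w [^] i \<notin> generate G {t}"
  shows "finite (generate G {w, t})" "card (generate G {w, t}) = q * q"
proof -
  have cl: "{} \<subseteq> carrier G" "{t} \<subseteq> carrier G" using c by auto
  have t1: "s \<otimes> w \<in> (\<otimes>) w ` generate G {t}" if "s \<in> {t}" for s
    using that by (auto simp: wt[symmetric] intro!: imageI generate.incl)
  have e: "finite (generate G {})" by (simp add: generate_empty)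
  have t: "finite (generate G {t})" "card (generate G {t}) = q * card (generate G {})"
    by (rule card_generate_insert[OF cl(1) c(2) e q(1,3)]; use nt in \<open>simp add: generate_empty\<close>)+
  note w = card_generate_insert[OF cl(2) c(1) t(1) q(1,2) t1 nw]
  show "finite (generate G {w, t})" using w(1) by blast
  show "card (generate G {w, t}) = q * q" using w(2) t(2) by (simp add: generate_empty)
qed

lemmas groups_UT_CC = group_UT comm_group.axioms(2)[OF comm_group_CC]

text \<open>In the following three proofs \<open>t\<close>, \<open>w\<close>, \<open>z\<close>, \<open>y\<close>, \<open>x\<close> are adjoined in turn.\<close>

lemma order_small_group_128_36: "finite (carrier small_group_128_36)" "order small_group_128_36 = 128"
proof -
  interpret group small_group_128_36 unfolding presented_eqs by (rule group_presented_group)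
  let ?P = small_group_128_36
  let ?x = "letter2 Lx" and ?y = "letter2 Ly" and ?z = "letter2 Lz" and ?w = "letter2 Lw" and ?t = "letter2 Lt"
  have c [simp]: "?x \<in> carrier ?P" "?y \<in> carrier ?P" "?z \<in> carrier ?P" "?w \<in> carrier ?P" "?t \<in> carrier ?P"
    and r: "?x [^]\<^bsub>?P\<^esub> (4::nat) = \<one>\<^bsub>?P\<^esub>" "?y [^]\<^bsub>?P\<^esub> (4::nat) = \<one>\<^bsub>?P\<^esub>" "?z [^]\<^bsub>?P\<^esub> (2::nat) = \<one>\<^bsub>?P\<^esub>"
      "?w [^]\<^bsub>?P\<^esub> (2::nat) = \<one>\<^bsub>?P\<^esub>" "?t [^]\<^bsub>?P\<^esub> (2::nat) = \<one>\<^bsub>?P\<^esub>"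
    and s: "?x \<otimes>\<^bsub>?P\<^esub> ?y = ?z \<otimes>\<^bsub>?P\<^esub> ?y \<otimes>\<^bsub>?P\<^esub> ?x" "?z \<otimes>\<^bsub>?P\<^esub> ?x = ?w \<otimes>\<^bsub>?P\<^esub> ?x \<otimes>\<^bsub>?P\<^esub> ?z"
      "?z \<otimes>\<^bsub>?P\<^esub> ?y = ?t \<otimes>\<^bsub>?P\<^esub> ?y \<otimes>\<^bsub>?P\<^esub> ?z" "?x \<otimes>\<^bsub>?P\<^esub> ?w = ?w \<otimes>\<^bsub>?P\<^esub> ?x" "?y \<otimes>\<^bsub>?P\<^esub> ?w = ?w \<otimes>\<^bsub>?P\<^esub> ?y"
      "?z \<otimes>\<^bsub>?P\<^esub> ?w = ?w \<otimes>\<^bsub>?P\<^esub> ?z" "?x \<otimes>\<^bsub>?P\<^esub> ?t = ?t \<otimes>\<^bsub>?P\<^esub> ?x" "?y \<otimes>\<^bsub>?P\<^esub> ?t = ?t \<otimes>\<^bsub>?P\<^esub> ?y"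
      "?z \<otimes>\<^bsub>?P\<^esub> ?t = ?t \<otimes>\<^bsub>?P\<^esub> ?z" "?w \<otimes>\<^bsub>?P\<^esub> ?t = ?t \<otimes>\<^bsub>?P\<^esub> ?w"
    using small_group_128_36_rels unfolding rels2_def by auto
  note UT = group_UT[of 2, simplified] and CC = groups_UT_CC(2)[of 4, simplified]
  obtain hz where hz: "hz \<in> hom ?P (UT 2)" "hz ?z = (0,0,0,1,0,0)" "hz ?w = (0,0,0,0,0,0)" "hz ?t = (0,0,0,0,0,0)"
    using small_group_128_36_hom[OF UT unitriangular_rels2(1)] by blast
  obtain hw where hw: "hw \<in> hom ?P (UT 2)" "hw ?w = (0,0,0,0,0,1)" "hw ?t = (0,0,0,0,0,0)"
    using small_group_128_36_hom[OF UT unitriangular_rels2(2)] by blast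
  obtain ht where ht: "ht \<in> hom ?P (UT 2)" "ht ?t = (0,0,0,0,0,1)"
    using small_group_128_36_hom[OF UT unitriangular_rels2(3)] by blast
  obtain hy where hy: "hy \<in> hom ?P (CC 4)" "hy ?y = (0,1)" "hy ?z = (0,0)" "hy ?w = (0,0)" "hy ?t = (0,0)"
    using small_group_128_36_hom[OF CC abelian_rels2(1)] by blast
  obtain hx where hx: "hx \<in> hom ?P (CC 4)" "hx ?x = (1,0)" "hx ?y = (0,0)" "hx ?z = (0,0)" "hx ?w = (0,0)" "hx ?t = (0,0)"
    using small_group_128_36_hom[OF CC abelian_rels2(2)] by blast
  have "?t [^]\<^bsub>?P\<^esub> i \<notin> generate ?P {}" if "0 < i" "i < 2" for i :: nat
    using that by (intro power_notin_generate[OF ht(1) UT]) (auto simp: ht power_UT, auto simp: UT_def)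
  then have nt: "?t [^]\<^bsub>?P\<^esub> i \<noteq> \<one>\<^bsub>?P\<^esub>" if "0 < i" "i < 2" for i :: nat
    using that by (simp add: generate_empty)
  have nw: "?w [^]\<^bsub>?P\<^esub> i \<notin> generate ?P {?t}" if "0 < i" "i < 2" for i :: nat
    using that by (intro power_notin_generate[OF hw(1) UT]) (auto simp: hw power_UT, auto simp: UT_def)
  have nz: "?z [^]\<^bsub>?P\<^esub> i \<notin> generate ?P {?w, ?t}" if "0 < i" "i < 2" for i :: nat
    using that by (intro power_notin_generate[OF hz(1) UT]) (auto simp: hz power_UT, auto simp: UT_def)
  have ny: "?y [^]\<^bsub>?P\<^esub> i \<notin> generate ?P {?z, ?w, ?t}" if "0 < i" "i < 4" for i :: nat
    using that by (intro power_notin_generate[OF hy(1) CC]) (auto simp: hy CC_power, auto simp: CC_def)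
  have nx: "?x [^]\<^bsub>?P\<^esub> i \<notin> generate ?P {?y, ?z, ?w, ?t}" if "0 < i" "i < 4" for i :: nat
    using that by (intro power_notin_generate[OF hx(1) CC]) (auto simp: hx CC_power, auto simp: CC_def)
  have zz: "?z \<otimes>\<^bsub>?P\<^esub> ?z = \<one>\<^bsub>?P\<^esub>" using r(3) by (simp add: numeral_2_eq_2)
  have zy: "?z \<otimes>\<^bsub>?P\<^esub> ?y = ?y \<otimes>\<^bsub>?P\<^esub> (?t \<otimes>\<^bsub>?P\<^esub> ?z)" by (simp only: s(3) s(8)[symmetric] m_assoc c)
  have zx: "?z \<otimes>\<^bsub>?P\<^esub> ?x = ?x \<otimes>\<^bsub>?P\<^esub> (?w \<otimes>\<^bsub>?P\<^esub> ?z)" by (simp only: s(2) s(4)[symmetric] m_assoc c)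
  \<comment> \<open>As \<open>z\<close> is an involution, \<open>x * y = z * y * x\<close> is solved
    for \<open>y * x\<close> by multiplying with \<open>z\<close>.\<close>
  have "?z \<otimes>\<^bsub>?P\<^esub> ?x \<otimes>\<^bsub>?P\<^esub> ?y = ?z \<otimes>\<^bsub>?P\<^esub> ?z \<otimes>\<^bsub>?P\<^esub> (?y \<otimes>\<^bsub>?P\<^esub> ?x)" by (simp add: m_assoc s(1))
  then have yx: "?y \<otimes>\<^bsub>?P\<^esub> ?x = ?x \<otimes>\<^bsub>?P\<^esub> (?w \<otimes>\<^bsub>?P\<^esub> ?z \<otimes>\<^bsub>?P\<^esub> ?y)" by (simp add: zz zx m_assoc)
  note wt = card_generate_two[OF c(4,5) _ r(4,5) s(10) nt nw, simplified]
  have "finite (generate ?P {?x, ?y, ?z, ?w, ?t}) \<and> card (generate ?P {?x, ?y, ?z, ?w, ?t}) = 4 * (4 * (2 * card (generate ?P {?w, ?t})))"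
    using c wt(1) r(1-3) s
    by (intro conjI card_generate_three nz ny nx)
      (auto simp: zy zx yx intro!: imageI generate.eng intro: generate.incl)
  then show "finite (carrier ?P)" "order ?P = 128" using wt by (simp_all add: small_group_128_36_generate order_def)
qed

lemma order_beauville_3_group: "finite (carrier beauville_3_group)" "order beauville_3_group = 243"
proof -
  interpret group beauville_3_group unfolding presented_eqs by (rule group_presented_group)
  let ?P = beauville_3_group
  let ?x = "letter3 Lx" and ?y = "letter3 Ly" and ?z = "letter3 Lz" and ?w = "letter3 Lw" and ?t = "letter3 Lt"
  have c [simp]: "?x \<in> carrier ?P" "?y \<in> carrier ?P" "?z \<in> carrier ?P" "?w \<in> carrier ?P" "?t \<in> carrier ?P"
    and r: "?x [^]\<^bsub>?P\<^esub> (3::nat) = \<one>\<^bsub>?P\<^esub>" "?y [^]\<^bsub>?P\<^esub> (3::nat) = \<one>\<^bsub>?P\<^esub>" "?z [^]\<^bsub>?P\<^esub> (3::nat) = \<one>\<^bsub>?P\<^esub>"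
      "?w [^]\<^bsub>?P\<^esub> (3::nat) = \<one>\<^bsub>?P\<^esub>" "?t [^]\<^bsub>?P\<^esub> (3::nat) = \<one>\<^bsub>?P\<^esub>"
    and s: "?y \<otimes>\<^bsub>?P\<^esub> ?x = ?x \<otimes>\<^bsub>?P\<^esub> (?y \<otimes>\<^bsub>?P\<^esub> ?z)" "?z \<otimes>\<^bsub>?P\<^esub> ?x = ?x \<otimes>\<^bsub>?P\<^esub> (?z \<otimes>\<^bsub>?P\<^esub> ?w)"
      "?z \<otimes>\<^bsub>?P\<^esub> ?y = ?y \<otimes>\<^bsub>?P\<^esub> (?z \<otimes>\<^bsub>?P\<^esub> ?t)" "?x \<otimes>\<^bsub>?P\<^esub> ?w = ?w \<otimes>\<^bsub>?P\<^esub> ?x" "?y \<otimes>\<^bsub>?P\<^esub> ?w = ?w \<otimes>\<^bsub>?P\<^esub> ?y"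
      "?z \<otimes>\<^bsub>?P\<^esub> ?w = ?w \<otimes>\<^bsub>?P\<^esub> ?z" "?x \<otimes>\<^bsub>?P\<^esub> ?t = ?t \<otimes>\<^bsub>?P\<^esub> ?x" "?y \<otimes>\<^bsub>?P\<^esub> ?t = ?t \<otimes>\<^bsub>?P\<^esub> ?y"
      "?z \<otimes>\<^bsub>?P\<^esub> ?t = ?t \<otimes>\<^bsub>?P\<^esub> ?z" "?w \<otimes>\<^bsub>?P\<^esub> ?t = ?t \<otimes>\<^bsub>?P\<^esub> ?w"
    using beauville_3_group_rels unfolding rels3_def by auto
  note UT = group_UT[of 3, simplified] and CC = groups_UT_CC(2)[of 3, simplified]
  obtain hz where hz: "hz \<in> hom ?P (UT 3)" "hz ?z = (0,0,0,2,0,0)" "hz ?w = (0,0,0,0,0,0)" "hz ?t = (0,0,0,0,0,0)"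
    using beauville_3_group_hom[OF UT unitriangular_rels3(1)] by blast
  obtain hw where hw: "hw \<in> hom ?P (UT 3)" "hw ?w = (0,0,0,0,0,1)" "hw ?t = (0,0,0,0,0,0)"
    using beauville_3_group_hom[OF UT unitriangular_rels3(2)] by blast
  obtain ht where ht: "ht \<in> hom ?P (UT 3)" "ht ?t = (0,0,0,0,0,2)"
    using beauville_3_group_hom[OF UT unitriangular_rels3(3)] by blast
  obtain hy where hy: "hy \<in> hom ?P (CC 3)" "hy ?y = (0,1)" "hy ?z = (0,0)" "hy ?w = (0,0)" "hy ?t = (0,0)"
    using beauville_3_group_hom[OF CC abelian_rels3(1)] by blast
  obtain hx where hx: "hx \<in> hom ?P (CC 3)" "hx ?x = (1,0)" "hx ?y = (0,0)" "hx ?z = (0,0)" "hx ?w = (0,0)" "hx ?t = (0,0)"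
    using beauville_3_group_hom[OF CC abelian_rels3(2)] by blast
  have two: "int i * 2 mod 3 \<noteq> 0" if "0 < i" "i < 3" for i :: nat using that by presburger
  have "?t [^]\<^bsub>?P\<^esub> i \<notin> generate ?P {}" if "0 < i" "i < 3" for i :: nat
    using that two[of i] by (intro power_notin_generate[OF ht(1) UT]) (auto simp: ht power_UT, auto simp: UT_def)
  then have nt: "?t [^]\<^bsub>?P\<^esub> i \<noteq> \<one>\<^bsub>?P\<^esub>" if "0 < i" "i < 3" for i :: nat
    using that by (simp add: generate_empty)
  have nw: "?w [^]\<^bsub>?P\<^esub> i \<notin> generate ?P {?t}" if "0 < i" "i < 3" for i :: nat
    using that by (intro power_notin_generate[OF hw(1) UT]) (auto simp: hw power_UT, auto simp: UT_def)
  have nz: "?z [^]\<^bsub>?P\<^esub> i \<notin> generate ?P {?w, ?t}" if "0 < i" "i < 3" for i :: nat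
    using that two[of i] by (intro power_notin_generate[OF hz(1) UT]) (auto simp: hz power_UT, auto simp: UT_def)
  have ny: "?y [^]\<^bsub>?P\<^esub> i \<notin> generate ?P {?z, ?w, ?t}" if "0 < i" "i < 3" for i :: nat
    using that by (intro power_notin_generate[OF hy(1) CC]) (auto simp: hy CC_power, auto simp: CC_def)
  have nx: "?x [^]\<^bsub>?P\<^esub> i \<notin> generate ?P {?y, ?z, ?w, ?t}" if "0 < i" "i < 3" for i :: nat
    using that by (intro power_notin_generate[OF hx(1) CC]) (auto simp: hx CC_power, auto simp: CC_def)
  note wt = card_generate_two[OF c(4,5) _ r(4,5) s(10) nt nw, simplified]
  have "finite (generate ?P {?x, ?y, ?z, ?w, ?t}) \<and> card (generate ?P {?x, ?y, ?z, ?w, ?t}) = 3 * (3 * (3 * card (generate ?P {?w, ?t})))"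
    using c wt(1) r(1-3) s
    by (intro conjI card_generate_three nz ny nx)
      (auto simp: intro!: imageI generate.eng intro: generate.incl)
  then show "finite (carrier ?P)" "order ?P = 243" using wt by (simp_all add: beauville_3_group_generate order_def)
qed

lemma order_heisenberg_group:
  assumes p: "1 < p"
  shows "finite (carrier (heisenberg_group p))" "order (heisenberg_group p) = p ^ 3"
proof -
  interpret group "heisenberg_group p" unfolding presented_eqs by (rule group_presented_group)
  let ?P = "heisenberg_group p"
  let ?x = "letterH p Lx" and ?y = "letterH p Ly" and ?z = "letterH p Lz"
  have c [simp]: "?x \<in> carrier ?P" "?y \<in> carrier ?P" "?z \<in> carrier ?P"
    and r: "?x [^]\<^bsub>?P\<^esub> p = \<one>\<^bsub>?P\<^esub>" "?y [^]\<^bsub>?P\<^esub> p = \<one>\<^bsub>?P\<^esub>" "?z [^]\<^bsub>?P\<^esub> p = \<one>\<^bsub>?P\<^esub>"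
    and s: "?x \<otimes>\<^bsub>?P\<^esub> ?y = ?z \<otimes>\<^bsub>?P\<^esub> ?y \<otimes>\<^bsub>?P\<^esub> ?x"
      "?x \<otimes>\<^bsub>?P\<^esub> ?z = ?z \<otimes>\<^bsub>?P\<^esub> ?x" "?y \<otimes>\<^bsub>?P\<^esub> ?z = ?z \<otimes>\<^bsub>?P\<^esub> ?y"
    using heisenberg_group_rels[of p] unfolding relsH_def by auto
  have p0: "0 < p" using p by simp
  note UT = group_UT[OF p0] and CC = groups_UT_CC(2)[OF p0]
  obtain hz where hz: "hz \<in> hom ?P (UT p)" "hz ?z = (0,0,0,1,0,0)"
    using heisenberg_group_hom[OF UT unitriangular_relsH[OF p]] by blast
  obtain hy where hy: "hy \<in> hom ?P (CC p)" "hy ?y = (0,1)" "hy ?z = (0,0)"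
    using heisenberg_group_hom[OF CC abelian_relsH(1)[OF p]] by blast
  obtain hx where hx: "hx \<in> hom ?P (CC p)" "hx ?x = (1,0)" "hx ?y = (0,0)" "hx ?z = (0,0)"
    using heisenberg_group_hom[OF CC abelian_relsH(2)[OF p]] by blast
  have nz: "?z [^]\<^bsub>?P\<^esub> i \<notin> generate ?P {}" if "0 < i" "i < p" for i :: nat
    using that by (intro power_notin_generate[OF hz(1) UT]) (auto simp: hz power_UT, auto simp: UT_def)
  have ny: "?y [^]\<^bsub>?P\<^esub> i \<notin> generate ?P {?z}" if "0 < i" "i < p" for i :: nat
    using that by (intro power_notin_generate[OF hy(1) CC]) (auto simp: hy CC_power, auto simp: CC_def)
  have nx: "?x [^]\<^bsub>?P\<^esub> i \<notin> generate ?P {?y, ?z}" if "0 < i" "i < p" for i :: nat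
    using that by (intro power_notin_generate[OF hx(1) CC]) (auto simp: hx CC_power, auto simp: CC_def)
  have "inv\<^bsub>?P\<^esub> ?z \<otimes>\<^bsub>?P\<^esub> ?x = inv\<^bsub>?P\<^esub> ?z \<otimes>\<^bsub>?P\<^esub> (?x \<otimes>\<^bsub>?P\<^esub> ?z) \<otimes>\<^bsub>?P\<^esub> inv\<^bsub>?P\<^esub> ?z" by (simp add: m_assoc)
  also have "\<dots> = ?x \<otimes>\<^bsub>?P\<^esub> inv\<^bsub>?P\<^esub> ?z" by (simp add: s(2) m_assoc[symmetric])
  finally have zi: "inv\<^bsub>?P\<^esub> ?z \<otimes>\<^bsub>?P\<^esub> ?x = ?x \<otimes>\<^bsub>?P\<^esub> inv\<^bsub>?P\<^esub> ?z" .
  have "?y \<otimes>\<^bsub>?P\<^esub> ?x = inv\<^bsub>?P\<^esub> ?z \<otimes>\<^bsub>?P\<^esub> (?x \<otimes>\<^bsub>?P\<^esub> ?y)" by (simp add: s(1) m_assoc[symmetric])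
  also have "\<dots> = inv\<^bsub>?P\<^esub> ?z \<otimes>\<^bsub>?P\<^esub> ?x \<otimes>\<^bsub>?P\<^esub> ?y" by (simp only: m_assoc c inv_closed)
  also have "\<dots> = ?x \<otimes>\<^bsub>?P\<^esub> (inv\<^bsub>?P\<^esub> ?z \<otimes>\<^bsub>?P\<^esub> ?y)" by (simp only: zi m_assoc c inv_closed)
  finally have yx: "?y \<otimes>\<^bsub>?P\<^esub> ?x = ?x \<otimes>\<^bsub>?P\<^esub> (inv\<^bsub>?P\<^esub> ?z \<otimes>\<^bsub>?P\<^esub> ?y)" .
  have "finite (generate ?P {?x, ?y, ?z}) \<and> card (generate ?P {?x, ?y, ?z}) = p * (p * (p * card (generate ?P {})))"
    using r p0
    by (intro conjI card_generate_three nz ny nx)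
      (auto simp: yx s(2)[symmetric] s(3)[symmetric] generate_empty intro!: imageI intro: generate.eng generate.incl generate.inv)
  then show "finite (carrier ?P)" "order ?P = p ^ 3"
    by (simp_all add: heisenberg_group_generate order_def generate_empty power3_eq_cube mult.assoc)
qed

section \<open>Beauville structures\<close>

lemma com_eqI: "a * b = c * b * a \<Longrightarrow> com a b = (c::'a::group_mult)"
  by (simp add: com_def mult.assoc)

lemma (in group_embedding) H_sgen: "generate G S = carrier G \<Longrightarrow> S \<subseteq> carrier G \<Longrightarrow> sgen (\<phi> ` S) = H"
  by (simp add: sgen_image)

lemma (in group_embedding) central:
  assumes S: "generate G S = carrier G" "S \<subseteq> carrier G" and w: "w \<in> carrier G"
    and c: "\<And>s. s \<in> S \<Longrightarrow> s \<otimes> w = w \<otimes> s" and g: "g \<in> H"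
  shows "com (\<phi> w) g = 1"
proof -
  have "subgrp {g. \<phi> w * g = g * \<phi> w}"
  proof (rule subgrpI)
    fix a assume "a \<in> {g. \<phi> w * g = g * \<phi> w}"
    then have "\<phi> w * a = a * \<phi> w" by simp
    then have "inverse a * (\<phi> w * a) * inverse a = inverse a * (a * \<phi> w) * inverse a" by simp
    then show "inverse a \<in> {g. \<phi> w * g = g * \<phi> w}" by (simp add: mult.assoc)
    fix b assume "b \<in> {g. \<phi> w * g = g * \<phi> w}"
    then show "a * b \<in> {g. \<phi> w * g = g * \<phi> w}" using \<open>\<phi> w * a = a * \<phi> w\<close> by (simp add: mult.assoc[symmetric]) (simp add: mult.assoc)
  qed simp
  moreover have "\<phi> s * \<phi> w = \<phi> w * \<phi> s" if "s \<in> S" for s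
    using c[OF that] S(2) that w mult[of s w] mult[of w s] by auto
  then have "\<phi> ` S \<subseteq> {g. \<phi> w * g = g * \<phi> w}" by auto
  ultimately have "sgen (\<phi> ` S) \<subseteq> {g. \<phi> w * g = g * \<phi> w}" by (rule gen_least)
  then show ?thesis using g H_sgen[OF S] by (auto simp: com_eq_one_iff)
qed

context group
begin

lemma pow_mod:
  assumes a: "a \<in> carrier G" "a [^] (k::nat) = \<one>" and r: "n mod k = r"
  shows "a [^] (n::nat) = a [^] r"
proof -
  have "a [^] n = a [^] (k * (n div k) + n mod k)" by simp
  also have "\<dots> = a [^] (k * (n div k)) \<otimes> a [^] (n mod k)" by (rule nat_pow_mult[OF a(1), symmetric])
  also have "a [^] (k * (n div k)) = (a [^] k) [^] (n div k)" by (rule nat_pow_pow[OF a(1), symmetric])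
  finally show ?thesis using a r by simp
qed

lemma pow_dvd: "a \<in> carrier G \<Longrightarrow> a [^] (k::nat) = \<one> \<Longrightarrow> k dvd n \<Longrightarrow> a [^] (n::nat) = \<one>"
  using pow_mod[of a k n 0] by auto

lemma conj_pow:
  assumes c: "a \<in> carrier G" "b \<in> carrier G" "g \<in> carrier G" and e: "a \<otimes> g = g \<otimes> b"
  shows "a [^] (n::nat) \<otimes> g = g \<otimes> b [^] n"
proof (induction n)
  case (Suc n)
  have "a [^] Suc n \<otimes> g = a [^] n \<otimes> (g \<otimes> b)" using c by (simp add: m_assoc e)
  also have "\<dots> = (g \<otimes> b [^] n) \<otimes> b" using c by (simp add: m_assoc[symmetric] Suc)
  finally show ?case using c by (simp add: m_assoc)
qed (use c in simp)

lemma conj_hom: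
  assumes "group_hom G K h" and c: "a \<in> carrier G" "b \<in> carrier G" "g \<in> carrier G"
    and e: "a [^] i \<otimes> g = g \<otimes> b [^] j"
  shows "h a [^]\<^bsub>K\<^esub> (i::nat) \<otimes>\<^bsub>K\<^esub> h g = h g \<otimes>\<^bsub>K\<^esub> h b [^]\<^bsub>K\<^esub> (j::nat)"
proof -
  interpret h: group_hom G K h by (rule assms(1))
  have "h (a [^] i \<otimes> g) = h (g \<otimes> b [^] j)" by (simp only: e)
  then show ?thesis using c by (simp add: h.hom_nat_pow)
qed

text \<open>In an abelian image the conjugating element cancels, leaving one congruence between
  exponents for each coordinate.\<close>

lemma conj_CC:
  assumes h: "group_hom G (CC m) h" and c: "a \<in> carrier G" "b \<in> carrier G" "g \<in> carrier G"
    and e: "a [^] (i::nat) \<otimes> g = g \<otimes> b [^] (j::nat)" and m: "0 < m" and ab: "h a = (u1, u2)" "h b = (v1, v2)"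
  shows "int i * u1 mod int m = int j * v1 mod int m" "int i * u2 mod int m = int j * v2 mod int m"
proof -
  interpret C: comm_group "CC m" by (rule comm_group_CC[OF m])
  interpret h: group_hom G "CC m" h by (rule h)
  have "h a [^]\<^bsub>CC m\<^esub> i \<otimes>\<^bsub>CC m\<^esub> h g = h b [^]\<^bsub>CC m\<^esub> j \<otimes>\<^bsub>CC m\<^esub> h g"
    using conj_hom[OF h c e] c by (simp add: C.m_comm)
  then have "h a [^]\<^bsub>CC m\<^esub> i = h b [^]\<^bsub>CC m\<^esub> j" using c by simp
  then show "int i * u1 mod int m = int j * v1 mod int m" "int i * u2 mod int m = int j * v2 mod int m"
    by (simp_all add: ab CC_power)
qed

text \<open>Generators of finite order have powers as inverses, so the induction needs closure under
  products only.\<close>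

lemma generate_torsion_induct:
  assumes S: "S \<subseteq> carrier G" and k: "0 < k" "\<And>s. s \<in> S \<Longrightarrow> s [^] (k::nat) = \<one>"
    and Q: "Q \<one>" "\<And>s. s \<in> S \<Longrightarrow> Q s" "\<And>a b. a \<in> carrier G \<Longrightarrow> b \<in> carrier G \<Longrightarrow> Q a \<Longrightarrow> Q b \<Longrightarrow> Q (a \<otimes> b)"
    and a: "a \<in> generate G S"
  shows "Q a"
  using a
proof induction
  case (inv s)
  then have s: "s \<in> carrier G" using S by blast
  obtain k' where k': "k = Suc k'" using k(1) by (cases k) auto
  have "inv s = s [^] k'" using k(2)[OF inv] s by (intro inv_equality) (simp_all add: k')
  moreover have "Q (s [^] n)" for n :: nat by (induction n) (use s inv Q in auto)
  ultimately show ?case by simp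
next
  case (eng a b)
  then show ?case using Q(3) generate_incl[OF S] by blast
qed (use Q in auto)

end

subsection \<open>The prime 2\<close>

context group_embedding
begin

text \<open>Squares lie in \<open>L 1\<close>, so the second pair agrees with \<open>(x, y)\<close>
  modulo the Frattini subgroup and again generates.\<close>

lemma rels2_layers:
  assumes r: "rels2 G x y z w t" and g: "generate G {x, y, z, w, t} = carrier G" and o: "order G = 2 ^ n"
  shows "generating_pair G x y" "generating_pair G (x [^] (3::nat) \<otimes> y [^] (2::nat)) (y \<otimes> x [^] (2::nat))"
    "a \<in> carrier G \<Longrightarrow> a [^] (4::nat) = \<one>"
proof -
  interpret H: fin_2_group H using fin_p_group_H[OF two_is_prime_nat o] by (simp add: fin_2_group_def)
  have c: "x \<in> carrier G" "y \<in> carrier G" "z \<in> carrier G" "w \<in> carrier G" "t \<in> carrier G"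
    using r by (auto simp: rels2_def)
  have s: "com (\<phi> x) (\<phi> y) = \<phi> z" "com (\<phi> z) (\<phi> x) = \<phi> w" "com (\<phi> z) (\<phi> y) = \<phi> t"
    using c r by (auto intro!: com_eqI simp: rels2_def simp flip: mult)
  have pw: "\<phi> x ^ 4 = 1" "\<phi> y ^ 4 = 1" "\<phi> z ^ 2 = 1" "\<phi> w ^ 2 = 1" "\<phi> t ^ 2 = 1"
    using c r by (auto simp: rels2_def map_one simp flip: pow)
  have cen: "com (\<phi> w) u = 1" "com (\<phi> t) u = 1" if "u \<in> H" for u
    by (rule central[OF g _ _ _ that]; use r in \<open>auto simp: rels2_def\<close>)+
  have in_gen: "\<phi> x \<in> sgen {\<phi> x, \<phi> y}" "\<phi> y \<in> sgen {\<phi> x, \<phi> y}" by (auto intro: gen_incl)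
  have zg: "\<phi> z \<in> sgen {\<phi> x, \<phi> y}" using in_gen by (auto simp flip: s(1) intro: subgrp_com[OF subgrp_gen])
  have "\<phi> w \<in> sgen {\<phi> x, \<phi> y}" "\<phi> t \<in> sgen {\<phi> x, \<phi> y}"
    using in_gen zg by (auto simp flip: s(2,3) intro: subgrp_com[OF subgrp_gen])
  then have "sgen (\<phi> ` {x, y, z, w, t}) \<subseteq> sgen {\<phi> x, \<phi> y}" using in_gen zg by (intro gen_least subgrp_gen) auto
  moreover have "sgen {\<phi> x, \<phi> y} \<subseteq> H" using c by (intro gen_least H.subG) auto
  ultimately have xy: "sgen {\<phi> x, \<phi> y} = H" using H_sgen[OF g] c by auto
  then show "generating_pair G x y" using sgen_pair_iff c by simp
  have b: "H.basis (\<phi> x) (\<phi> y)" using H.sgen_basis[OF _ _ xy] c by auto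
  have "\<phi> a ^ 4 = 1" if "a \<in> carrier G" for a
    using H.two_group_layers(2)[OF b s(1)[symmetric] pw(3,1,2)] pw cen that by (simp add: s)
  then show "a [^] (4::nat) = \<one>" if "a \<in> carrier G"
    using that eq_one_iff[of "a [^] (4::nat)"] by (simp add: pow)
  let ?u = "\<phi> x ^ 3 * \<phi> y ^ 2" and ?v = "\<phi> y * \<phi> x ^ 2"
  let ?S = "sgen ({?u, ?v} \<union> H.L 1)"
  have L: "\<phi> x ^ 2 \<in> ?S" "\<phi> y ^ 2 \<in> ?S" using H.square_in_first c by (auto intro!: gen_incl)
  have u: "\<phi> x * (\<phi> x ^ 2 * \<phi> y ^ 2) \<in> ?S" and v: "?v \<in> ?S"
    by (auto intro!: gen_incl simp: power2_eq_square power3_eq_cube mult.assoc)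
  have "\<phi> x \<in> ?S" using u L subgrp_mult[OF subgrp_gen L] subgrp_mult_right_iff[OF subgrp_gen] by blast
  moreover have "\<phi> y \<in> ?S" using v L subgrp_mult_right_iff[OF subgrp_gen] by blast
  ultimately have "H.basis ?u ?v" using c by (intro H.basis_transfer[OF b]) auto
  then have "sgen {?u, ?v} = H" by (rule H.basis_gen)
  then show "generating_pair G (x [^] (3::nat) \<otimes> y [^] (2::nat)) (y \<otimes> x [^] (2::nat))"
    using c by (simp add: mult pow flip: sgen_pair_iff)
qed

end

text \<open>The group has exponent 4, and exponents in the abelian quotient leave only squares of
  elements on the same line. For each of the three lines, one matrix representation kills the square
  from the first pair but not that from the second.\<close>

lemma small_group_128_36_beauville:
  "beauville_structure small_group_128_36 (letter2 Lx, letter2 Ly)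
    (letter2 Lx [^]\<^bsub>small_group_128_36\<^esub> (3::nat) \<otimes>\<^bsub>small_group_128_36\<^esub> letter2 Ly [^]\<^bsub>small_group_128_36\<^esub> (2::nat),
     letter2 Ly \<otimes>\<^bsub>small_group_128_36\<^esub> letter2 Lx [^]\<^bsub>small_group_128_36\<^esub> (2::nat))"
proof -
  interpret P: group small_group_128_36 unfolding presented_eqs by (rule group_presented_group)
  let ?P = small_group_128_36
  obtain \<phi> :: "_ \<Rightarrow> letter word set perm" where "group_embedding ?P \<phi>" using P.cayley_embedding[OF order_small_group_128_36(1)] by blast
  then interpret E: group_embedding ?P \<phi> .
  have o: "order ?P = 2 ^ 7" using order_small_group_128_36(2) by simp
  note gp = E.rels2_layers[OF small_group_128_36_rels small_group_128_36_generate o]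
  define x where "x = letter2 Lx"
  define y where "y = letter2 Ly"
  define b1 where "b1 = x [^]\<^bsub>?P\<^esub> (3::nat) \<otimes>\<^bsub>?P\<^esub> y [^]\<^bsub>?P\<^esub> (2::nat)"
  define b2 where "b2 = y \<otimes>\<^bsub>?P\<^esub> x [^]\<^bsub>?P\<^esub> (2::nat)"
  have c [simp]: "x \<in> carrier ?P" "y \<in> carrier ?P" using gp(1) by (auto simp: generating_pair_def x_def y_def)
  have cb [simp]: "b1 \<in> carrier ?P" "b2 \<in> carrier ?P" by (simp_all add: b1_def b2_def)
  note UT = group_UT[of 2, simplified] and CC = groups_UT_CC(2)[of 4, simplified]
  have homI: "group_hom ?P K h" if "h \<in> hom ?P K" "group K" for h and K :: "('k, 'l) monoid_scheme"
    using that by (simp add: group_hom_def group_hom_axioms_def)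
  obtain q where q: "q \<in> hom ?P (CC 4)" "q x = (1,0)" "q y = (0,1)"
    using small_group_128_36_hom[OF CC abelian_rels2(1)] by (auto simp: x_def y_def)
  obtain h1 where h1: "h1 \<in> hom ?P (UT 2)" "h1 x = (1,1,0,0,0,0)" "h1 y = (0,0,1,0,0,0)"
    using small_group_128_36_hom[OF UT unitriangular_rels2(2)] by (auto simp: x_def y_def)
  obtain h2 where h2: "h2 \<in> hom ?P (UT 2)" "h2 x = (0,0,1,0,0,0)" "h2 y = (1,1,0,0,0,0)"
    using small_group_128_36_hom[OF UT unitriangular_rels2(3)] by (auto simp: x_def y_def)
  obtain h3 where h3: "h3 \<in> hom ?P (UT 2)" "h3 x = (1,1,0,0,0,0)" "h3 y = (1,1,1,1,1,1)"
    using small_group_128_36_hom[OF UT unitriangular_rels2(4)] by (auto simp: x_def y_def)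
  interpret q: group_hom ?P "CC 4" q by (rule homI[OF q(1) CC])
  interpret h1: group_hom ?P "UT 2" h1 by (rule homI[OF h1(1) UT])
  interpret h2: group_hom ?P "UT 2" h2 by (rule homI[OF h2(1) UT])
  interpret h3: group_hom ?P "UT 2" h3 by (rule homI[OF h3(1) UT])
  have qb: "q (x \<otimes>\<^bsub>?P\<^esub> y) = (1, 1)" "q b1 = (3, 2)" "q b2 = (2, 1)" "q (b1 \<otimes>\<^bsub>?P\<^esub> b2) = (1, 3)"
    by (simp_all add: b1_def b2_def q.hom_nat_pow q CC_power) (simp_all add: CC_def)
  have tr: "b [^]\<^bsub>?P\<^esub> j = \<one>\<^bsub>?P\<^esub>" if "b \<in> carrier ?P" "4 dvd j" for b and j :: nat
    using P.pow_dvd[OF that(1) gp(3)[OF that(1)] that(2)] .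
  \<comment> \<open>The remaining case: both exponents are 2 modulo 4, so the squares would be
    conjugate, yet their images are trivial and nontrivial.\<close>
  have sp: "b [^]\<^bsub>?P\<^esub> j = \<one>\<^bsub>?P\<^esub>"
    if h: "group_hom ?P (UT 2) h" and c: "a \<in> carrier ?P" "b \<in> carrier ?P" "g \<in> carrier ?P"
      and e: "a [^]\<^bsub>?P\<^esub> i \<otimes>\<^bsub>?P\<^esub> g = g \<otimes>\<^bsub>?P\<^esub> b [^]\<^bsub>?P\<^esub> j"
      and ij: "4 dvd j \<or> i mod 4 = 2 \<and> j mod 4 = 2"
      and ab: "h a [^]\<^bsub>UT 2\<^esub> (2::nat) = \<one>\<^bsub>UT 2\<^esub>" "h b [^]\<^bsub>UT 2\<^esub> (2::nat) \<noteq> \<one>\<^bsub>UT 2\<^esub>"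
    for a b g h and i j :: nat
  proof (cases "4 dvd j")
    case False
    interpret h: group_hom ?P "UT 2" h by (rule h)
    have "a [^]\<^bsub>?P\<^esub> (2::nat) \<otimes>\<^bsub>?P\<^esub> g = g \<otimes>\<^bsub>?P\<^esub> b [^]\<^bsub>?P\<^esub> (2::nat)"
      using e ij False P.pow_mod[OF c(1) gp(3)[OF c(1)], of i 2] P.pow_mod[OF c(2) gp(3)[OF c(2)], of j 2] by simp
    from P.conj_hom[OF h c this] have "h g \<otimes>\<^bsub>UT 2\<^esub> h b [^]\<^bsub>UT 2\<^esub> (2::nat) = h g" using c ab by simp
    then have False using ab c by simp
    then show ?thesis ..
  qed (use tr c in blast)
  have "beauville_structure ?P (x, y) (b1, b2)"
  proof (rule P.beauville_structureI[OF order_small_group_128_36(1)])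
    show "generating_pair ?P x y" "generating_pair ?P b1 b2" using gp(1,2) by (simp_all add: x_def y_def b1_def b2_def)
    fix a b g and i j :: nat
    assume a: "a \<in> {x, y, x \<otimes>\<^bsub>?P\<^esub> y}" and b: "b \<in> {b1, b2, b1 \<otimes>\<^bsub>?P\<^esub> b2}" and g: "g \<in> carrier ?P"
      and e: "a [^]\<^bsub>?P\<^esub> i \<otimes>\<^bsub>?P\<^esub> g = g \<otimes>\<^bsub>?P\<^esub> b [^]\<^bsub>?P\<^esub> j"
    have ab: "a \<in> carrier ?P" "b \<in> carrier ?P" using a b by auto
    have mods: "int (i mod 4) * fst (q a) mod 4 = int (j mod 4) * fst (q b) mod 4"
      "int (i mod 4) * snd (q a) mod 4 = int (j mod 4) * snd (q b) mod 4"
      using P.conj_CC[OF q.group_hom_axioms ab g e, of "fst (q a)" "snd (q a)" "fst (q b)" "snd (q b)"]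
      by (simp_all add: zmod_int mod_mult_left_eq)
    have ij: "i mod 4 = 0 \<or> i mod 4 = 1 \<or> i mod 4 = 2 \<or> i mod 4 = 3" "j mod 4 = 0 \<or> j mod 4 = 1 \<or> j mod 4 = 2 \<or> j mod 4 = 3"
      by linarith+
    from a consider (x) "a = x" | (y) "a = y" | (xy) "a = x \<otimes>\<^bsub>?P\<^esub> y" by blast
    then show "b [^]\<^bsub>?P\<^esub> j = \<one>\<^bsub>?P\<^esub>"
    proof cases
      case x
      from b consider (1) "b = b1" | (2) "b = b2" | (3) "b = b1 \<otimes>\<^bsub>?P\<^esub> b2" by blast
      then show ?thesis
      proof cases
        case 1
        have "4 dvd j \<or> i mod 4 = 2 \<and> j mod 4 = 2" using mods ij by (elim disjE) (simp_all add: x 1 q qb dvd_eq_mod_eq_0)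
        then show ?thesis 
          by (rule sp[OF h2.group_hom_axioms ab g e])
            (simp_all add: x 1 b1_def h2.hom_nat_pow h2 small_powers UT_def)
      next
        case 2
        have "4 dvd j" using mods ij by (elim disjE) (simp_all add: x 2 q qb dvd_eq_mod_eq_0)
        then show ?thesis by (rule tr[OF ab(2)])
      next
        case 3
        have "4 dvd j" using mods ij by (elim disjE) (simp_all add: x 3 q qb dvd_eq_mod_eq_0)
        then show ?thesis by (rule tr[OF ab(2)])
      qed
    next
      case y
      from b consider (1) "b = b1" | (2) "b = b2" | (3) "b = b1 \<otimes>\<^bsub>?P\<^esub> b2" by blast
      then show ?thesis
      proof cases
        case 1
        have "4 dvd j" using mods ij by (elim disjE) (simp_all add: y 1 q qb dvd_eq_mod_eq_0)
        then show ?thesis by (rule tr[OF ab(2)])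
      next
        case 2
        have "4 dvd j \<or> i mod 4 = 2 \<and> j mod 4 = 2" using mods ij by (elim disjE) (simp_all add: y 2 q qb dvd_eq_mod_eq_0)
        then show ?thesis 
          by (rule sp[OF h1.group_hom_axioms ab g e])
            (simp_all add: y 2 b2_def h1.hom_nat_pow h1 small_powers UT_def)
      next
        case 3
        have "4 dvd j" using mods ij by (elim disjE) (simp_all add: y 3 q qb dvd_eq_mod_eq_0)
        then show ?thesis by (rule tr[OF ab(2)])
      qed
    next
      case xy
      from b consider (1) "b = b1" | (2) "b = b2" | (3) "b = b1 \<otimes>\<^bsub>?P\<^esub> b2" by blast
      then show ?thesis
      proof cases
        case 1
        have "4 dvd j" using mods ij by (elim disjE) (simp_all add: xy 1 q qb dvd_eq_mod_eq_0)
        then show ?thesis by (rule tr[OF ab(2)])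
      next
        case 2
        have "4 dvd j" using mods ij by (elim disjE) (simp_all add: xy 2 q qb dvd_eq_mod_eq_0)
        then show ?thesis by (rule tr[OF ab(2)])
      next
        case 3
        have "4 dvd j \<or> i mod 4 = 2 \<and> j mod 4 = 2" using mods ij by (elim disjE) (simp_all add: xy 3 q qb dvd_eq_mod_eq_0)
        then show ?thesis 
          by (rule sp[OF h3.group_hom_axioms ab g e])
            (simp_all add: xy 3 b1_def b2_def h3.hom_nat_pow h3 small_powers UT_def)
      qed
    qed
  qed
  then show ?thesis by (simp add: x_def y_def b1_def b2_def)
qed

lemma nonabelian_of_hom:
  fixes G (structure)
  assumes "group_hom G K h" "x \<in> carrier G" "y \<in> carrier G" "h x \<otimes>\<^bsub>K\<^esub> h y \<noteq> h y \<otimes>\<^bsub>K\<^esub> h x"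
  shows "\<not> comm_group G"
proof
  assume "comm_group G"
  then interpret comm_group G .
  interpret h: group_hom G K h by (rule assms(1))
  have "h (x \<otimes> y) = h (y \<otimes> x)" using assms by (simp add: m_comm)
  then show False using assms by simp
qed

lemma small_group_128_36_nonabelian_beauville: "nonabelian_beauville_p_group 2 small_group_128_36"
proof -
  have g: "group small_group_128_36" unfolding presented_eqs by (rule group_presented_group)
  note UT = group_UT[of 2, simplified]
  obtain h where h: "h \<in> hom small_group_128_36 (UT 2)" "h (letter2 Lx) = (1,0,0,0,0,0)" "h (letter2 Ly) = (0,1,0,0,0,0)"
    using small_group_128_36_hom[OF UT unitriangular_rels2(1)] by blast
  have "\<not> comm_group small_group_128_36"
    using h g UT small_group_128_36_rels
    by (intro nonabelian_of_hom[of _ "UT 2" h "letter2 Lx" "letter2 Ly"])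
      (simp_all add: group_hom_def group_hom_axioms_def rels2_def, simp add: UT_def)
  moreover have "order small_group_128_36 = 2 ^ 7" using order_small_group_128_36(2) by simp
  ultimately show ?thesis
    unfolding nonabelian_beauville_p_group_def finite_p_group_def beauville_group_def
    using g order_small_group_128_36(1) small_group_128_36_beauville by blast
qed

subsection \<open>The prime 3\<close>

lemma com_inverse_eqI:
  fixes a b c :: "'a::group_mult"
  assumes "b * a = a * (b * c)"
  shows "com (inverse b) (inverse a) = c"
proof -
  have "com (inverse b) (inverse a) = inverse b * (inverse a * (b * a))" by (simp add: com_def mult.assoc)
  then show ?thesis by (simp add: assms)
qed

lemma com_inverse_right_eqI:
  fixes b c d :: "'a::group_mult"
  assumes e: "c * b = b * (c * d)" and cd: "c * d = d * c"
  shows "com c (inverse b) = inverse d"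
proof -
  have "c * d = inverse b * (c * b)" by (simp add: e)
  then have "d * com c (inverse b) = inverse b * (c * b) * inverse b * inverse c * b"
    by (simp add: com_def cd mult.assoc[symmetric])
  also have "\<dots> = 1" by (simp add: mult.assoc)
  finally show ?thesis using g_inverse_unique by metis
qed

lemma com_inverse_left_eq_one: "com a b = 1 \<Longrightarrow> com (inverse a) b = (1::'a::group_mult)"
  using com_mult_left[of "inverse a" a b] by (simp add: cj_simps)

context group_embedding
begin

text \<open>The second pair is \<open>x\<close> and \<open>y^2\<close>, changed by the central
  elements \<open>t\<close> and \<open>w\<close> of \<open>L 1\<close>. It stays on the lines of
  \<open>x\<close> and \<open>y\<close>, while its product moves from the line of
  \<open>x * y\<close> to that of \<open>x * y^2\<close>.\<close>

lemma rels3_layers: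
  assumes r: "rels3 G x y z w t" and g: "generate G {x, y, z, w, t} = carrier G" and o: "order G = 3 ^ n"
  shows "generating_pair G x y" "generating_pair G (x \<otimes> t) (y \<otimes> y \<otimes> w)"
    "a \<in> carrier G \<Longrightarrow> a [^] (9::nat) = \<one>"
proof -
  have "Factorial_Ring.prime (3::nat)" by simp
  then interpret H: fin_p_group H 3 using fin_p_group_H o by blast
  have c: "x \<in> carrier G" "y \<in> carrier G" "z \<in> carrier G" "w \<in> carrier G" "t \<in> carrier G"
    using r by (auto simp: rels3_def)
  have e: "\<phi> y * \<phi> x = \<phi> x * (\<phi> y * \<phi> z)" "\<phi> z * \<phi> x = \<phi> x * (\<phi> z * \<phi> w)" "\<phi> z * \<phi> y = \<phi> y * (\<phi> z * \<phi> t)"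
    "\<phi> z * \<phi> w = \<phi> w * \<phi> z" "\<phi> z * \<phi> t = \<phi> t * \<phi> z"
    using c r by (auto simp: rels3_def simp flip: mult)
  \<comment> \<open>The presentation conjugates from the right, so \<open>z\<close>,
    \<open>w\<close>, \<open>t\<close> are commutators of inverses. The layer lemma is therefore
    applied to the basis \<open>(y^-1, x^-1)\<close>.\<close>
  note s = com_inverse_eqI[OF e(1)] com_inverse_eqI[OF e(2)] com_inverse_eqI[OF e(3)]
  note s' = com_inverse_right_eqI[OF e(3,5)] com_inverse_right_eqI[OF e(2,4)]
  have pw: "\<phi> x ^ 3 = 1" "\<phi> y ^ 3 = 1" "\<phi> z ^ 3 = 1" "\<phi> w ^ 3 = 1" "\<phi> t ^ 3 = 1"
    using c r by (auto simp: rels3_def map_one simp flip: pow)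
  have ipw: "inverse u ^ 3 = 1" if "u ^ 3 = 1" for u :: 'b using that by (simp flip: g_inverse_power)
  have cen: "com (\<phi> w) u = 1" "com (\<phi> t) u = 1" if "u \<in> H" for u
    by (rule central[OF g _ _ _ that]; use r in \<open>auto simp: rels3_def\<close>)+
  have in_gen: "\<phi> x \<in> sgen {\<phi> x, \<phi> y}" "\<phi> y \<in> sgen {\<phi> x, \<phi> y}" by (auto intro: gen_incl)
  have zg: "\<phi> z \<in> sgen {\<phi> x, \<phi> y}"
    using in_gen by (auto simp flip: s(1) intro: subgrp_com[OF subgrp_gen] subgrp_inverse[OF subgrp_gen])
  have "\<phi> w \<in> sgen {\<phi> x, \<phi> y}" "\<phi> t \<in> sgen {\<phi> x, \<phi> y}"
    unfolding s(2)[symmetric] s(3)[symmetric] by (intro subgrp_com[OF subgrp_gen] subgrp_inverse[OF subgrp_gen] in_gen zg)+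
  then have "sgen (\<phi> ` {x, y, z, w, t}) \<subseteq> sgen {\<phi> x, \<phi> y}" using in_gen zg by (intro gen_least subgrp_gen) auto
  moreover have "sgen {\<phi> x, \<phi> y} \<subseteq> H" using c by (intro gen_least H.subG) auto
  ultimately have xy: "sgen {\<phi> x, \<phi> y} = H" using H_sgen[OF g] c by auto
  then show "generating_pair G x y" using sgen_pair_iff c by simp
  have b: "H.basis (\<phi> x) (\<phi> y)" using H.sgen_basis[OF _ _ xy] c by auto
  have b': "H.basis (inverse (\<phi> y)) (inverse (\<phi> x))"
  proof (rule H.basis_transfer[OF b])
    have "inverse (\<phi> x) \<in> sgen ({inverse (\<phi> y), inverse (\<phi> x)} \<union> H.L 1)"
      "inverse (\<phi> y) \<in> sgen ({inverse (\<phi> y), inverse (\<phi> x)} \<union> H.L 1)" by (auto intro: gen_incl)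
    then show "\<phi> x \<in> sgen ({inverse (\<phi> y), inverse (\<phi> x)} \<union> H.L 1)"
      "\<phi> y \<in> sgen ({inverse (\<phi> y), inverse (\<phi> x)} \<union> H.L 1)"
      using subgrp_inverse_iff[OF subgrp_gen] by blast+
  qed (use c in auto)
  have L1: "f ^ 3 = 1" if "f \<in> H.L 1" for f
    by (rule H.three_group_layers(2)[OF HOL.refl b' s(1)[symmetric] pw(3) ipw[OF pw(2)] ipw[OF pw(1)] _ _ _ _ that])
      (simp_all add: s' ipw pw com_inverse_left_eq_one cen)
  have "\<phi> a ^ 9 = 1" if "a \<in> carrier G" for a
  proof -
    have "\<phi> a ^ 3 \<in> H.L 1" using H.L_power_in[of "\<phi> a" 1] that by simp
    from L1[OF this] show ?thesis by (simp flip: power_mult)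
  qed
  then show "a [^] (9::nat) = \<one>" if "a \<in> carrier G"
    using that eq_one_iff[of "a [^] (9::nat)"] by (simp add: pow)
  let ?u = "\<phi> x * \<phi> t" and ?v = "\<phi> y * \<phi> y * \<phi> w"
  let ?S = "sgen ({?u, ?v} \<union> H.L 1)"
  have "com (inverse (\<phi> z)) (inverse (\<phi> x)) \<in> H.L 1" "com (inverse (\<phi> z)) (inverse (\<phi> y)) \<in> H.L 1"
    using c by (auto intro!: H.L_comI[of _ 0])
  then have L: "\<phi> w \<in> ?S" "\<phi> t \<in> ?S" by (simp_all add: s gen_incl)
  have u: "?u \<in> ?S" and v: "?v \<in> ?S" by (auto intro!: gen_incl)
  have "\<phi> x \<in> ?S" using u L subgrp_mult_right_iff[OF subgrp_gen] by blast
  moreover have "\<phi> y * \<phi> y \<in> ?S" using v L subgrp_mult_right_iff[OF subgrp_gen] by blast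
  then have "\<phi> y * \<phi> y * (\<phi> y * \<phi> y) \<in> ?S" using subgrp_mult[OF subgrp_gen] by blast
  moreover have "\<phi> y * \<phi> y * (\<phi> y * \<phi> y) = \<phi> y ^ 3 * \<phi> y" by (simp add: power3_eq_cube mult.assoc)
  ultimately have "H.basis ?u ?v" using c by (intro H.basis_transfer[OF b]) (auto simp: pw)
  then have "sgen {?u, ?v} = H" by (rule H.basis_gen)
  then show "generating_pair G (x \<otimes> t) (y \<otimes> y \<otimes> w)"
    using c by (simp add: mult flip: sgen_pair_iff)
qed

end

text \<open>The upper left 3 by 3 blocks of these matrices modulo 3 are the powers of the block with entries
  1, 1, 0 in the places (1,2), (2,3), (1,3); both unitriangular representations take values in them.\<close>

definition power_block :: "ut \<Rightarrow> bool" where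
  "power_block = (\<lambda>(a, b, c, d, e, f). a = b \<and> 3 dvd 2 * d - b * b + b)"

text \<open>The divisibility encodes \<open>d = binomial(b, 2)\<close> modulo 3, the (1,3) entry of
  the \<open>b\<close>-th power of the block; binomial(b, 2) is additive in \<open>b\<close> up to
  the product term \<open>b * b'\<close>, as is the entry.\<close>

lemma power_block_mult:
  assumes "power_block u" "power_block v"
  shows "power_block (u \<otimes>\<^bsub>UT 3\<^esub> v)"
proof -
  obtain a c d e f where u: "u = (a, a, c, d, e, f)" "3 dvd 2 * d - a * a + a"
    using assms(1) by (cases u) (auto simp: power_block_def)
  obtain a' c' d' e' f' where v: "v = (a', a', c', d', e', f')" "3 dvd 2 * d' - a' * a' + a'"
    using assms(2) by (cases v) (auto simp: power_block_def)
  have "3 dvd (2 * d - a * a + a) + (2 * d' - a' * a' + a')" by (rule dvd_add[OF u(2) v(2)])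
  also have "(2 * d - a * a + a) + (2 * d' - a' * a' + a') = 2 * (d + d' + a * a') - (a + a') * (a + a') + (a + a')"
    by (simp add: algebra_simps)
  finally have z: "(2 * (d + d' + a * a') - (a + a') * (a + a') + (a + a')) mod 3 = 0" by (simp only: dvd_eq_mod_eq_0)
  have m: "(2 * ((d + d' + a * a') mod 3) - ((a + a') mod 3) * ((a + a') mod 3) + (a + a') mod 3) mod 3 =
    (2 * (d + d' + a * a') - (a + a') * (a + a') + (a + a')) mod 3"
    by (rule mod_add_cong[OF mod_diff_cong[OF mod_mult_cong[OF HOL.refl mod_mod_trivial] mod_mult_cong[OF mod_mod_trivial mod_mod_trivial]] mod_mod_trivial])
  have "(2 * ((d + d' + a * a') mod 3) - ((a + a') mod 3) * ((a + a') mod 3) + (a + a') mod 3) mod 3 = 0"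
    by (rule HOL.trans[OF m z])
  then have "3 dvd 2 * ((d + d' + a * a') mod 3) - ((a + a') mod 3) * ((a + a') mod 3) + (a + a') mod 3"
    by (simp only: dvd_eq_mod_eq_0)
  moreover obtain C E F where "u \<otimes>\<^bsub>UT 3\<^esub> v = ((a + a') mod 3, (a + a') mod 3, C, (d + d' + a * a') mod 3, E, F)"
    unfolding u v by (simp add: UT_def)
  ultimately show ?thesis by (simp only: power_block_def prod.case simp_thms)
qed

text \<open>All generators in both pairs have order 3, so on the shared lines it suffices that
  \<open>x\<close> is not conjugate to \<open>x * t\<close>, nor \<open>y^2\<close> to
  \<open>y^2 * w\<close>. The two products lie on different lines, which leaves their cubes to be
  compared.\<close>

lemma beauville_3_group_beauville:
  "beauville_structure beauville_3_group (letter3 Lx, letter3 Ly)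
    (letter3 Lx \<otimes>\<^bsub>beauville_3_group\<^esub> letter3 Lt, letter3 Ly \<otimes>\<^bsub>beauville_3_group\<^esub> letter3 Ly \<otimes>\<^bsub>beauville_3_group\<^esub> letter3 Lw)"
proof -
  interpret P: group beauville_3_group unfolding presented_eqs by (rule group_presented_group)
  let ?P = beauville_3_group
  obtain \<phi> :: "_ \<Rightarrow> letter word set perm" where "group_embedding ?P \<phi>" using P.cayley_embedding[OF order_beauville_3_group(1)] by blast
  then interpret E: group_embedding ?P \<phi> .
  have o: "order ?P = 3 ^ 5" using order_beauville_3_group(2) by simp
  note gp = E.rels3_layers[OF beauville_3_group_rels beauville_3_group_generate o]
  define x where "x = letter3 Lx"
  define y where "y = letter3 Ly"
  define z where "z = letter3 Lz"
  define w where "w = letter3 Lw"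
  define t where "t = letter3 Lt"
  note xyzwt = x_def y_def z_def w_def t_def
  define b1 where "b1 = x \<otimes>\<^bsub>?P\<^esub> t"
  define b2 where "b2 = y \<otimes>\<^bsub>?P\<^esub> y \<otimes>\<^bsub>?P\<^esub> w"
  have c [simp]: "x \<in> carrier ?P" "y \<in> carrier ?P" "z \<in> carrier ?P" "w \<in> carrier ?P" "t \<in> carrier ?P"
    and r: "x [^]\<^bsub>?P\<^esub> (3::nat) = \<one>\<^bsub>?P\<^esub>" "y [^]\<^bsub>?P\<^esub> (3::nat) = \<one>\<^bsub>?P\<^esub>" "z [^]\<^bsub>?P\<^esub> (3::nat) = \<one>\<^bsub>?P\<^esub>"
      "w [^]\<^bsub>?P\<^esub> (3::nat) = \<one>\<^bsub>?P\<^esub>" "t [^]\<^bsub>?P\<^esub> (3::nat) = \<one>\<^bsub>?P\<^esub>"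
    and s: "x \<otimes>\<^bsub>?P\<^esub> t = t \<otimes>\<^bsub>?P\<^esub> x" "y \<otimes>\<^bsub>?P\<^esub> w = w \<otimes>\<^bsub>?P\<^esub> y"
    using beauville_3_group_rels unfolding rels3_def xyzwt by auto
  have cb [simp]: "b1 \<in> carrier ?P" "b2 \<in> carrier ?P" by (simp_all add: b1_def b2_def)
  have b13: "b1 [^]\<^bsub>?P\<^esub> (3::nat) = \<one>\<^bsub>?P\<^esub>"
    using P.pow_mult_distrib[OF s(1) c(1,5), of 3] r by (simp add: b1_def)
  have "y \<otimes>\<^bsub>?P\<^esub> y \<otimes>\<^bsub>?P\<^esub> w = y \<otimes>\<^bsub>?P\<^esub> (w \<otimes>\<^bsub>?P\<^esub> y)" by (simp only: P.m_assoc c s(2))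
  also have "\<dots> = w \<otimes>\<^bsub>?P\<^esub> y \<otimes>\<^bsub>?P\<^esub> y" by (simp only: P.m_assoc[symmetric] c s(2))
  also have "\<dots> = w \<otimes>\<^bsub>?P\<^esub> (y \<otimes>\<^bsub>?P\<^esub> y)" by (simp only: P.m_assoc c)
  finally have yyw: "y \<otimes>\<^bsub>?P\<^esub> y \<otimes>\<^bsub>?P\<^esub> w = w \<otimes>\<^bsub>?P\<^esub> (y \<otimes>\<^bsub>?P\<^esub> y)" .
  have b23: "b2 [^]\<^bsub>?P\<^esub> (3::nat) = \<one>\<^bsub>?P\<^esub>"
    using P.pow_mult_distrib[OF yyw, of 3] P.pow_mult_distrib[of y y 3] r by (simp add: b2_def)
  note UT = group_UT[of 3, simplified] and CC = groups_UT_CC(2)[of 3, simplified]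
  obtain q where q: "q \<in> hom ?P (CC 3)" "q x = (1,0)" "q y = (0,1)" "q w = (0,0)" "q t = (0,0)"
    using beauville_3_group_hom[OF CC abelian_rels3(1)] by (auto simp: xyzwt)
  obtain h1 where h1: "h1 \<in> hom ?P (UT 3)" "h1 x = (1,1,0,0,0,0)" "h1 y = (0,0,1,0,0,0)" "h1 z = (0,0,0,0,2,1)"
      "h1 w = (0,0,0,0,0,1)" "h1 t = (0,0,0,0,0,0)"
    using beauville_3_group_hom[OF UT unitriangular_rels3(2)] by (auto simp: xyzwt)
  obtain h2 where h2: "h2 \<in> hom ?P (UT 3)" "h2 x = (0,0,1,0,0,0)" "h2 y = (1,1,0,0,0,0)" "h2 z = (0,0,0,0,1,2)"
      "h2 w = (0,0,0,0,0,0)" "h2 t = (0,0,0,0,0,2)"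
    using beauville_3_group_hom[OF UT unitriangular_rels3(3)] by (auto simp: xyzwt)
  interpret q: group_hom ?P "CC 3" q using q(1) CC by (simp add: group_hom_def group_hom_axioms_def)
  interpret h1: group_hom ?P "UT 3" h1 using h1(1) UT by (simp add: group_hom_def group_hom_axioms_def)
  interpret h2: group_hom ?P "UT 3" h2 using h2(1) UT by (simp add: group_hom_def group_hom_axioms_def)
  have qb: "q (x \<otimes>\<^bsub>?P\<^esub> y) = (1, 1)" "q b1 = (1, 0)" "q b2 = (0, 2)" "q (b1 \<otimes>\<^bsub>?P\<^esub> b2) = (1, 2)"
    by (simp_all add: b1_def b2_def q) (simp_all add: CC_def)
  have St: "power_block (h g)" if h: "group_hom ?P (UT 3) h" and g: "g \<in> carrier ?P"
    and hs: "power_block (h x)" "power_block (h y)" "power_block (h z)" "power_block (h w)" "power_block (h t)" for h g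
  proof -
    interpret h: group_hom ?P "UT 3" h by (rule h)
    have "g \<in> generate ?P {x, y, z, w, t}" using g beauville_3_group_generate by (simp add: xyzwt)
    then show ?thesis
    proof (rule P.generate_torsion_induct[rotated -1, where k = 3])
      show "power_block (h \<one>\<^bsub>?P\<^esub>)" by (simp add: h.hom_one) (simp add: UT_def power_block_def)
      fix a b assume "a \<in> carrier ?P" "b \<in> carrier ?P" "power_block (h a)" "power_block (h b)"
      then show "power_block (h (a \<otimes>\<^bsub>?P\<^esub> b))" by (simp add: power_block_mult)
    qed (use r hs in auto)
  qed
  have comp: "\<exists>b c d e f. h g = (b, b, c, d, e, f) \<and> 0 \<le> b \<and> b < 3 \<and> 0 \<le> d \<and> d < 3 \<and> 3 dvd 2 * d - b * b + b"
    if h: "group_hom ?P (UT 3) h" and g: "g \<in> carrier ?P" and "power_block (h g)" for h g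
  proof -
    interpret h: group_hom ?P "UT 3" h by (rule h)
    have "h g \<in> carrier (UT 3)" using g by simp
    then show ?thesis using that(3) by (cases "h g") (auto simp: power_block_def UT_def)
  qed
  have dvd3: "v = 0" if "3 dvd v" "0 \<le> v" "v < 3" for v :: int using that zdvd_not_zless[of v 3] by fastforce
  \<comment> \<open>Under \<open>h2\<close> the entry (2,4) forces \<open>b = 0\<close>, so the
    block of \<open>g\<close> is trivial and \<open>d\<close> vanishes modulo 3; the corner entry
    asks for 3 to divide \<open>2 + d\<close>.\<close>
  have unit: "\<not> x \<otimes>\<^bsub>?P\<^esub> g = g \<otimes>\<^bsub>?P\<^esub> b1" if g: "g \<in> carrier ?P" for g
  proof
    assume "x \<otimes>\<^bsub>?P\<^esub> g = g \<otimes>\<^bsub>?P\<^esub> b1"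
    then have "h2 (x \<otimes>\<^bsub>?P\<^esub> g) = h2 (g \<otimes>\<^bsub>?P\<^esub> b1)" by simp
    then have eq: "h2 x \<otimes>\<^bsub>UT 3\<^esub> h2 g = h2 g \<otimes>\<^bsub>UT 3\<^esub> (h2 x \<otimes>\<^bsub>UT 3\<^esub> h2 t)" using g by (simp add: b1_def)
    have "power_block (h2 g)" by (rule St[OF h2.group_hom_axioms g]) (simp_all add: h2 power_block_def)
    then obtain b c d e f where u: "h2 g = (b, b, c, d, e, f)" "0 \<le> b" "b < 3" "0 \<le> d" "d < 3" "3 dvd 2 * d - b * b + b"
      using comp[OF h2.group_hom_axioms g] by blast
    have "e mod 3 = (e + b) mod 3" "f mod 3 = (2 + f + d) mod 3"
      using eq by (auto simp: h2 u UT_def mod_simps algebra_simps)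
    then have "3 dvd e - (e + b)" "3 dvd f - (2 + f + d)" by (simp_all only: mod_eq_dvd_iff)
    then have d: "3 dvd b" "3 dvd 2 + d" by presburger+
    have "b = 0" using dvd3 d u by blast
    then have "3 dvd 2 * d" using u by simp
    then have "3 dvd d" by presburger
    then show False using d(2) by presburger
  qed
  have unit': "\<not> y [^]\<^bsub>?P\<^esub> (2::nat) \<otimes>\<^bsub>?P\<^esub> g = g \<otimes>\<^bsub>?P\<^esub> b2" if g: "g \<in> carrier ?P" for g
  proof
    assume "y [^]\<^bsub>?P\<^esub> (2::nat) \<otimes>\<^bsub>?P\<^esub> g = g \<otimes>\<^bsub>?P\<^esub> b2"
    then have "h1 (y \<otimes>\<^bsub>?P\<^esub> y \<otimes>\<^bsub>?P\<^esub> g) = h1 (g \<otimes>\<^bsub>?P\<^esub> b2)" by (simp add: numeral_2_eq_2)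
    then have eq: "h1 y \<otimes>\<^bsub>UT 3\<^esub> h1 y \<otimes>\<^bsub>UT 3\<^esub> h1 g = h1 g \<otimes>\<^bsub>UT 3\<^esub> (h1 y \<otimes>\<^bsub>UT 3\<^esub> h1 y \<otimes>\<^bsub>UT 3\<^esub> h1 w)"
      using g by (simp add: b2_def)
    have "power_block (h1 g)" by (rule St[OF h1.group_hom_axioms g]) (simp_all add: h1 power_block_def)
    then obtain b c d e f where u: "h1 g = (b, b, c, d, e, f)" "0 \<le> b" "b < 3" "0 \<le> d" "d < 3" "3 dvd 2 * d - b * b + b"
      using comp[OF h1.group_hom_axioms g] by blast
    have "e mod 3 = (e + 2 * b) mod 3" "f mod 3 = (1 + f + 2 * d) mod 3"
      using eq by (auto simp: h1 u UT_def mod_simps algebra_simps)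
    then have "3 dvd e - (e + 2 * b)" "3 dvd f - (1 + f + 2 * d)" by (simp_all only: mod_eq_dvd_iff)
    then have d: "3 dvd 2 * b" "3 dvd 1 + 2 * d" by presburger+
    have "3 dvd b" using d(1) by presburger
    then have "b = 0" using dvd3 u by blast
    then have "3 dvd 2 * d" using u by simp
    then show False using d(2) by presburger
  qed
  \<comment> \<open>Raising to the \<open>j\<close>-th power normalises the exponent on the right to
    1, because \<open>j * j\<close> is 1 modulo 3.\<close>
  have red: "a [^]\<^bsub>?P\<^esub> k \<otimes>\<^bsub>?P\<^esub> g = g \<otimes>\<^bsub>?P\<^esub> b"
    if ab: "a \<in> carrier ?P" "b \<in> carrier ?P" and g: "g \<in> carrier ?P"
      and e: "a [^]\<^bsub>?P\<^esub> i \<otimes>\<^bsub>?P\<^esub> g = g \<otimes>\<^bsub>?P\<^esub> b [^]\<^bsub>?P\<^esub> j"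
      and p3: "a [^]\<^bsub>?P\<^esub> (3::nat) = \<one>\<^bsub>?P\<^esub>" "b [^]\<^bsub>?P\<^esub> (3::nat) = \<one>\<^bsub>?P\<^esub>"
      and m: "(i * j) mod 3 = k" "(j * j) mod 3 = 1" for a b g and i j k :: nat
  proof -
    have "(a [^]\<^bsub>?P\<^esub> i) [^]\<^bsub>?P\<^esub> j \<otimes>\<^bsub>?P\<^esub> g = g \<otimes>\<^bsub>?P\<^esub> (b [^]\<^bsub>?P\<^esub> j) [^]\<^bsub>?P\<^esub> j"
      using P.conj_pow[OF _ _ g e] ab by simp
    then show ?thesis using P.pow_mod[OF ab(1) p3(1) m(1)] P.pow_mod[OF ab(2) p3(2) m(2)] ab by (simp add: P.nat_pow_pow)
  qed
  \<comment> \<open>The cubes map to the corner with values 1, 2 under \<open>h1\<close> and 1, 1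
    under \<open>h2\<close>. With \<open>k\<close> and \<open>l\<close> a third of the exponents, 3
    divides \<open>k - 2 * l\<close> and \<open>k - l\<close>, hence \<open>l\<close>.\<close>
  have triple: "9 dvd j"
    if g: "g \<in> carrier ?P" and d: "3 dvd i" "3 dvd j"
      and e: "(x \<otimes>\<^bsub>?P\<^esub> y) [^]\<^bsub>?P\<^esub> i \<otimes>\<^bsub>?P\<^esub> g = g \<otimes>\<^bsub>?P\<^esub> (b1 \<otimes>\<^bsub>?P\<^esub> b2) [^]\<^bsub>?P\<^esub> j" for g and i j :: nat
  proof -
    obtain k l where kl: "i = 3 * k" "j = 3 * l" using d by (auto elim!: dvdE)
    let ?A = "(x \<otimes>\<^bsub>?P\<^esub> y) [^]\<^bsub>?P\<^esub> (3::nat)" and ?B = "(b1 \<otimes>\<^bsub>?P\<^esub> b2) [^]\<^bsub>?P\<^esub> (3::nat)"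
    have AB: "?A \<in> carrier ?P" "?B \<in> carrier ?P" by simp_all
    have e': "?A [^]\<^bsub>?P\<^esub> k \<otimes>\<^bsub>?P\<^esub> g = g \<otimes>\<^bsub>?P\<^esub> ?B [^]\<^bsub>?P\<^esub> l" using e by (simp add: kl P.nat_pow_pow)
    have v1: "h1 ?A = (0,0,0,0,0,1)" "h1 ?B = (0,0,0,0,0,2)"
      by (simp_all add: h1.hom_nat_pow b1_def b2_def h1) (simp_all add: small_powers UT_def)
    have v2: "h2 ?A = (0,0,0,0,0,1)" "h2 ?B = (0,0,0,0,0,1)"
      by (simp_all add: h2.hom_nat_pow b1_def b2_def h2) (simp_all add: small_powers UT_def)
    have lin: "3 dvd int k * \<alpha> - int l * \<beta>"
      if h: "group_hom ?P (UT 3) h" and v: "h ?A = (0,0,0,0,0,\<alpha>)" "h ?B = (0,0,0,0,0,\<beta>)" for h \<alpha> \<beta>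
    proof -
      obtain a b c d e f where u: "h g = (a, b, c, d, e, f)" by (cases "h g")
      have pwr: "(0, 0, 0, 0, 0, \<gamma>) [^]\<^bsub>UT 3\<^esub> n = (0, 0, 0, 0, 0, int n * \<gamma> mod 3)" for \<gamma> and n :: nat
        by (simp add: power_UT)
      have "(int k * \<alpha> mod 3 + f) mod 3 = (f + int l * \<beta> mod 3) mod 3"
        using P.conj_hom[OF h AB g e'] by (simp add: v u pwr) (simp add: UT_def)
      then have "(int k * \<alpha> + f) mod 3 = (f + int l * \<beta>) mod 3" by (simp add: mod_simps)
      then show ?thesis by (simp add: mod_eq_dvd_iff algebra_simps)
    qed
    have "3 dvd int k * 1 - int l * 2" "3 dvd int k * 1 - int l * 1"
      using lin[OF h1.group_hom_axioms v1] lin[OF h2.group_hom_axioms v2] .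
    then have "3 dvd (int k * 1 - int l * 1) - (int k * 1 - int l * 2)" by (rule dvd_diff[rotated])
    then have "3 dvd l" by (simp flip: int_dvd_int_iff)
    then show ?thesis by (auto simp: kl)
  qed
  have "beauville_structure ?P (x, y) (b1, b2)"
  proof (rule P.beauville_structureI[OF order_beauville_3_group(1)])
    show "generating_pair ?P x y" "generating_pair ?P b1 b2" using gp(1,2) by (simp_all add: xyzwt b1_def b2_def)
    fix a b g and i j :: nat
    assume a: "a \<in> {x, y, x \<otimes>\<^bsub>?P\<^esub> y}" and b: "b \<in> {b1, b2, b1 \<otimes>\<^bsub>?P\<^esub> b2}" and g: "g \<in> carrier ?P"
      and e: "a [^]\<^bsub>?P\<^esub> i \<otimes>\<^bsub>?P\<^esub> g = g \<otimes>\<^bsub>?P\<^esub> b [^]\<^bsub>?P\<^esub> j"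
    have ab: "a \<in> carrier ?P" "b \<in> carrier ?P" using a b by auto
    have mods: "int (i mod 3) * fst (q a) mod 3 = int (j mod 3) * fst (q b) mod 3"
      "int (i mod 3) * snd (q a) mod 3 = int (j mod 3) * snd (q b) mod 3"
      using P.conj_CC[OF q.group_hom_axioms ab g e, of "fst (q a)" "snd (q a)" "fst (q b)" "snd (q b)"]
      by (simp_all add: zmod_int mod_mult_left_eq)
    have ij: "i mod 3 = 0 \<or> i mod 3 = 1 \<or> i mod 3 = 2" "j mod 3 = 0 \<or> j mod 3 = 1 \<or> j mod 3 = 2"
      by linarith+
    have triv: "b [^]\<^bsub>?P\<^esub> j = \<one>\<^bsub>?P\<^esub>" if "a [^]\<^bsub>?P\<^esub> i = \<one>\<^bsub>?P\<^esub>" using e that ab g by simp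
    have prod: "(m * n) mod 3 = k" if "m mod 3 = m'" "n mod 3 = n'" "(m' * n') mod 3 = k" for m n m' n' k :: nat
      using that by (metis mod_mult_eq)
    from a consider (x) "a = x" | (y) "a = y" | (xy) "a = x \<otimes>\<^bsub>?P\<^esub> y" by blast
    then show "b [^]\<^bsub>?P\<^esub> j = \<one>\<^bsub>?P\<^esub>"
    proof cases
      case x
      from b consider (1) "b = b1" | (2) "b = b2" | (3) "b = b1 \<otimes>\<^bsub>?P\<^esub> b2" by blast
      then show ?thesis
      proof cases
        case 1
        have "3 dvd j \<or> i mod 3 = 1 \<and> j mod 3 = 1 \<or> i mod 3 = 2 \<and> j mod 3 = 2" using mods ij by (elim disjE) (simp_all add: x 1 q qb dvd_eq_mod_eq_0)
        then show ?thesis 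
        proof (elim disjE conjE)
          assume "3 dvd j"
          then show ?thesis using P.pow_dvd[OF cb(1) b13] 1 by simp
        next
          assume m: "i mod 3 = 1" "j mod 3 = 1"
          have "x [^]\<^bsub>?P\<^esub> (1::nat) \<otimes>\<^bsub>?P\<^esub> g = g \<otimes>\<^bsub>?P\<^esub> b1"
            using red[OF _ _ g, of x b1 i j 1] e prod[OF m] prod[OF m(2,2)] r b13 x 1 by simp
          then show ?thesis using unit[OF g] by simp
        next
          assume m: "i mod 3 = 2" "j mod 3 = 2"
          have "x [^]\<^bsub>?P\<^esub> (1::nat) \<otimes>\<^bsub>?P\<^esub> g = g \<otimes>\<^bsub>?P\<^esub> b1"
            using red[OF _ _ g, of x b1 i j 1] e prod[OF m] prod[OF m(2,2)] r b13 x 1 by simp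
          then show ?thesis using unit[OF g] by simp
        qed
      next
        case 2
        have "3 dvd j" using mods ij by (elim disjE) (simp_all add: x 2 q qb dvd_eq_mod_eq_0)
        then show ?thesis using P.pow_dvd[OF cb(2) b23] 2 by simp
      next
        case 3
        have "3 dvd i" using mods ij by (elim disjE) (simp_all add: x 3 q qb dvd_eq_mod_eq_0)
        then show ?thesis using P.pow_dvd[OF c(1) r(1)] x by (intro triv) simp
      qed
    next
      case y
      from b consider (1) "b = b1" | (2) "b = b2" | (3) "b = b1 \<otimes>\<^bsub>?P\<^esub> b2" by blast
      then show ?thesis
      proof cases
        case 1
        have "3 dvd j" using mods ij by (elim disjE) (simp_all add: y 1 q qb dvd_eq_mod_eq_0)
        then show ?thesis using P.pow_dvd[OF cb(1) b13] 1 by simp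
      next
        case 2
        have "3 dvd j \<or> i mod 3 = 2 \<and> j mod 3 = 1 \<or> i mod 3 = 1 \<and> j mod 3 = 2" using mods ij by (elim disjE) (simp_all add: y 2 q qb dvd_eq_mod_eq_0)
        then show ?thesis 
        proof (elim disjE conjE)
          assume "3 dvd j"
          then show ?thesis using P.pow_dvd[OF cb(2) b23] 2 by simp
        next
          assume m: "i mod 3 = 2" "j mod 3 = 1"
          have "y [^]\<^bsub>?P\<^esub> (2::nat) \<otimes>\<^bsub>?P\<^esub> g = g \<otimes>\<^bsub>?P\<^esub> b2"
            using red[OF _ _ g, of y b2 i j 2] e prod[OF m] prod[OF m(2,2)] r b23 y 2 by simp
          then show ?thesis using unit'[OF g] by simp
        next
          assume m: "i mod 3 = 1" "j mod 3 = 2"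
          have "y [^]\<^bsub>?P\<^esub> (2::nat) \<otimes>\<^bsub>?P\<^esub> g = g \<otimes>\<^bsub>?P\<^esub> b2"
            using red[OF _ _ g, of y b2 i j 2] e prod[OF m] prod[OF m(2,2)] r b23 y 2 by simp
          then show ?thesis using unit'[OF g] by simp
        qed
      next
        case 3
        have "3 dvd i" using mods ij by (elim disjE) (simp_all add: y 3 q qb dvd_eq_mod_eq_0)
        then show ?thesis using P.pow_dvd[OF c(2) r(2)] y by (intro triv) simp
      qed
    next
      case xy
      from b consider (1) "b = b1" | (2) "b = b2" | (3) "b = b1 \<otimes>\<^bsub>?P\<^esub> b2" by blast
      then show ?thesis
      proof cases
        case 1
        have "3 dvd j" using mods ij by (elim disjE) (simp_all add: xy 1 q qb dvd_eq_mod_eq_0)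
        then show ?thesis using P.pow_dvd[OF cb(1) b13] 1 by simp
      next
        case 2
        have "3 dvd j" using mods ij by (elim disjE) (simp_all add: xy 2 q qb dvd_eq_mod_eq_0)
        then show ?thesis using P.pow_dvd[OF cb(2) b23] 2 by simp
      next
        case 3
        have "3 dvd i \<and> 3 dvd j" using mods ij by (elim disjE) (simp_all add: xy 3 q qb dvd_eq_mod_eq_0)
        then show ?thesis using triple[OF g] e xy 3 P.pow_dvd[OF ab(2) gp(3)[OF ab(2)]] by blast
      qed
    qed
  qed
  then show ?thesis by (simp add: xyzwt b1_def b2_def)
qed

lemma beauville_3_group_nonabelian_beauville: "nonabelian_beauville_p_group 3 beauville_3_group"
proof -
  have g: "group beauville_3_group" unfolding presented_eqs by (rule group_presented_group)
  note UT = group_UT[of 3, simplified]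
  obtain h where h: "h \<in> hom beauville_3_group (UT 3)" "h (letter3 Lx) = (1,0,0,0,0,0)" "h (letter3 Ly) = (0,1,0,0,0,0)"
    using beauville_3_group_hom[OF UT unitriangular_rels3(1)] by blast
  have "\<not> comm_group beauville_3_group"
    using h g UT beauville_3_group_rels
    by (intro nonabelian_of_hom[of _ "UT 3" h "letter3 Lx" "letter3 Ly"])
      (simp_all add: group_hom_def group_hom_axioms_def rels3_def, simp add: UT_def)
  moreover have "order beauville_3_group = 3 ^ 5" using order_beauville_3_group(2) by simp
  ultimately show ?thesis
    unfolding nonabelian_beauville_p_group_def finite_p_group_def beauville_group_def
    using g order_beauville_3_group(1) beauville_3_group_beauville by blast
qed

subsection \<open>The primes at least 5\<close>

text \<open>The exponents 2 and 4 put the second pair on the lines of slope 2 and 4 and its product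
  on slope 3. For \<open>p >= 5\<close> these avoid the slopes 0, 1 and infinity of the first
  pair.\<close>

lemma (in group_embedding) relsH_layers:
  assumes r: "relsH p G x y z" and g: "generate G {x, y, z} = carrier G"
    and p: "Factorial_Ring.prime p" "order G = p ^ n" "2 < p"
  shows "generating_pair G x y" "generating_pair G (x \<otimes> y [^] (2::nat)) (x \<otimes> y [^] (4::nat))"
    "a \<in> carrier G \<Longrightarrow> a [^] p = \<one>"
proof -
  interpret H: fin_p_group H p by (rule fin_p_group_H[OF p(1,2)])
  have c: "x \<in> carrier G" "y \<in> carrier G" "z \<in> carrier G" using r by (auto simp: relsH_def)
  have s: "com (\<phi> x) (\<phi> y) = \<phi> z" using c r by (auto intro!: com_eqI simp: relsH_def simp flip: mult)
  have pw: "\<phi> x ^ p = 1" "\<phi> y ^ p = 1" "\<phi> z ^ p = 1" using c r by (auto simp: relsH_def map_one simp flip: pow)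
  have cen: "com (\<phi> z) u = 1" if "u \<in> H" for u
    by (rule central[OF g _ _ _ that]; use r in \<open>auto simp: relsH_def\<close>)
  have in_gen: "\<phi> x \<in> sgen {\<phi> x, \<phi> y}" "\<phi> y \<in> sgen {\<phi> x, \<phi> y}" by (auto intro: gen_incl)
  have "\<phi> z \<in> sgen {\<phi> x, \<phi> y}" using in_gen by (auto simp flip: s intro: subgrp_com[OF subgrp_gen])
  then have "sgen (\<phi> ` {x, y, z}) \<subseteq> sgen {\<phi> x, \<phi> y}" using in_gen by (intro gen_least subgrp_gen) auto
  moreover have "sgen {\<phi> x, \<phi> y} \<subseteq> H" using c by (intro gen_least H.subG) auto
  ultimately have xy: "sgen {\<phi> x, \<phi> y} = H" using H_sgen[OF g] c by auto
  then show "generating_pair G x y" using sgen_pair_iff c by simp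
  have b: "H.basis (\<phi> x) (\<phi> y)" using H.sgen_basis[OF _ _ xy] c by auto
  have L2: "H.L 2 = {1}"
    by (rule H.heisenberg_layers[OF b s[symmetric]]) (use pw cen c in auto)
  have "\<phi> a ^ p = 1" if "a \<in> carrier G" for a
    using H.power_trivial_odd[OF L2 p(3) _ _ xy pw(1,2)] c that by simp
  then show "a [^] p = \<one>" if "a \<in> carrier G"
    using that eq_one_iff[of "a [^] p"] by (simp add: pow)
  let ?u = "\<phi> x * \<phi> y ^ 2" and ?v = "\<phi> x * \<phi> y ^ 4"
  let ?S = "sgen {?u, ?v}"
  have "?u * \<phi> y ^ 2 \<in> ?S" by (auto intro!: gen_incl simp: mult.assoc simp flip: power_add)
  moreover have u: "?u \<in> ?S" by (auto intro!: gen_incl)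
  ultimately have y2: "\<phi> y ^ 2 \<in> ?S" using subgrp_mult_left_iff[OF subgrp_gen] by blast
  have x: "\<phi> x \<in> ?S" using u y2 subgrp_mult_right_iff[OF subgrp_gen] by blast
  \<comment> \<open>With \<open>p = 2 * k + 1\<close>, the power \<open>(y^2)^(k+1)\<close> is
    \<open>y^(p+1) = y\<close>, so \<open>y\<close> is recovered from its square.\<close>
  have "odd p" using p prime_odd_nat by blast
  then obtain k where k: "p = 2 * k + 1" by (elim oddE)
  have "(\<phi> y ^ 2) ^ (k + 1) = \<phi> y ^ Suc p" by (simp only: k power_mult[symmetric]) simp
  then have "(\<phi> y ^ 2) ^ (k + 1) = \<phi> y ^ p * \<phi> y" by (simp only: power_Suc2)
  then have "\<phi> y \<in> ?S" using subgrp_power[OF subgrp_gen y2, of "k + 1"] by (simp add: pw)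
  then have "sgen {\<phi> x, \<phi> y} \<subseteq> ?S" using x by (intro gen_least subgrp_gen) auto
  moreover have "?S \<subseteq> H" using c by (intro gen_least H.subG) auto
  ultimately have "?S = H" using xy by auto
  then show "generating_pair G (x \<otimes> y [^] (2::nat)) (x \<otimes> y [^] (4::nat))"
    using c by (simp add: mult pow flip: sgen_pair_iff)
qed

text \<open>\<open>D\<close> is the determinant of two direction vectors; eliminating
  \<open>i\<close> makes \<open>p\<close> divide \<open>j * D\<close>. The bound 12 is the least
  common multiple of the nine determinants that occur, all prime to \<open>p >= 5\<close>.\<close>

lemma dvd_of_determinant:
  fixes j p :: nat
  assumes p: "Factorial_Ring.prime p" "5 \<le> p" and d: "D dvd (12::int)"
    and e: "i * u1 mod int p = int j * v1 mod int p" "i * u2 mod int p = int j * v2 mod int p" and D: "D = u1 * v2 - u2 * v1"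
  shows "p dvd j"
proof -
  have d': "int p dvd i * u1 - int j * v1" "int p dvd i * u2 - int j * v2" using e by (simp_all only: mod_eq_dvd_iff)
  have "int p dvd u2 * (i * u1 - int j * v1) - u1 * (i * u2 - int j * v2)"
    by (rule dvd_diff[OF dvd_mult[OF d'(1)] dvd_mult[OF d'(2)]])
  also have "u2 * (i * u1 - int j * v1) - u1 * (i * u2 - int j * v2) = int j * D" by (simp add: D algebra_simps)
  finally have "int p dvd int j * 12" by (rule dvd_trans[OF _ mult_dvd_mono[OF dvd_refl d]])
  then have "int p dvd int (j * 12)" by simp
  then have "p dvd j * (2 * 2 * 3)" by (simp only: int_dvd_int_iff) simp
  moreover have "\<not> p dvd 2" "\<not> p dvd 3" using p by (auto dest: dvd_imp_le)
  ultimately show ?thesis using p by (simp only: prime_dvd_mult_iff) blast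
qed

lemma heisenberg_group_beauville:
  assumes p: "Factorial_Ring.prime p" "5 \<le> p"
  shows "beauville_structure (heisenberg_group p) (letterH p Lx, letterH p Ly)
    (letterH p Lx \<otimes>\<^bsub>heisenberg_group p\<^esub> letterH p Ly [^]\<^bsub>heisenberg_group p\<^esub> (2::nat),
     letterH p Lx \<otimes>\<^bsub>heisenberg_group p\<^esub> letterH p Ly [^]\<^bsub>heisenberg_group p\<^esub> (4::nat))"
proof -
  interpret P: group "heisenberg_group p" unfolding presented_eqs by (rule group_presented_group)
  let ?P = "heisenberg_group p"
  have p1: "1 < p" and p0: "0 < p" and p2: "2 < p" using p by auto
  obtain \<phi> :: "_ \<Rightarrow> letter word set perm" where "group_embedding ?P \<phi>" using P.cayley_embedding[OF order_heisenberg_group(1)[OF p1]] by blast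
  then interpret E: group_embedding ?P \<phi> .
  note gp = E.relsH_layers[OF heisenberg_group_rels heisenberg_group_generate p(1) order_heisenberg_group(2)[OF p1] p2]
  define x where "x = letterH p Lx"
  define y where "y = letterH p Ly"
  define b1 where "b1 = x \<otimes>\<^bsub>?P\<^esub> y [^]\<^bsub>?P\<^esub> (2::nat)"
  define b2 where "b2 = x \<otimes>\<^bsub>?P\<^esub> y [^]\<^bsub>?P\<^esub> (4::nat)"
  have c [simp]: "x \<in> carrier ?P" "y \<in> carrier ?P" using gp(1) by (auto simp: generating_pair_def x_def y_def)
  have cb [simp]: "b1 \<in> carrier ?P" "b2 \<in> carrier ?P" by (simp_all add: b1_def b2_def)
  note CC = groups_UT_CC(2)[OF p0]
  obtain q where q: "q \<in> hom ?P (CC p)" "q x = (1,0)" "q y = (0,1)"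
    using heisenberg_group_hom[OF CC abelian_relsH(1)[OF p1]] by (auto simp: x_def y_def)
  interpret q: group_hom ?P "CC p" q using q(1) CC by (simp add: group_hom_def group_hom_axioms_def)
  let ?m = "int p"
  have qa: "q x = (1 mod ?m, 0 mod ?m)" "q y = (0 mod ?m, 1 mod ?m)" "q (x \<otimes>\<^bsub>?P\<^esub> y) = (1 mod ?m, 1 mod ?m)"
    using p1 by (simp_all add: q) (simp add: CC_def)
  have qb: "q b1 = (1 mod ?m, 2 mod ?m)" "q b2 = (1 mod ?m, 4 mod ?m)" "q (b1 \<otimes>\<^bsub>?P\<^esub> b2) = (2 mod ?m, 6 mod ?m)"
    by (simp_all add: b1_def b2_def q.hom_nat_pow q CC_power) (simp_all add: CC_def mod_simps)
  have "beauville_structure ?P (x, y) (b1, b2)"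
  proof (rule P.beauville_structureI[OF order_heisenberg_group(1)[OF p1]])
    show "generating_pair ?P x y" "generating_pair ?P b1 b2" using gp(1,2) by (simp_all add: x_def y_def b1_def b2_def)
    fix a b g and i j :: nat
    assume a: "a \<in> {x, y, x \<otimes>\<^bsub>?P\<^esub> y}" and b: "b \<in> {b1, b2, b1 \<otimes>\<^bsub>?P\<^esub> b2}" and g: "g \<in> carrier ?P"
      and e: "a [^]\<^bsub>?P\<^esub> i \<otimes>\<^bsub>?P\<^esub> g = g \<otimes>\<^bsub>?P\<^esub> b [^]\<^bsub>?P\<^esub> j"
    have ab: "a \<in> carrier ?P" "b \<in> carrier ?P" using a b by auto
    have key: "p dvd j" if "q a = (u1 mod ?m, u2 mod ?m)" "q b = (v1 mod ?m, v2 mod ?m)" "u1 * v2 - u2 * v1 dvd 12" for u1 u2 v1 v2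
      using P.conj_CC[OF q.group_hom_axioms ab g e p0 that(1,2)]
      by (intro dvd_of_determinant[OF p that(3) _ _ HOL.refl, of "int i"]) (simp_all add: mod_simps)
    obtain u where u: "u \<in> {(1, 0), (0, 1), (1, 1)}" "q a = (fst u mod ?m, snd u mod ?m)"
    proof -
      from a consider "a = x" | "a = y" | "a = x \<otimes>\<^bsub>?P\<^esub> y" by blast
      then show ?thesis
      proof cases
        case 1
        show ?thesis by (rule that[of "(1, 0)"]) (simp_all only: 1 qa fst_conv snd_conv insert_iff simp_thms)
      next
        case 2
        show ?thesis by (rule that[of "(0, 1)"]) (simp_all only: 2 qa fst_conv snd_conv insert_iff simp_thms)
      next
        case 3
        show ?thesis by (rule that[of "(1, 1)"]) (simp_all only: 3 qa fst_conv snd_conv insert_iff simp_thms)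
      qed
    qed
    obtain v where v: "v \<in> {(1, 2), (1, 4), (2, 6)}" "q b = (fst v mod ?m, snd v mod ?m)"
    proof -
      from b consider "b = b1" | "b = b2" | "b = b1 \<otimes>\<^bsub>?P\<^esub> b2" by blast
      then show ?thesis
      proof cases
        case 1
        show ?thesis by (rule that[of "(1, 2)"]) (simp_all only: 1 qb fst_conv snd_conv insert_iff simp_thms)
      next
        case 2
        show ?thesis by (rule that[of "(1, 4)"]) (simp_all only: 2 qb fst_conv snd_conv insert_iff simp_thms)
      next
        case 3
        show ?thesis by (rule that[of "(2, 6)"]) (simp_all only: 3 qb fst_conv snd_conv insert_iff simp_thms)
      qed
    qed
    have "fst u * snd v - snd u * fst v dvd 12" using u(1) v(1) by (elim insertE emptyE) simp_all
    then have "p dvd j" by (rule key[OF u(2) v(2)])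
    then show "b [^]\<^bsub>?P\<^esub> j = \<one>\<^bsub>?P\<^esub>" by (rule P.pow_dvd[OF ab(2) gp(3)[OF ab(2)]])
  qed
  then show ?thesis by (simp add: x_def y_def b1_def b2_def)
qed

lemma heisenberg_group_nonabelian_beauville:
  assumes p: "Factorial_Ring.prime p" "5 \<le> p"
  shows "nonabelian_beauville_p_group p (heisenberg_group p)"
proof -
  have p1: "1 < p" and p0: "0 < p" using p by auto
  have g: "group (heisenberg_group p)" unfolding presented_eqs by (rule group_presented_group)
  note UT = group_UT[OF p0]
  obtain h where h: "h \<in> hom (heisenberg_group p) (UT p)" "h (letterH p Lx) = (1,0,0,0,0,0)" "h (letterH p Ly) = (0,1,0,0,0,0)"
    using heisenberg_group_hom[OF UT unitriangular_relsH[OF p1]] by blast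
  have "\<not> comm_group (heisenberg_group p)"
    using h g UT heisenberg_group_rels[of p] p1
    by (intro nonabelian_of_hom[of _ "UT p" h "letterH p Lx" "letterH p Ly"])
      (simp_all add: group_hom_def group_hom_axioms_def relsH_def, simp add: UT_def)
  then show ?thesis
    unfolding nonabelian_beauville_p_group_def finite_p_group_def beauville_group_def
    using g order_heisenberg_group[OF p1] heisenberg_group_beauville[OF p] by blast
qed

section \<open>Minimality and uniqueness\<close>

lemma generate_monoid_of:
  assumes H: "subgrp H" and S: "S \<subseteq> H" "sgen S = H"
  shows "generate (monoid_of H) S = H"
proof
  interpret group "monoid_of H" by (rule group_monoid_of[OF H])
  show "generate (monoid_of H) S \<subseteq> H" using generate_incl[of S] S by simp
  have "subgrp (generate (monoid_of H) S)"
  proof (rule subgrpI)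
    show "1 \<in> generate (monoid_of H) S" using generate.one[of "monoid_of H" S] by simp
    fix a assume a: "a \<in> generate (monoid_of H) S"
    then have "a \<in> H" using generate_incl[of S] S by auto
    then show "inverse a \<in> generate (monoid_of H) S"
      using generate_m_inv_closed[OF _ a] S inv_monoid_of[OF H] by simp
    fix b assume "b \<in> generate (monoid_of H) S"
    then show "a * b \<in> generate (monoid_of H) S" using generate.eng[OF a, of b] by simp
  qed
  then have "sgen S \<subseteq> generate (monoid_of H) S" by (rule gen_least) (auto intro: generate.incl)
  then show "H \<subseteq> generate (monoid_of H) S" using S by simp
qed

text \<open>The image among permutations is where the type class results apply; the isomorphism is
  carried along for the way back to \<open>G\<close>.\<close>

lemma nonabelian_beauville_embedding:
  fixes G :: "'a monoid"
  assumes p: "Factorial_Ring.prime p" and nb: "nonabelian_beauville_p_group p G"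
  shows "\<exists>(H :: 'a perm set) x1 y1 x2 y2. fin_p_group H p \<and> fin_p_group.beauville_pairs H x1 y1 x2 y2 \<and>
    (\<exists>a\<in>H. \<exists>b\<in>H. a * b \<noteq> b * a) \<and> card H = order G \<and> G \<cong> monoid_of H"
proof -
  obtain n Q1 Q2 where G: "group G" "finite (carrier G)" "order G = p ^ n" "\<not> comm_group G" and Q: "beauville_structure G Q1 Q2"
    using nb unfolding nonabelian_beauville_p_group_def finite_p_group_def beauville_group_def by blast
  obtain x1 y1 x2 y2 where Q': "Q1 = (x1, y1)" "Q2 = (x2, y2)" by (cases Q1, cases Q2) blast
  obtain \<phi> :: "'a \<Rightarrow> 'a perm" where "group_embedding G \<phi>" using group.cayley_embedding[OF G(1,2)] by blast
  then interpret E: group_embedding G \<phi> .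
  show ?thesis
    using E.fin_p_group_H[OF p G(3)] E.beauville_pairs_H[OF p G(3) Q[unfolded Q']] E.noncomm[OF G(4)] E.card_H E.iso_H
    by blast
qed

text \<open>The relations forced by the small order are those of the presentation, with
  \<open>w\<close> and \<open>t\<close> central because \<open>L 3\<close> is trivial; equal orders
  then give the isomorphism.\<close>

lemma small_group_128_36_minimal:
  fixes G :: "'a monoid"
  assumes nb: "nonabelian_beauville_p_group 2 G" and o: "order G \<le> 128"
  shows "order G = 128 \<and> G \<cong> small_group_128_36"
proof -
  obtain H :: "'a perm set" and x y x2 y2 where fp: "fin_p_group H 2" and bp: "fin_p_group.beauville_pairs H x y x2 y2"
    and nc: "\<exists>a\<in>H. \<exists>b\<in>H. a * b \<noteq> b * a" and H: "card H = order G" "G \<cong> monoid_of H"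
    using nonabelian_beauville_embedding[OF two_is_prime_nat nb] by blast
  interpret fin_2_group H using fp by (simp add: fin_2_group_def)
  have card: "card H \<le> 128" using H o by simp
  note bt = beauville_two_group[OF bp nc card]
  have xy: "x \<in> H" "y \<in> H" "sgen {x, y} = H" using bp unfolding beauville_pairs_def by auto
  define z where "z = com x y"
  define w where "w = com z x"
  define t where "t = com z y"
  have z: "z \<in> L 1" unfolding z_def by (rule com_in_first[OF xy(1,2)])
  have wt: "w \<in> L 2" "t \<in> L 2" unfolding w_def t_def using L_comI[OF z, of _ 2] xy by auto
  have HH: "z \<in> H" "w \<in> H" "t \<in> H" using z wt L_in_G by auto
  have cen: "g * w = w * g" "g * t = t * g" if "g \<in> H" for g
    using L_comI'[OF wt(1) that, of 3] L_comI'[OF wt(2) that, of 3] bt(5) by (simp_all add: com_eq_one_iff)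
  have sq: "w ^ 2 = 1" "t ^ 2 = 1" using square_in[OF wt(1), of 3] square_in[OF wt(2), of 3] bt(5) by simp_all
  have zz: "z ^ 2 = 1" unfolding z_def by (rule bt(4))
  have m: "x * y = z * y * x" "z * x = w * x * z" "z * y = t * y * z"
    unfolding z_def w_def t_def by (rule mult_com)+
  have r: "rels2 (monoid_of H) x y z w t"
    unfolding rels2_def pow_monoid_of
      monoid.simps partial_object.simps
    by (intro conjI) (rule xy(1,2) HH bt(2,3) zz sq m cen[OF xy(1)] cen[OF xy(2)] cen[OF HH(1)] cen(2)[OF HH(2)])+
  have "sgen {x, y} \<subseteq> sgen {x, y, z, w, t}" by (rule gen_mono) auto
  moreover have "sgen {x, y, z, w, t} \<subseteq> H" using xy HH by (intro gen_least subG) auto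
  ultimately have "generate (monoid_of H) {x, y, z, w, t} = H" using xy HH by (intro generate_monoid_of subG) auto
  then have "monoid_of H \<cong> small_group_128_36"
    using bt(1) finG order_small_group_128_36 by (intro small_group_128_36_iso[OF group_monoid_of[OF subG] r]) (simp_all add: order_def)
  then show ?thesis using H bt(1) iso_trans by metis
qed

lemma beauville_3_group_minimal:
  fixes G :: "'a monoid"
  assumes nb: "nonabelian_beauville_p_group 3 G" and o: "order G \<le> 243"
  shows "order G = 243 \<and> G \<cong> beauville_3_group"
proof -
  have p3: "Factorial_Ring.prime (3::nat)" by simp
  obtain H :: "'a perm set" and x1 y1 x2 y2 where fp: "fin_p_group H 3" and bp: "fin_p_group.beauville_pairs H x1 y1 x2 y2"
    and nc: "\<exists>a\<in>H. \<exists>b\<in>H. a * b \<noteq> b * a" and H: "card H = order G" "G \<cong> monoid_of H"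
    using nonabelian_beauville_embedding[OF p3 nb] by blast
  interpret fin_p_group H 3 by (rule fp)
  have card: "card H \<le> 243" using H o by simp
  obtain x y where xy: "x \<in> H" "y \<in> H" "sgen {x, y} = H" and c: "card H = 243" and cu: "x ^ 3 = 1" "y ^ 3 = 1"
    and L3: "L 3 = {1}" and L1: "\<And>f. f \<in> L 1 \<Longrightarrow> f ^ 3 = 1"
    using beauville_three_group[OF HOL.refl bp nc card] by blast
  \<comment> \<open>Chosen so that \<open>y * x = x * (y * z)\<close>, the form in which the
    presentation conjugates.\<close>
  define z where "z = com (inverse y) (inverse x)"
  define w where "w = com (inverse z) (inverse x)"
  define t where "t = com (inverse z) (inverse y)"
  have z: "z \<in> L 1" unfolding z_def by (rule L_comI[of _ 0]) (use xy in auto)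
  then have iz: "inverse z \<in> L 1" by (rule nrm_inverse[OF nrm_L])
  have wt: "w \<in> L 2" "t \<in> L 2" unfolding w_def t_def using L_comI[OF iz, of _ 2] xy by auto
  have HH: "z \<in> H" "w \<in> H" "t \<in> H" using z wt L_in_G by auto
  have cen: "g * w = w * g" "g * t = t * g" if "g \<in> H" for g
    using L_comI'[OF wt(1) that, of 3] L_comI'[OF wt(2) that, of 3] L3 by (simp_all add: com_eq_one_iff)
  have "L 2 \<subseteq> L 1" using L_Suc_subset[of 1] by (simp add: numeral_2_eq_2)
  then have cu': "z ^ 3 = 1" "w ^ 3 = 1" "t ^ 3 = 1" using L1 z wt by auto
  have rel: "b * a = a * (b * com (inverse b) (inverse a))" for a b :: "'a perm"
    by (simp add: com_def mult.assoc)
  have m: "y * x = x * (y * z)" "z * x = x * (z * w)" "z * y = y * (z * t)"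
    unfolding z_def w_def t_def by (rule rel)+
  have r: "rels3 (monoid_of H) x y z w t"
    unfolding rels3_def pow_monoid_of
      monoid.simps partial_object.simps
    by (intro conjI) (rule xy(1,2) HH cu cu' m cen[OF xy(1)] cen[OF xy(2)] cen[OF HH(1)] cen(2)[OF HH(2)])+
  have "sgen {x, y} \<subseteq> sgen {x, y, z, w, t}" by (rule gen_mono) auto
  moreover have "sgen {x, y, z, w, t} \<subseteq> H" using xy HH by (intro gen_least subG) auto
  ultimately have "generate (monoid_of H) {x, y, z, w, t} = H" using xy HH by (intro generate_monoid_of subG) auto
  then have "monoid_of H \<cong> beauville_3_group"
    using c finG order_beauville_3_group by (intro beauville_3_group_iso[OF group_monoid_of[OF subG] r]) (simp_all add: order_def)
  then show ?thesis using H c iso_trans by metis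
qed

lemma heisenberg_group_minimal:
  fixes G :: "'a monoid"
  assumes p: "Factorial_Ring.prime p" "2 < p" and nb: "nonabelian_beauville_p_group p G" and o: "order G \<le> p ^ 3"
  shows "order G = p ^ 3 \<and> G \<cong> heisenberg_group p"
proof -
  have p1: "1 < p" using p by simp
  obtain H :: "'a perm set" and x y x2 y2 where fp: "fin_p_group H p" and bp: "fin_p_group.beauville_pairs H x y x2 y2"
    and nc: "\<exists>a\<in>H. \<exists>b\<in>H. a * b \<noteq> b * a" and H: "card H = order G" "G \<cong> monoid_of H"
    using nonabelian_beauville_embedding[OF p(1) nb] by blast
  interpret fin_p_group H p by (rule fp)
  have card: "card H \<le> p ^ 3" using H o by simp
  note bt = beauville_odd_cube[OF bp nc p(2) card]
  have xy: "x \<in> H" "y \<in> H" "sgen {x, y} = H" using bp unfolding beauville_pairs_def by auto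
  define z where "z = com x y"
  have z: "z \<in> L 1" unfolding z_def by (rule L_comI[of _ 0]) (use xy in auto)
  have zH: "z \<in> H" using z L_in_G by auto
  have cen: "g * z = z * g" if "g \<in> H" for g
    using L_comI'[OF z that, of 2] bt(2) by (simp add: com_eq_one_iff)
  have m: "x * y = z * y * x" unfolding z_def by (rule mult_com)
  have r: "relsH p (monoid_of H) x y z"
    unfolding relsH_def pow_monoid_of
      monoid.simps partial_object.simps
    by (intro conjI) (rule xy(1,2) zH bt(3)[OF xy(1)] bt(3)[OF xy(2)] bt(3)[OF zH] m cen[OF xy(1)] cen[OF xy(2)])+
  have "sgen {x, y} \<subseteq> sgen {x, y, z}" by (rule gen_mono) auto
  moreover have "sgen {x, y, z} \<subseteq> H" using xy zH by (intro gen_least subG) auto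
  ultimately have "generate (monoid_of H) {x, y, z} = H" using xy zH by (intro generate_monoid_of subG) auto
  then have "monoid_of H \<cong> heisenberg_group p"
    using bt(1) finG order_heisenberg_group[OF p1] by (intro heisenberg_group_iso[OF group_monoid_of[OF subG] r]) (simp_all add: order_def)
  then show ?thesis using H bt(1) iso_trans by metis
qed

theorem corollary9:
  shows
    "(smallest_nonabelian_beauville TYPE('a) 2 small_group_128_36 \<and>
        order small_group_128_36 = 2 ^ 7) \<and>
     (smallest_nonabelian_beauville TYPE('a) 3 beauville_3_group \<and>
        order beauville_3_group = 3 ^ 5) \<and>
     (smallest_nonabelian_beauville TYPE('a) 5 small_group_125_3 \<and>
        order small_group_125_3 = 5 ^ 3) \<and>
     (\<forall>p::nat. Factorial_Ring.prime p \<and> 7 \<le> p \<longrightarrow>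
        smallest_nonabelian_beauville TYPE('a) p (heisenberg_group p) \<and>
        order (heisenberg_group p) = p ^ 3)"
proof -
  \<comment> \<open>A competitor of larger order satisfies the bound trivially; one of order at most
    128 is covered by the minimality lemma.\<close>
  have two: "smallest_nonabelian_beauville TYPE('a) 2 small_group_128_36"
    unfolding smallest_nonabelian_beauville_def order_small_group_128_36(2)
    using small_group_128_36_nonabelian_beauville small_group_128_36_minimal by (metis nat_le_linear order.refl)
  have three: "smallest_nonabelian_beauville TYPE('a) 3 beauville_3_group"
    unfolding smallest_nonabelian_beauville_def order_beauville_3_group(2)
    using beauville_3_group_nonabelian_beauville beauville_3_group_minimal by (metis nat_le_linear order.refl)
  have odd: "smallest_nonabelian_beauville TYPE('a) p (heisenberg_group p)" "order (heisenberg_group p) = p ^ 3"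
    if p: "Factorial_Ring.prime p" "5 \<le> p" for p :: nat
  proof -
    have p1: "1 < p" "2 < p" using p by auto
    show o: "order (heisenberg_group p) = p ^ 3" by (rule order_heisenberg_group(2)[OF p1(1)])
    show "smallest_nonabelian_beauville TYPE('a) p (heisenberg_group p)"
      unfolding smallest_nonabelian_beauville_def o
      using heisenberg_group_nonabelian_beauville[OF p] heisenberg_group_minimal[OF p(1) p1(2)] by (metis nat_le_linear order.refl)
  qed
  have five: "Factorial_Ring.prime (5::nat)" by simp
  show ?thesis
    using two three odd[OF five] odd(1) odd(2) order_small_group_128_36(2) order_beauville_3_group(2) by (simp add: small_group_125_3_def)
qed

end
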